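(* Let $B\subseteq A$ be a right-finite extension of Artin algebras. Suppose that there is an integer $s\ge 0$ such that $\mathrm{rad}^{s}(B)\,A\,\mathrm{rad}(B)\subseteq B$ and that $B/\mathrm{rad}^{s}(B)$ is representation-finite. If $\mathrm{fin.dim}(A)<\infty$, then $\mathrm{fin.dim}(B)<\infty$.
   Context: An Artin algebra is an algebra that is finitely generated as a module over a commutative Artin ring. All modules are finitely generated, and left modules unless stated otherwise. An extension $B\subseteq A$ of Artin algebras means that $B$ is a subalgebra of $A$ with the same identity. It is right-finite if the projective dimension of the right $B$-module $A_B$ is finite. $\mathrm{rad}(B)$ is the Jacobson radical of $B$, $\mathrm{rad}^s(B)$ its $s$-th power, and $\mathrm{rad}^0(B)=B$. The finitistic dimension $\mathrm{fin.dim}(A)$ is the supremum of the projective dimensions of those finitely generated left $A$-modules having finite projective dimension. An algebra is representation-finite if it has only finitely many non-isomorphic indecomposable modules. *)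

theory Defs
  imports "HOL-Algebra.Module" "HOL-Algebra.Ideal_Product" "HOL-Algebra.QuotRing" "HOL-Algebra.Subrings"
    "HOL-Library.Extended_Nat"
begin

text \<open>The library locale \<^locale>\<open>module\<close> requires a commutative ring of scalars, whereas the
  modules here are left modules over a possibly noncommutative ring.  The multiplicative record
  fields of a module carry no meaning.  The locale \<^locale>\<open>submodule\<close> does not mention
  commutativity and is used as it stands.\<close>

locale left_module = R?: ring R + M?: abelian_group M
  for R :: "('a, 'r) ring_scheme" (structure) and M :: "('a, 'm, 'n) module_scheme" (structure) +
  assumes smult_closed [simp, intro]:
      "\<lbrakk>a \<in> carrier R; x \<in> carrier M\<rbrakk> \<Longrightarrow> a \<odot>\<^bsub>M\<^esub> x \<in> carrier M"
    and smult_l_distr: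
      "\<lbrakk>a \<in> carrier R; b \<in> carrier R; x \<in> carrier M\<rbrakk> \<Longrightarrow>
      (a \<oplus> b) \<odot>\<^bsub>M\<^esub> x = a \<odot>\<^bsub>M\<^esub> x \<oplus>\<^bsub>M\<^esub> b \<odot>\<^bsub>M\<^esub> x"
    and smult_r_distr:
      "\<lbrakk>a \<in> carrier R; x \<in> carrier M; y \<in> carrier M\<rbrakk> \<Longrightarrow>
      a \<odot>\<^bsub>M\<^esub> (x \<oplus>\<^bsub>M\<^esub> y) = a \<odot>\<^bsub>M\<^esub> x \<oplus>\<^bsub>M\<^esub> a \<odot>\<^bsub>M\<^esub> y"
    and smult_assoc1:
      "\<lbrakk>a \<in> carrier R; b \<in> carrier R; x \<in> carrier M\<rbrakk> \<Longrightarrow>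
      (a \<otimes> b) \<odot>\<^bsub>M\<^esub> x = a \<odot>\<^bsub>M\<^esub> (b \<odot>\<^bsub>M\<^esub> x)"
    and smult_one [simp]:
      "x \<in> carrier M \<Longrightarrow> \<one> \<odot>\<^bsub>M\<^esub> x = x"

definition finitely_generated :: "('a, 'r) ring_scheme \<Rightarrow> ('a, 'm, 'n) module_scheme \<Rightarrow> bool" where
  "finitely_generated R M \<longleftrightarrow>
     (\<exists>S. finite S \<and> S \<subseteq> carrier M \<and> (\<forall>N. submodule N R M \<and> S \<subseteq> N \<longrightarrow> N = carrier M))"

definition fg_module :: "('a, 'r) ring_scheme \<Rightarrow> ('a, 'm, 'n) module_scheme \<Rightarrow> bool" where
  "fg_module R M \<longleftrightarrow> left_module R M \<and> finitely_generated R M"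

definition module_hom ::
    "('a, 'r) ring_scheme \<Rightarrow> ('a, 'm, 'p) module_scheme \<Rightarrow> ('a, 'n, 'q) module_scheme \<Rightarrow> ('m \<Rightarrow> 'n) set" where
  "module_hom R M N =
     {f \<in> carrier M \<rightarrow> carrier N.
        (\<forall>x \<in> carrier M. \<forall>y \<in> carrier M. f (x \<oplus>\<^bsub>M\<^esub> y) = f x \<oplus>\<^bsub>N\<^esub> f y) \<and>
        (\<forall>a \<in> carrier R. \<forall>x \<in> carrier M. f (a \<odot>\<^bsub>M\<^esub> x) = a \<odot>\<^bsub>N\<^esub> f x)}"

definition module_iso ::
    "('a, 'r) ring_scheme \<Rightarrow> ('a, 'm, 'p) module_scheme \<Rightarrow> ('a, 'n, 'q) module_scheme \<Rightarrow> bool" where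
  "module_iso R M N \<longleftrightarrow> (\<exists>f \<in> module_hom R M N. bij_betw f (carrier M) (carrier N))"

text \<open>A definition cannot quantify over modules of all carrier types.  Over a ring with elements of
  type \<^typ>\<open>'a\<close>, every finitely generated module is a quotient of a free module of finite rank and
  hence isomorphic to a module whose elements are sets of sequences in \<^typ>\<open>'a\<close> (lemma
  \<open>fg_module_universe\<close> below).  Quantifiers over finitely generated modules range over this type.\<close>

type_synonym 'a fgmod = "('a, (nat \<Rightarrow> 'a) set) module"

text \<open>Projective objects among the finitely generated modules.\<close>

definition projective :: "('a, 'r) ring_scheme \<Rightarrow> ('a, 'm, 'n) module_scheme \<Rightarrow> bool" where
  "projective R P \<longleftrightarrow> fg_module R P \<and>
     (\<forall>(M :: 'a fgmod) (N :: 'a fgmod) g f.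
        fg_module R M \<and> fg_module R N \<and>
        g \<in> module_hom R M N \<and> g ` carrier M = carrier N \<and> f \<in> module_hom R P N
        \<longrightarrow> (\<exists>h \<in> module_hom R P M. \<forall>x \<in> carrier P. g (h x) = f x))"

text \<open>Exactness of \<open>\<cdots> \<rightarrow> P 2 \<rightarrow> P 1 \<rightarrow> P 0 \<rightarrow> M \<rightarrow> 0\<close>, where \<open>d i\<close> maps \<open>P (Suc i)\<close> to \<open>P i\<close> and
  \<open>e\<close> is the augmentation.\<close>

definition projective_resolution ::
    "('a, 'r) ring_scheme \<Rightarrow> ('a, 'm, 'n) module_scheme \<Rightarrow> (nat \<Rightarrow> 'a fgmod) \<Rightarrow>
     (nat \<Rightarrow> (nat \<Rightarrow> 'a) set \<Rightarrow> (nat \<Rightarrow> 'a) set) \<Rightarrow> ((nat \<Rightarrow> 'a) set \<Rightarrow> 'm) \<Rightarrow> bool" where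
  "projective_resolution R M P d e \<longleftrightarrow>
     (\<forall>i. projective R (P i)) \<and>
     e \<in> module_hom R (P 0) M \<and>
     (\<forall>i. d i \<in> module_hom R (P (Suc i)) (P i)) \<and>
     e ` carrier (P 0) = carrier M \<and>
     {x \<in> carrier (P 0). e x = \<zero>\<^bsub>M\<^esub>} = d 0 ` carrier (P (Suc 0)) \<and>
     (\<forall>i. {x \<in> carrier (P (Suc i)). d i x = \<zero>\<^bsub>P i\<^esub>} = d (Suc i) ` carrier (P (Suc (Suc i))))"

text \<open>For finitely generated \<open>M\<close> over a Noetherian ring (in particular over an Artin algebra), only
  resolutions by finitely generated projectives matter.  The infimum of the empty set is \<open>\<infinity>\<close>;
  the zero module has projective dimension \<open>0\<close>.\<close>

definition proj_dim :: "('a, 'r) ring_scheme \<Rightarrow> ('a, 'm, 'n) module_scheme \<Rightarrow> enat" where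
  "proj_dim R M =
     Inf {enat n | n. \<exists>P d e. projective_resolution R M P d e \<and> (\<forall>i>n. carrier (P i) = {\<zero>\<^bsub>P i\<^esub>})}"

definition fin_dim :: "('a, 'r) ring_scheme \<Rightarrow> enat" where
  "fin_dim R = Sup {proj_dim R M | M :: 'a fgmod. fg_module R M \<and> proj_dim R M < \<infinity>}"

definition indecomposable :: "('a, 'r) ring_scheme \<Rightarrow> ('a, 'm, 'n) module_scheme \<Rightarrow> bool" where
  "indecomposable R M \<longleftrightarrow> carrier M \<noteq> {\<zero>\<^bsub>M\<^esub>} \<and>
     (\<forall>U V. submodule U R M \<and> submodule V R M \<and>
        U \<inter> V = {\<zero>\<^bsub>M\<^esub>} \<and> U <+>\<^bsub>M\<^esub> V = carrier M
        \<longrightarrow> U = {\<zero>\<^bsub>M\<^esub>} \<or> V = {\<zero>\<^bsub>M\<^esub>})"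

definition representation_finite :: "('a, 'r) ring_scheme \<Rightarrow> bool" where
  "representation_finite R \<longleftrightarrow>
     (\<exists>S :: 'a fgmod set. finite S \<and>
        (\<forall>M :: 'a fgmod. fg_module R M \<and> indecomposable R M \<longrightarrow> (\<exists>N \<in> S. module_iso R M N)))"

definition left_ideal :: "'a set \<Rightarrow> ('a, 'r) ring_scheme \<Rightarrow> bool" where
  "left_ideal I R \<longleftrightarrow> additive_subgroup I R \<and> (\<forall>a \<in> carrier R. \<forall>x \<in> I. a \<otimes>\<^bsub>R\<^esub> x \<in> I)"

definition maximal_left_ideal :: "'a set \<Rightarrow> ('a, 'r) ring_scheme \<Rightarrow> bool" where
  "maximal_left_ideal I R \<longleftrightarrow> left_ideal I R \<and> I \<noteq> carrier R \<and>
     (\<forall>J. left_ideal J R \<and> I \<subseteq> J \<longrightarrow> J = I \<or> J = carrier R)"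

definition rad :: "('a, 'r) ring_scheme \<Rightarrow> 'a set" where
  "rad R = {x \<in> carrier R. \<forall>I. maximal_left_ideal I R \<longrightarrow> x \<in> I}"

primrec rad_pow :: "('a, 'r) ring_scheme \<Rightarrow> nat \<Rightarrow> 'a set" where
  "rad_pow R 0 = carrier R"
| "rad_pow R (Suc s) = rad_pow R s \<cdot>\<^bsub>R\<^esub> rad R"

definition artinian :: "('a, 'r) ring_scheme \<Rightarrow> bool" where
  "artinian R \<longleftrightarrow>
     (\<forall>I :: nat \<Rightarrow> 'a set. (\<forall>n. ideal (I n) R) \<and> (\<forall>n. I (Suc n) \<subseteq> I n)
        \<longrightarrow> (\<exists>n. \<forall>m\<ge>n. I m = I n))"

text \<open>Unlike in the library locale \<^locale>\<open>algebra\<close>, the ring \<open>A\<close> need not be commutative.\<close>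

locale artin_algebra = module K A + A?: ring A
  for K :: "('k, 'r) ring_scheme" (structure) and A :: "('k, 'a, 'm) module_scheme" (structure) +
  assumes smult_mult_left:
      "\<lbrakk>c \<in> carrier K; x \<in> carrier A; y \<in> carrier A\<rbrakk> \<Longrightarrow>
      (c \<odot>\<^bsub>A\<^esub> x) \<otimes>\<^bsub>A\<^esub> y = c \<odot>\<^bsub>A\<^esub> (x \<otimes>\<^bsub>A\<^esub> y)"
    and smult_mult_right:
      "\<lbrakk>c \<in> carrier K; x \<in> carrier A; y \<in> carrier A\<rbrakk> \<Longrightarrow>
      x \<otimes>\<^bsub>A\<^esub> (c \<odot>\<^bsub>A\<^esub> y) = c \<odot>\<^bsub>A\<^esub> (x \<otimes>\<^bsub>A\<^esub> y)"
    and artinian_base: "artinian K"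
    and fin_gen: "finitely_generated K A"

text \<open>The predicate \<^locale>\<open>subring\<close> includes that \<open>B\<close> contains the identity of \<open>A\<close>.\<close>

definition artin_extension ::
    "('k, 'r) ring_scheme \<Rightarrow> 'a set \<Rightarrow> ('k, 'a, 'm) module_scheme \<Rightarrow> bool" where
  "artin_extension K B A \<longleftrightarrow>
     artin_algebra K A \<and> artin_algebra K (A\<lparr>carrier := B\<rparr>) \<and> submodule B K A \<and> subring B A"

text \<open>Right \<open>R\<close>-modules are left modules over the opposite ring.\<close>

definition op_ring :: "('a, 'r) ring_scheme \<Rightarrow> ('a, 'r) ring_scheme" where
  "op_ring R = R\<lparr>mult := \<lambda>x y. y \<otimes>\<^bsub>R\<^esub> x\<rparr>"

definition right_mult_module :: "('a, 'r) ring_scheme \<Rightarrow> ('a, 'a) module" where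
  "right_mult_module A =
     \<lparr>carrier = carrier A, mult = mult A, one = one A, zero = zero A, add = add A,
      smult = \<lambda>b x. x \<otimes>\<^bsub>A\<^esub> b\<rparr>"

definition right_finite :: "'a set \<Rightarrow> ('a, 'r) ring_scheme \<Rightarrow> bool" where
  "right_finite B A \<longleftrightarrow> proj_dim (op_ring (A\<lparr>carrier := B\<rparr>)) (right_mult_module A) < \<infinity>"


text \<open>Adequacy of \<^typ>\<open>'a fgmod\<close>.\<close>

primrec lincomb :: "('a, 'm, 'n) module_scheme \<Rightarrow> (nat \<Rightarrow> 'm) \<Rightarrow> nat \<Rightarrow> (nat \<Rightarrow> 'a) \<Rightarrow> 'm" where
  "lincomb M s 0 f = \<zero>\<^bsub>M\<^esub>"
| "lincomb M s (Suc n) f = lincomb M s n f \<oplus>\<^bsub>M\<^esub> f n \<odot>\<^bsub>M\<^esub> s n"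

context left_module
begin

lemma smult_l_null: "x \<in> carrier M \<Longrightarrow> \<zero> \<odot>\<^bsub>M\<^esub> x = \<zero>\<^bsub>M\<^esub>"
  by (metis M.add.l_cancel_one' R.l_zero R.zero_closed smult_closed smult_l_distr)

lemma smult_r_null: "a \<in> carrier R \<Longrightarrow> a \<odot>\<^bsub>M\<^esub> \<zero>\<^bsub>M\<^esub> = \<zero>\<^bsub>M\<^esub>"
  by (metis M.add.l_cancel_one' M.l_zero M.zero_closed smult_closed smult_r_distr)

lemma smult_l_minus: "a \<in> carrier R \<Longrightarrow> x \<in> carrier M \<Longrightarrow> (\<ominus> a) \<odot>\<^bsub>M\<^esub> x = \<ominus>\<^bsub>M\<^esub> (a \<odot>\<^bsub>M\<^esub> x)"
  by (metis M.minus_equality R.a_inv_closed R.l_neg smult_closed smult_l_distr smult_l_null)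

lemma lincomb_closed:
  "\<forall>i. s i \<in> carrier M \<Longrightarrow> \<forall>i. f i \<in> carrier R \<Longrightarrow> lincomb M s n f \<in> carrier M"
  by (induction n) auto

lemma lincomb_add:
  assumes "\<forall>i. s i \<in> carrier M" "\<forall>i. f i \<in> carrier R" "\<forall>i. g i \<in> carrier R"
  shows "lincomb M s n (\<lambda>i. f i \<oplus> g i) = lincomb M s n f \<oplus>\<^bsub>M\<^esub> lincomb M s n g"
  by (induction n) (simp_all add: assms lincomb_closed smult_l_distr M.a_ac)

lemma lincomb_smult:
  assumes "\<forall>i. s i \<in> carrier M" "\<forall>i. f i \<in> carrier R" "a \<in> carrier R"
  shows "lincomb M s n (\<lambda>i. a \<otimes> f i) = a \<odot>\<^bsub>M\<^esub> lincomb M s n f"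
  by (induction n) (simp_all add: assms lincomb_closed smult_r_distr smult_assoc1 smult_r_null)

lemma lincomb_unit:
  assumes "\<forall>i. s i \<in> carrier M"
  shows "lincomb M s n (\<lambda>i. if i = j then \<one> else \<zero>) = (if j < n then s j else \<zero>\<^bsub>M\<^esub>)"
  by (induction n) (auto simp: assms smult_l_null less_Suc_eq)

lemma submodule_lincombs:
  assumes s: "\<forall>i. s i \<in> carrier M"
  shows "submodule (lincomb M s n ` {f. \<forall>i. f i \<in> carrier R}) R M" (is "submodule ?H R M")
proof -
  have HI: "lincomb M s n f \<in> ?H" if "\<forall>i. f i \<in> carrier R" for f
    using that by simp
  have HE: "\<exists>f. (\<forall>i. f i \<in> carrier R) \<and> x = lincomb M s n f" if "x \<in> ?H" for x
    using that by auto
  have neg: "\<ominus>\<^bsub>M\<^esub> x \<in> ?H" if x: "x \<in> ?H" for x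
  proof -
    obtain f where f: "\<forall>i. f i \<in> carrier R" "x = lincomb M s n f" using HE[OF x] by auto
    have "\<ominus>\<^bsub>M\<^esub> x = lincomb M s n (\<lambda>i. (\<ominus> \<one>) \<otimes> f i)"
      using s f by (simp add: lincomb_smult lincomb_closed smult_l_minus del: R.l_minus)
    then show ?thesis using HI f by simp
  qed
  have zero: "\<zero>\<^bsub>M\<^esub> \<in> ?H"
  proof -
    have "\<zero>\<^bsub>M\<^esub> = lincomb M s n (\<lambda>i. \<zero> \<otimes> \<zero>)"
      using s lincomb_smult[of s "\<lambda>i. \<zero>" \<zero> n] by (simp add: smult_l_null lincomb_closed)
    then show ?thesis using HI[of "\<lambda>i. \<zero> \<otimes> \<zero>"] by simp
  qed
  have add: "x \<oplus>\<^bsub>M\<^esub> y \<in> ?H" if x: "x \<in> ?H" and y: "y \<in> ?H" for x y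
  proof -
    obtain f g where f: "\<forall>i. f i \<in> carrier R" "x = lincomb M s n f"
      and g: "\<forall>i. g i \<in> carrier R" "y = lincomb M s n g"
      using HE[OF x] HE[OF y] by auto
    have "x \<oplus>\<^bsub>M\<^esub> y = lincomb M s n (\<lambda>i. f i \<oplus> g i)" using s f g by (simp add: lincomb_add)
    then show ?thesis using HI f g by simp
  qed
  have smult: "a \<odot>\<^bsub>M\<^esub> x \<in> ?H" if a: "a \<in> carrier R" and x: "x \<in> ?H" for a x
  proof -
    obtain f where f: "\<forall>i. f i \<in> carrier R" "x = lincomb M s n f" using HE[OF x] by auto
    have "a \<odot>\<^bsub>M\<^esub> x = lincomb M s n (\<lambda>i. a \<otimes> f i)" using s f a by (simp add: lincomb_smult)
    then show ?thesis using HI f a by simp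
  qed
  have sub: "?H \<subseteq> carrier M" using s lincomb_closed by auto
  show ?thesis
  proof (intro submodule.intro submodule_axioms.intro)
    show "subgroup ?H (add_monoid M)"
      by (rule M.add.subgroupI) (use sub zero neg add in \<open>auto simp: a_inv_def\<close>)
  qed (use smult in blast)
qed

end

lemma fg_module_universe:
  fixes R :: "('a, 'r) ring_scheme" and M :: "('a, 'm, 'n) module_scheme"
  assumes "fg_module R M"
  shows "\<exists>N :: 'a fgmod. fg_module R N \<and> module_iso R M N"
proof -
  interpret left_module R M using assms by (simp add: fg_module_def)
  obtain S where S: "finite S" "S \<subseteq> carrier M"
    and gen: "\<And>N. submodule N R M \<Longrightarrow> S \<subseteq> N \<Longrightarrow> N = carrier M"
    using assms unfolding fg_module_def finitely_generated_def by blast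
  obtain n s0 where s0: "S = s0 ` {i::nat. i < n}"
    using S(1) finite_imp_nat_seg_image_inj_on by blast
  define s where "s i = (if i < n then s0 i else \<zero>\<^bsub>M\<^esub>)" for i
  have s: "\<forall>i. s i \<in> carrier M" using S(2) s0 by (auto simp: s_def)
  let ?H = "lincomb M s n ` {f. \<forall>i. f i \<in> carrier R}"
  have "S \<subseteq> ?H"
  proof
    fix x assume "x \<in> S"
    then obtain j where "j < n" "x = s j" using s0 by (auto simp: s_def)
    then have "x = lincomb M s n (\<lambda>i. if i = j then \<one>\<^bsub>R\<^esub> else \<zero>\<^bsub>R\<^esub>)" using s by (simp add: lincomb_unit)
    then show "x \<in> ?H" by auto
  qed
  then have H: "?H = carrier M" by (rule gen[OF submodule_lincombs[OF s]])
  define \<phi> where "\<phi> m = {f. (\<forall>i. f i \<in> carrier R) \<and> lincomb M s n f = m}" for m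
  have inj: "inj_on \<phi> (carrier M)"
  proof (rule inj_onI)
    fix x y assume xy: "x \<in> carrier M" "y \<in> carrier M" "\<phi> x = \<phi> y"
    have "x \<in> ?H" using xy(1) by (simp only: H)
    then obtain f where "f \<in> \<phi> x" by (auto simp only: \<phi>_def image_iff mem_Collect_eq)
    then have "f \<in> \<phi> x" "f \<in> \<phi> y" using xy(3) by simp_all
    then show "x = y" by (simp add: \<phi>_def)
  qed
  define \<psi> where "\<psi> = inv_into (carrier M) \<phi>"
  have \<psi>[simp]: "\<psi> (\<phi> m) = m" if "m \<in> carrier M" for m using that inj by (simp add: \<psi>_def)
  define N :: "'a fgmod" where "N = \<lparr>carrier = \<phi> ` carrier M, mult = \<lambda>x y. x, one = {}, zero = \<phi> \<zero>\<^bsub>M\<^esub>,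
    add = \<lambda>x y. \<phi> (\<psi> x \<oplus>\<^bsub>M\<^esub> \<psi> y), smult = \<lambda>a x. \<phi> (a \<odot>\<^bsub>M\<^esub> \<psi> x)\<rparr>"
  have grp: "abelian_group N"
  proof (rule abelian_groupI)
    fix x assume "x \<in> carrier N"
    then obtain m where "m \<in> carrier M" "x = \<phi> m" by (auto simp: N_def)
    then show "\<exists>y \<in> carrier N. y \<oplus>\<^bsub>N\<^esub> x = \<zero>\<^bsub>N\<^esub>"
      by (intro bexI[of _ "\<phi> (\<ominus>\<^bsub>M\<^esub> m)"]) (auto simp: N_def M.l_neg)
  qed (auto simp: N_def M.a_ac)
  have lm: "left_module R N"
    by (intro left_module.intro left_module_axioms.intro grp R.ring_axioms)
      (auto simp: N_def smult_l_distr smult_r_distr smult_assoc1)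
  have iso: "\<phi> \<in> module_hom R M N" "bij_betw \<phi> (carrier M) (carrier N)"
    using inj by (auto simp: module_hom_def N_def bij_betw_def)
  interpret N: left_module R N by (rule lm)
  have "finitely_generated R N"
    unfolding finitely_generated_def
  proof (intro exI[of _ "\<phi> ` S"] conjI allI impI)
    fix L assume L: "submodule L R N \<and> \<phi> ` S \<subseteq> L"
    have Lsub: "subgroup L (add_monoid N)" using L by (simp add: submodule_def)
    have LN: "L \<subseteq> carrier N" using subgroup.subset[OF Lsub] by simp
    let ?L = "{m \<in> carrier M. \<phi> m \<in> L}"
    have add: "\<phi> (x \<oplus>\<^bsub>M\<^esub> y) \<in> L" if "x \<in> ?L" "y \<in> ?L" for x y
      using that subgroup.m_closed[OF Lsub, of "\<phi> x" "\<phi> y"] by (simp add: N_def)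
    have smult: "\<phi> (a \<odot>\<^bsub>M\<^esub> x) \<in> L" if "a \<in> carrier R" "x \<in> ?L" for a x
      using that L submodule.smult_closed[of L R N a "\<phi> x"] by (simp add: N_def)
    have zero: "\<zero>\<^bsub>M\<^esub> \<in> ?L" using subgroup.one_closed[OF Lsub] by (simp add: N_def)
    have neg: "\<ominus>\<^bsub>M\<^esub> x \<in> ?L" if "x \<in> ?L" for x
      using smult[of "\<ominus>\<^bsub>R\<^esub> \<one>\<^bsub>R\<^esub>" x] that by (simp add: smult_l_minus)
    have "submodule ?L R M"
    proof (intro submodule.intro submodule_axioms.intro)
      show "subgroup ?L (add_monoid M)"
        by (rule M.add.subgroupI) (use zero neg add in \<open>auto simp: a_inv_def\<close>)
    qed (use smult in auto)
    moreover have "S \<subseteq> ?L" using L S(2) by auto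
    ultimately have "?L = carrier M" by (rule gen)
    then have "\<phi> ` carrier M \<subseteq> L" by blast
    then show "L = carrier N" using LN by (auto simp: N_def)
  qed (use S in \<open>auto simp: N_def\<close>)
  then show ?thesis using lm iso unfolding fg_module_def module_iso_def by blast
qed

end

theory Submission
  imports Defs "HOL-Library.Multiset" "HOL-Algebra.Ring_Divisibility"
begin

text \<open>
  Let \<open>S\<close> be the subring with carrier \<open>B\<close> and let \<open>X\<close> be a finitely generated \<open>S\<close>-module of finite projective dimension.
  The proof bounds this dimension independently of \<open>X\<close> by extending a resolution of \<open>X\<close> to \<open>A\<close>, where dimensions are
  bounded, and by an argument of Igusa and Todorov back over \<open>S\<close>.

  A free resolution of \<open>X\<close> is a sequence of matrices over \<open>S\<close>.  Its syzygies are the images \<open>im_S n\<close> of the matrices acting on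
  vectors over \<open>S\<close>; the same matrices acting on vectors over \<open>A\<close> have images \<open>im_A n\<close>.  As \<open>A\<close> has a finite projective
  resolution as a right \<open>S\<close>-module, the extended sequence is exact beyond some degree \<open>n0\<close> that depends on \<open>A\<close> only
  (\<open>tensor_exact_resolution\<close>, the vanishing of Tor).  For large \<open>n\<close> the module \<open>im_S n\<close> is projective, so \<open>im_A n\<close> is
  (\<open>projective_im_A\<close>).  Hence \<open>im_A (Suc n0)\<close> has finite projective dimension, at most \<open>m\<close> if \<open>m\<close> is the finitistic dimension of
  \<open>A\<close>, and \<open>im_A (Suc j)\<close> is projective for \<open>j = Suc (n0 + m)\<close>.

  Let \<open>I = rad_pow S s\<close>.  After a projective summand is split off, the entries of the vectors in \<open>im_S (Suc j)\<close> lie in \<open>rad S\<close>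
  (\<open>superfluous_kernel\<close>).  Since \<open>I A (rad S)\<close> is contained in \<open>B\<close>, multiplication by \<open>I\<close> then moves \<open>im_A (Suc j)\<close> into the vectors
  over \<open>S\<close>, that is, into \<open>im_S (Suc j)\<close>.  So \<open>im_S (Suc j)\<close> is the kernel of a surjection from \<open>im_A (Suc j)\<close> onto a
  module over \<open>S Quot I\<close> (\<open>igusa_todorov_step\<close>).  The target is a direct sum of copies of finitely many modules because \<open>S Quot I\<close> is
  representation-finite (\<open>annihilated_decomposition\<close>).  The source is projective over \<open>A\<close>, hence over \<open>S\<close> a direct summand of a
  power of \<open>A\<close>, and so again a direct sum of copies of finitely many modules by the Krull-Schmidt theorem (\<open>finite_summands\<close>).

  It remains to see that the kernels of finite projective dimension of surjections between direct sums of modules from a finite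
  list have bounded projective dimension (\<open>igusa_todorov_bound\<close>).  Two direct sums are related in degree \<open>d\<close> if their \<open>d\<close>-th
  syzygies agree up to projective summands.  The differences of the multiplicity vectors of related pairs form an ascending chain of
  groups of integer vectors, so some degree \<open>e\<close> captures all relations.  A kernel of finite projective dimension forces source and
  target to be related in some degree, hence in degree \<open>e\<close>.  Up to projective summands, the \<open>e\<close>-th syzygy of the
  kernel is therefore the kernel of a surjection from \<open>M\<close> plus a projective onto \<open>M\<close>, where \<open>M\<close> is a direct sum of modules from
  a finite list.  By the Fitting decomposition of its component on \<open>M\<close>, the dimension of this kernel is bounded by that of a direct
  summand of \<open>M\<close> of finite projective dimension (\<open>pd_kernel_summand\<close>), and there are finitely many indecomposable candidates.

  The module theory rests on one property of Artin algebras: the regular module has finite length.  For the commutative base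
  ring this is derived from the descending chain condition (\<open>artinian_ideal_rank\<close>).
\<close>

section \<open>Submodules and homomorphisms\<close>

lemma (in abelian_group) minus_self [simp]: "x \<in> carrier G \<Longrightarrow> x \<ominus> x = \<zero>"
  by (simp add: a_minus_def r_neg)

lemma (in abelian_group) add_minus_cancel [simp]: "x \<in> carrier G \<Longrightarrow> y \<in> carrier G \<Longrightarrow> x \<ominus> y \<oplus> y = x"
  by (simp add: a_minus_def a_assoc l_neg)

lemma (in abelian_group) minus_add_cancel [simp]: "x \<in> carrier G \<Longrightarrow> y \<in> carrier G \<Longrightarrow> x \<oplus> y \<ominus> y = x"
  by (simp add: a_minus_def a_assoc r_neg)

lemma (in abelian_group) minus_eq_zero_iff [simp]: "x \<in> carrier G \<Longrightarrow> y \<in> carrier G \<Longrightarrow> x \<ominus> y = \<zero> \<longleftrightarrow> x = y"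
  using add_minus_cancel[of x y] l_zero[of y] minus_self[of y] by metis

context left_module
begin

lemma submoduleI:
  assumes "U \<subseteq> carrier M" "\<zero>\<^bsub>M\<^esub> \<in> U" "\<And>x y. x \<in> U \<Longrightarrow> y \<in> U \<Longrightarrow> x \<oplus>\<^bsub>M\<^esub> y \<in> U"
    "\<And>a x. a \<in> carrier R \<Longrightarrow> x \<in> U \<Longrightarrow> a \<odot>\<^bsub>M\<^esub> x \<in> U"
  shows "submodule U R M"
proof (intro submodule.intro submodule_axioms.intro)
  have "\<ominus>\<^bsub>M\<^esub> x \<in> U" if "x \<in> U" for x
    using assms(4)[of "\<ominus> \<one>" x] that assms(1) smult_l_minus[of \<one> x] by auto
  then show "subgroup U (add_monoid M)"
    by (intro M.add.subgroupI) (use assms in \<open>auto simp: a_inv_def\<close>)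
qed (use assms in blast)

lemma submodule_subset: "submodule U R M \<Longrightarrow> U \<subseteq> carrier M"
  and submodule_zero: "submodule U R M \<Longrightarrow> \<zero>\<^bsub>M\<^esub> \<in> U"
  and submodule_add: "submodule U R M \<Longrightarrow> x \<in> U \<Longrightarrow> y \<in> U \<Longrightarrow> x \<oplus>\<^bsub>M\<^esub> y \<in> U"
  and submodule_smult: "submodule U R M \<Longrightarrow> a \<in> carrier R \<Longrightarrow> x \<in> U \<Longrightarrow> a \<odot>\<^bsub>M\<^esub> x \<in> U"
  and submodule_neg: "submodule U R M \<Longrightarrow> x \<in> U \<Longrightarrow> \<ominus>\<^bsub>M\<^esub> x \<in> U"
  using subgroup.subset[of U "add_monoid M"] subgroup.one_closed[of U "add_monoid M"]
    subgroup.m_closed[of U "add_monoid M"] subgroup.m_inv_closed[of U "add_monoid M"]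
  by (simp_all add: submodule_def submodule_axioms_def a_inv_def)

lemma submodule_mem: "submodule U R M \<Longrightarrow> x \<in> U \<Longrightarrow> x \<in> carrier M"
  using submodule_subset by blast

lemma submodule_diff: "submodule U R M \<Longrightarrow> x \<in> U \<Longrightarrow> y \<in> U \<Longrightarrow> x \<ominus>\<^bsub>M\<^esub> y \<in> U"
  by (simp add: a_minus_def submodule_add submodule_neg)

lemma submodule_carrier: "submodule (carrier M) R M"
  by (rule submoduleI) auto

lemma submodule_zero_set: "submodule {\<zero>\<^bsub>M\<^esub>} R M"
  by (rule submoduleI) (auto simp: smult_r_null)

lemma submodule_Int: "submodule U R M \<Longrightarrow> submodule V R M \<Longrightarrow> submodule (U \<inter> V) R M"
  by (rule submoduleI) (auto simp: submodule_zero submodule_add submodule_smult dest: submodule_mem)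

text \<open>The library's sum of subsets, \<open>U <+>\<^bsub>M\<^esub> V\<close>, as a comprehension; the two agree
  by \<open>ssum_eq_set_add\<close>.\<close>

definition ssum :: "'m set \<Rightarrow> 'm set \<Rightarrow> 'm set" where
  "ssum U V = {u \<oplus>\<^bsub>M\<^esub> v | u v. u \<in> U \<and> v \<in> V}"

lemma ssum_eq_set_add: "ssum U V = U <+>\<^bsub>M\<^esub> V"
  by (auto simp: ssum_def set_add_def set_mult_def)

lemma submodule_ssum:
  assumes U: "submodule U R M" and V: "submodule V R M" shows "submodule (ssum U V) R M"
proof (rule submoduleI)
  show "ssum U V \<subseteq> carrier M" using assms by (auto simp: ssum_def dest: submodule_mem)
  show "\<zero>\<^bsub>M\<^esub> \<in> ssum U V" unfolding ssum_def
    using submodule_zero[OF U] submodule_zero[OF V] M.l_zero[OF M.zero_closed] by (metis (mono_tags, lifting) mem_Collect_eq)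
  fix x y assume "x \<in> ssum U V" "y \<in> ssum U V"
  then obtain a b c d where *: "x = a \<oplus>\<^bsub>M\<^esub> b" "y = c \<oplus>\<^bsub>M\<^esub> d" "a \<in> U" "c \<in> U" "b \<in> V" "d \<in> V"
    by (auto simp: ssum_def)
  then have "x \<oplus>\<^bsub>M\<^esub> y = (a \<oplus>\<^bsub>M\<^esub> c) \<oplus>\<^bsub>M\<^esub> (b \<oplus>\<^bsub>M\<^esub> d)"
    using submodule_mem[OF U] submodule_mem[OF V] by (simp add: M.a_ac)
  then show "x \<oplus>\<^bsub>M\<^esub> y \<in> ssum U V"
    unfolding ssum_def using submodule_add[OF U] submodule_add[OF V] * by blast
next
  fix r x assume r: "r \<in> carrier R" and "x \<in> ssum U V"
  then obtain a b where *: "x = a \<oplus>\<^bsub>M\<^esub> b" "a \<in> U" "b \<in> V" by (auto simp: ssum_def)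
  then have "r \<odot>\<^bsub>M\<^esub> x = r \<odot>\<^bsub>M\<^esub> a \<oplus>\<^bsub>M\<^esub> r \<odot>\<^bsub>M\<^esub> b"
    using submodule_mem[OF U] submodule_mem[OF V] r by (simp add: smult_r_distr)
  then show "r \<odot>\<^bsub>M\<^esub> x \<in> ssum U V"
    unfolding ssum_def using submodule_smult[OF U r] submodule_smult[OF V r] * by blast
qed

lemma ssum_upper1: "submodule U R M \<Longrightarrow> submodule V R M \<Longrightarrow> U \<subseteq> ssum U V"
  unfolding ssum_def by clarify
    (metis M.r_zero submodule_mem submodule_zero)

lemma ssum_upper2: "submodule U R M \<Longrightarrow> submodule V R M \<Longrightarrow> V \<subseteq> ssum U V"
  unfolding ssum_def by clarify (metis M.l_zero submodule_mem submodule_zero)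

lemma left_module_sub:
  assumes U: "submodule U R M" shows "left_module R (M\<lparr>carrier := U\<rparr>)"
proof (intro left_module.intro left_module_axioms.intro abelian_groupI)
  show "ring R" by (rule R.ring_axioms)
  fix x assume "x \<in> carrier (M\<lparr>carrier := U\<rparr>)"
  then show "\<exists>y\<in>carrier (M\<lparr>carrier := U\<rparr>). y \<oplus>\<^bsub>M\<lparr>carrier := U\<rparr>\<^esub> x = \<zero>\<^bsub>M\<lparr>carrier := U\<rparr>\<^esub>"
    using submodule_neg[OF U] submodule_mem[OF U] M.l_neg by auto
qed (use submodule_mem[OF U] in \<open>auto simp: M.a_ac smult_l_distr smult_r_distr smult_assoc1
    submodule_add[OF U] submodule_smult[OF U] submodule_zero[OF U]\<close>)

lemma submodule_sub_iff:
  assumes U: "submodule U R M"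
  shows "submodule V R (M\<lparr>carrier := U\<rparr>) \<longleftrightarrow> submodule V R M \<and> V \<subseteq> U"
proof -
  interpret U: left_module R "M\<lparr>carrier := U\<rparr>" by (rule left_module_sub[OF U])
  show ?thesis
  proof safe
    assume V: "submodule V R (M\<lparr>carrier := U\<rparr>)"
    show sub: "x \<in> V \<Longrightarrow> x \<in> U" for x using U.submodule_mem[OF V] by simp
    show "submodule V R M"
      by (rule submoduleI) (use U.submodule_zero[OF V] U.submodule_add[OF V] U.submodule_smult[OF V]
         sub submodule_mem[OF U] in auto)
  next
    assume V: "submodule V R M" "V \<subseteq> U"
    show "submodule V R (M\<lparr>carrier := U\<rparr>)"
      by (rule U.submoduleI) (use submodule_zero[OF V(1)] submodule_add[OF V(1)] submodule_smult[OF V(1)] V in auto)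
  qed
qed

end

definition kern :: "('a, 'm, 'p) module_scheme \<Rightarrow> ('a, 'n, 'q) module_scheme \<Rightarrow> ('m \<Rightarrow> 'n) \<Rightarrow> 'm set" where
  "kern M N f = {x \<in> carrier M. f x = \<zero>\<^bsub>N\<^esub>}"

lemma hom_closed: "f \<in> module_hom R M N \<Longrightarrow> x \<in> carrier M \<Longrightarrow> f x \<in> carrier N"
  and hom_add: "f \<in> module_hom R M N \<Longrightarrow> x \<in> carrier M \<Longrightarrow> y \<in> carrier M \<Longrightarrow> f (x \<oplus>\<^bsub>M\<^esub> y) = f x \<oplus>\<^bsub>N\<^esub> f y"
  and hom_smult: "f \<in> module_hom R M N \<Longrightarrow> a \<in> carrier R \<Longrightarrow> x \<in> carrier M \<Longrightarrow> f (a \<odot>\<^bsub>M\<^esub> x) = a \<odot>\<^bsub>N\<^esub> f x"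
  by (auto simp: module_hom_def)

lemma homI: "(\<And>x. x \<in> carrier M \<Longrightarrow> f x \<in> carrier N) \<Longrightarrow>
   (\<And>x y. x \<in> carrier M \<Longrightarrow> y \<in> carrier M \<Longrightarrow> f (x \<oplus>\<^bsub>M\<^esub> y) = f x \<oplus>\<^bsub>N\<^esub> f y) \<Longrightarrow>
   (\<And>a x. a \<in> carrier R \<Longrightarrow> x \<in> carrier M \<Longrightarrow> f (a \<odot>\<^bsub>M\<^esub> x) = a \<odot>\<^bsub>N\<^esub> f x) \<Longrightarrow> f \<in> module_hom R M N"
  by (auto simp: module_hom_def)

lemma hom_zero:
  assumes "left_module R M" "left_module R N" "f \<in> module_hom R M N"
  shows "f \<zero>\<^bsub>M\<^esub> = \<zero>\<^bsub>N\<^esub>"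
proof -
  interpret M: left_module R M by fact
  interpret N: left_module R N by fact
  have "f \<zero>\<^bsub>M\<^esub> \<oplus>\<^bsub>N\<^esub> f \<zero>\<^bsub>M\<^esub> = f \<zero>\<^bsub>M\<^esub>" using hom_add[OF assms(3), of "\<zero>\<^bsub>M\<^esub>" "\<zero>\<^bsub>M\<^esub>"] by simp
  then show ?thesis using hom_closed[OF assms(3)] by (metis M.M.zero_closed N.M.add.l_cancel_one')
qed

lemma hom_neg:
  assumes "left_module R M" "left_module R N" "f \<in> module_hom R M N" "x \<in> carrier M"
  shows "f (\<ominus>\<^bsub>M\<^esub> x) = \<ominus>\<^bsub>N\<^esub> f x"
proof -
  interpret M: left_module R M by fact
  interpret N: left_module R N by fact
  have "f (\<ominus>\<^bsub>M\<^esub> x) \<oplus>\<^bsub>N\<^esub> f x = \<zero>\<^bsub>N\<^esub>"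
    using hom_add[OF assms(3), of "\<ominus>\<^bsub>M\<^esub> x" x] assms hom_zero[OF assms(1-3)] by (simp add: M.M.l_neg)
  then show ?thesis using N.M.minus_equality hom_closed[OF assms(3)] assms(4) by auto
qed

lemma hom_diff:
  assumes "left_module R M" "left_module R N" "f \<in> module_hom R M N" "x \<in> carrier M" "y \<in> carrier M"
  shows "f (x \<ominus>\<^bsub>M\<^esub> y) = f x \<ominus>\<^bsub>N\<^esub> f y"
proof -
  interpret M: left_module R M by fact
  interpret N: left_module R N by fact
  show ?thesis using assms by (simp add: a_minus_def hom_add hom_neg)
qed

lemma hom_id [simp]: "(\<lambda>x. x) \<in> module_hom R M M"
  by (auto simp: module_hom_def)

lemma hom_comp: "f \<in> module_hom R M N \<Longrightarrow> g \<in> module_hom R N L \<Longrightarrow> (\<lambda>x. g (f x)) \<in> module_hom R M L"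
  by (auto simp: module_hom_def Pi_iff)

lemma hom_add_fun:
  assumes "left_module R N" "f \<in> module_hom R M N" "g \<in> module_hom R M N"
  shows "(\<lambda>x. f x \<oplus>\<^bsub>N\<^esub> g x) \<in> module_hom R M N"
proof -
  interpret N: left_module R N by fact
  show ?thesis using assms(2,3)
    by (auto simp: module_hom_def Pi_iff N.smult_r_distr N.M.a_ac)
qed

lemma hom_zero_fun:
  assumes "left_module R N" shows "(\<lambda>x. \<zero>\<^bsub>N\<^esub>) \<in> module_hom R M N"
proof -
  interpret N: left_module R N by fact
  show ?thesis by (auto simp: module_hom_def N.smult_r_null)
qed

lemma hom_neg_fun:
  assumes "left_module R N" "f \<in> module_hom R M N"
  shows "(\<lambda>x. \<ominus>\<^bsub>N\<^esub> f x) \<in> module_hom R M N"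
proof -
  interpret N: left_module R N by fact
  have neg: "\<ominus>\<^bsub>N\<^esub> y = (\<ominus>\<^bsub>R\<^esub> \<one>\<^bsub>R\<^esub>) \<odot>\<^bsub>N\<^esub> y" if "y \<in> carrier N" for y using that by (simp add: N.smult_l_minus)
  have comm: "\<ominus>\<^bsub>N\<^esub> (a \<odot>\<^bsub>N\<^esub> y) = a \<odot>\<^bsub>N\<^esub> (\<ominus>\<^bsub>N\<^esub> y)" if "a \<in> carrier R" "y \<in> carrier N" for a y
  proof -
    have "a \<odot>\<^bsub>N\<^esub> (\<ominus>\<^bsub>N\<^esub> y) \<oplus>\<^bsub>N\<^esub> a \<odot>\<^bsub>N\<^esub> y = \<zero>\<^bsub>N\<^esub>"
      using that by (simp flip: N.smult_r_distr add: N.M.l_neg N.smult_r_null)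
    then show ?thesis using that N.M.minus_equality by auto
  qed
  show ?thesis using assms(2)
    by (auto simp: module_hom_def Pi_iff N.M.minus_add comm)
qed

lemma hom_diff_fun:
  assumes "left_module R N" "f \<in> module_hom R M N" "g \<in> module_hom R M N"
  shows "(\<lambda>x. f x \<ominus>\<^bsub>N\<^esub> g x) \<in> module_hom R M N"
  using hom_add_fun[OF assms(1,2) hom_neg_fun[OF assms(1,3)]] by (simp add: a_minus_def)

lemma hom_restrict: "f \<in> module_hom R M N \<Longrightarrow> U \<subseteq> carrier M \<Longrightarrow> f \<in> module_hom R (M\<lparr>carrier := U\<rparr>) N"
  by (auto simp: module_hom_def Pi_iff subset_iff)

lemma hom_corestrict: "f \<in> module_hom R M N \<Longrightarrow> f ` carrier M \<subseteq> V \<Longrightarrow> f \<in> module_hom R M (N\<lparr>carrier := V\<rparr>)"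
  by (auto simp: module_hom_def Pi_iff subset_iff)

lemma hom_cong:
  assumes "left_module R M" "f \<in> module_hom R M N" "\<And>x. x \<in> carrier M \<Longrightarrow> g x = f x"
  shows "g \<in> module_hom R M N"
proof -
  interpret M: left_module R M by fact
  show ?thesis using assms by (auto simp: module_hom_def Pi_iff)
qed

lemma hom_pow: "f \<in> module_hom R M M \<Longrightarrow> (f ^^ n) \<in> module_hom R M M"
  by (induction n) (auto simp: module_hom_def Pi_iff)

lemma submodule_vimage:
  assumes "left_module R M" "left_module R N" "f \<in> module_hom R M N" "submodule V R N"
  shows "submodule {x \<in> carrier M. f x \<in> V} R M"
proof -
  interpret M: left_module R M by fact
  interpret N: left_module R N by fact
  show ?thesis
    by (rule M.submoduleI) (use assms in \<open>auto simp: hom_zero hom_add hom_smult N.submodule_zero N.submodule_add N.submodule_smult\<close>)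
qed

lemma submodule_kern:
  assumes "left_module R M" "left_module R N" "f \<in> module_hom R M N"
  shows "submodule (kern M N f) R M"
  using submodule_vimage[OF assms left_module.submodule_zero_set[OF assms(2)]] by (simp add: kern_def)

lemma submodule_image:
  assumes "left_module R M" "left_module R N" "f \<in> module_hom R M N" "submodule U R M"
  shows "submodule (f ` U) R N"
proof -
  interpret M: left_module R M by fact
  interpret N: left_module R N by fact
  note UC = M.submodule_mem[OF assms(4)]
  show ?thesis
  proof (rule N.submoduleI)
    show "f ` U \<subseteq> carrier N" using UC hom_closed[OF assms(3)] by blast
    show "\<zero>\<^bsub>N\<^esub> \<in> f ` U" using hom_zero[OF assms(1-3)] M.submodule_zero[OF assms(4)] by force
    fix x y assume "x \<in> f ` U" "y \<in> f ` U"
    then show "x \<oplus>\<^bsub>N\<^esub> y \<in> f ` U" using M.submodule_add[OF assms(4)] hom_add[OF assms(3)] UC by (smt (verit) imageE imageI)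
  next
    fix a x assume "a \<in> carrier R" "x \<in> f ` U"
    then show "a \<odot>\<^bsub>N\<^esub> x \<in> f ` U" using M.submodule_smult[OF assms(4)] hom_smult[OF assms(3)] UC by (smt (verit) imageE imageI)
  qed
qed

lemma submodule_range:
  assumes "left_module R M" "left_module R N" "f \<in> module_hom R M N"
  shows "submodule (f ` carrier M) R N"
  using submodule_image[OF assms left_module.submodule_carrier[OF assms(1)]] .

lemma inj_on_kern:
  assumes "left_module R M" "left_module R N" "f \<in> module_hom R M N"
  shows "inj_on f (carrier M) \<longleftrightarrow> kern M N f = {\<zero>\<^bsub>M\<^esub>}"
proof -
  interpret M: left_module R M by fact
  interpret N: left_module R N by fact
  show ?thesis
  proof
    assume inj: "inj_on f (carrier M)"
    have "x = \<zero>\<^bsub>M\<^esub>" if "x \<in> carrier M" "f x = \<zero>\<^bsub>N\<^esub>" for x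
      using inj_onD[OF inj _ that(1) M.M.zero_closed] that(2) hom_zero[OF assms] by metis
    then show "kern M N f = {\<zero>\<^bsub>M\<^esub>}" unfolding kern_def using hom_zero[OF assms] by blast
  next
    assume k: "kern M N f = {\<zero>\<^bsub>M\<^esub>}"
    show "inj_on f (carrier M)"
    proof (rule inj_onI)
      fix x y assume xy: "x \<in> carrier M" "y \<in> carrier M" "f x = f y"
      have "f (x \<ominus>\<^bsub>M\<^esub> y) = f y \<ominus>\<^bsub>N\<^esub> f y" using hom_diff[OF assms xy(1,2)] xy(3) by metis
      also have "\<dots> = \<zero>\<^bsub>N\<^esub>" using hom_closed[OF assms(3) xy(2)] by simp
      finally have "x \<ominus>\<^bsub>M\<^esub> y \<in> kern M N f" unfolding kern_def using M.M.minus_closed[OF xy(1,2)] by blast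
      then have "x \<ominus>\<^bsub>M\<^esub> y = \<zero>\<^bsub>M\<^esub>" unfolding k by blast
      then show "x = y" using xy(1,2) by simp
    qed
  qed
qed

section \<open>Isomorphisms and products\<close>

lemma module_isoI: "f \<in> module_hom R M N \<Longrightarrow> bij_betw f (carrier M) (carrier N) \<Longrightarrow> module_iso R M N"
  by (auto simp: module_iso_def)

lemma hom_inv:
  assumes "left_module R M" "f \<in> module_hom R M N" "bij_betw f (carrier M) (carrier N)"
  shows "inv_into (carrier M) f \<in> module_hom R N M"
proof -
  interpret M: left_module R M by fact
  let ?g = "inv_into (carrier M) f"
  have g: "?g y \<in> carrier M" "f (?g y) = y" if "y \<in> carrier N" for y
    using that assms(3) by (auto simp: bij_betw_def inv_into_into f_inv_into_f)
  have eq: "?g y = x" if "x \<in> carrier M" "f x = y" for x y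
    using that assms(3) by (auto simp: bij_betw_def)
  show ?thesis
    by (rule homI) (auto simp: g assms intro!: eq hom_add[OF assms(2), THEN trans] hom_smult[OF assms(2), THEN trans])
qed

lemma module_isoE:
  assumes "module_iso R M N" "left_module R M"
  obtains f g where "f \<in> module_hom R M N" "g \<in> module_hom R N M"
    "\<And>x. x \<in> carrier M \<Longrightarrow> g (f x) = x" "\<And>y. y \<in> carrier N \<Longrightarrow> f (g y) = y"
proof -
  obtain f where f: "f \<in> module_hom R M N" "bij_betw f (carrier M) (carrier N)"
    using assms(1) by (auto simp: module_iso_def)
  show ?thesis
    by (rule that[OF f(1) hom_inv[OF assms(2) f]])
      (use f(2) in \<open>auto simp: bij_betw_def f_inv_into_f\<close>)
qed

lemma module_isoI2:
  assumes "f \<in> module_hom R M N" "g \<in> module_hom R N M"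
    "\<And>x. x \<in> carrier M \<Longrightarrow> g (f x) = x" "\<And>y. y \<in> carrier N \<Longrightarrow> f (g y) = y"
  shows "module_iso R M N"
  by (rule module_isoI[OF assms(1)], rule bij_betw_byWitness[where f'=g])
    (use assms in \<open>auto simp: hom_closed\<close>)

lemma module_iso_refl [simp]: "module_iso R M M"
  by (rule module_isoI2[of "\<lambda>x. x" _ _ _ "\<lambda>x. x"]) auto

lemma module_iso_sym: "module_iso R M N \<Longrightarrow> left_module R M \<Longrightarrow> module_iso R N M"
  by (metis module_isoE module_isoI2)

lemma module_iso_trans: "module_iso R M N \<Longrightarrow> module_iso R N L \<Longrightarrow> module_iso R M L"
  unfolding module_iso_def using hom_comp[of _ R M N _ L] bij_betw_trans[of _ "carrier M" "carrier N" _ "carrier L"]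
  unfolding comp_def by blast

definition prod_mod :: "('a, 'm, 'p) module_scheme \<Rightarrow> ('a, 'n, 'q) module_scheme \<Rightarrow> ('a, 'm \<times> 'n) module" where
  "prod_mod M N = \<lparr>carrier = carrier M \<times> carrier N, monoid.mult = \<lambda>x y. x, one = (\<zero>\<^bsub>M\<^esub>, \<zero>\<^bsub>N\<^esub>), zero = (\<zero>\<^bsub>M\<^esub>, \<zero>\<^bsub>N\<^esub>),
     add = \<lambda>x y. (fst x \<oplus>\<^bsub>M\<^esub> fst y, snd x \<oplus>\<^bsub>N\<^esub> snd y), smult = \<lambda>a x. (a \<odot>\<^bsub>M\<^esub> fst x, a \<odot>\<^bsub>N\<^esub> snd x)\<rparr>"

lemma prod_mod_simps [simp]:
  "carrier (prod_mod M N) = carrier M \<times> carrier N"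
  "\<zero>\<^bsub>prod_mod M N\<^esub> = (\<zero>\<^bsub>M\<^esub>, \<zero>\<^bsub>N\<^esub>)"
  "x \<oplus>\<^bsub>prod_mod M N\<^esub> y = (fst x \<oplus>\<^bsub>M\<^esub> fst y, snd x \<oplus>\<^bsub>N\<^esub> snd y)"
  "a \<odot>\<^bsub>prod_mod M N\<^esub> x = (a \<odot>\<^bsub>M\<^esub> fst x, a \<odot>\<^bsub>N\<^esub> snd x)"
  by (simp_all add: prod_mod_def)

lemma left_module_prod [simp, intro]:
  assumes "left_module R M" "left_module R N" shows "left_module R (prod_mod M N)"
proof -
  interpret M: left_module R M by fact
  interpret N: left_module R N by fact
  show ?thesis
  proof (intro left_module.intro left_module_axioms.intro abelian_groupI)
    show "ring R" by (rule M.R.ring_axioms)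
    fix x assume x: "x \<in> carrier (prod_mod M N)"
    then show "\<exists>y\<in>carrier (prod_mod M N). y \<oplus>\<^bsub>prod_mod M N\<^esub> x = \<zero>\<^bsub>prod_mod M N\<^esub>"
      by (intro bexI[of _ "(\<ominus>\<^bsub>M\<^esub> fst x, \<ominus>\<^bsub>N\<^esub> snd x)"]) (auto simp: M.M.l_neg N.M.l_neg)
  qed (auto simp: M.smult_l_distr M.smult_r_distr M.smult_assoc1 N.smult_l_distr N.smult_r_distr N.smult_assoc1 M.M.a_ac N.M.a_ac)
qed

lemma hom_fst: "fst \<in> module_hom R (prod_mod M N) M"
  and hom_snd: "snd \<in> module_hom R (prod_mod M N) N"
  by (auto simp: module_hom_def)

lemma hom_inl: "left_module R N \<Longrightarrow> (\<lambda>x. (x, \<zero>\<^bsub>N\<^esub>)) \<in> module_hom R M (prod_mod M N)"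
  using left_module.smult_r_null[of R N]
  by (auto simp: module_hom_def abelian_monoid.l_zero abelian_group.axioms(1) abelian_monoid.zero_closed left_module.axioms(2))

lemma hom_inr: "left_module R M \<Longrightarrow> (\<lambda>x. (\<zero>\<^bsub>M\<^esub>, x)) \<in> module_hom R N (prod_mod M N)"
  using left_module.smult_r_null[of R M]
  by (auto simp: module_hom_def abelian_monoid.l_zero abelian_group.axioms(1) abelian_monoid.zero_closed left_module.axioms(2))

lemma hom_pair: "f \<in> module_hom R L M \<Longrightarrow> g \<in> module_hom R L N \<Longrightarrow> (\<lambda>x. (f x, g x)) \<in> module_hom R L (prod_mod M N)"
  by (auto simp: module_hom_def)

lemma module_iso_prod:
  assumes "module_iso R M M'" "module_iso R N N'"
  shows "module_iso R (prod_mod M N) (prod_mod M' N')"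
proof -
  obtain f where f: "f \<in> module_hom R M M'" "bij_betw f (carrier M) (carrier M')" using assms(1) by (auto simp: module_iso_def)
  obtain g where g: "g \<in> module_hom R N N'" "bij_betw g (carrier N) (carrier N')" using assms(2) by (auto simp: module_iso_def)
  have "map_prod f g \<in> module_hom R (prod_mod M N) (prod_mod M' N')"
    using f(1) g(1) by (auto simp: module_hom_def)
  moreover have "bij_betw (map_prod f g) (carrier (prod_mod M N)) (carrier (prod_mod M' N'))"
    using f(2) g(2) by (auto intro!: bij_betw_map_prod)
  ultimately show ?thesis by (rule module_isoI)
qed

lemma module_iso_prod_comm: "module_iso R (prod_mod M N) (prod_mod N M)"
  by (rule module_isoI2[of prod.swap _ _ _ prod.swap]) (auto simp: module_hom_def)

lemma module_iso_prod_assoc: "module_iso R (prod_mod (prod_mod M N) L) (prod_mod M (prod_mod N L))"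
  by (rule module_isoI2[of "\<lambda>((x,y),z). (x,(y,z))" _ _ _ "\<lambda>(x,(y,z)). ((x,y),z)"]) (auto simp: module_hom_def)

lemma module_iso_prod_zero:
  assumes "left_module R N" "carrier N = {\<zero>\<^bsub>N\<^esub>}" shows "module_iso R (prod_mod M N) M"
  by (rule module_isoI2[OF hom_fst hom_inl[OF assms(1)]]) (use assms(2) in auto)

lemma module_iso_zero:
  assumes "left_module R M" "left_module R N" "carrier M = {\<zero>\<^bsub>M\<^esub>}" "carrier N = {\<zero>\<^bsub>N\<^esub>}" shows "module_iso R M N"
  by (rule module_isoI2[OF hom_zero_fun[OF assms(2)] hom_zero_fun[OF assms(1)]]) (use assms(3,4) in auto)

lemma module_iso_internal_sum:
  assumes "left_module R M" and U: "submodule U R M" and V: "submodule V R M"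
    and int: "U \<inter> V = {\<zero>\<^bsub>M\<^esub>}" and sum: "\<And>x. x \<in> carrier M \<Longrightarrow> \<exists>u\<in>U. \<exists>v\<in>V. x = u \<oplus>\<^bsub>M\<^esub> v"
  shows "module_iso R (prod_mod (M\<lparr>carrier := U\<rparr>) (M\<lparr>carrier := V\<rparr>)) M"
proof -
  interpret left_module R M by fact
  let ?P = "prod_mod (M\<lparr>carrier := U\<rparr>) (M\<lparr>carrier := V\<rparr>)"
  let ?f = "\<lambda>x. fst x \<oplus>\<^bsub>M\<^esub> snd x"
  note UC = submodule_mem[OF U] and VC = submodule_mem[OF V]
  have P: "left_module R ?P" using left_module_sub U V by auto
  have f: "?f \<in> module_hom R ?P M" by (rule homI) (auto simp: UC VC M.a_ac smult_r_distr)
  have "kern ?P M ?f = {\<zero>\<^bsub>?P\<^esub>}"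
  proof (safe; clarsimp simp: kern_def)
    fix u v assume uv: "u \<in> U" "v \<in> V" "u \<oplus>\<^bsub>M\<^esub> v = \<zero>\<^bsub>M\<^esub>"
    then have "u = \<ominus>\<^bsub>M\<^esub> v" using UC VC M.minus_equality by auto
    then have "u \<in> V" using submodule_neg[OF V] uv by auto
    then have "u = \<zero>\<^bsub>M\<^esub>" using int uv by blast
    then show "u = \<zero>\<^bsub>M\<^esub> \<and> v = \<zero>\<^bsub>M\<^esub>" using uv VC by auto
  qed (use submodule_zero U V in auto)
  then have "inj_on ?f (carrier ?P)" using inj_on_kern[OF P assms(1) f] by auto
  moreover have "?f ` carrier ?P = carrier M" using sum UC VC by (auto simp: image_iff)
  ultimately show ?thesis using module_isoI[OF f] by (auto simp: bij_betw_def)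
qed

section \<open>Modules of finite length\<close>

text \<open>Finite length is witnessed by a function to the natural numbers that increases strictly along inclusions
  of submodules, as the length does. No composition series has to be handled, and witnesses can be combined by
  addition. The bound \<^term>\<open>H\<close> expresses that a submodule has finite length without passing to another
  module.\<close>

definition rank_on :: "('a, 'r) ring_scheme \<Rightarrow> ('a, 'm, 'p) module_scheme \<Rightarrow> 'm set \<Rightarrow> ('m set \<Rightarrow> nat) \<Rightarrow> bool" where
  "rank_on R M H \<rho> \<longleftrightarrow> (\<forall>U V. submodule U R M \<longrightarrow> submodule V R M \<longrightarrow> U \<subset> V \<longrightarrow> V \<subseteq> H \<longrightarrow> \<rho> U < \<rho> V)"

definition finite_length_on :: "('a, 'r) ring_scheme \<Rightarrow> ('a, 'm, 'p) module_scheme \<Rightarrow> 'm set \<Rightarrow> bool" where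
  "finite_length_on R M H \<longleftrightarrow> (\<exists>\<rho>. rank_on R M H \<rho>)"

abbreviation finite_length :: "('a, 'r) ring_scheme \<Rightarrow> ('a, 'm, 'p) module_scheme \<Rightarrow> bool" where
  "finite_length R M \<equiv> finite_length_on R M (carrier M)"

lemma finite_length_onI:
  fixes \<rho> :: "'m set \<Rightarrow> nat" and M :: "('a, 'm, 'p) module_scheme"
  assumes "\<And>U V. submodule U R M \<Longrightarrow> submodule V R M \<Longrightarrow> U \<subseteq> V \<Longrightarrow> V \<subseteq> H \<Longrightarrow> \<rho> U \<le> \<rho> V \<and> (\<rho> U = \<rho> V \<longrightarrow> V \<subseteq> U)"
  shows "finite_length_on R M H"
proof -
  have "\<rho> U < \<rho> V" if "submodule U R M" "submodule V R M" "U \<subset> V" "V \<subseteq> H" for U V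
    using assms[OF that(1,2) _ that(4)] that(3) less_le[of "\<rho> U" "\<rho> V"] by (metis psubset_eq subset_antisym)
  then have "rank_on R M H \<rho>" unfolding rank_on_def by blast
  then show ?thesis unfolding finite_length_on_def by blast
qed

lemma rank_onD:
  assumes "rank_on R M H \<rho>" "submodule U R M" "submodule V R M" "U \<subseteq> V" "V \<subseteq> H"
  shows "\<rho> U \<le> \<rho> V" "\<rho> U = \<rho> V \<Longrightarrow> U = V"
proof -
  have "U = V \<or> \<rho> U < \<rho> V" using assms unfolding rank_on_def by auto
  then show "\<rho> U \<le> \<rho> V" "\<rho> U = \<rho> V \<Longrightarrow> U = V" by auto
qed

lemma finite_length_on_mono:
  assumes "finite_length_on R M H" "H' \<subseteq> H" shows "finite_length_on R M H'"
proof -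
  obtain \<rho> where "rank_on R M H \<rho>" using assms(1) unfolding finite_length_on_def by blast
  note \<rho> = rank_onD[OF this]
  show ?thesis
  proof (rule finite_length_onI[where \<rho> = \<rho>])
    fix U V assume *: "submodule U R M" "submodule V R M" "U \<subseteq> V" "V \<subseteq> H'"
    then have "V \<subseteq> H" using assms(2) by simp
    then show "\<rho> U \<le> \<rho> V \<and> (\<rho> U = \<rho> V \<longrightarrow> V \<subseteq> U)" using \<rho>[OF *(1-3)] by auto
  qed
qed

lemma finite_length_sub_iff:
  assumes "left_module R M" "submodule H R M"
  shows "finite_length R (M\<lparr>carrier := H\<rparr>) \<longleftrightarrow> finite_length_on R M H"
proof -
  have "(submodule U R M \<and> U \<subseteq> H \<longrightarrow> submodule V R M \<and> V \<subseteq> H \<longrightarrow> U \<subset> V \<longrightarrow> V \<subseteq> H \<longrightarrow> P) \<longleftrightarrow>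
    (submodule U R M \<longrightarrow> submodule V R M \<longrightarrow> U \<subset> V \<longrightarrow> V \<subseteq> H \<longrightarrow> P)" for U V and P :: bool
    by auto
  then show ?thesis unfolding finite_length_on_def rank_on_def by (simp add: left_module.submodule_sub_iff[OF assms])
qed

lemma finite_length_inj:
  assumes "left_module R M" "left_module R N" "f \<in> module_hom R M N" "inj_on f (carrier M)" "finite_length R N"
  shows "finite_length R M"
proof -
  obtain \<rho> where "rank_on R N (carrier N) \<rho>" using assms(5) unfolding finite_length_on_def by blast
  note \<rho> = rank_onD[OF this]
  show ?thesis
  proof (rule finite_length_onI[where \<rho> = "\<lambda>U. \<rho> (f ` U)"])
    fix U V assume *: "submodule U R M" "submodule V R M" "U \<subseteq> V" "V \<subseteq> carrier M"
    have fUV: "submodule (f ` U) R N" "submodule (f ` V) R N" "f ` U \<subseteq> f ` V" "f ` V \<subseteq> carrier N"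
      using submodule_image[OF assms(1-3)] * hom_closed[OF assms(3)] by blast+
    have "V \<subseteq> U" if "f ` U = f ` V" using that inj_on_image_eq_iff[OF assms(4), of U V] * by auto
    then show "\<rho> (f ` U) \<le> \<rho> (f ` V) \<and> (\<rho> (f ` U) = \<rho> (f ` V) \<longrightarrow> V \<subseteq> U)"
      using \<rho>[OF fUV] by blast
  qed
qed

lemma finite_length_image:
  assumes "left_module R M" "left_module R N" "f \<in> module_hom R M N" "f ` carrier M = carrier N" "finite_length R M"
  shows "finite_length R N"
proof -
  obtain \<rho> where "rank_on R M (carrier M) \<rho>" using assms(5) unfolding finite_length_on_def by blast
  note \<rho> = rank_onD[OF this]
  let ?i = "\<lambda>U. {x \<in> carrier M. f x \<in> U}"
  show ?thesis
  proof (rule finite_length_onI[where \<rho> = "\<lambda>U. \<rho> (?i U)"])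
    fix U V assume *: "submodule U R N" "submodule V R N" "U \<subseteq> V" "V \<subseteq> carrier N"
    have i: "submodule (?i U) R M" "submodule (?i V) R M" "?i U \<subseteq> ?i V" "?i V \<subseteq> carrier M"
      using submodule_vimage[OF assms(1-3)] * by blast+
    have "V \<subseteq> U" if "?i U = ?i V"
    proof
      fix v assume "v \<in> V"
      then have "v \<in> f ` carrier M" using * assms(4) by blast
      then obtain x where "x \<in> carrier M" "f x = v" by blast
      then show "v \<in> U" using that \<open>v \<in> V\<close> by blast
    qed
    then show "\<rho> (?i U) \<le> \<rho> (?i V) \<and> (\<rho> (?i U) = \<rho> (?i V) \<longrightarrow> V \<subseteq> U)"
      using \<rho>[OF i] by blast
  qed
qed

text \<open>A submodule is determined, among the submodules that contain it, by its intersection with the kernel and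
  its image. So the ranks of these two add up to a rank of the source.\<close>

lemma finite_length_ext:
  assumes "left_module R M" "left_module R N" "f \<in> module_hom R M N" "finite_length_on R M (kern M N f)" "finite_length R N"
  shows "finite_length R M"
proof -
  interpret M: left_module R M by fact
  interpret N: left_module R N by fact
  let ?K = "kern M N f"
  have K: "submodule ?K R M" by (rule submodule_kern[OF assms(1-3)])
  obtain \<rho> where "rank_on R M ?K \<rho>" using assms(4) unfolding finite_length_on_def by blast
  note \<rho> = rank_onD[OF this]
  obtain \<sigma> where "rank_on R N (carrier N) \<sigma>" using assms(5) unfolding finite_length_on_def by blast
  note \<sigma> = rank_onD[OF this]
  show ?thesis
  proof (rule finite_length_onI[where \<rho> = "\<lambda>U. \<rho> (U \<inter> ?K) + \<sigma> (f ` U)"])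
    fix U V assume *: "submodule U R M" "submodule V R M" "U \<subseteq> V" "V \<subseteq> carrier M"
    have i: "submodule (f ` U) R N" "submodule (f ` V) R N" "f ` U \<subseteq> f ` V" "f ` V \<subseteq> carrier N"
      using submodule_image[OF assms(1-3)] * hom_closed[OF assms(3)] by blast+
    have k: "submodule (U \<inter> ?K) R M" "submodule (V \<inter> ?K) R M" "U \<inter> ?K \<subseteq> V \<inter> ?K" "V \<inter> ?K \<subseteq> ?K"
      using M.submodule_Int[OF _ K] * by blast+
    have "V \<subseteq> U" if eq: "f ` U = f ` V" "U \<inter> ?K = V \<inter> ?K"
    proof
      fix v assume v: "v \<in> V"
      then obtain u where u: "u \<in> U" "f u = f v" using eq(1) by force
      have c: "u \<in> carrier M" "v \<in> carrier M" using u v * by auto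
      have "f (v \<ominus>\<^bsub>M\<^esub> u) = \<zero>\<^bsub>N\<^esub>" using hom_diff[OF assms(1-3)] c u(2) hom_closed[OF assms(3)] by simp
      then have "v \<ominus>\<^bsub>M\<^esub> u \<in> V \<inter> ?K"
        using c M.submodule_diff[OF *(2) v] u * by (auto simp: kern_def)
      then have "v \<ominus>\<^bsub>M\<^esub> u \<in> U" using eq by blast
      then show "v \<in> U" using M.submodule_add[OF *(1) _ u(1)] c by fastforce
    qed
    then show "\<rho> (U \<inter> ?K) + \<sigma> (f ` U) \<le> \<rho> (V \<inter> ?K) + \<sigma> (f ` V) \<and> (\<rho> (U \<inter> ?K) + \<sigma> (f ` U) = \<rho> (V \<inter> ?K) + \<sigma> (f ` V) \<longrightarrow> V \<subseteq> U)"
      using \<rho>[OF k] \<sigma>[OF i] by linarith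
  qed
qed

lemma finite_length_submodule:
  assumes "left_module R M" "submodule H R M" "finite_length R M"
  shows "finite_length R (M\<lparr>carrier := H\<rparr>)"
  unfolding finite_length_sub_iff[OF assms(1,2)] using finite_length_on_mono[OF assms(3) left_module.submodule_subset[OF assms(1,2)]] .

lemma finite_length_prod:
  assumes "left_module R M" "left_module R N" "finite_length R M" "finite_length R N"
  shows "finite_length R (prod_mod M N)"
proof (rule finite_length_ext[OF left_module_prod[OF assms(1,2)] assms(1) hom_fst _ assms(3)])
  let ?P = "prod_mod M N"
  let ?K = "kern ?P M fst"
  interpret M: left_module R M by fact
  interpret P: left_module R ?P using assms(1,2) by blast
  have K: "submodule ?K R ?P" by (rule submodule_kern[OF left_module_prod[OF assms(1,2)] assms(1) hom_fst])
  have sub: "?K \<subseteq> carrier ?P" unfolding kern_def by blast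
  have inj: "inj_on snd ?K" unfolding kern_def by (rule inj_onI) (simp add: prod_eq_iff)
  have "finite_length R (?P\<lparr>carrier := ?K\<rparr>)"
    by (rule finite_length_inj[OF P.left_module_sub[OF K] assms(2) hom_restrict[OF hom_snd sub] _ assms(4)]) (simp add: inj)
  then show "finite_length_on R ?P ?K"
    unfolding finite_length_sub_iff[OF P.left_module_axioms K] .
qed

lemma finite_length_zero: "left_module R M \<Longrightarrow> carrier M = {\<zero>\<^bsub>M\<^esub>} \<Longrightarrow> finite_length R M"
  by (rule finite_length_onI[where \<rho>="\<lambda>_. 0"]) (auto dest: left_module.submodule_zero)

lemma finite_length_maximal:
  assumes "finite_length R M" "\<S> \<noteq> {}" "\<And>U. U \<in> \<S> \<Longrightarrow> submodule U R M" "\<And>U. U \<in> \<S> \<Longrightarrow> U \<subseteq> carrier M" "submodule (carrier M) R M"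
  shows "\<exists>U\<in>\<S>. \<forall>V\<in>\<S>. U \<subseteq> V \<longrightarrow> V = U"
proof -
  obtain \<rho> where "rank_on R M (carrier M) \<rho>" using assms(1) unfolding finite_length_on_def by blast
  note \<rho> = rank_onD[OF this]
  obtain U0 where U0: "U0 \<in> \<S>" using assms(2) by blast
  have "\<forall>U. U \<in> \<S> \<longrightarrow> \<rho> U \<le> \<rho> (carrier M)" using \<rho>(1)[OF assms(3) assms(5) assms(4)] by simp
  then obtain U where U: "U \<in> \<S>" "\<forall>V. V \<in> \<S> \<longrightarrow> \<rho> V \<le> \<rho> U"
    using ex_has_greatest_nat[of "\<lambda>U. U \<in> \<S>" U0 \<rho> "Suc (\<rho> (carrier M))"] U0 by (auto simp: less_Suc_eq_le)
  show ?thesis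
  proof (intro bexI[OF _ U(1)] ballI impI)
    fix V assume V: "V \<in> \<S>" "U \<subseteq> V"
    have "\<rho> U = \<rho> V" using \<rho>(1)[OF assms(3)[OF U(1)] assms(3)[OF V(1)] V(2) assms(4)[OF V(1)]] U(2) V(1) by (simp add: order.antisym)
    then show "V = U" using \<rho>(2)[OF assms(3)[OF U(1)] assms(3)[OF V(1)] V(2) assms(4)[OF V(1)]] by simp
  qed
qed

lemma finite_length_minimal:
  assumes "finite_length R M" "\<S> \<noteq> {}" "\<And>U. U \<in> \<S> \<Longrightarrow> submodule U R M" "\<And>U. U \<in> \<S> \<Longrightarrow> U \<subseteq> carrier M"
  shows "\<exists>U\<in>\<S>. \<forall>V\<in>\<S>. V \<subseteq> U \<longrightarrow> V = U"
proof -
  obtain \<rho> where "rank_on R M (carrier M) \<rho>" using assms(1) unfolding finite_length_on_def by blast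
  note \<rho> = rank_onD[OF this]
  obtain U where U: "U \<in> \<S>" "\<forall>V. V \<in> \<S> \<longrightarrow> \<rho> U \<le> \<rho> V"
    using ex_has_least_nat[of "\<lambda>U. U \<in> \<S>" _ \<rho>] assms(2) by blast
  show ?thesis
  proof (intro bexI[OF _ U(1)] ballI impI)
    fix V assume V: "V \<in> \<S>" "V \<subseteq> U"
    have "\<rho> V = \<rho> U" using \<rho>(1)[OF assms(3)[OF V(1)] assms(3)[OF U(1)] V(2) assms(4)[OF U(1)]] U(2) V(1) by (simp add: order.antisym)
    then show "V = U" using \<rho>(2)[OF assms(3)[OF V(1)] assms(3)[OF U(1)] V(2) assms(4)[OF U(1)]] by simp
  qed
qed

context left_module
begin

definition span :: "'m set \<Rightarrow> 'm set" where "span S = \<Inter>{U. submodule U R M \<and> S \<subseteq> U}"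

lemma span_least: "submodule U R M \<Longrightarrow> S \<subseteq> U \<Longrightarrow> span S \<subseteq> U"
  and span_superset: "S \<subseteq> span S"
  by (auto simp: span_def)

lemma submodule_span: "S \<subseteq> carrier M \<Longrightarrow> submodule (span S) R M"
  by (rule submoduleI) (use submodule_carrier in \<open>auto simp: span_def submodule_zero submodule_add submodule_smult\<close>)

text \<open>The span of a finite set that is maximal among such spans absorbs every further element.\<close>

lemma finite_length_imp_fg:
  assumes "finite_length R M" shows "finitely_generated R M"
proof -
  let ?S = "span ` {S. finite S \<and> S \<subseteq> carrier M}"
  have ne: "?S \<noteq> {}" by blast
  have sub: "submodule U R M" if "U \<in> ?S" for U using that submodule_span by blast
  obtain U where U: "U \<in> ?S" "\<And>V. V \<in> ?S \<Longrightarrow> U \<subseteq> V \<Longrightarrow> V = U"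
    using finite_length_maximal[OF assms ne sub submodule_subset[OF sub] submodule_carrier] by meson
  then obtain S where S: "finite S" "S \<subseteq> carrier M" "U = span S" by blast
  have "x \<in> span S" if x: "x \<in> carrier M" for x
  proof -
    have "span (insert x S) \<in> ?S" using S x by blast
    moreover have "span S \<subseteq> span (insert x S)"
      by (rule span_least[OF submodule_span]) (use S x span_superset[of "insert x S"] in auto)
    ultimately have "span (insert x S) = span S" using U(2) S(3) by blast
    then show ?thesis using span_superset[of "insert x S"] by blast
  qed
  then show ?thesis unfolding finitely_generated_def
    by (intro exI[of _ S]) (use S span_least submodule_subset in blast)
qed

end

lemma fg_lincomb:
  assumes "fg_module R M"
  obtains n s where "\<forall>i. s i \<in> carrier M" "lincomb M s n ` {f. \<forall>i. f i \<in> carrier R} = carrier M"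
proof -
  interpret left_module R M using assms by (simp add: fg_module_def)
  obtain S where S: "finite S" "S \<subseteq> carrier M"
    and gen: "\<And>N. submodule N R M \<Longrightarrow> S \<subseteq> N \<Longrightarrow> N = carrier M"
    using assms unfolding fg_module_def finitely_generated_def by blast
  obtain n s0 where s0: "S = s0 ` {i::nat. i < n}"
    using S(1) finite_imp_nat_seg_image_inj_on by blast
  define s where "s i = (if i < n then s0 i else \<zero>\<^bsub>M\<^esub>)" for i
  have s: "\<forall>i. s i \<in> carrier M" using S(2) s0 by (auto simp: s_def)
  let ?H = "lincomb M s n ` {f. \<forall>i. f i \<in> carrier R}"
  have "S \<subseteq> ?H"
  proof
    fix x assume "x \<in> S"
    then obtain j where "j < n" "x = s j" using s0 by (auto simp: s_def)
    then have "x = lincomb M s n (\<lambda>i. if i = j then \<one>\<^bsub>R\<^esub> else \<zero>\<^bsub>R\<^esub>)" using s by (simp add: lincomb_unit)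
    then show "x \<in> ?H" by auto
  qed
  then have "?H = carrier M" by (rule gen[OF submodule_lincombs[OF s]])
  then show ?thesis by (rule that[OF s])
qed

definition regm :: "('a, 'r) ring_scheme \<Rightarrow> ('a, 'a) module" where
  "regm R = \<lparr>carrier = carrier R, monoid.mult = monoid.mult R, one = one R, zero = zero R, add = add R, smult = monoid.mult R\<rparr>"

lemma regm_simps [simp]: "carrier (regm R) = carrier R" "\<zero>\<^bsub>regm R\<^esub> = \<zero>\<^bsub>R\<^esub>" "x \<oplus>\<^bsub>regm R\<^esub> y = x \<oplus>\<^bsub>R\<^esub> y" "a \<odot>\<^bsub>regm R\<^esub> x = a \<otimes>\<^bsub>R\<^esub> x"
  by (simp_all add: regm_def)

lemma (in ring) left_module_regm: "left_module R (regm R)"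
proof (intro left_module.intro left_module_axioms.intro abelian_groupI)
  show "ring R" by (rule ring_axioms)
  fix x assume "x \<in> carrier (regm R)"
  then show "\<exists>y\<in>carrier (regm R). y \<oplus>\<^bsub>regm R\<^esub> x = \<zero>\<^bsub>regm R\<^esub>"
    by (intro bexI[of _ "\<ominus> x"]) (auto simp: l_neg)
qed (auto simp: a_ac l_distr r_distr m_assoc)

lemma (in left_module) hom_right_mult:
  "x \<in> carrier M \<Longrightarrow> (\<lambda>r. r \<odot>\<^bsub>M\<^esub> x) \<in> module_hom R (regm R) M"
  by (rule homI) (auto simp: smult_l_distr smult_assoc1)

text \<open>Induction on the number of generators. A submodule of the span of the first \<open>Suc n\<close>
  generators is determined, among those that contain it, by its intersection with the span of the first
  \<open>n\<close> and by the left ideal of the scalars that move the last generator into its sum with that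
  span.\<close>

lemma fg_imp_finite_length:
  assumes "fg_module R M" "finite_length R (regm R)"
  shows "finite_length R M"
proof -
  interpret left_module R M using assms by (simp add: fg_module_def)
  obtain n s where s: "\<forall>i. s i \<in> carrier M" "lincomb M s n ` {f. \<forall>i. f i \<in> carrier R} = carrier M"
    using fg_lincomb[OF assms(1)] .
  let ?H = "\<lambda>n. lincomb M s n ` {f. \<forall>i. f i \<in> carrier R}"
  have H: "submodule (?H n) R M" for n using submodule_lincombs[OF s(1)] .
  obtain \<sigma> where "rank_on R (regm R) (carrier (regm R)) \<sigma>" using assms(2) unfolding finite_length_on_def by blast
  note \<sigma> = rank_onD[OF this]
  have "finite_length_on R M (?H n)" for n
  proof (induction n)
    case 0
    show ?case by (rule finite_length_onI[where \<rho>="\<lambda>_. 0"]) (auto dest: submodule_zero)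
  next
    case (Suc n)
    obtain \<rho> where "rank_on R M (?H n) \<rho>" using Suc unfolding finite_length_on_def by blast
  note \<rho> = rank_onD[OF this]
    let ?I = "\<lambda>U. {r \<in> carrier (regm R). r \<odot>\<^bsub>M\<^esub> s n \<in> ssum U (?H n)}"
    show ?case
    proof (rule finite_length_onI[where \<rho>="\<lambda>U. \<rho> (U \<inter> ?H n) + \<sigma> (?I U)"])
      fix U V assume *: "submodule U R M" "submodule V R M" "U \<subseteq> V" "V \<subseteq> ?H (Suc n)"
      have h: "submodule (U \<inter> ?H n) R M" "submodule (V \<inter> ?H n) R M" "U \<inter> ?H n \<subseteq> V \<inter> ?H n" "V \<inter> ?H n \<subseteq> ?H n"
        using submodule_Int[OF _ H] * by blast+
      have sn: "s n \<in> carrier M" using s(1) by blast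
      have mono: "ssum U (?H n) \<subseteq> ssum V (?H n)" using *(3) unfolding ssum_def by blast
      have i: "submodule (?I U) R (regm R)" "submodule (?I V) R (regm R)" "?I U \<subseteq> ?I V" "?I V \<subseteq> carrier (regm R)"
        using submodule_vimage[OF R.left_module_regm left_module_axioms hom_right_mult[OF sn] submodule_ssum[OF _ H[of n]]] * mono
        by blast+
      have "V \<subseteq> U" if eq: "U \<inter> ?H n = V \<inter> ?H n" "?I U = ?I V"
      proof
        fix v assume v: "v \<in> V"
        then obtain f where f: "\<forall>i. f i \<in> carrier R" "v = lincomb M s n f \<oplus>\<^bsub>M\<^esub> f n \<odot>\<^bsub>M\<^esub> s n" using * by auto
        have lc: "lincomb M s n f \<in> ?H n" using f(1) by blast
        have c: "lincomb M s n f \<in> carrier M" "v \<in> carrier M" "s n \<in> carrier M" "f n \<in> carrier R"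
          using f lincomb_closed s(1) v submodule_mem[OF *(2)] by auto
        have "f n \<odot>\<^bsub>M\<^esub> s n = v \<oplus>\<^bsub>M\<^esub> \<ominus>\<^bsub>M\<^esub> (lincomb M s n f)"
          using c M.minus_add_cancel[of "f n \<odot>\<^bsub>M\<^esub> s n" "lincomb M s n f"] by (simp add: f(2) M.a_ac a_minus_def)
        then have "f n \<in> ?I V" using v c submodule_neg[OF H lc] by (auto simp: ssum_def)
        then have "f n \<in> ?I U" using eq by simp
        then obtain u h where u: "u \<in> U" "h \<in> ?H n" "f n \<odot>\<^bsub>M\<^esub> s n = u \<oplus>\<^bsub>M\<^esub> h" by (auto simp: ssum_def)
        have cu: "u \<in> carrier M" "h \<in> carrier M" using u submodule_mem[OF *(1)] submodule_mem[OF H] by blast+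
        have veq: "v = (lincomb M s n f \<oplus>\<^bsub>M\<^esub> h) \<oplus>\<^bsub>M\<^esub> u" using f(2) u cu c by (simp add: M.a_ac)
        then have "v \<ominus>\<^bsub>M\<^esub> u = lincomb M s n f \<oplus>\<^bsub>M\<^esub> h" using cu c by simp
        then have "v \<ominus>\<^bsub>M\<^esub> u \<in> ?H n" using submodule_add[OF H lc u(2)] by simp
        moreover have "v \<ominus>\<^bsub>M\<^esub> u \<in> V" using submodule_diff[OF *(2) v] u *(3) by blast
        ultimately have "v \<ominus>\<^bsub>M\<^esub> u \<in> U" using eq by blast
        then show "v \<in> U" using submodule_add[OF *(1) _ u(1)] c cu by fastforce
      qed
      then show "\<rho> (U \<inter> ?H n) + \<sigma> (?I U) \<le> \<rho> (V \<inter> ?H n) + \<sigma> (?I V) \<and> (\<rho> (U \<inter> ?H n) + \<sigma> (?I U) = \<rho> (V \<inter> ?H n) + \<sigma> (?I V) \<longrightarrow> V \<subseteq> U)"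
        using \<rho>[OF h] \<sigma>[OF i] by linarith
    qed
  qed
  then show ?thesis using s(2) by metis
qed

section \<open>Complements and the Fitting decomposition\<close>

lemma (in left_module) complement_projection:
  assumes U: "submodule U R M" and V: "submodule V R M"
    and int: "U \<inter> V = {\<zero>\<^bsub>M\<^esub>}" and sum: "\<forall>x \<in> carrier M. \<exists>u\<in>U. \<exists>v\<in>V. x = u \<oplus>\<^bsub>M\<^esub> v"
  shows "\<exists>\<pi> \<in> module_hom R M M. (\<forall>x \<in> carrier M. \<pi> x \<in> U) \<and> (\<forall>x \<in> carrier M. x \<ominus>\<^bsub>M\<^esub> \<pi> x \<in> V) \<and>
    (\<forall>u \<in> U. \<pi> u = u) \<and> (\<forall>v \<in> V. \<pi> v = \<zero>\<^bsub>M\<^esub>)"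
proof -
  define \<pi> where "\<pi> x = (SOME u. u \<in> U \<and> x \<ominus>\<^bsub>M\<^esub> u \<in> V)" for x
  note UC = submodule_mem[OF U] and VC = submodule_mem[OF V]
  have ex: "\<exists>u. u \<in> U \<and> x \<ominus>\<^bsub>M\<^esub> u \<in> V" if x: "x \<in> carrier M" for x
  proof -
    obtain u v where "u \<in> U" "v \<in> V" "x = v \<oplus>\<^bsub>M\<^esub> u" using bspec[OF sum x] UC VC M.a_comm by metis
    then show ?thesis using UC VC by (intro exI[of _ u]) auto
  qed
  have P: "\<pi> x \<in> U" "x \<ominus>\<^bsub>M\<^esub> \<pi> x \<in> V" if "x \<in> carrier M" for x
    using someI_ex[OF ex[OF that]] by (auto simp: \<pi>_def)
  have uniq: "\<pi> x = u" if "x \<in> carrier M" "u \<in> U" "x \<ominus>\<^bsub>M\<^esub> u \<in> V" for x u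
  proof -
    have c: "\<pi> x \<in> carrier M" "u \<in> carrier M" using UC P that by auto
    have "u \<ominus>\<^bsub>M\<^esub> \<pi> x = (x \<ominus>\<^bsub>M\<^esub> \<pi> x) \<ominus>\<^bsub>M\<^esub> (x \<ominus>\<^bsub>M\<^esub> u)"
      using that c by (simp add: a_minus_def M.minus_add M.a_ac M.r_neg1 M.r_neg2)
    then have "u \<ominus>\<^bsub>M\<^esub> \<pi> x \<in> V" using submodule_diff[OF V] P that by metis
    moreover have "u \<ominus>\<^bsub>M\<^esub> \<pi> x \<in> U" using submodule_diff[OF U] P that by blast
    ultimately have "u \<ominus>\<^bsub>M\<^esub> \<pi> x = \<zero>\<^bsub>M\<^esub>" using int by blast
    then show ?thesis using c by simp
  qed
  have hom: "\<pi> \<in> module_hom R M M"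
  proof (rule homI)
    show "\<pi> x \<in> carrier M" if "x \<in> carrier M" for x using that P UC by blast
    fix x y assume x: "x \<in> carrier M" and y: "y \<in> carrier M"
    have c: "\<pi> x \<in> carrier M" "\<pi> y \<in> carrier M" using x y P UC by blast+
    have "x \<oplus>\<^bsub>M\<^esub> y \<ominus>\<^bsub>M\<^esub> (\<pi> x \<oplus>\<^bsub>M\<^esub> \<pi> y) = (x \<ominus>\<^bsub>M\<^esub> \<pi> x) \<oplus>\<^bsub>M\<^esub> (y \<ominus>\<^bsub>M\<^esub> \<pi> y)"
      using x y c by (simp add: a_minus_def M.minus_add M.a_ac)
    then show "\<pi> (x \<oplus>\<^bsub>M\<^esub> y) = \<pi> x \<oplus>\<^bsub>M\<^esub> \<pi> y"
      using submodule_add[OF V P(2)[OF x] P(2)[OF y]] submodule_add[OF U P(1)[OF x] P(1)[OF y]] x y by (intro uniq) auto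
  next
    fix a x assume a: "a \<in> carrier R" and x: "x \<in> carrier M"
    have c: "\<pi> x \<in> carrier M" using x P UC by blast
    have "a \<odot>\<^bsub>M\<^esub> (x \<ominus>\<^bsub>M\<^esub> \<pi> x) \<oplus>\<^bsub>M\<^esub> a \<odot>\<^bsub>M\<^esub> \<pi> x = a \<odot>\<^bsub>M\<^esub> x"
      using a x c by (simp flip: smult_r_distr)
    then have "a \<odot>\<^bsub>M\<^esub> x \<ominus>\<^bsub>M\<^esub> a \<odot>\<^bsub>M\<^esub> \<pi> x = a \<odot>\<^bsub>M\<^esub> (x \<ominus>\<^bsub>M\<^esub> \<pi> x)"
      using M.minus_add_cancel[of "a \<odot>\<^bsub>M\<^esub> (x \<ominus>\<^bsub>M\<^esub> \<pi> x)" "a \<odot>\<^bsub>M\<^esub> \<pi> x"] a x c by simp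
    then show "\<pi> (a \<odot>\<^bsub>M\<^esub> x) = a \<odot>\<^bsub>M\<^esub> \<pi> x"
      using submodule_smult[OF V a P(2)[OF x]] submodule_smult[OF U a P(1)[OF x]] x a by (intro uniq) auto
  qed
  show ?thesis
  proof (intro bexI[OF _ hom] conjI ballI P)
    show "\<pi> u = u" if "u \<in> U" for u using that UC submodule_zero[OF V] by (intro uniq) auto
    show "\<pi> v = \<zero>\<^bsub>M\<^esub>" if "v \<in> V" for v
      using that VC[OF that] submodule_zero[OF U] M.minus_add_cancel[of v "\<zero>\<^bsub>M\<^esub>"] by (intro uniq) auto
  qed
qed

text \<open>The kernels of the powers ascend, the images descend, and both become stationary.\<close>

lemma fitting:
  assumes "left_module R M" "finite_length R M" and f: "f \<in> module_hom R M M"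
  shows "\<exists>n. kern M M (f ^^ n) \<inter> (f ^^ n) ` carrier M = {\<zero>\<^bsub>M\<^esub>} \<and>
    (\<forall>x \<in> carrier M. \<exists>u \<in> kern M M (f ^^ n). \<exists>v \<in> (f ^^ n) ` carrier M. x = u \<oplus>\<^bsub>M\<^esub> v) \<and>
    f ` ((f ^^ n) ` carrier M) = (f ^^ n) ` carrier M \<and> n > 0"
proof -
  interpret left_module R M by fact
  have fn: "f ^^ n \<in> module_hom R M M" for n by (rule hom_pow[OF f])
  have fnc: "(f ^^ n) x \<in> carrier M" if "x \<in> carrier M" for n x using hom_closed[OF fn that] .
  let ?K = "\<lambda>n. kern M M (f ^^ n)" and ?I = "\<lambda>n. (f ^^ n) ` carrier M"
  have K: "submodule (?K n) R M" and I: "submodule (?I n) R M" for n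
    using submodule_kern[OF assms(1,1) fn] submodule_range[OF assms(1,1) fn] by auto
  have Kmono: "?K n \<subseteq> ?K (n + m)" for n m
    by (auto simp: kern_def funpow_add add.commute[of n] hom_zero[OF assms(1,1) fn])
  have Imono: "?I (n + m) \<subseteq> ?I n" for n m
    using fnc by (auto simp: funpow_add)
  obtain a where a: "\<And>n. ?K a \<subseteq> ?K n \<Longrightarrow> ?K n = ?K a"
  proof -
    have sub: "submodule U R M" if "U \<in> range ?K" for U using that K by blast
    obtain U where U: "U \<in> range ?K" "\<And>V. V \<in> range ?K \<Longrightarrow> U \<subseteq> V \<Longrightarrow> V = U"
      using finite_length_maximal[OF assms(2) _ sub submodule_subset[OF sub] submodule_carrier] by (metis (no_types, lifting) UNIV_not_empty image_is_empty)
    then obtain a where "U = ?K a" by blast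
    then show ?thesis using that[of a] U(2) by blast
  qed
  obtain b where b: "\<And>n. ?I n \<subseteq> ?I b \<Longrightarrow> ?I n = ?I b"
  proof -
    have sub: "submodule U R M" if "U \<in> range ?I" for U using that I by blast
    obtain U where U: "U \<in> range ?I" "\<And>V. V \<in> range ?I \<Longrightarrow> V \<subseteq> U \<Longrightarrow> V = U"
      using finite_length_minimal[OF assms(2) _ sub submodule_subset[OF sub]] by (metis (no_types, lifting) UNIV_not_empty image_is_empty)
    then obtain b where "U = ?I b" by blast
    then show ?thesis using that[of b] U(2) by blast
  qed
  \<comment> \<open>Both chains are stationary from here on; \<^term>\<open>n\<close> is positive so that one factor \<^term>\<open>f\<close> can be split off the power.\<close>
  define n where "n = Suc (a + b)"
  have Kn: "?K (n + m) = ?K n" for m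
    using a[OF Kmono[of a "Suc b + m"]] a[OF Kmono[of a "Suc b"]] by (simp add: n_def add_ac)
  have In: "?I (n + m) = ?I n" for m
    using b[OF Imono[of b "Suc a + m"]] b[OF Imono[of b "Suc a"]] by (simp add: n_def add_ac)
  show ?thesis
  proof (intro exI[of _ n] conjI ballI)
    show "?K n \<inter> ?I n = {\<zero>\<^bsub>M\<^esub>}"
    proof safe
      fix x assume "(f ^^ n) x \<in> ?K n" "x \<in> carrier M"
      then have "x \<in> ?K (n + n)" by (simp add: kern_def funpow_add)
      then show "(f ^^ n) x = \<zero>\<^bsub>M\<^esub>" unfolding Kn by (simp add: kern_def)
    qed (use submodule_zero[OF K] submodule_zero[OF I] in auto)
    show "f ` ?I n = ?I n"
      using In[of 1] by (simp add: image_image)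
    fix x assume x: "x \<in> carrier M"
    have "(f ^^ n) x \<in> ?I (n + n)" unfolding In using x by blast
    then obtain y where y: "y \<in> carrier M" "(f ^^ n) x = (f ^^ n) ((f ^^ n) y)" by (auto simp: funpow_add)
    have "x \<ominus>\<^bsub>M\<^esub> (f ^^ n) y \<in> ?K n"
      using x y fnc hom_diff[OF assms(1,1) fn] by (auto simp: kern_def)
    moreover have "x = (x \<ominus>\<^bsub>M\<^esub> (f ^^ n) y) \<oplus>\<^bsub>M\<^esub> (f ^^ n) y" using x y fnc by simp
    ultimately show "\<exists>u \<in> ?K n. \<exists>v \<in> ?I n. x = u \<oplus>\<^bsub>M\<^esub> v" using y(1) by blast
  qed (simp add: n_def)
qed

text \<open>An injective endomorphism has no kernel part in its Fitting decomposition, and it permutes the other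
  part.\<close>

lemma finite_length_inj_endo_surj:
  assumes "left_module R M" "finite_length R M" and f: "f \<in> module_hom R M M" and inj: "inj_on f (carrier M)"
  shows "f ` carrier M = carrier M"
proof -
  interpret left_module R M by fact
  have inj0: "x = \<zero>\<^bsub>M\<^esub>" if "f x = \<zero>\<^bsub>M\<^esub>" "x \<in> carrier M" for x
    using inj that by (metis M.zero_closed assms(1) f hom_zero inj_on_def)
  have k: "x \<in> carrier M \<Longrightarrow> (f ^^ n) x = \<zero>\<^bsub>M\<^esub> \<Longrightarrow> x = \<zero>\<^bsub>M\<^esub>" for n x
  proof (induction n)
    case (Suc n)
    then show ?case using inj0[of "(f ^^ n) x"] hom_closed[OF hom_pow[OF f]] by simp
  qed simp
  obtain n where n: "\<forall>x \<in> carrier M. \<exists>u \<in> kern M M (f ^^ n). \<exists>v \<in> (f ^^ n) ` carrier M. x = u \<oplus>\<^bsub>M\<^esub> v"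
     "f ` ((f ^^ n) ` carrier M) = (f ^^ n) ` carrier M"
    using fitting[OF assms(1-3)] by (elim exE conjE)
  have "x \<in> f ` carrier M" if x: "x \<in> carrier M" for x
  proof -
    obtain u v where uv: "u \<in> kern M M (f ^^ n)" "v \<in> (f ^^ n) ` carrier M" "x = u \<oplus>\<^bsub>M\<^esub> v"
      using n(1) x by (meson)
    have "u = \<zero>\<^bsub>M\<^esub>" using k[of u n] uv(1) by (simp add: kern_def)
    moreover have "v \<in> carrier M" using uv(2) hom_closed[OF hom_pow[OF f]] by (elim imageE) simp
    ultimately have "x = v" using uv(3) by simp
    then have "x \<in> f ` ((f ^^ n) ` carrier M)" unfolding n(2) using uv(2) by (simp only:)
    then obtain y where "y \<in> carrier M" "x = f ((f ^^ n) y)" by (elim imageE) simp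
    then show ?thesis using hom_closed[OF hom_pow[OF f, of n]] by simp
  qed
  then show ?thesis using hom_closed[OF f] by blast
qed

section \<open>Finitely generated modules over a ring of finite length\<close>

text \<open>A representative among the modules over which the quantifiers in the definitions of projectivity,
  resolutions and finitistic dimension range. Constructions such as products and submodules leave this type and
  are brought back by copying.\<close>

definition fg_copy :: "('a, 'r) ring_scheme \<Rightarrow> ('a, 'm, 'p) module_scheme \<Rightarrow> 'a fgmod" where
  "fg_copy R M = (SOME N. fg_module R N \<and> module_iso R M N)"

lemma fg_copy_fg: "fg_module R M \<Longrightarrow> fg_module R (fg_copy R M)" and fg_copy_iso: "fg_module R M \<Longrightarrow> module_iso R M (fg_copy R M)"
  using someI_ex[OF fg_module_universe[of R M]] by (auto simp: fg_copy_def)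

lemma fg_left_module [dest]: "fg_module R M \<Longrightarrow> left_module R M"
  by (simp add: fg_module_def)

lemma fg_copy_iso': "fg_module R M \<Longrightarrow> module_iso R (fg_copy R M) M"
  using fg_copy_iso module_iso_sym by blast

text \<open>Direct summands up to isomorphism; stating them as retracts avoids the choice of a complement.\<close>

definition retract :: "('a, 'r) ring_scheme \<Rightarrow> ('a, 'm, 'p) module_scheme \<Rightarrow> ('a, 'n, 'q) module_scheme \<Rightarrow> bool" where
  "retract R X Y \<longleftrightarrow> (\<exists>i \<in> module_hom R X Y. \<exists>p \<in> module_hom R Y X. \<forall>x \<in> carrier X. p (i x) = x)"

lemma retractI: "i \<in> module_hom R X Y \<Longrightarrow> p \<in> module_hom R Y X \<Longrightarrow> (\<And>x. x \<in> carrier X \<Longrightarrow> p (i x) = x) \<Longrightarrow> retract R X Y"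
  by (auto simp: retract_def)

lemma retract_trans: "retract R X Y \<Longrightarrow> retract R Y Z \<Longrightarrow> retract R X Z"
proof -
  assume "retract R X Y" "retract R Y Z"
  then obtain i p j q where "i \<in> module_hom R X Y" "p \<in> module_hom R Y X" "\<And>x. x \<in> carrier X \<Longrightarrow> p (i x) = x"
    "j \<in> module_hom R Y Z" "q \<in> module_hom R Z Y" "\<And>x. x \<in> carrier Y \<Longrightarrow> q (j x) = x"
    unfolding retract_def by blast
  then show ?thesis by (intro retractI[OF hom_comp[of i R X Y j Z] hom_comp[of q R Z Y p X]]) (auto simp: hom_closed)
qed

lemma retract_iso: "module_iso R X Y \<Longrightarrow> left_module R X \<Longrightarrow> retract R X Y"
  by (meson module_isoE retractI)

lemma retract_iso': "module_iso R X Y \<Longrightarrow> left_module R X \<Longrightarrow> retract R Y X"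
  by (meson module_isoE retractI)

lemma retract_inl: "left_module R X \<Longrightarrow> left_module R Y \<Longrightarrow> retract R X (prod_mod X Y)"
  by (rule retractI[OF hom_inl hom_fst]) auto

lemma retract_inr: "left_module R X \<Longrightarrow> left_module R Y \<Longrightarrow> retract R Y (prod_mod X Y)"
  by (rule retractI[OF hom_inr hom_snd]) auto

text \<open>The property of an Artin algebra on which the theory of its modules rests: it makes finitely generated
  modules the same as modules of finite length.\<close>

locale finite_length_ring = ring R for R (structure) + assumes finite_length_regular: "finite_length R (regm R)"
begin

lemma fg_iff: "fg_module R M \<longleftrightarrow> left_module R M \<and> finite_length R M"
  using fg_imp_finite_length[OF _ finite_length_regular] left_module.finite_length_imp_fg by (auto simp: fg_module_def)

lemma fg_sub: "fg_module R M \<Longrightarrow> submodule U R M \<Longrightarrow> fg_module R (M\<lparr>carrier := U\<rparr>)"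
  using finite_length_submodule left_module.left_module_sub unfolding fg_iff by blast

lemma fg_surj: "fg_module R M \<Longrightarrow> left_module R N \<Longrightarrow> f \<in> module_hom R M N \<Longrightarrow> f ` carrier M = carrier N \<Longrightarrow> fg_module R N"
  unfolding fg_iff using finite_length_image by blast

lemma fg_iso: "fg_module R M \<Longrightarrow> left_module R N \<Longrightarrow> module_iso R M N \<Longrightarrow> fg_module R N"
  unfolding module_iso_def bij_betw_def using fg_surj by blast

lemma fg_prod [intro]: "fg_module R M \<Longrightarrow> fg_module R N \<Longrightarrow> fg_module R (prod_mod M N)"
  unfolding fg_iff using finite_length_prod by blast

lemma fg_zero: "left_module R M \<Longrightarrow> carrier M = {\<zero>\<^bsub>M\<^esub>} \<Longrightarrow> fg_module R M"
  unfolding fg_iff using finite_length_zero by blast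

end

section \<open>Free modules of row vectors\<close>

text \<open>The pointwise module structure on a set of sequences. A vector of length \<open>k\<close> is a sequence
  that vanishes from position \<open>k\<close> on, so that free modules of all ranks and their submodules share
  one type.\<close>

definition vecm :: "('a, 'r) ring_scheme \<Rightarrow> (nat \<Rightarrow> 'a) set \<Rightarrow> ('a, nat \<Rightarrow> 'a) module" where
  "vecm R S = \<lparr>carrier = S, monoid.mult = \<lambda>x y. x, one = (\<lambda>_. \<zero>\<^bsub>R\<^esub>), zero = (\<lambda>_. \<zero>\<^bsub>R\<^esub>), add = \<lambda>x y i. x i \<oplus>\<^bsub>R\<^esub> y i,
     smult = \<lambda>a x i. a \<otimes>\<^bsub>R\<^esub> x i\<rparr>"

lemma vecm_simps [simp]: "carrier (vecm R S) = S" "\<zero>\<^bsub>vecm R S\<^esub> = (\<lambda>_. \<zero>\<^bsub>R\<^esub>)"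
   "x \<oplus>\<^bsub>vecm R S\<^esub> y = (\<lambda>i. x i \<oplus>\<^bsub>R\<^esub> y i)" "a \<odot>\<^bsub>vecm R S\<^esub> x = (\<lambda>i. a \<otimes>\<^bsub>R\<^esub> x i)"
   "vecm R S\<lparr>carrier := T\<rparr> = vecm R T"
  by (simp_all add: vecm_def)

definition vecs :: "('a, 'r) ring_scheme \<Rightarrow> nat \<Rightarrow> (nat \<Rightarrow> 'a) set" where
  "vecs R k = {x. (\<forall>i<k. x i \<in> carrier R) \<and> (\<forall>i\<ge>k. x i = \<zero>\<^bsub>R\<^esub>)}"

abbreviation free :: "('a, 'r) ring_scheme \<Rightarrow> nat \<Rightarrow> ('a, nat \<Rightarrow> 'a) module" where
  "free R k \<equiv> vecm R (vecs R k)"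

definition unitv :: "('a, 'r) ring_scheme \<Rightarrow> nat \<Rightarrow> nat \<Rightarrow> nat \<Rightarrow> 'a" where
  "unitv R k i = (\<lambda>j. if j = i \<and> i < k then \<one>\<^bsub>R\<^esub> else \<zero>\<^bsub>R\<^esub>)"

lemma lincomb_cong: "(\<And>i. i < n \<Longrightarrow> f i = g i) \<Longrightarrow> (\<And>i. i < n \<Longrightarrow> s i = t i) \<Longrightarrow> lincomb M s n f = lincomb M t n g"
  by (induction n) auto

lemma hom_lincomb:
  assumes "left_module R M" "left_module R N" "h \<in> module_hom R M N" "\<forall>i. s i \<in> carrier M" "\<forall>i. f i \<in> carrier R"
  shows "h (lincomb M s n f) = lincomb N (\<lambda>i. h (s i)) n f"
proof -
  interpret M: left_module R M by fact
  show ?thesis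
    by (induction n) (use assms in \<open>auto simp: hom_zero hom_add hom_smult M.lincomb_closed\<close>)
qed

lemma (in left_module) lincomb_submodule:
  "submodule U R M \<Longrightarrow> (\<And>i. i < n \<Longrightarrow> s i \<in> U) \<Longrightarrow> (\<And>i. i < n \<Longrightarrow> f i \<in> carrier R) \<Longrightarrow> lincomb M s n f \<in> U"
  by (induction n) (auto simp: submodule_zero submodule_add submodule_smult)

context ring begin

lemma left_module_vecm_all: "left_module R (vecm R {x. \<forall>i. x i \<in> carrier R})"
proof (intro left_module.intro left_module_axioms.intro abelian_groupI)
  show "ring R" by (rule ring_axioms)
  fix x assume "x \<in> carrier (vecm R {x. \<forall>i. x i \<in> carrier R})"
  then show "\<exists>y\<in>carrier (vecm R {x. \<forall>i. x i \<in> carrier R}). y \<oplus>\<^bsub>vecm R {x. \<forall>i. x i \<in> carrier R}\<^esub> x = \<zero>\<^bsub>vecm R {x. \<forall>i. x i \<in> carrier R}\<^esub>"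
    by (intro bexI[of _ "\<lambda>i. \<ominus> x i"]) (auto simp: l_neg)
qed (auto simp: a_ac l_distr r_distr m_assoc)

lemma vecs_carrier: "x \<in> vecs R k \<Longrightarrow> x i \<in> carrier R"
  by (cases "i < k") (auto simp: vecs_def)

lemma submodule_vecs: "submodule (vecs R k) R (vecm R {x. \<forall>i. x i \<in> carrier R})"
  by (rule left_module.submoduleI[OF left_module_vecm_all]) (auto simp: vecs_carrier, auto simp: vecs_def)

lemma left_module_free: "left_module R (free R k)"
  using left_module.left_module_sub[OF left_module_vecm_all submodule_vecs[of k]] by simp

lemma unitv_in: "unitv R k i \<in> vecs R k"
  by (auto simp: unitv_def vecs_def)

lemma lincomb_unitv:
  assumes "x \<in> vecs R k" shows "lincomb (vecm R S) (unitv R k) k x = x"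
proof -
  have "n \<le> k \<Longrightarrow> lincomb (vecm R S) (unitv R k) n x = (\<lambda>j. if j < n then x j else \<zero>)" for n
    by (induction n) (auto simp: fun_eq_iff unitv_def vecs_carrier[OF assms] less_Suc_eq)
  then show ?thesis using assms by (auto simp: vecs_def fun_eq_iff)
qed

lemma finitely_generated_free: "fg_module R (free R k)"
proof -
  interpret F: left_module R "free R k" by (rule left_module_free)
  have "N = carrier (free R k)" if N: "submodule N R (free R k)" "unitv R k ` {..<k} \<subseteq> N" for N
  proof (rule antisym)
    show "carrier (free R k) \<subseteq> N"
    proof
      fix x assume x: "x \<in> carrier (free R k)"
      have "lincomb (free R k) (unitv R k) k x \<in> N"
        by (rule F.lincomb_submodule[OF N(1)]) (use N(2) x in \<open>auto simp: vecs_carrier\<close>)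
      then show "x \<in> N" using lincomb_unitv x by simp
    qed
  qed (rule F.submodule_subset[OF N(1)])
  then show ?thesis unfolding fg_module_def finitely_generated_def
    by (intro conjI F.left_module_axioms exI[of _ "unitv R k ` {..<k}"]) (auto simp: unitv_in)
qed

lemma free_hom:
  assumes "left_module R M" "\<forall>i. s i \<in> carrier M"
  shows "lincomb M s k \<in> module_hom R (free R k) M"
proof -
  interpret M: left_module R M by fact
  show ?thesis by (rule homI) (use assms(2) in \<open>auto simp: vecs_carrier M.lincomb_closed M.lincomb_add M.lincomb_smult\<close>)
qed

lemma free_hom_eq:
  assumes "left_module R M" "f \<in> module_hom R (free R k) M" "x \<in> vecs R k"
  shows "f x = lincomb M (\<lambda>i. f (unitv R k i)) k x"
  using hom_lincomb[OF left_module_free assms(1,2), of "unitv R k" x k]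
  by (simp add: lincomb_unitv[OF assms(3)] unitv_in vecs_carrier[OF assms(3)])

lemma free_cover:
  assumes "fg_module R M"
  obtains k g where "g \<in> module_hom R (free R k) M" "g ` vecs R k = carrier M"
proof -
  have M: "left_module R M" using assms by blast
  obtain n s where s: "\<forall>i. s i \<in> carrier M" "lincomb M s n ` {f. \<forall>i. f i \<in> carrier R} = carrier M"
    using fg_lincomb[OF assms] .
  have "lincomb M s n ` vecs R n = carrier M"
  proof (rule antisym)
    show "lincomb M s n ` vecs R n \<subseteq> carrier M" using s(2) by (auto simp: vecs_carrier)
    show "carrier M \<subseteq> lincomb M s n ` vecs R n"
    proof
      fix x assume "x \<in> carrier M"
      then have "x \<in> lincomb M s n ` {f. \<forall>i. f i \<in> carrier R}" unfolding s(2) .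
      then obtain f where f: "\<forall>i. f i \<in> carrier R" "x = lincomb M s n f" by (elim imageE) simp
      have "x = lincomb M s n (\<lambda>i. if i < n then f i else \<zero>)" unfolding f(2) by (rule lincomb_cong) auto
      moreover have "(\<lambda>i. if i < n then f i else \<zero>) \<in> vecs R n" using f(1) by (auto simp: vecs_def)
      ultimately show "x \<in> lincomb M s n ` vecs R n" by blast
    qed
  qed
  then show ?thesis using that free_hom[OF M s(1)] by blast
qed

end

section \<open>Projective modules\<close>

lemma projective_fg [dest]: "projective R P \<Longrightarrow> fg_module R P"
  by (simp add: projective_def)

text \<open>The definition of projectivity lets the test modules range over one type; copies transfer the lifting
  property to all types.\<close>

lemma projective_lift:
  assumes P: "projective R P" and M: "fg_module R M" and N: "fg_module R N"
    and g: "g \<in> module_hom R M N" "g ` carrier M = carrier N" and f: "f \<in> module_hom R P N"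
  obtains h where "h \<in> module_hom R P M" "\<And>x. x \<in> carrier P \<Longrightarrow> g (h x) = f x"
proof -
  obtain \<phi> \<phi>' where \<phi>: "\<phi> \<in> module_hom R M (fg_copy R M)" "\<phi>' \<in> module_hom R (fg_copy R M) M"
    "\<And>x. x \<in> carrier M \<Longrightarrow> \<phi>' (\<phi> x) = x" "\<And>y. y \<in> carrier (fg_copy R M) \<Longrightarrow> \<phi> (\<phi>' y) = y"
    using module_isoE[OF fg_copy_iso[OF M]] M by blast
  obtain \<psi> \<psi>' where \<psi>: "\<psi> \<in> module_hom R N (fg_copy R N)" "\<psi>' \<in> module_hom R (fg_copy R N) N"
    "\<And>x. x \<in> carrier N \<Longrightarrow> \<psi>' (\<psi> x) = x" "\<And>y. y \<in> carrier (fg_copy R N) \<Longrightarrow> \<psi> (\<psi>' y) = y"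
    using module_isoE[OF fg_copy_iso[OF N]] N by blast
  let ?g = "\<lambda>x. \<psi> (g (\<phi>' x))"
  have 1: "?g \<in> module_hom R (fg_copy R M) (fg_copy R N)" using hom_comp[OF hom_comp[OF \<phi>(2) g(1)] \<psi>(1)] .
  have "y \<in> ?g ` carrier (fg_copy R M)" if y: "y \<in> carrier (fg_copy R N)" for y
  proof -
    obtain x where x: "x \<in> carrier M" "g x = \<psi>' y" using g(2) hom_closed[OF \<psi>(2) y] by force
    then have "?g (\<phi> x) = y" using \<phi> \<psi> y by simp
    then show ?thesis using hom_closed[OF \<phi>(1) x(1)] by blast
  qed
  then have 2: "?g ` carrier (fg_copy R M) = carrier (fg_copy R N)" using hom_closed[OF 1] by blast
  have 3: "(\<lambda>x. \<psi> (f x)) \<in> module_hom R P (fg_copy R N)" using hom_comp[OF f \<psi>(1)] .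
  obtain h where h: "h \<in> module_hom R P (fg_copy R M)" "\<forall>x \<in> carrier P. ?g (h x) = \<psi> (f x)"
    using P fg_copy_fg[OF M] fg_copy_fg[OF N] 1 2 3 unfolding projective_def by blast
  show ?thesis
  proof (rule that[OF hom_comp[OF h(1) \<phi>(2)]])
    fix x assume x: "x \<in> carrier P"
    have "\<psi>' (\<psi> (g (\<phi>' (h x)))) = \<psi>' (\<psi> (f x))" using h(2) x by simp
    then show "g (\<phi>' (h x)) = f x"
      using \<psi>(3) hom_closed[OF g(1) hom_closed[OF \<phi>(2) hom_closed[OF h(1) x]]] hom_closed[OF f x] by simp
  qed
qed

lemma retract_projective:
  assumes "projective R Q" "retract R P Q" "fg_module R P"
  shows "projective R P"
  unfolding projective_def
proof (intro conjI allI impI assms(3))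
  obtain i p where ip: "i \<in> module_hom R P Q" "p \<in> module_hom R Q P" "\<And>x. x \<in> carrier P \<Longrightarrow> p (i x) = x"
    using assms(2) unfolding retract_def by blast
  fix M N :: "'a fgmod" and g f
  assume *: "fg_module R M \<and> fg_module R N \<and> g \<in> module_hom R M N \<and> g ` carrier M = carrier N \<and> f \<in> module_hom R P N"
  then obtain h where h: "h \<in> module_hom R Q M" "\<And>x. x \<in> carrier Q \<Longrightarrow> g (h x) = f (p x)"
    using projective_lift[OF assms(1), of M N g "\<lambda>x. f (p x)"] hom_comp[OF ip(2), of f N] by metis
  show "\<exists>h\<in>module_hom R P M. \<forall>x\<in>carrier P. g (h x) = f x"
    by (rule bexI[OF _ hom_comp[OF ip(1) h(1)]]) (use h(2) ip hom_closed[OF ip(1)] in auto)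
qed

lemma projective_iso: "projective R P \<Longrightarrow> module_iso R P Q \<Longrightarrow> fg_module R Q \<Longrightarrow> projective R Q"
  using retract_projective retract_iso' by blast

context ring begin

lemma projective_free: "projective R (free R k)"
  unfolding projective_def
proof (intro conjI allI impI finitely_generated_free)
  fix M N :: "'a fgmod" and g f
  assume "fg_module R M \<and> fg_module R N \<and> g \<in> module_hom R M N \<and> g ` carrier M = carrier N \<and> f \<in> module_hom R (free R k) N"
  then have M: "left_module R M" and N: "left_module R N" and g: "g \<in> module_hom R M N" "g ` carrier M = carrier N"
    and f: "f \<in> module_hom R (free R k) N" by auto
  have "\<exists>m \<in> carrier M. g m = f (unitv R k i)" for i
  proof -
    have "f (unitv R k i) \<in> carrier N" using hom_closed[OF f, of "unitv R k i"] unitv_in by simp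
    then show ?thesis unfolding g(2)[symmetric] by (elim imageE) auto
  qed
  then obtain s where s: "\<And>i. s i \<in> carrier M" "\<And>i. g (s i) = f (unitv R k i)" by metis
  show "\<exists>h\<in>module_hom R (free R k) M. \<forall>x\<in>carrier (free R k). g (h x) = f x"
    by (rule bexI[OF _ free_hom[OF M, of s]])
      (use s hom_lincomb[OF M N g(1), of s] free_hom_eq[OF N f] in \<open>auto simp: vecs_carrier\<close>)
qed

lemma projective_retract_free:
  assumes "projective R P" obtains k where "retract R P (free R k)"
proof -
  obtain k g where g: "g \<in> module_hom R (free R k) P" "g ` vecs R k = carrier P"
    by (rule free_cover[OF projective_fg[OF assms]]) (rule that)
  have gs: "g ` carrier (free R k) = carrier P" using g(2) by simp
  obtain h where h: "h \<in> module_hom R P (free R k)" "\<And>x. x \<in> carrier P \<Longrightarrow> g (h x) = x"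
    using projective_lift[OF assms finitely_generated_free projective_fg[OF assms] g(1) gs hom_id] by blast
  show ?thesis by (rule that, rule retractI[OF h(1) g(1)], rule h(2))
qed

end

lemma (in finite_length_ring) projective_prod [intro]:
  assumes P: "projective R P" and Q: "projective R Q"
  shows "projective R (prod_mod P Q)"
  unfolding projective_def
proof (intro conjI allI impI)
  have lP: "left_module R P" and lQ: "left_module R Q" using assms by blast+
  show "fg_module R (prod_mod P Q)" using assms by blast
  fix M N :: "'a fgmod" and g f
  assume *: "fg_module R M \<and> fg_module R N \<and> g \<in> module_hom R M N \<and> g ` carrier M = carrier N \<and> f \<in> module_hom R (prod_mod P Q) N"
  then have g: "g \<in> module_hom R M N" and f: "f \<in> module_hom R (prod_mod P Q) N" and M: "left_module R M" by auto
  interpret P: left_module R P by fact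
  interpret Q: left_module R Q by fact
  obtain h where h: "h \<in> module_hom R P M" "\<And>x. x \<in> carrier P \<Longrightarrow> g (h x) = f (x, \<zero>\<^bsub>Q\<^esub>)"
    using projective_lift[OF P, of M N g "\<lambda>x. f (x, \<zero>\<^bsub>Q\<^esub>)"] * hom_comp[OF hom_inl[OF lQ] f] by metis
  obtain h' where h': "h' \<in> module_hom R Q M" "\<And>x. x \<in> carrier Q \<Longrightarrow> g (h' x) = f (\<zero>\<^bsub>P\<^esub>, x)"
    using projective_lift[OF Q, of M N g "\<lambda>x. f (\<zero>\<^bsub>P\<^esub>, x)"] * hom_comp[OF hom_inr[OF lP] f] by metis
  show "\<exists>h\<in>module_hom R (prod_mod P Q) M. \<forall>x\<in>carrier (prod_mod P Q). g (h x) = f x"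
  proof (rule bexI)
    show "(\<lambda>x. h (fst x) \<oplus>\<^bsub>M\<^esub> h' (snd x)) \<in> module_hom R (prod_mod P Q) M"
      using hom_add_fun[OF M hom_comp[OF hom_fst h(1)] hom_comp[OF hom_snd h'(1)]] .
    show "\<forall>x\<in>carrier (prod_mod P Q). g (h (fst x) \<oplus>\<^bsub>M\<^esub> h' (snd x)) = f x"
    proof
      fix x assume "x \<in> carrier (prod_mod P Q)"
      then obtain p q where x: "x = (p, q)" "p \<in> carrier P" "q \<in> carrier Q" by auto
      have "f ((p, \<zero>\<^bsub>Q\<^esub>) \<oplus>\<^bsub>prod_mod P Q\<^esub> (\<zero>\<^bsub>P\<^esub>, q)) = f (p, \<zero>\<^bsub>Q\<^esub>) \<oplus>\<^bsub>N\<^esub> f (\<zero>\<^bsub>P\<^esub>, q)"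
        by (rule hom_add[OF f]) (use x in auto)
      then show "g (h (fst x) \<oplus>\<^bsub>M\<^esub> h' (snd x)) = f x"
        using x h h' by (simp add: hom_add[OF g] hom_closed[OF h(1)] hom_closed[OF h'(1)])
    qed
  qed
qed

lemma projective_zero:
  assumes "fg_module R P" "carrier P = {\<zero>\<^bsub>P\<^esub>}"
  shows "projective R P"
  unfolding projective_def
proof (intro conjI allI impI assms(1))
  fix M N :: "'a fgmod" and g f
  assume *: "fg_module R M \<and> fg_module R N \<and> g \<in> module_hom R M N \<and> g ` carrier M = carrier N \<and> f \<in> module_hom R P N"
  then have l: "left_module R M" "left_module R N" "left_module R P" using assms by auto
  show "\<exists>h\<in>module_hom R P M. \<forall>x\<in>carrier P. g (h x) = f x"
    by (rule bexI[OF _ hom_zero_fun[OF l(1)]])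
      (use * assms(2) hom_zero[OF l(1,2), of g] hom_zero[OF l(3,2), of f] in auto)
qed

section \<open>Short exact sequences and stable equivalence\<close>

definition ses :: "('a, 'r) ring_scheme \<Rightarrow> ('a, 'w, 'p) module_scheme \<Rightarrow> ('a, 'y, 'q) module_scheme \<Rightarrow> ('a, 'm, 's) module_scheme
    \<Rightarrow> ('w \<Rightarrow> 'y) \<Rightarrow> ('y \<Rightarrow> 'm) \<Rightarrow> bool" where
  "ses R W Y M f g \<longleftrightarrow> fg_module R W \<and> fg_module R Y \<and> fg_module R M \<and> f \<in> module_hom R W Y \<and> g \<in> module_hom R Y M \<and>
     inj_on f (carrier W) \<and> g ` carrier Y = carrier M \<and> f ` carrier W = kern Y M g"

text \<open>Short exact sequences up to the choice of maps, so that every term can be replaced by an isomorphic one.\<close>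

definition exact :: "('a, 'r) ring_scheme \<Rightarrow> ('a, 'w, 'p) module_scheme \<Rightarrow> ('a, 'y, 'q) module_scheme \<Rightarrow> ('a, 'm, 's) module_scheme \<Rightarrow> bool" where
  "exact R W Y M \<longleftrightarrow> (\<exists>f g. ses R W Y M f g)"

lemma exactI: "ses R W Y M f g \<Longrightarrow> exact R W Y M"
  by (auto simp: exact_def)

lemma exact_fg: "exact R W Y M \<Longrightarrow> fg_module R W" "exact R W Y M \<Longrightarrow> fg_module R Y" "exact R W Y M \<Longrightarrow> fg_module R M"
  by (auto simp: exact_def ses_def)

lemma ses_zero: "ses R W Y M f g \<Longrightarrow> w \<in> carrier W \<Longrightarrow> g (f w) = \<zero>\<^bsub>M\<^esub>"
  unfolding ses_def kern_def by blast

lemma ses_ker: "ses R W Y M f g \<Longrightarrow> y \<in> carrier Y \<Longrightarrow> g y = \<zero>\<^bsub>M\<^esub> \<Longrightarrow> \<exists>w \<in> carrier W. f w = y"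
proof -
  assume "ses R W Y M f g" "y \<in> carrier Y" "g y = \<zero>\<^bsub>M\<^esub>"
  then have "y \<in> f ` carrier W" unfolding ses_def kern_def by blast
  then show ?thesis by blast
qed

lemma ses_surj: "ses R W Y M f g \<Longrightarrow> m \<in> carrier M \<Longrightarrow> \<exists>y \<in> carrier Y. g y = m"
proof -
  assume "ses R W Y M f g" "m \<in> carrier M"
  then have "m \<in> g ` carrier Y" unfolding ses_def by blast
  then show ?thesis by blast
qed

lemma sesI:
  assumes "fg_module R W" "fg_module R Y" "fg_module R M" "f \<in> module_hom R W Y" "g \<in> module_hom R Y M"
    "\<And>w. w \<in> carrier W \<Longrightarrow> f w = \<zero>\<^bsub>Y\<^esub> \<Longrightarrow> w = \<zero>\<^bsub>W\<^esub>" "\<And>m. m \<in> carrier M \<Longrightarrow> \<exists>y \<in> carrier Y. g y = m"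
    "\<And>w. w \<in> carrier W \<Longrightarrow> g (f w) = \<zero>\<^bsub>M\<^esub>" "\<And>y. y \<in> carrier Y \<Longrightarrow> g y = \<zero>\<^bsub>M\<^esub> \<Longrightarrow> \<exists>w \<in> carrier W. f w = y"
  shows "ses R W Y M f g"
proof -
  have "kern W Y f = {\<zero>\<^bsub>W\<^esub>}" using assms hom_zero[of R W Y f] fg_left_module
    by (auto simp: kern_def left_module.submodule_zero[OF _ left_module.submodule_carrier])
  then have "inj_on f (carrier W)" using inj_on_kern assms fg_left_module by blast
  moreover have "g ` carrier Y = carrier M" using assms hom_closed[OF assms(5)] by blast
  moreover have "f ` carrier W = kern Y M g"
    unfolding kern_def using assms hom_closed[OF assms(4)] by (auto simp: image_iff) metis
  ultimately show ?thesis using assms by (auto simp: ses_def)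
qed

lemma ses_inj: "ses R W Y M f g \<Longrightarrow> w \<in> carrier W \<Longrightarrow> f w = \<zero>\<^bsub>Y\<^esub> \<Longrightarrow> w = \<zero>\<^bsub>W\<^esub>"
proof -
  assume s: "ses R W Y M f g" "w \<in> carrier W" "f w = \<zero>\<^bsub>Y\<^esub>"
  then have "left_module R W" "left_module R Y" "f \<in> module_hom R W Y" "inj_on f (carrier W)" by (auto simp: ses_def)
  then have "kern W Y f = {\<zero>\<^bsub>W\<^esub>}" using inj_on_kern by blast
  then show ?thesis using s(2,3) by (auto simp: kern_def)
qed

lemma exact_cong:
  assumes "exact R W Y M" "module_iso R W' W" "module_iso R Y Y'" "module_iso R M M'"
    "fg_module R W'" "fg_module R Y'" "fg_module R M'"
  shows "exact R W' Y' M'"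
proof -
  obtain f g where s: "ses R W Y M f g" using assms(1) by (auto simp: exact_def)
  then have fg: "f \<in> module_hom R W Y" "g \<in> module_hom R Y M" "fg_module R W" "fg_module R Y" "fg_module R M" by (auto simp: ses_def)
  obtain a a' where a: "a \<in> module_hom R W' W" "a' \<in> module_hom R W W'" "\<And>x. x \<in> carrier W' \<Longrightarrow> a' (a x) = x" "\<And>x. x \<in> carrier W \<Longrightarrow> a (a' x) = x"
    using module_isoE[OF assms(2)] assms(5) by blast
  obtain b b' where b: "b \<in> module_hom R Y Y'" "b' \<in> module_hom R Y' Y" "\<And>x. x \<in> carrier Y \<Longrightarrow> b' (b x) = x" "\<And>x. x \<in> carrier Y' \<Longrightarrow> b (b' x) = x"
    using module_isoE[OF assms(3)] fg by blast
  obtain c c' where c: "c \<in> module_hom R M M'" "c' \<in> module_hom R M' M" "\<And>x. x \<in> carrier M \<Longrightarrow> c' (c x) = x" "\<And>x. x \<in> carrier M' \<Longrightarrow> c (c' x) = x"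
    using module_isoE[OF assms(4)] fg by blast
  note cl = hom_closed[OF a(1)] hom_closed[OF a(2)] hom_closed[OF b(1)] hom_closed[OF b(2)] hom_closed[OF c(1)] hom_closed[OF c(2)]
    hom_closed[OF fg(1)] hom_closed[OF fg(2)]
  note z = hom_zero[OF _ _ a(1)] hom_zero[OF _ _ a(2)] hom_zero[OF _ _ b(1)] hom_zero[OF _ _ b(2)] hom_zero[OF _ _ c(1)] hom_zero[OF _ _ c(2)]
  have lm: "left_module R W" "left_module R Y" "left_module R M" "left_module R W'" "left_module R Y'" "left_module R M'"
    using assms fg by blast+
  have "ses R W' Y' M' (\<lambda>x. b (f (a x))) (\<lambda>y. c (g (b' y)))"
  proof (rule sesI[OF assms(5-7)])
    show "(\<lambda>x. b (f (a x))) \<in> module_hom R W' Y'" using hom_comp[OF hom_comp[OF a(1) fg(1)] b(1)] .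
    show "(\<lambda>x. c (g (b' x))) \<in> module_hom R Y' M'" using hom_comp[OF hom_comp[OF b(2) fg(2)] c(1)] .
    show "w = \<zero>\<^bsub>W'\<^esub>" if w: "w \<in> carrier W'" "b (f (a w)) = \<zero>\<^bsub>Y'\<^esub>" for w
    proof -
      have "f (a w) = b' \<zero>\<^bsub>Y'\<^esub>" using w b(3) cl by metis
      then have "a w = \<zero>\<^bsub>W\<^esub>" using z lm cl ses_inj[OF s] w by metis
      then show ?thesis using a(3) w z lm by metis
    qed
    show "\<exists>y\<in>carrier Y'. c (g (b' y)) = m" if "m \<in> carrier M'" for m
      using ses_surj[OF s, of "c' m"] that b c cl by metis
    show "c (g (b' (b (f (a w))))) = \<zero>\<^bsub>M'\<^esub>" if "w \<in> carrier W'" for w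
      using that ses_zero[OF s] b(3) cl z lm by metis
    show "\<exists>w\<in>carrier W'. b (f (a w)) = y" if y: "y \<in> carrier Y'" "c (g (b' y)) = \<zero>\<^bsub>M'\<^esub>" for y
    proof -
      have "g (b' y) = c' \<zero>\<^bsub>M'\<^esub>" using y c(3) cl by metis
      then obtain w where "w \<in> carrier W" "f w = b' y" using ses_ker[OF s, of "b' y"] z lm cl y by metis
      then show ?thesis using a b cl y by metis
    qed
  qed
  then show ?thesis by (rule exactI)
qed

context finite_length_ring
begin

lemma ses_kern:
  assumes "fg_module R Y" "fg_module R M" "g \<in> module_hom R Y M" "g ` carrier Y = carrier M"
  shows "ses R (Y\<lparr>carrier := kern Y M g\<rparr>) Y M (\<lambda>x. x) g"
proof -
  have K: "submodule (kern Y M g) R Y" using submodule_kern assms by blast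
  show ?thesis unfolding ses_def
    using assms fg_sub[OF assms(1) K] by (auto simp: kern_def module_hom_def)
qed

lemma exact_kern_copy:
  assumes "fg_module R Y" "fg_module R M" "g \<in> module_hom R Y M" "g ` carrier Y = carrier M"
  obtains K :: "'a fgmod" and f where "ses R K Y M f g"
proof -
  let ?K = "Y\<lparr>carrier := kern Y M g\<rparr>"
  have s: "ses R ?K Y M (\<lambda>x. x) g" by (rule ses_kern[OF assms])
  then have K: "fg_module R ?K" by (simp add: ses_def)
  obtain a where a: "a \<in> module_hom R (fg_copy R ?K) ?K" "bij_betw a (carrier (fg_copy R ?K)) (carrier ?K)"
    using fg_copy_iso'[OF K] by (auto simp: module_iso_def)
  have "ses R (fg_copy R ?K) Y M a g"
    unfolding ses_def using assms fg_copy_fg[OF K] a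
    by (auto simp: bij_betw_def module_hom_def kern_def Pi_iff)
  then show ?thesis by (rule that)
qed

lemma ses_iso_right:
  assumes s: "ses R W Y M f g" and \<phi>: "\<phi> \<in> module_hom R M M'" "bij_betw \<phi> (carrier M) (carrier M')" and M': "fg_module R M'"
  shows "ses R W Y M' f (\<lambda>y. \<phi> (g y))"
proof -
  have g: "g \<in> module_hom R Y M" "g ` carrier Y = carrier M" and l: "left_module R M" "left_module R M'"
    using s M' by (auto simp: ses_def)
  have "kern M M' \<phi> = {\<zero>\<^bsub>M\<^esub>}" using inj_on_kern[OF l \<phi>(1)] \<phi>(2) by (auto simp: bij_betw_def)
  then have "\<phi> (g y) = \<zero>\<^bsub>M'\<^esub> \<longleftrightarrow> g y = \<zero>\<^bsub>M\<^esub>" if "y \<in> carrier Y" for y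
    using hom_closed[OF g(1) that] by (auto simp: kern_def)
  then have "kern Y M' (\<lambda>y. \<phi> (g y)) = kern Y M g" by (auto simp: kern_def)
  moreover have "(\<lambda>y. \<phi> (g y)) ` carrier Y = carrier M'"
    using g(2) \<phi>(2) unfolding bij_betw_def by (metis image_image)
  ultimately show ?thesis
    using s M' hom_comp[OF g(1) \<phi>(1)] by (auto simp: ses_def)
qed

lemma ses_prod:
  assumes s: "ses R K P X f g" and s': "ses R K' P' X' f' g'"
  shows "ses R (prod_mod K K') (prod_mod P P') (prod_mod X X') (map_prod f f') (map_prod g g')"
proof (rule sesI)
  show "fg_module R (prod_mod K K')" "fg_module R (prod_mod P P')" "fg_module R (prod_mod X X')"
    using s s' by (auto simp: ses_def)
  show "map_prod f f' \<in> module_hom R (prod_mod K K') (prod_mod P P')" "map_prod g g' \<in> module_hom R (prod_mod P P') (prod_mod X X')"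
    using s s' by (auto simp: ses_def module_hom_def)
qed (use ses_inj[OF s] ses_inj[OF s'] ses_surj[OF s] ses_surj[OF s'] ses_zero[OF s] ses_zero[OF s']
   ses_ker[OF s] ses_ker[OF s'] in \<open>auto simp: image_iff\<close>)

lemma ses_refl:
  assumes "fg_module R Q" "fg_module R Z" "carrier Z = {\<zero>\<^bsub>Z\<^esub>}" shows "ses R Z Q Q (\<lambda>_. \<zero>\<^bsub>Q\<^esub>) (\<lambda>x. x)"
proof -
  interpret left_module R Q using assms by blast
  show ?thesis
    by (rule sesI) (use assms hom_zero_fun[OF left_module_axioms] in auto)
qed

lemma ses_section_iso:
  assumes s: "ses R W Y M f g" and \<sigma>: "\<sigma> \<in> module_hom R M Y" "\<And>m. m \<in> carrier M \<Longrightarrow> g (\<sigma> m) = m"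
  shows "module_iso R (prod_mod W M) Y"
proof -
  have f: "f \<in> module_hom R W Y" and g: "g \<in> module_hom R Y M" and l: "left_module R W" "left_module R Y" "left_module R M"
    using s by (auto simp: ses_def)
  interpret Y: left_module R Y by fact
  interpret W: left_module R W by fact
  interpret M: left_module R M by fact
  let ?h = "\<lambda>x. f (fst x) \<oplus>\<^bsub>Y\<^esub> \<sigma> (snd x)"
  have h: "?h \<in> module_hom R (prod_mod W M) Y"
    using hom_add_fun[OF l(2) hom_comp[OF hom_fst f] hom_comp[OF hom_snd \<sigma>(1)]] .
  note cl = hom_closed[OF f] hom_closed[OF g] hom_closed[OF \<sigma>(1)]
  have gh: "g (?h x) = snd x" if "x \<in> carrier (prod_mod W M)" for x
    using that cl ses_zero[OF s] \<sigma>(2) by (auto simp: hom_add[OF g])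
  have "x = \<zero>\<^bsub>prod_mod W M\<^esub>" if x: "x \<in> carrier (prod_mod W M)" "?h x = \<zero>\<^bsub>Y\<^esub>" for x
  proof -
    have "snd x = \<zero>\<^bsub>M\<^esub>" using gh[OF x(1)] x(2) hom_zero[OF l(2,3) g] by simp
    moreover then have "f (fst x) = \<zero>\<^bsub>Y\<^esub>" using x cl hom_zero[OF l(3,2) \<sigma>(1)] by auto
    ultimately show ?thesis using ses_inj[OF s] x by (cases x) auto
  qed
  then have "kern (prod_mod W M) Y ?h = {\<zero>\<^bsub>prod_mod W M\<^esub>}"
    using hom_zero[OF _ _ h] l unfolding kern_def by auto
  then have "inj_on ?h (carrier (prod_mod W M))" using inj_on_kern[OF left_module_prod[OF l(1,3)] l(2) h] by simp
  moreover have "y \<in> ?h ` carrier (prod_mod W M)" if y: "y \<in> carrier Y" for y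
  proof -
    have "g (y \<ominus>\<^bsub>Y\<^esub> \<sigma> (g y)) = \<zero>\<^bsub>M\<^esub>" using y cl \<sigma>(2) hom_diff[OF l(2,3) g] by simp
    then obtain w where w: "w \<in> carrier W" "f w = y \<ominus>\<^bsub>Y\<^esub> \<sigma> (g y)" using ses_ker[OF s] y cl by (metis Y.M.minus_closed)
    then have "y = ?h (w, g y)" using y cl by simp
    moreover have "(w, g y) \<in> carrier (prod_mod W M)" using w y cl by simp
    ultimately show ?thesis by (rule image_eqI)
  qed
  ultimately show ?thesis using hom_closed[OF h] by (intro module_isoI[OF h]) (auto simp: bij_betw_def)
qed

lemma ses_projective_split:
  assumes s: "ses R W Y M f g" and M: "projective R M"
  shows "module_iso R (prod_mod W M) Y"
proof -
  have *: "fg_module R Y" "fg_module R M" "g \<in> module_hom R Y M" "g ` carrier Y = carrier M" using s by (auto simp: ses_def)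
  obtain \<sigma> where "\<sigma> \<in> module_hom R M Y" "\<And>m. m \<in> carrier M \<Longrightarrow> g (\<sigma> m) = m"
    using projective_lift[OF M * hom_id] by blast
  then show ?thesis using ses_section_iso[OF s] by blast
qed

lemma exact_split: "exact R W Y M \<Longrightarrow> projective R M \<Longrightarrow> module_iso R (prod_mod W M) Y"
  unfolding exact_def using ses_projective_split by blast

lemma ses_prod_inl:
  assumes "fg_module R W" "fg_module R M" shows "ses R W (prod_mod W M) M (\<lambda>x. (x, \<zero>\<^bsub>M\<^esub>)) snd"
proof -
  interpret W: left_module R W using assms(1) by blast
  interpret M: left_module R M using assms(2) by blast
  show ?thesis
  proof (rule sesI[OF assms(1) fg_prod[OF assms] assms(2) hom_inl[OF M.left_module_axioms] hom_snd])
    show "\<exists>y\<in>carrier (prod_mod W M). snd y = m" if "m \<in> carrier M" for m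
      using that by (intro bexI[of _ "(\<zero>\<^bsub>W\<^esub>, m)"]) auto
  qed auto
qed

lemma retract_complement:
  assumes "retract R X Y" "fg_module R Y" "fg_module R X"
  obtains K :: "'a fgmod" where "fg_module R K" "module_iso R (prod_mod K X) Y"
proof -
  obtain i p where ip: "i \<in> module_hom R X Y" "p \<in> module_hom R Y X" "\<And>x. x \<in> carrier X \<Longrightarrow> p (i x) = x"
    using assms(1) unfolding retract_def by blast
  have "p ` carrier Y = carrier X" using ip hom_closed[OF ip(1)] hom_closed[OF ip(2)] by force
  then obtain K :: "'a fgmod" and f where K: "ses R K Y X f p"
    using exact_kern_copy[OF assms(2,3) ip(2)] by blast
  show ?thesis by (rule that[OF _ ses_section_iso[OF K ip(1,3)]]) (use K in \<open>auto simp: ses_def\<close>)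
qed

text \<open>The projection of the pullback to \<^term>\<open>P'\<close> has kernel \<^term>\<open>K\<close>, and it splits.\<close>

lemma pullback_iso:
  assumes s: "ses R K P M f g" and s': "ses R K' P' M f' g'" and P': "projective R P'"
  shows "module_iso R (prod_mod K P') ((prod_mod P P')\<lparr>carrier := {x \<in> carrier P \<times> carrier P'. g (fst x) = g' (snd x)}\<rparr>)"
    (is "module_iso R _ ?X")
proof -
  have h: "f \<in> module_hom R K P" "g \<in> module_hom R P M" "g' \<in> module_hom R P' M"
    and l: "left_module R K" "left_module R P" "left_module R P'" "left_module R M"
    and sj: "fg_module R P" "fg_module R M" "g ` carrier P = carrier M"
    using s s' by (auto simp: ses_def)
  interpret P: left_module R P by fact
  interpret P': left_module R P' by fact
  interpret M: left_module R M by fact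
  interpret K: left_module R K by fact
  obtain j where j: "j \<in> module_hom R P' P" "\<And>x. x \<in> carrier P' \<Longrightarrow> g (j x) = g' x"
    using projective_lift[OF P' sj(1,2) h(2) sj(3) h(3)] by blast
  let ?\<phi> = "\<lambda>x. (f (fst x) \<oplus>\<^bsub>P\<^esub> j (snd x), snd x)"
  note cl = hom_closed[OF h(1)] hom_closed[OF h(2)] hom_closed[OF h(3)] hom_closed[OF j(1)]
  have \<phi>: "?\<phi> \<in> module_hom R (prod_mod K P') (prod_mod P P')"
    using hom_pair[OF hom_add_fun[OF l(2) hom_comp[OF hom_fst h(1)] hom_comp[OF hom_snd j(1)]] hom_snd] .
  have im: "?\<phi> ` carrier (prod_mod K P') \<subseteq> carrier ?X"
    using cl ses_zero[OF s] j(2) by (auto simp: hom_add[OF h(2)])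
  have "inj_on ?\<phi> (carrier (prod_mod K P'))"
  proof -
    have "x = \<zero>\<^bsub>K\<^esub>" if "x \<in> carrier K" "f x \<oplus>\<^bsub>P\<^esub> j \<zero>\<^bsub>P'\<^esub> = \<zero>\<^bsub>P\<^esub>" for x
      using that cl ses_inj[OF s] by (simp add: hom_zero[OF l(3,2) j(1)])
    then have "kern (prod_mod K P') (prod_mod P P') ?\<phi> = {\<zero>\<^bsub>prod_mod K P'\<^esub>}"
      by (auto simp: kern_def hom_zero[OF l(3,2) j(1)] hom_zero[OF l(1,2) h(1)])
    then show ?thesis using inj_on_kern[OF left_module_prod[OF l(1,3)] left_module_prod[OF l(2,3)] \<phi>] by simp
  qed
  moreover have "x \<in> ?\<phi> ` carrier (prod_mod K P')" if x: "x \<in> carrier ?X" for x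
  proof -
    obtain p q where pq: "x = (p, q)" "p \<in> carrier P" "q \<in> carrier P'" "g p = g' q" using x by auto
    have "g (p \<ominus>\<^bsub>P\<^esub> j q) = \<zero>\<^bsub>M\<^esub>" using pq cl j(2) hom_diff[OF l(2,4) h(2)] by simp
    then obtain k where "k \<in> carrier K" "f k = p \<ominus>\<^bsub>P\<^esub> j q" using ses_ker[OF s] pq cl by (metis P.M.minus_closed)
    then show ?thesis using pq cl by (intro image_eqI[of _ _ "(k, q)"]) auto
  qed
  ultimately show ?thesis using im
    by (intro module_isoI[OF hom_corestrict[OF \<phi>]]) (auto simp: bij_betw_def)
qed

text \<open>Both sides are isomorphic to the pullback of the two surjections.\<close>

lemma schanuel:
  assumes s: "ses R K P M f g" and s': "ses R K' P' M f' g'" and P: "projective R P" and P': "projective R P'"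
  shows "module_iso R (prod_mod K P') (prod_mod K' P)"
proof -
  let ?X = "(prod_mod P P')\<lparr>carrier := {x \<in> carrier P \<times> carrier P'. g (fst x) = g' (snd x)}\<rparr>"
  let ?Y = "(prod_mod P' P)\<lparr>carrier := {x \<in> carrier P' \<times> carrier P. g' (fst x) = g (snd x)}\<rparr>"
  have "module_iso R ?X ?Y"
    by (rule module_isoI2[of prod.swap _ _ _ prod.swap]) (auto simp: module_hom_def)
  moreover have "left_module R (prod_mod K' P)" using s s' by (auto simp: ses_def)
  ultimately show ?thesis
    using module_iso_trans[OF module_iso_trans[OF pullback_iso[OF s s' P']] module_iso_sym[OF pullback_iso[OF s' s P]]] by blast
qed

text \<open>Isomorphism up to projective summands: the relation in which syzygies are unique.\<close>

definition stably_iso :: "('a, 'm, 'p) module_scheme \<Rightarrow> ('a, 'n, 'q) module_scheme \<Rightarrow> bool" where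
  "stably_iso X Y \<longleftrightarrow> (\<exists>(P :: 'a fgmod) (Q :: 'a fgmod). projective R P \<and> projective R Q \<and> module_iso R (prod_mod X P) (prod_mod Y Q))"

lemma projective_fg_copy: "projective R P \<Longrightarrow> projective R (fg_copy R P)"
  using projective_iso fg_copy_iso fg_copy_fg by blast

lemma steqI:
  assumes "projective R P" "projective R Q" "module_iso R (prod_mod X P) (prod_mod Y Q)" "left_module R X"
  shows "stably_iso X Y"
proof -
  have P: "fg_module R P" and Q: "fg_module R Q" using assms by auto
  have "module_iso R (prod_mod X (fg_copy R P)) (prod_mod Y (fg_copy R Q))"
    by (rule module_iso_trans[OF module_iso_trans[OF module_iso_prod[OF module_iso_refl fg_copy_iso'[OF P]] assms(3)]
         module_iso_prod[OF module_iso_refl fg_copy_iso[OF Q]]])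
  then show ?thesis unfolding stably_iso_def using projective_fg_copy[OF assms(1)] projective_fg_copy[OF assms(2)] by (intro exI conjI)
qed

lemma module_iso_prod_assoc': "module_iso R (prod_mod M (prod_mod N L)) (prod_mod (prod_mod M N) L)"
  by (rule module_isoI2[of "\<lambda>(x,(y,z)). ((x,y),z)" _ _ _ "\<lambda>((x,y),z). (x,(y,z))"]) (auto simp: module_hom_def)

lemma module_iso_prod4: "module_iso R (prod_mod (prod_mod A B) (prod_mod C D)) (prod_mod (prod_mod A C) (prod_mod B D))"
  by (rule module_isoI2[of "\<lambda>((x,y),(z,w)). ((x,z),(y,w))" _ _ _ "\<lambda>((x,y),(z,w)). ((x,z),(y,w))"]) (auto simp: module_hom_def)

lemma zero_fgmod: obtains Z :: "'a fgmod" where "fg_module R Z" "carrier Z = {\<zero>\<^bsub>Z\<^esub>}" "projective R Z"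
proof -
  have "left_module R (free R 0)" by (rule left_module_free)
  moreover have c: "carrier (free R 0) = {\<zero>\<^bsub>free R 0\<^esub>}" by (auto simp: vecs_def)
  ultimately have fg: "fg_module R (free R 0)" using fg_zero by blast
  obtain f where f: "f \<in> module_hom R (free R 0) (fg_copy R (free R 0))" "f ` carrier (free R 0) = carrier (fg_copy R (free R 0))"
    using fg_copy_iso[OF fg] unfolding module_iso_def bij_betw_def by blast
  have "f \<zero>\<^bsub>free R 0\<^esub> = \<zero>\<^bsub>fg_copy R (free R 0)\<^esub>"
    by (rule hom_zero[OF left_module_free fg_left_module[OF fg_copy_fg[OF fg]] f(1)])
  then have "carrier (fg_copy R (free R 0)) = {\<zero>\<^bsub>fg_copy R (free R 0)\<^esub>}" using f(2) unfolding c by simp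
  then show ?thesis using that fg_copy_fg[OF fg] projective_zero by blast
qed

lemma iso_imp_stably_iso: "module_iso R X Y \<Longrightarrow> stably_iso X Y"
  using zero_fgmod module_iso_prod[OF _ module_iso_refl] unfolding stably_iso_def by metis

lemma stably_iso_refl [simp]: "stably_iso X X"
  by (rule iso_imp_stably_iso) simp

lemma stably_iso_sym: "stably_iso X Y \<Longrightarrow> left_module R X \<Longrightarrow> stably_iso Y X"
  unfolding stably_iso_def by (meson fg_left_module left_module_prod module_iso_sym projective_fg)

lemma stably_iso_trans:
  assumes "stably_iso X Y" "stably_iso Y Z" "left_module R X" shows "stably_iso X Z"
proof -
  obtain P Q :: "'a fgmod" where 1: "projective R P" "projective R Q" "module_iso R (prod_mod X P) (prod_mod Y Q)"
    using assms(1) unfolding stably_iso_def by blast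
  obtain P' Q' :: "'a fgmod" where 2: "projective R P'" "projective R Q'" "module_iso R (prod_mod Y P') (prod_mod Z Q')"
    using assms(2) unfolding stably_iso_def by blast
  have "module_iso R (prod_mod X (prod_mod P P')) (prod_mod (prod_mod X P) P')" by (rule module_iso_prod_assoc')
  also have "module_iso R \<dots> (prod_mod (prod_mod Y Q) P')" by (rule module_iso_prod[OF 1(3) module_iso_refl])
  also (module_iso_trans) have "module_iso R \<dots> (prod_mod Y (prod_mod Q P'))" by (rule module_iso_prod_assoc)
  also (module_iso_trans) have "module_iso R \<dots> (prod_mod Y (prod_mod P' Q))" by (rule module_iso_prod[OF module_iso_refl module_iso_prod_comm])
  also (module_iso_trans) have "module_iso R \<dots> (prod_mod (prod_mod Y P') Q)" by (rule module_iso_prod_assoc')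
  also (module_iso_trans) have "module_iso R \<dots> (prod_mod (prod_mod Z Q') Q)" by (rule module_iso_prod[OF 2(3) module_iso_refl])
  also (module_iso_trans) have "module_iso R \<dots> (prod_mod Z (prod_mod Q' Q))" by (rule module_iso_prod_assoc)
  finally (module_iso_trans) show ?thesis using 1 2 assms(3) by (intro steqI[of "prod_mod P P'" "prod_mod Q' Q"]) auto
qed

lemma stably_iso_prod:
  assumes "stably_iso X Y" "stably_iso X' Y'" "left_module R X" "left_module R X'"
  shows "stably_iso (prod_mod X X') (prod_mod Y Y')"
proof -
  obtain P Q :: "'a fgmod" where 1: "projective R P" "projective R Q" "module_iso R (prod_mod X P) (prod_mod Y Q)"
    using assms(1) unfolding stably_iso_def by blast
  obtain P' Q' :: "'a fgmod" where 2: "projective R P'" "projective R Q'" "module_iso R (prod_mod X' P') (prod_mod Y' Q')"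
    using assms(2) unfolding stably_iso_def by blast
  have "module_iso R (prod_mod (prod_mod X X') (prod_mod P P')) (prod_mod (prod_mod X P) (prod_mod X' P'))" by (rule module_iso_prod4)
  also have "module_iso R \<dots> (prod_mod (prod_mod Y Q) (prod_mod Y' Q'))" by (rule module_iso_prod[OF 1(3) 2(3)])
  also (module_iso_trans) have "module_iso R \<dots> (prod_mod (prod_mod Y Y') (prod_mod Q Q'))" by (rule module_iso_prod4)
  finally (module_iso_trans) show ?thesis using 1 2 assms(3,4) by (intro steqI[of "prod_mod P P'" "prod_mod Q Q'"]) auto
qed

lemma stably_iso_projective:
  assumes "stably_iso X Y" "projective R X" "fg_module R Y" shows "projective R Y"
proof -
  obtain P Q :: "'a fgmod" where 1: "projective R P" "projective R Q" "module_iso R (prod_mod X P) (prod_mod Y Q)"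
    using assms(1) unfolding stably_iso_def by blast
  then have "projective R (prod_mod Y Q)" using projective_iso[OF projective_prod[OF assms(2) 1(1)] 1(3)] assms(3) by blast
  then show ?thesis using retract_projective[OF _ retract_inl] assms(3) 1(2) by blast
qed

lemma stably_iso_add_projective: "projective R P \<Longrightarrow> left_module R X \<Longrightarrow> stably_iso (prod_mod X P) X"
proof -
  assume P: "projective R P" and X: "left_module R X"
  obtain Z :: "'a fgmod" where Z: "fg_module R Z" "carrier Z = {\<zero>\<^bsub>Z\<^esub>}" "projective R Z" by (rule zero_fgmod)
  have "module_iso R (prod_mod (prod_mod X P) Z) (prod_mod X P)" using module_iso_prod_zero Z by blast
  then show ?thesis using steqI[OF Z(3) P] X P by blast
qed

section \<open>Syzygies and projective dimension\<close>

text \<open>Any two syzygies of stably equivalent modules are stably equivalent.\<close>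

text \<open>Adding projective summands makes \<^term>\<open>X\<close> and \<^term>\<open>X'\<close> isomorphic, and then Schanuel's lemma
  compares the kernels.\<close>

lemma kernels_stably_iso:
  assumes s: "exact R K P X" and s': "exact R K' P' X'" and P: "projective R P" and P': "projective R P'" and X: "stably_iso X X'"
  shows "stably_iso K K'"
proof -
  obtain f g f' g' where s: "ses R K P X f g" and s': "ses R K' P' X' f' g'" using assms(1,2) by (auto simp: exact_def)
  obtain Q Q' :: "'a fgmod" where Q: "projective R Q" "projective R Q'" "module_iso R (prod_mod X Q) (prod_mod X' Q')"
    using X unfolding stably_iso_def by blast
  obtain \<phi> where \<phi>: "\<phi> \<in> module_hom R (prod_mod X Q) (prod_mod X' Q')" "bij_betw \<phi> (carrier (prod_mod X Q)) (carrier (prod_mod X' Q'))"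
    using Q(3) unfolding module_iso_def by blast
  obtain Z :: "'a fgmod" where Z: "fg_module R Z" "carrier Z = {\<zero>\<^bsub>Z\<^esub>}" "projective R Z" by (rule zero_fgmod)
  have fg: "fg_module R X'" "fg_module R K" "fg_module R K'" using s s' by (auto simp: ses_def)
  have "module_iso R (prod_mod (prod_mod K Z) (prod_mod P' Q')) (prod_mod (prod_mod K' Z) (prod_mod P Q))"
    by (rule schanuel[OF ses_iso_right[OF ses_prod[OF s ses_refl] \<phi>] ses_prod[OF s' ses_refl]])
      (use Q P P' Z fg in blast)+
  then have "stably_iso (prod_mod K Z) (prod_mod K' Z)" using Q P P' Z fg by (intro steqI[of "prod_mod P' Q'" "prod_mod P Q"]) auto
  moreover have "stably_iso K (prod_mod K Z)" "stably_iso (prod_mod K' Z) K'"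
    using stably_iso_add_projective[OF Z(3)] stably_iso_sym fg Z by blast+
  ultimately show ?thesis using stably_iso_trans fg Z by (metis fg_left_module left_module_prod)
qed

text \<open>A choice of first syzygy, unique up to stable isomorphism by \<open>stably_iso_syzygy\<close>.\<close>

definition syzygy :: "('a, 'm, 'p) module_scheme \<Rightarrow> 'a fgmod" where
  "syzygy X = (SOME K. \<exists>k. exact R K (free R k) X)"

lemma exact_syzygy: assumes "fg_module R X" obtains k where "exact R (syzygy X) (free R k) X"
proof -
  obtain k g where g: "g \<in> module_hom R (free R k) X" "g ` carrier (free R k) = carrier X"
    by (rule free_cover[OF assms]) (rule that, simp_all)
  then have "\<exists>K :: 'a fgmod. \<exists>k. exact R K (free R k) X"
    using exact_kern_copy[OF finitely_generated_free assms] exactI by metis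
  then have "\<exists>k. exact R (syzygy X) (free R k) X" unfolding syzygy_def by (rule someI_ex)
  then show ?thesis using that by blast
qed

lemma syzygy_fg [intro]: "fg_module R X \<Longrightarrow> fg_module R (syzygy X)"
  using exact_syzygy exact_fg by metis

lemma stably_iso_syzygy: "exact R K P X \<Longrightarrow> projective R P \<Longrightarrow> stably_iso X X' \<Longrightarrow> fg_module R X' \<Longrightarrow> stably_iso K (syzygy X')"
  using exact_syzygy kernels_stably_iso projective_free by metis

lemma syzygy_stably_iso: "fg_module R X \<Longrightarrow> fg_module R X' \<Longrightarrow> stably_iso X X' \<Longrightarrow> stably_iso (syzygy X) (syzygy X')"
  using exact_syzygy stably_iso_syzygy projective_free by metis

primrec nth_syzygy :: "nat \<Rightarrow> 'a fgmod \<Rightarrow> 'a fgmod" where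
  "nth_syzygy 0 X = X"
| "nth_syzygy (Suc n) X = syzygy (nth_syzygy n X)"

lemma nth_syzygy_fg [intro]: "fg_module R X \<Longrightarrow> fg_module R (nth_syzygy n X)"
  by (induction n) auto

lemma nth_syzygy_stably_iso: "fg_module R X \<Longrightarrow> fg_module R X' \<Longrightarrow> stably_iso X X' \<Longrightarrow> stably_iso (nth_syzygy n X) (nth_syzygy n X')"
  by (induction n) (auto intro: syzygy_stably_iso)

lemma nth_syzygy_add: "nth_syzygy (m + n) X = nth_syzygy m (nth_syzygy n X)"
  by (induction m) auto

lemma syzygy_projective: "projective R X \<Longrightarrow> projective R (syzygy X)"
proof -
  assume X: "projective R X"
  then obtain k where e: "exact R (syzygy X) (free R k) X" using exact_syzygy by blast
  have "retract R (syzygy X) (free R k)"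
    using retract_trans[OF retract_inl retract_iso[OF exact_split[OF e X]]] syzygy_fg[OF projective_fg[OF X]] X by blast
  then show ?thesis using retract_projective[OF projective_free] syzygy_fg[OF projective_fg[OF X]] by blast
qed

text \<open>Projective dimension at most \<^term>\<open>n\<close>, measured by a syzygy instead of a resolution;
  \<open>proj_dim_le_iff\<close> is the comparison.\<close>

definition pd_le :: "nat \<Rightarrow> ('a, 'm, 'p) module_scheme \<Rightarrow> bool" where
  "pd_le n M \<longleftrightarrow> fg_module R M \<and> projective R (nth_syzygy n (fg_copy R M))"

lemma pd_fg: "pd_le n M \<Longrightarrow> fg_module R M" by (simp add: pd_le_def)

lemma pd_stably_iso:
  assumes "pd_le n M" "stably_iso M M'" "fg_module R M'" shows "pd_le n M'"
proof -
  have fg: "fg_module R M" using assms by (simp add: pd_le_def)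
  have "stably_iso (fg_copy R M) M'"
    by (rule stably_iso_trans[OF iso_imp_stably_iso[OF fg_copy_iso'[OF fg]] assms(2) fg_left_module[OF fg_copy_fg[OF fg]]])
  then have "stably_iso (fg_copy R M) (fg_copy R M')"
    by (rule stably_iso_trans[OF _ iso_imp_stably_iso[OF fg_copy_iso[OF assms(3)]] fg_left_module[OF fg_copy_fg[OF fg]]])
  then have "stably_iso (nth_syzygy n (fg_copy R M)) (nth_syzygy n (fg_copy R M'))" by (rule nth_syzygy_stably_iso[OF fg_copy_fg[OF fg] fg_copy_fg[OF assms(3)]])
  then show ?thesis using assms(1,3) stably_iso_projective[OF _ _ nth_syzygy_fg[OF fg_copy_fg[OF assms(3)], of n]] unfolding pd_le_def by blast
qed

lemma pd_iso: "pd_le n M \<Longrightarrow> module_iso R M M' \<Longrightarrow> fg_module R M' \<Longrightarrow> pd_le n M'"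
  using pd_stably_iso iso_imp_stably_iso by blast

lemma pd_fgmod: "fg_module R M \<Longrightarrow> pd_le n M \<longleftrightarrow> projective R (nth_syzygy n M)" for M :: "'a fgmod"
proof -
  assume M: "fg_module R M"
  have "stably_iso (nth_syzygy n M) (nth_syzygy n (fg_copy R M))" "stably_iso (nth_syzygy n (fg_copy R M)) (nth_syzygy n M)"
    using nth_syzygy_stably_iso[OF M fg_copy_fg[OF M] iso_imp_stably_iso[OF fg_copy_iso[OF M]]] nth_syzygy_stably_iso[OF fg_copy_fg[OF M] M iso_imp_stably_iso[OF fg_copy_iso'[OF M]]] by simp_all
  then show ?thesis unfolding pd_le_def using M stably_iso_projective nth_syzygy_fg[OF M] nth_syzygy_fg[OF fg_copy_fg[OF M]] by metis
qed

lemma pd_0: "pd_le 0 M \<longleftrightarrow> projective R M"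
  unfolding pd_le_def using projective_iso[OF _ fg_copy_iso'[of R M]] projective_fg_copy[of M] projective_fg[of R M] by auto

lemma pd_Suc:
  assumes "exact R K P M" "projective R P"
  shows "pd_le (Suc n) M \<longleftrightarrow> pd_le n K"
proof -
  have fg: "fg_module R M" "fg_module R K" using assms exact_fg by blast+
  have "stably_iso K (syzygy (fg_copy R M))" using stably_iso_syzygy[OF assms] iso_imp_stably_iso[OF fg_copy_iso] fg_copy_fg fg by blast
  then have "pd_le n K \<longleftrightarrow> pd_le n (syzygy (fg_copy R M))" using pd_stably_iso stably_iso_sym fg fg_copy_fg syzygy_fg by (meson fg_left_module)
  also have "\<dots> \<longleftrightarrow> projective R (nth_syzygy n (syzygy (fg_copy R M)))" using pd_fgmod syzygy_fg fg_copy_fg fg by blast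
  also have "nth_syzygy n (syzygy (fg_copy R M)) = nth_syzygy (Suc n) (fg_copy R M)" using nth_syzygy_add[of n 1] by simp
  finally show ?thesis using fg by (simp add: pd_le_def)
qed

lemma pd_mono: "pd_le n M \<Longrightarrow> n \<le> m \<Longrightarrow> pd_le m M"
proof (induction m)
  case (Suc m)
  then show ?case using syzygy_projective by (cases "n = Suc m") (auto simp: pd_le_def)
qed simp

lemma pd_projective: "projective R M \<Longrightarrow> pd_le n M"
  using pd_mono[of 0 M n] pd_0 by blast

text \<open>A lift to \<^term>\<open>Y\<close> of the cover of \<^term>\<open>M\<close>, together with the cover of \<^term>\<open>W\<close>, covers
  \<^term>\<open>Y\<close>. The kernels of the three covers form an exact sequence.\<close>

lemma horseshoe:
  assumes "exact R W Y M"
  obtains Z :: "'a fgmod" where "exact R (syzygy W) Z (syzygy M)" "stably_iso Z (syzygy Y)"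
proof -
  obtain f g where s: "ses R W Y M f g" using assms by (auto simp: exact_def)
  have fg: "fg_module R W" "fg_module R Y" "fg_module R M" and f: "f \<in> module_hom R W Y" and g: "g \<in> module_hom R Y M" "g ` carrier Y = carrier M"
    using s by (auto simp: ses_def)
  have l: "left_module R W" "left_module R Y" "left_module R M" using fg by auto
  interpret Y: left_module R Y by fact
  interpret W: left_module R W by fact
  interpret M: left_module R M by fact
  obtain k a b where a: "ses R (syzygy W) (free R k) W a b" using exact_syzygy[OF fg(1)] unfolding exact_def by metis
  obtain l c d where c: "ses R (syzygy M) (free R l) M c d" using exact_syzygy[OF fg(3)] unfolding exact_def by metis
  let ?F = "free R k" and ?G = "free R l"
  have lF: "left_module R ?F" "left_module R ?G" using left_module_free by auto
  interpret F: left_module R ?F by fact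
  interpret G: left_module R ?G by fact
  have b: "b \<in> module_hom R ?F W" and d: "d \<in> module_hom R ?G M" using a c by (auto simp: ses_def)
  obtain h where h: "h \<in> module_hom R ?G Y" "\<And>x. x \<in> carrier ?G \<Longrightarrow> g (h x) = d x"
    using projective_lift[OF projective_free fg(2,3) g d] by blast
  note cl = hom_closed[OF b] hom_closed[OF d] hom_closed[OF h(1)] hom_closed[OF f] hom_closed[OF g(1)]
  let ?e = "\<lambda>x. f (b (fst x)) \<oplus>\<^bsub>Y\<^esub> h (snd x)"
  have e: "?e \<in> module_hom R (prod_mod ?F ?G) Y"
    using hom_add_fun[OF l(2) hom_comp[OF hom_fst hom_comp[OF b f]] hom_comp[OF hom_snd h(1)]] .
  have esurj: "?e ` carrier (prod_mod ?F ?G) = carrier Y"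
  proof -
    have "y \<in> ?e ` carrier (prod_mod ?F ?G)" if y: "y \<in> carrier Y" for y
    proof -
      obtain x where x: "x \<in> carrier ?G" "d x = g y" using ses_surj[OF c cl(5)[OF y]] by blast
      then have "g (y \<ominus>\<^bsub>Y\<^esub> h x) = \<zero>\<^bsub>M\<^esub>" using y cl h(2) hom_diff[OF l(2,3) g(1)] by simp
      then obtain w where w: "w \<in> carrier W" "f w = y \<ominus>\<^bsub>Y\<^esub> h x" using ses_ker[OF s] y x cl by (metis Y.M.minus_closed)
      obtain v where v: "v \<in> carrier ?F" "b v = w" using ses_surj[OF a w(1)] by blast
      have "y = ?e (v, x)" using y x w v cl by simp
      then show ?thesis using v x by (intro image_eqI[of _ _ "(v,x)"]) auto
    qed
    then show ?thesis using hom_closed[OF e] by blast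
  qed
  have fgP: "fg_module R (prod_mod ?F ?G)" using finitely_generated_free by blast
  let ?KW = "?F\<lparr>carrier := kern ?F W b\<rparr>" and ?KM = "?G\<lparr>carrier := kern ?G M d\<rparr>"
    and ?Z = "(prod_mod ?F ?G)\<lparr>carrier := kern (prod_mod ?F ?G) Y ?e\<rparr>"
  have sW: "ses R ?KW ?F W (\<lambda>x. x) b" and sM: "ses R ?KM ?G M (\<lambda>x. x) d" and sY: "ses R ?Z (prod_mod ?F ?G) Y (\<lambda>x. x) ?e"
    using ses_kern[OF finitely_generated_free fg(1) b] ses_kern[OF finitely_generated_free fg(3) d] ses_kern[OF fgP fg(2) e esurj] a c
    by (simp_all add: ses_def)
  have isoW: "module_iso R (syzygy W) ?KW"
    using a by (intro module_isoI[of a]) (auto simp: ses_def bij_betw_def module_hom_def)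
  have isoM: "module_iso R (syzygy M) ?KM"
    using c by (intro module_isoI[of c]) (auto simp: ses_def bij_betw_def module_hom_def)
  have fgK: "fg_module R ?KW" "fg_module R ?KM" "fg_module R ?Z" using sW sM sY by (auto simp: ses_def)
  have "ses R ?KW ?Z ?KM (\<lambda>x. (x, \<zero>\<^bsub>?G\<^esub>)) snd"
  proof (rule sesI[OF fgK(1,3,2)])
    show "(\<lambda>x. (x, \<zero>\<^bsub>?G\<^esub>)) \<in> module_hom R ?KW ?Z"
      using hom_inl[OF lF(2), of ?F] cl hom_zero[OF lF(2) l(2) h(1)] hom_zero[OF l(1,2) f]
      by (auto simp: module_hom_def kern_def)
    show "snd \<in> module_hom R ?Z ?KM"
    proof (rule hom_corestrict[OF hom_restrict[OF hom_snd]])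
      have "d y = \<zero>\<^bsub>M\<^esub>" if "x \<in> carrier ?F" "y \<in> carrier ?G" "f (b x) \<oplus>\<^bsub>Y\<^esub> h y = \<zero>\<^bsub>Y\<^esub>" for x y
      proof -
        have "g (f (b x) \<oplus>\<^bsub>Y\<^esub> h y) = d y" using that(1,2) cl ses_zero[OF s] h(2) by (simp add: hom_add[OF g(1)])
        then show ?thesis using that(3) hom_zero[OF l(2,3) g(1)] by simp
      qed
      then show "snd ` carrier ?Z \<subseteq> kern ?G M d" by (auto simp: kern_def)
    qed (auto simp: kern_def)
    show "w = \<zero>\<^bsub>?KW\<^esub>" if "(w, \<zero>\<^bsub>?G\<^esub>) = \<zero>\<^bsub>?Z\<^esub>" for w using that by simp
    show "\<exists>y\<in>carrier ?Z. snd y = m" if m: "m \<in> carrier ?KM" for m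
    proof -
      have m': "m \<in> carrier ?G" "d m = \<zero>\<^bsub>M\<^esub>" using m by (auto simp: kern_def)
      then obtain w where w: "w \<in> carrier W" "f w = h m" using ses_ker[OF s, of "h m"] h cl by auto
      obtain v where v: "v \<in> carrier ?F" "b v = \<ominus>\<^bsub>W\<^esub> w" using ses_surj[OF a, of "\<ominus>\<^bsub>W\<^esub> w"] w by auto
      have "f (b v) \<oplus>\<^bsub>Y\<^esub> h m = \<zero>\<^bsub>Y\<^esub>" using v w hom_neg[OF l(1,2) f w(1)] cl m' by (simp add: Y.M.l_neg)
      then show ?thesis using v m' by (intro bexI[of _ "(v, m)"]) (auto simp: kern_def)
    qed
    show "\<exists>w\<in>carrier ?KW. (w, \<zero>\<^bsub>?G\<^esub>) = y" if y: "y \<in> carrier ?Z" "snd y = \<zero>\<^bsub>?KM\<^esub>" for y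
    proof -
      obtain v where v: "y = (v, \<zero>\<^bsub>?G\<^esub>)" "v \<in> carrier ?F" "f (b v) \<oplus>\<^bsub>Y\<^esub> h \<zero>\<^bsub>?G\<^esub> = \<zero>\<^bsub>Y\<^esub>" using y by (cases y) (auto simp: kern_def)
      have "f (b v) = \<zero>\<^bsub>Y\<^esub>" using v(2,3) cl hom_zero[OF lF(2) l(2) h(1)] by simp
      then have "b v = \<zero>\<^bsub>W\<^esub>" using ses_inj[OF s] cl v by blast
      then show ?thesis using v by (auto simp: kern_def)
    qed
  qed simp_all
  then have "exact R (syzygy W) (fg_copy R ?Z) (syzygy M)"
    using exact_cong[OF exactI isoW fg_copy_iso[OF fgK(3)] module_iso_sym[OF isoM]] syzygy_fg fg fg_copy_fg fgK by blast
  moreover have "stably_iso (fg_copy R ?Z) (syzygy Y)"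
    by (rule stably_iso_trans[OF iso_imp_stably_iso[OF fg_copy_iso'] stably_iso_syzygy[OF exactI[OF sY]]])
      (use fgK fg_copy_fg fg projective_free in auto)
  ultimately show ?thesis by (rule that)
qed

lemma horseshoe_nth_syzygy:
  fixes W Y M :: "'a fgmod"
  assumes "exact R W Y M"
  shows "\<exists>Z :: 'a fgmod. exact R (nth_syzygy n W) Z (nth_syzygy n M) \<and> stably_iso Z (nth_syzygy n Y)"
proof (induction n)
  case 0
  show ?case using assms by auto
next
  case (Suc n)
  then obtain Z :: "'a fgmod" where Z: "exact R (nth_syzygy n W) Z (nth_syzygy n M)" "stably_iso Z (nth_syzygy n Y)" by blast
  obtain Z' :: "'a fgmod" where Z': "exact R (syzygy (nth_syzygy n W)) Z' (syzygy (nth_syzygy n M))" "stably_iso Z' (syzygy Z)" using horseshoe[OF Z(1)] .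
  have fg: "fg_module R Z" "fg_module R Y" "fg_module R Z'" using Z(1) Z'(1) assms exact_fg by blast+
  then have "stably_iso (syzygy Z) (syzygy (nth_syzygy n Y))" using syzygy_stably_iso Z(2) by blast
  then have "stably_iso Z' (syzygy (nth_syzygy n Y))" using stably_iso_trans[OF Z'(2)] fg by blast
  then show ?case using Z'(1) by auto
qed

lemma exact_copies:
  assumes "exact R W Y M" shows "exact R (fg_copy R W) (fg_copy R Y) (fg_copy R M)"
  using exact_cong[OF assms fg_copy_iso' fg_copy_iso fg_copy_iso] exact_fg[OF assms] fg_copy_fg by metis

text \<open>By the horseshoe lemma the syzygies form exact sequences as well. In degree \<^term>\<open>n\<close> the right-hand
  term is projective, so the sequence splits; the same argument gives \<open>pd_kernel\<close>.\<close>

lemma pd_ext: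
  assumes "exact R W Y M" "pd_le n W" "pd_le n M" shows "pd_le n Y"
proof -
  obtain Z :: "'a fgmod" where Z: "exact R (nth_syzygy n (fg_copy R W)) Z (nth_syzygy n (fg_copy R M))" "stably_iso Z (nth_syzygy n (fg_copy R Y))"
    using horseshoe_nth_syzygy[OF exact_copies[OF assms(1)]] by blast
  have "projective R (nth_syzygy n (fg_copy R W))" "projective R (nth_syzygy n (fg_copy R M))" using assms by (auto simp: pd_le_def)
  then have "projective R Z" using exact_split[OF Z(1)] projective_iso projective_prod exact_fg[OF Z(1)] by blast
  then show ?thesis using stably_iso_projective[OF Z(2)] exact_fg[OF assms(1)] fg_copy_fg nth_syzygy_fg by (auto simp: pd_le_def)
qed

lemma pd_kernel:
  assumes "exact R W Y M" "pd_le n Y" "pd_le n M" shows "pd_le n W"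
proof -
  obtain Z :: "'a fgmod" where Z: "exact R (nth_syzygy n (fg_copy R W)) Z (nth_syzygy n (fg_copy R M))" "stably_iso Z (nth_syzygy n (fg_copy R Y))"
    using horseshoe_nth_syzygy[OF exact_copies[OF assms(1)]] by blast
  have *: "projective R (nth_syzygy n (fg_copy R Y))" "projective R (nth_syzygy n (fg_copy R M))" using assms by (auto simp: pd_le_def)
  have fg: "fg_module R Z" "fg_module R (nth_syzygy n (fg_copy R W))" using exact_fg[OF Z(1)] by blast+
  have "projective R Z" using stably_iso_projective[OF stably_iso_sym[OF Z(2)] *(1)] fg by blast
  moreover have "retract R (nth_syzygy n (fg_copy R W)) Z"
    by (rule retract_trans[OF retract_inl retract_iso[OF exact_split[OF Z(1) *(2)]]]) (use * fg in blast)+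
  ultimately show ?thesis using retract_projective fg exact_fg[OF assms(1)] by (auto simp: pd_le_def)
qed

lemma syzygy_prod:
  assumes "fg_module R X" "fg_module R Y" shows "stably_iso (syzygy (prod_mod X Y)) (prod_mod (syzygy X) (syzygy Y))"
proof -
  obtain k a b where a: "ses R (syzygy X) (free R k) X a b" using exact_syzygy[OF assms(1)] unfolding exact_def by metis
  obtain l c d where c: "ses R (syzygy Y) (free R l) Y c d" using exact_syzygy[OF assms(2)] unfolding exact_def by metis
  have "stably_iso (prod_mod (syzygy X) (syzygy Y)) (syzygy (prod_mod X Y))"
    by (rule stably_iso_syzygy[OF exactI[OF ses_prod[OF a c]]]) (use projective_free assms in auto)
  then show ?thesis using stably_iso_sym assms by (metis fg_left_module fg_prod syzygy_fg)
qed

lemma nth_syzygy_prod: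
  fixes X Y S :: "'a fgmod"
  assumes "fg_module R X" "fg_module R Y" "fg_module R S" "stably_iso S (prod_mod X Y)"
  shows "stably_iso (nth_syzygy n S) (prod_mod (nth_syzygy n X) (nth_syzygy n Y))"
proof (induction n)
  case (Suc n)
  have "stably_iso (syzygy (nth_syzygy n S)) (syzygy (prod_mod (nth_syzygy n X) (nth_syzygy n Y)))"
    by (rule syzygy_stably_iso[OF _ _ Suc]) (use assms in auto)
  then show ?case using stably_iso_trans[OF _ syzygy_prod] assms by (metis fg_left_module syzygy_fg nth_syzygy.simps(2) nth_syzygy_fg)
qed (use assms in simp)

lemma pd_retract:
  assumes "retract R X Y" "fg_module R X" "pd_le n Y" shows "pd_le n X"
proof -
  have Y: "fg_module R Y" using assms(3) by (rule pd_fg)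
  obtain K :: "'a fgmod" where K: "fg_module R K" "module_iso R (prod_mod K X) Y" using retract_complement[OF assms(1) Y assms(2)] .
  have cX: "fg_module R (fg_copy R X)" "fg_module R (fg_copy R Y)" using fg_copy_fg assms Y by auto
  have "module_iso R (fg_copy R Y) (prod_mod K (fg_copy R X))"
    using fg_copy_iso'[OF Y] module_iso_sym[OF K(2)] module_iso_prod[OF module_iso_refl fg_copy_iso[OF assms(2)]]
     module_iso_trans K assms(2) by (metis fg_left_module left_module_prod)
  then have s: "stably_iso (nth_syzygy n (fg_copy R Y)) (prod_mod (nth_syzygy n K) (nth_syzygy n (fg_copy R X)))"
    using nth_syzygy_prod iso_imp_stably_iso K cX by blast
  have "projective R (nth_syzygy n (fg_copy R Y))" using assms by (simp add: pd_le_def)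
  then have "projective R (prod_mod (nth_syzygy n K) (nth_syzygy n (fg_copy R X)))" using stably_iso_projective[OF s] K cX by blast
  then have "projective R (nth_syzygy n (fg_copy R X))" using retract_projective[OF _ retract_inr] nth_syzygy_fg[OF K(1)] nth_syzygy_fg[OF cX(1)] by blast
  then show ?thesis using assms by (simp add: pd_le_def)
qed

lemma pd_prod: "pd_le n X \<Longrightarrow> pd_le n Y \<Longrightarrow> pd_le n (prod_mod X Y)"
  using pd_ext[OF exactI[OF ses_prod_inl[OF pd_fg pd_fg]]] by metis

end

section \<open>Comparison with projective resolutions\<close>

lemma resolution_shift:
  assumes "projective_resolution T L P d e"
  shows "projective_resolution T ((P 0)\<lparr>carrier := kern (P 0) L e\<rparr>) (\<lambda>i. P (Suc i)) (\<lambda>i. d (Suc i)) (d 0)"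
  using assms hom_corestrict[of "d 0" T "P (Suc 0)" "P 0" "kern (P 0) L e"] unfolding projective_resolution_def kern_def by auto

lemma projective_resolution_iso:
  assumes r: "projective_resolution R M P d e" and l: "left_module R M" "left_module R N"
    and \<phi>: "\<phi> \<in> module_hom R M N" "bij_betw \<phi> (carrier M) (carrier N)"
  shows "projective_resolution R N P d (\<lambda>x. \<phi> (e x))"
proof -
  have e: "e \<in> module_hom R (P 0) M" "e ` carrier (P 0) = carrier M" using r by (auto simp: projective_resolution_def)
  have k: "kern M N \<phi> = {\<zero>\<^bsub>M\<^esub>}" using inj_on_kern[OF l \<phi>(1)] \<phi>(2) by (simp add: bij_betw_def)
  have "\<phi> (e x) = \<zero>\<^bsub>N\<^esub> \<longleftrightarrow> e x = \<zero>\<^bsub>M\<^esub>" if "x \<in> carrier (P 0)" for x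
    using k hom_closed[OF e(1) that] hom_zero[OF l \<phi>(1)] by (auto simp: kern_def)
  then have "{x \<in> carrier (P 0). \<phi> (e x) = \<zero>\<^bsub>N\<^esub>} = {x \<in> carrier (P 0). e x = \<zero>\<^bsub>M\<^esub>}" by auto
  moreover have "(\<lambda>x. \<phi> (e x)) ` carrier (P 0) = carrier N" using \<phi>(2) e(2) unfolding bij_betw_def by (metis image_image)
  ultimately show ?thesis using r hom_comp[OF e(1) \<phi>(1)] unfolding projective_resolution_def by simp
qed

context finite_length_ring
begin

definition has_res :: "nat \<Rightarrow> ('a, 'm, 'p) module_scheme \<Rightarrow> bool" where
  "has_res n M \<longleftrightarrow> (\<exists>P d e. projective_resolution R M P d e \<and> (\<forall>i>n. carrier (P i) = {\<zero>\<^bsub>P i\<^esub>}))"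

lemma has_res_imp_pd_fgmod:
  fixes M :: "'a fgmod"
  assumes "projective_resolution R M P d e" "fg_module R M" "\<And>i. i > n \<Longrightarrow> carrier (P i) = {\<zero>\<^bsub>P i\<^esub>}"
  shows "pd_le n M"
  using assms
proof (induction n arbitrary: M P d e)
  case 0
  have r: "projective R (P 0)" "projective R (P 1)" "e \<in> module_hom R (P 0) M" "d 0 \<in> module_hom R (P (Suc 0)) (P 0)" "e ` carrier (P 0) = carrier M"
    "{x \<in> carrier (P 0). e x = \<zero>\<^bsub>M\<^esub>} = d 0 ` carrier (P (Suc 0))"
    using 0(1) unfolding projective_resolution_def by auto
  have l: "left_module R (P 0)" "left_module R M" "left_module R (P (Suc 0))" using r 0(2) by auto
  have "kern (P 0) M e = {\<zero>\<^bsub>P 0\<^esub>}" using r(6) 0(3)[of 1] hom_zero[OF l(3,1) r(4)] by (simp add: kern_def)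
  then have "bij_betw e (carrier (P 0)) (carrier M)" using r(5) inj_on_kern[OF l(1,2) r(3)] by (simp add: bij_betw_def)
  then have "module_iso R (P 0) M" using module_isoI[OF r(3)] by blast
  then show ?case using projective_iso r(1) 0(2) pd_0 by blast
next
  case (Suc n)
  have r: "\<And>i. projective R (P i)" "e \<in> module_hom R (P 0) M" "\<And>i. d i \<in> module_hom R (P (Suc i)) (P i)" "e ` carrier (P 0) = carrier M"
    "{x \<in> carrier (P 0). e x = \<zero>\<^bsub>M\<^esub>} = d 0 ` carrier (P (Suc 0))"
    "\<And>i. {x \<in> carrier (P (Suc i)). d i x = \<zero>\<^bsub>P i\<^esub>} = d (Suc i) ` carrier (P (Suc (Suc i)))"
    using Suc.prems(1) unfolding projective_resolution_def by auto
  let ?K = "(P 0)\<lparr>carrier := kern (P 0) M e\<rparr>"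
  have s: "ses R ?K (P 0) M (\<lambda>x. x) e" using ses_kern[OF projective_fg[OF r(1)] Suc.prems(2) r(2,4)] .
  have K: "fg_module R ?K" using s by (simp add: ses_def)
  have "pd_le n ?K" by (rule Suc.IH[OF resolution_shift[OF Suc.prems(1)] K]) (use Suc.prems(3) in simp)
  then show ?case using pd_Suc[OF exactI[OF s] r(1)] by blast
qed

lemma has_res_imp_pd: assumes "has_res n M" "fg_module R M" shows "pd_le n M"
proof -
  obtain P d e where r: "projective_resolution R M P d e" "\<forall>i>n. carrier (P i) = {\<zero>\<^bsub>P i\<^esub>}"
    using assms(1) unfolding has_res_def by blast
  obtain \<phi> where \<phi>: "\<phi> \<in> module_hom R M (fg_copy R M)" "bij_betw \<phi> (carrier M) (carrier (fg_copy R M))"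
    using fg_copy_iso[OF assms(2)] unfolding module_iso_def by blast
  have "projective_resolution R (fg_copy R M) P d (\<lambda>x. \<phi> (e x))"
    by (rule projective_resolution_iso[OF r(1) _ _ \<phi>]) (use assms(2) fg_copy_fg in blast)+
  then have "pd_le n (fg_copy R M)" using has_res_imp_pd_fgmod fg_copy_fg[OF assms(2)] r(2) by blast
  then show ?thesis using pd_iso fg_copy_iso' assms(2) by blast
qed

lemma pd_imp_has_res:
  "pd_le n M \<Longrightarrow> has_res n M"
proof -
  have base: "\<exists>P d e. projective_resolution R M P d e \<and> (\<forall>i>0. carrier (P i) = {\<zero>\<^bsub>P i\<^esub>})" if M: "projective R M" for M :: "'a fgmod"
  proof -
    obtain Z :: "'a fgmod" where Z: "fg_module R Z" "carrier Z = {\<zero>\<^bsub>Z\<^esub>}" "projective R Z" by (rule zero_fgmod)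
    have l: "left_module R M" "left_module R Z" using M Z by blast+
    let ?P = "\<lambda>i. if i = 0 then M else Z" and ?d = "\<lambda>i _. if i = 0 then \<zero>\<^bsub>M\<^esub> else \<zero>\<^bsub>Z\<^esub>"
    have "projective_resolution R M ?P ?d (\<lambda>x. x)"
      unfolding projective_resolution_def using Z M l hom_zero_fun[OF l(1)] hom_zero_fun[OF l(2)]
        left_module.submodule_zero[OF l(1) left_module.submodule_carrier[OF l(1)]] by auto
    then show ?thesis using Z(2) by (intro exI conjI) auto
  qed
  have fgm: "pd_le n M \<Longrightarrow> has_res n M" for M :: "'a fgmod" and n
  proof (induction n arbitrary: M)
    case 0
    then show ?case unfolding has_res_def using base pd_0 by blast
  next
    case (Suc n)
    have M: "fg_module R M" using Suc.prems pd_fg by blast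
    obtain k where "exact R (syzygy M) (free R k) M" using exact_syzygy[OF M] .
    then have "exact R (syzygy M) (fg_copy R (free R k)) M"
      using exact_cong[OF _ module_iso_refl fg_copy_iso module_iso_refl] M fg_copy_fg finitely_generated_free by blast
    then obtain f g where s: "ses R (syzygy M) (fg_copy R (free R k)) M f g" by (auto simp: exact_def)
    have F: "projective R (fg_copy R (free R k))" using projective_fg_copy projective_free by blast
    have "pd_le n (syzygy M)" using pd_Suc[OF exactI[OF s] F] Suc.prems by blast
    then obtain P d e where r: "projective_resolution R (syzygy M) P d e" "\<forall>i>n. carrier (P i) = {\<zero>\<^bsub>P i\<^esub>}"
      using Suc.IH unfolding has_res_def by blast
    have r': "\<And>i. projective R (P i)" "e \<in> module_hom R (P 0) (syzygy M)" "\<And>i. d i \<in> module_hom R (P (Suc i)) (P i)" "e ` carrier (P 0) = carrier (syzygy M)"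
     "{x \<in> carrier (P 0). e x = \<zero>\<^bsub>syzygy M\<^esub>} = d 0 ` carrier (P (Suc 0))"
     "\<And>i. {x \<in> carrier (P (Suc i)). d i x = \<zero>\<^bsub>P i\<^esub>} = d (Suc i) ` carrier (P (Suc (Suc i)))"
      using r(1) unfolding projective_resolution_def by auto
    have s': "f \<in> module_hom R (syzygy M) (fg_copy R (free R k))" "g \<in> module_hom R (fg_copy R (free R k)) M"
      "g ` carrier (fg_copy R (free R k)) = carrier M" "f ` carrier (syzygy M) = kern (fg_copy R (free R k)) M g"
      using s by (auto simp: ses_def)
    let ?F = "fg_copy R (free R k)"
    have z: "f \<zero>\<^bsub>syzygy M\<^esub> = \<zero>\<^bsub>?F\<^esub>" using hom_zero[OF fg_left_module[OF syzygy_fg[OF M]] fg_left_module[OF projective_fg[OF F]] s'(1)] .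
    have k: "{x \<in> carrier (P 0). f (e x) = \<zero>\<^bsub>?F\<^esub>} = d 0 ` carrier (P (Suc 0))"
      unfolding r'(5)[symmetric] using ses_inj[OF s] hom_closed[OF r'(2)] z by auto
    have im: "{x \<in> carrier ?F. g x = \<zero>\<^bsub>M\<^esub>} = (\<lambda>x. f (e x)) ` carrier (P 0)"
      using s'(4) r'(4) unfolding kern_def by (metis image_image)
    let ?P = "\<lambda>i. case i of 0 \<Rightarrow> ?F | Suc j \<Rightarrow> P j"
    let ?d = "\<lambda>i. case i of 0 \<Rightarrow> (\<lambda>x. f (e x)) | Suc j \<Rightarrow> d j"
    have "projective_resolution R M ?P ?d g"
      unfolding projective_resolution_def
      using F r' s' k im hom_comp[OF r'(2) s'(1)] by (auto split: nat.splits)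
    moreover have "\<forall>i>Suc n. carrier (?P i) = {\<zero>\<^bsub>?P i\<^esub>}" using r(2) by (auto split: nat.splits)
    ultimately show ?case unfolding has_res_def by blast
  qed
  assume p: "pd_le n M"
  then have M: "fg_module R M" by (rule pd_fg)
  have "has_res n (fg_copy R M)" using fgm pd_iso[OF p fg_copy_iso fg_copy_fg] M by blast
  then obtain P d e where r: "projective_resolution R (fg_copy R M) P d e" "\<forall>i>n. carrier (P i) = {\<zero>\<^bsub>P i\<^esub>}"
    unfolding has_res_def by blast
  obtain \<phi> where \<phi>: "\<phi> \<in> module_hom R (fg_copy R M) M" "bij_betw \<phi> (carrier (fg_copy R M)) (carrier M)"
    using fg_copy_iso'[OF M] unfolding module_iso_def by blast
  have "projective_resolution R M P d (\<lambda>x. \<phi> (e x))"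
    by (rule projective_resolution_iso[OF r(1) _ _ \<phi>]) (use M fg_copy_fg in blast)+
  then show ?thesis using r(2) unfolding has_res_def by blast
qed

lemma proj_dim_le_iff:
  assumes "fg_module R M" shows "proj_dim R M \<le> enat n \<longleftrightarrow> pd_le n M"
proof -
  let ?S = "{enat n | n. has_res n M}"
  have eq: "proj_dim R M = Inf ?S" unfolding proj_dim_def has_res_def by simp
  show ?thesis
  proof
    assume "pd_le n M"
    then have "enat n \<in> ?S" using pd_imp_has_res by blast
    then show "proj_dim R M \<le> enat n" unfolding eq by (rule Inf_lower)
  next
    assume le: "proj_dim R M \<le> enat n"
    have "?S \<noteq> {}"
    proof
      assume "?S = {}"
      then have "proj_dim R M = \<infinity>" unfolding eq by (metis Inf_enat_def)
      then show False using le by simp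
    qed
    then have "Inf ?S \<in> ?S" unfolding Inf_enat_def by (metis (mono_tags, lifting) LeastI ex_in_conv)
    then obtain m where "Inf ?S = enat m" "has_res m M" by blast
    then show "pd_le n M" using le eq has_res_imp_pd[OF _ assms] pd_mono by fastforce
  qed
qed

lemma proj_dim_finite_iff:
  assumes "fg_module R M" shows "proj_dim R M < \<infinity> \<longleftrightarrow> (\<exists>n. pd_le n M)"
proof -
  have "proj_dim R M < \<infinity> \<longleftrightarrow> (\<exists>n. proj_dim R M \<le> enat n)" by (metis enat_ord_simps(4) enat_ord_simps(5) leD not_enat_eq order_refl)
  then show ?thesis using proj_dim_le_iff[OF assms] by blast
qed

end

section \<open>Indecomposable modules and cancellation\<close>

lemma indecomposable_iso:
  assumes "left_module R M" "left_module R N" "module_iso R M N" "indecomposable R M"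
  shows "indecomposable R N"
proof -
  interpret M: left_module R M by fact
  interpret N: left_module R N by fact
  obtain f where f: "f \<in> module_hom R M N" "bij_betw f (carrier M) (carrier N)" using assms(3) by (auto simp: module_iso_def)
  have inj: "inj_on f (carrier M)" and im: "f ` carrier M = carrier N" using f(2) by (auto simp: bij_betw_def)
  have f0: "f \<zero>\<^bsub>M\<^esub> = \<zero>\<^bsub>N\<^esub>" by (rule hom_zero[OF assms(1,2) f(1)])
  let ?i = "\<lambda>U. {x \<in> carrier M. f x \<in> U}"
  have bk: "f ` ?i U = U" if "U \<subseteq> carrier N" for U using that im by (auto simp: image_iff)
  have z: "U = {\<zero>\<^bsub>N\<^esub>}" if "U \<subseteq> carrier N" "?i U = {\<zero>\<^bsub>M\<^esub>}" for U using bk[OF that(1)] that(2) f0 by simp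
  show ?thesis unfolding indecomposable_def
  proof (intro conjI allI impI)
    show "carrier N \<noteq> {\<zero>\<^bsub>N\<^esub>}"
    proof
      assume "carrier N = {\<zero>\<^bsub>N\<^esub>}"
      then have "\<forall>x\<in>carrier M. f x = f \<zero>\<^bsub>M\<^esub>" using hom_closed[OF f(1)] f0 by auto
      then have "carrier M = {\<zero>\<^bsub>M\<^esub>}" using inj_onD[OF inj] by blast
      then show False using assms(4) by (simp add: indecomposable_def)
    qed
    fix U V assume *: "submodule U R N \<and> submodule V R N \<and> U \<inter> V = {\<zero>\<^bsub>N\<^esub>} \<and> U <+>\<^bsub>N\<^esub> V = carrier N"
    then have U: "submodule U R N" and V: "submodule V R N" and UV: "U \<inter> V = {\<zero>\<^bsub>N\<^esub>}" "N.ssum U V = carrier N" by (auto simp: N.ssum_eq_set_add)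
    have i: "submodule (?i U) R M" "submodule (?i V) R M" using submodule_vimage[OF assms(1,2) f(1)] U V by auto
    have "x = \<zero>\<^bsub>M\<^esub>" if "x \<in> carrier M" "f x \<in> U" "f x \<in> V" for x
    proof -
      have "f x = f \<zero>\<^bsub>M\<^esub>" using that UV(1) f0 by auto
      then show ?thesis using inj_onD[OF inj] that(1) by blast
    qed
    then have int: "?i U \<inter> ?i V = {\<zero>\<^bsub>M\<^esub>}" using M.submodule_zero[OF i(1)] M.submodule_zero[OF i(2)] by blast
    have "x \<in> M.ssum (?i U) (?i V)" if x: "x \<in> carrier M" for x
    proof -
      have "f x \<in> N.ssum U V" unfolding UV(2) using hom_closed[OF f(1) x] .
      then obtain u v where uv: "u \<in> U" "v \<in> V" "f x = u \<oplus>\<^bsub>N\<^esub> v" by (auto simp: N.ssum_def)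
      have "u \<in> f ` ?i U" "v \<in> f ` ?i V" using uv by (simp_all only: bk[OF N.submodule_subset[OF U]] bk[OF N.submodule_subset[OF V]])
      then obtain u' v' where u': "u' \<in> ?i U" "f u' = u" and v': "v' \<in> ?i V" "f v' = v" by blast
      have "f x = f (u' \<oplus>\<^bsub>M\<^esub> v')" using u' v' uv(3) hom_add[OF f(1)] by simp
      then have "x = u' \<oplus>\<^bsub>M\<^esub> v'" using inj_onD[OF inj] x u' v' by simp
      then show ?thesis using u'(1) v'(1) unfolding M.ssum_def by blast
    qed
    then have "M.ssum (?i U) (?i V) = carrier M" using M.submodule_subset[OF M.submodule_ssum[OF i]] by blast
    then have "?i U = {\<zero>\<^bsub>M\<^esub>} \<or> ?i V = {\<zero>\<^bsub>M\<^esub>}" using assms(4) i int unfolding indecomposable_def M.ssum_eq_set_add by blast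
    then show "U = {\<zero>\<^bsub>N\<^esub>} \<or> V = {\<zero>\<^bsub>N\<^esub>}" using z N.submodule_subset U V by blast
  qed
qed

context finite_length_ring
begin

text \<open>One of the two summands in the Fitting decomposition is zero.\<close>

lemma indecomposable_endo:
  assumes "fg_module R Z" "indecomposable R Z" "f \<in> module_hom R Z Z"
  shows "bij_betw f (carrier Z) (carrier Z) \<or> (\<exists>n. \<forall>x \<in> carrier Z. (f ^^ n) x = \<zero>\<^bsub>Z\<^esub>)"
proof -
  have Z: "left_module R Z" "finite_length R Z" using assms(1) by (auto simp: fg_iff)
  interpret left_module R Z by (rule Z(1))
  obtain n where n: "kern Z Z (f ^^ n) \<inter> (f ^^ n) ` carrier Z = {\<zero>\<^bsub>Z\<^esub>}"
     "\<forall>x \<in> carrier Z. \<exists>u \<in> kern Z Z (f ^^ n). \<exists>v \<in> (f ^^ n) ` carrier Z. x = u \<oplus>\<^bsub>Z\<^esub> v"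
     "f ` ((f ^^ n) ` carrier Z) = (f ^^ n) ` carrier Z" "n > 0"
    using fitting[OF Z assms(3)] by (elim exE conjE)
  let ?K = "kern Z Z (f ^^ n)" and ?I = "(f ^^ n) ` carrier Z"
  have K: "submodule ?K R Z" and I: "submodule ?I R Z"
    using submodule_kern[OF Z(1,1) hom_pow[OF assms(3)]] submodule_range[OF Z(1,1) hom_pow[OF assms(3)]] by auto
  have "?K <+>\<^bsub>Z\<^esub> ?I = carrier Z"
  proof (rule antisym)
    show "?K <+>\<^bsub>Z\<^esub> ?I \<subseteq> carrier Z" using submodule_subset[OF submodule_ssum[OF K I]] by (simp add: ssum_eq_set_add)
    show "carrier Z \<subseteq> ?K <+>\<^bsub>Z\<^esub> ?I" unfolding ssum_eq_set_add[symmetric] ssum_def using n(2) by blast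
  qed
  then have "?K = {\<zero>\<^bsub>Z\<^esub>} \<or> ?I = {\<zero>\<^bsub>Z\<^esub>}" using assms(2) K I n(1) unfolding indecomposable_def by blast
  then show ?thesis
  proof
    assume k: "?K = {\<zero>\<^bsub>Z\<^esub>}"
    have "x = \<zero>\<^bsub>Z\<^esub>" if x: "x \<in> carrier Z" "f x = \<zero>\<^bsub>Z\<^esub>" for x
    proof -
      obtain m where m: "n = Suc m" using n(4) by (cases n) auto
      have "(f ^^ n) x = (f ^^ m) (f x)" unfolding m by (simp only: funpow_Suc_right comp_apply)
      also have "\<dots> = \<zero>\<^bsub>Z\<^esub>" using x(2) hom_zero[OF Z(1,1) hom_pow[OF assms(3)]] by simp
      finally have "x \<in> ?K" using x(1) unfolding kern_def by simp
      then show ?thesis unfolding k by simp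
    qed
    then have "kern Z Z f = {\<zero>\<^bsub>Z\<^esub>}" using hom_zero[OF Z(1,1) assms(3)] unfolding kern_def by auto
    then have "inj_on f (carrier Z)" using inj_on_kern[OF Z(1,1) assms(3)] by simp
    then show ?thesis using finite_length_inj_endo_surj[OF Z assms(3)] by (simp add: bij_betw_def)
  next
    assume "?I = {\<zero>\<^bsub>Z\<^esub>}"
    then have "\<forall>x \<in> carrier Z. (f ^^ n) x = \<zero>\<^bsub>Z\<^esub>" by auto
    then show ?thesis by blast
  qed
qed

text \<open>If \<^term>\<open>g\<close> is nilpotent, then \<^term>\<open>f\<close> is injective, because \<^term>\<open>g\<close> fixes the kernel of
  \<^term>\<open>f\<close>.\<close>

lemma indecomposable_local:
  assumes "fg_module R Z" "indecomposable R Z" "f \<in> module_hom R Z Z" "g \<in> module_hom R Z Z"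
    and sum: "\<And>x. x \<in> carrier Z \<Longrightarrow> f x \<oplus>\<^bsub>Z\<^esub> g x = x"
  shows "bij_betw f (carrier Z) (carrier Z) \<or> bij_betw g (carrier Z) (carrier Z)"
proof (rule disjCI)
  assume ng: "\<not> bij_betw g (carrier Z) (carrier Z)"
  have Z: "left_module R Z" "finite_length R Z" using assms(1) by (auto simp: fg_iff)
  interpret left_module R Z by (rule Z(1))
  obtain n where n: "\<And>x. x \<in> carrier Z \<Longrightarrow> (g ^^ n) x = \<zero>\<^bsub>Z\<^esub>" using indecomposable_endo[OF assms(1,2,4)] ng by blast
  have "x = \<zero>\<^bsub>Z\<^esub>" if x: "x \<in> carrier Z" "f x = \<zero>\<^bsub>Z\<^esub>" for x
  proof -
    have gx: "g x = x" using sum[OF x(1)] x hom_closed[OF assms(4)] by simp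
    have "(g ^^ n) x = x" by (induction n) (simp_all add: gx)
    then show ?thesis using n x by simp
  qed
  then have "kern Z Z f = {\<zero>\<^bsub>Z\<^esub>}" using hom_zero[OF Z(1,1) assms(3)] unfolding kern_def by auto
  then have "inj_on f (carrier Z)" using inj_on_kern[OF Z(1,1) assms(3)] by simp
  then show "bij_betw f (carrier Z) (carrier Z)" using finite_length_inj_endo_surj[OF Z assms(3)] by (simp add: bij_betw_def)
qed

text \<open>The idempotent endomorphism of \<^term>\<open>U\<close> given by the retract is not nilpotent, so it is bijective.\<close>

lemma indecomposable_retract_iso:
  assumes "fg_module R U" "indecomposable R U" "left_module R Z" "retract R Z U" "carrier Z \<noteq> {\<zero>\<^bsub>Z\<^esub>}"
  shows "module_iso R Z U"
proof -
  obtain i p where ip: "i \<in> module_hom R Z U" "p \<in> module_hom R U Z" "\<And>x. x \<in> carrier Z \<Longrightarrow> p (i x) = x"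
    using assms(4) unfolding retract_def by blast
  let ?e = "\<lambda>x. i (p x)"
  have e: "?e \<in> module_hom R U U" using hom_comp[OF ip(2,1)] .
  have l: "left_module R U" using assms(1) by blast
  have inj: "inj_on i (carrier Z)" using ip(3) by (metis inj_onI)
  have "bij_betw ?e (carrier U) (carrier U)"
  proof (rule ccontr)
    assume "\<not> bij_betw ?e (carrier U) (carrier U)"
    then obtain n where n: "\<And>x. x \<in> carrier U \<Longrightarrow> (?e ^^ n) x = \<zero>\<^bsub>U\<^esub>" using indecomposable_endo[OF assms(1,2) e] by blast
    have "z = \<zero>\<^bsub>Z\<^esub>" if z: "z \<in> carrier Z" for z
    proof -
      have "(?e ^^ n) (i z) = i z" by (induction n) (use z ip(3) in simp_all)
      then have "i z = \<zero>\<^bsub>U\<^esub>" using n hom_closed[OF ip(1) z] by simp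
      then have "i z = i \<zero>\<^bsub>Z\<^esub>" using hom_zero[OF assms(3) l ip(1)] by simp
      moreover have "\<zero>\<^bsub>Z\<^esub> \<in> carrier Z" by (rule left_module.submodule_zero[OF assms(3) left_module.submodule_carrier[OF assms(3)]])
      ultimately show ?thesis using inj_onD[OF inj] z by blast
    qed
    then have "carrier Z = {\<zero>\<^bsub>Z\<^esub>}" using left_module.submodule_zero[OF assms(3) left_module.submodule_carrier[OF assms(3)]] by blast
    then show False using assms(5) by simp
  qed
  then have surj: "?e ` carrier U = carrier U" by (simp add: bij_betw_def)
  have "u \<in> i ` carrier Z" if "u \<in> carrier U" for u
  proof -
    have "u \<in> ?e ` carrier U" using that surj by simp
    then show ?thesis using hom_closed[OF ip(2)] by blast
  qed
  then have "i ` carrier Z = carrier U" using hom_closed[OF ip(1)] by blast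
  then show ?thesis using module_isoI[OF ip(1)] inj by (simp add: bij_betw_def)
qed

lemma retractI_bij:
  assumes "left_module R Z" "i \<in> module_hom R Z X" "p \<in> module_hom R X Z" "bij_betw (\<lambda>z. p (i z)) (carrier Z) (carrier Z)"
  shows "retract R Z X"
proof -
  have pi: "(\<lambda>z. p (i z)) \<in> module_hom R Z Z" using hom_comp[OF assms(2,3)] .
  let ?q = "inv_into (carrier Z) (\<lambda>z. p (i z))"
  have q: "?q \<in> module_hom R Z Z" by (rule hom_inv[OF assms(1) pi assms(4)])
  show ?thesis
    by (rule retractI[OF assms(2) hom_comp[OF assms(3) q]]) (use assms(4) in \<open>simp add: bij_betw_def inv_into_f_eq\<close>)
qed

text \<open>The compositions through the two factors add up to the identity of \<^term>\<open>Z\<close>, so one of them is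
  bijective.\<close>

lemma indecomposable_retract_prod:
  assumes "fg_module R Z" "indecomposable R Z" "left_module R X" "left_module R Y" "retract R Z (prod_mod X Y)"
  shows "retract R Z X \<or> retract R Z Y"
proof -
  obtain i p where ip: "i \<in> module_hom R Z (prod_mod X Y)" "p \<in> module_hom R (prod_mod X Y) Z" "\<And>x. x \<in> carrier Z \<Longrightarrow> p (i x) = x"
    using assms(5) unfolding retract_def by blast
  interpret X: left_module R X by fact
  interpret Y: left_module R Y by fact
  have l: "left_module R Z" using assms(1) by blast
  have i1: "(\<lambda>z. fst (i z)) \<in> module_hom R Z X" and i2: "(\<lambda>z. snd (i z)) \<in> module_hom R Z Y"
    using hom_comp[OF ip(1) hom_fst] hom_comp[OF ip(1) hom_snd] by auto
  have p1: "(\<lambda>x. p (x, \<zero>\<^bsub>Y\<^esub>)) \<in> module_hom R X Z" and p2: "(\<lambda>y. p (\<zero>\<^bsub>X\<^esub>, y)) \<in> module_hom R Y Z"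
    using hom_comp[OF hom_inl[OF assms(4)] ip(2)] hom_comp[OF hom_inr[OF assms(3)] ip(2)] by auto
  have "p (fst (i z), \<zero>\<^bsub>Y\<^esub>) \<oplus>\<^bsub>Z\<^esub> p (\<zero>\<^bsub>X\<^esub>, snd (i z)) = z" if z: "z \<in> carrier Z" for z
  proof -
    have c: "fst (i z) \<in> carrier X" "snd (i z) \<in> carrier Y" using hom_closed[OF i1 z] hom_closed[OF i2 z] by auto
    then have "p (fst (i z), \<zero>\<^bsub>Y\<^esub>) \<oplus>\<^bsub>Z\<^esub> p (\<zero>\<^bsub>X\<^esub>, snd (i z)) = p ((fst (i z), \<zero>\<^bsub>Y\<^esub>) \<oplus>\<^bsub>prod_mod X Y\<^esub> (\<zero>\<^bsub>X\<^esub>, snd (i z)))"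
      by (intro hom_add[OF ip(2), symmetric]) auto
    also have "(fst (i z), \<zero>\<^bsub>Y\<^esub>) \<oplus>\<^bsub>prod_mod X Y\<^esub> (\<zero>\<^bsub>X\<^esub>, snd (i z)) = i z" using c by simp
    finally show ?thesis using ip(3)[OF z] by simp
  qed
  from indecomposable_local[OF assms(1,2) hom_comp[OF i1 p1] hom_comp[OF i2 p2] this]
  show ?thesis using retractI_bij[OF l i1 p1] retractI_bij[OF l i2 p2] by blast
qed

subsection \<open>Direct sums of lists\<close>

text \<open>The direct sum of a list, copied at each step so that its value has the type of the members.\<close>

primrec dsum :: "'a fgmod list \<Rightarrow> 'a fgmod" where
  "dsum [] = (SOME Z. fg_module R Z \<and> carrier Z = {\<zero>\<^bsub>Z\<^esub>})"
| "dsum (X # Xs) = fg_copy R (prod_mod X (dsum Xs))"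

lemma dsum_Nil: "fg_module R (dsum [])" "carrier (dsum []) = {\<zero>\<^bsub>dsum []\<^esub>}"
proof -
  have "\<exists>Z :: 'a fgmod. fg_module R Z \<and> carrier Z = {\<zero>\<^bsub>Z\<^esub>}" using zero_fgmod by metis
  from someI_ex[OF this] show "fg_module R (dsum [])" "carrier (dsum []) = {\<zero>\<^bsub>dsum []\<^esub>}" by simp_all
qed

lemma dsum_fg: "(\<forall>X\<in>set Xs. fg_module R X) \<Longrightarrow> fg_module R (dsum Xs)"
  by (induction Xs) (use dsum_Nil in \<open>auto intro!: fg_copy_fg\<close>)

lemma dsum_Cons:
  assumes "fg_module R X" "\<forall>X\<in>set Xs. fg_module R X"
  shows "module_iso R (dsum (X # Xs)) (prod_mod X (dsum Xs))" "module_iso R (prod_mod X (dsum Xs)) (dsum (X # Xs))"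
proof -
  have "fg_module R (prod_mod X (dsum Xs))" using assms dsum_fg[OF assms(2)] by blast
  then show "module_iso R (dsum (X # Xs)) (prod_mod X (dsum Xs))" "module_iso R (prod_mod X (dsum Xs)) (dsum (X # Xs))"
    using fg_copy_iso fg_copy_iso' by auto
qed

lemma module_iso_zero_prod:
  "left_module R N \<Longrightarrow> carrier N = {\<zero>\<^bsub>N\<^esub>} \<Longrightarrow> module_iso R (prod_mod N M) M"
  using module_iso_trans[OF module_iso_prod_comm module_iso_prod_zero] .

lemma dsum_append:
  assumes "\<forall>X\<in>set Xs. fg_module R X" "\<forall>X\<in>set Ys. fg_module R X"
  shows "module_iso R (dsum (Xs @ Ys)) (prod_mod (dsum Xs) (dsum Ys))"
  using assms(1)
proof (induction Xs)
  case Nil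
  have "module_iso R (prod_mod (dsum []) (dsum Ys)) (dsum Ys)"
    by (rule module_iso_zero_prod[OF fg_left_module[OF dsum_Nil(1)] dsum_Nil(2)])
  then show ?case using module_iso_sym[OF _ left_module_prod[OF fg_left_module[OF dsum_Nil(1)] fg_left_module[OF dsum_fg[OF assms(2)]]]] by simp
next
  case (Cons X Xs)
  have X: "fg_module R X" and Xs: "\<forall>X\<in>set Xs. fg_module R X" using Cons.prems by auto
  have XY: "\<forall>X\<in>set (Xs @ Ys). fg_module R X" using Xs assms(2) by auto
  have l: "left_module R (prod_mod X (dsum Xs))" using X dsum_fg[OF Xs] by blast
  have "module_iso R (dsum (X # (Xs @ Ys))) (prod_mod X (dsum (Xs @ Ys)))" by (rule dsum_Cons(1)[OF X XY])
  also have "module_iso R \<dots> (prod_mod X (prod_mod (dsum Xs) (dsum Ys)))"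
    by (rule module_iso_prod[OF module_iso_refl Cons.IH[OF Xs]])
  also (module_iso_trans) have "module_iso R \<dots> (prod_mod (prod_mod X (dsum Xs)) (dsum Ys))" by (rule module_iso_prod_assoc')
  also (module_iso_trans) have "module_iso R \<dots> (prod_mod (dsum (X # Xs)) (dsum Ys))"
    by (rule module_iso_prod[OF dsum_Cons(2)[OF X Xs] module_iso_refl])
  finally (module_iso_trans) show ?case by simp
qed

lemma dsum_cong:
  assumes "list_all2 (\<lambda>X Y. fg_module R X \<and> fg_module R Y \<and> module_iso R X Y) Xs Ys"
  shows "module_iso R (dsum Xs) (dsum Ys)"
  using assms
proof (induction rule: list_all2_induct)
  case (Cons X Xs Y Ys)
  have Xs: "\<forall>X\<in>set Xs. fg_module R X" and Ys: "\<forall>X\<in>set Ys. fg_module R X"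
    using Cons(2) by (auto simp: list_all2_conv_all_nth in_set_conv_nth)
  show ?case
    by (rule module_iso_trans[OF dsum_Cons(1) module_iso_trans[OF module_iso_prod dsum_Cons(2)]])
      (use Cons Xs Ys in auto)
qed simp

lemma dsum_remove1:
  assumes "\<forall>X\<in>set Xs. fg_module R X" "Y \<in> set Xs"
  shows "module_iso R (dsum Xs) (dsum (Y # remove1 Y Xs))"
  using assms
proof (induction Xs)
  case (Cons X Xs)
  show ?case
  proof (cases "X = Y")
    case False
    have X: "fg_module R X" and Xs: "\<forall>X\<in>set Xs. fg_module R X" and Y: "fg_module R Y" "Y \<in> set Xs"
      using Cons.prems False by auto
    have rm: "\<forall>X\<in>set (remove1 Y Xs). fg_module R X" using Xs by (meson notin_set_remove1)
    have rX: "\<forall>Z\<in>set (X # remove1 Y Xs). fg_module R Z" using rm X by auto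
    have rY: "\<forall>Z\<in>set (Y # remove1 Y Xs). fg_module R Z" using rm Y by auto
    have "module_iso R (dsum (X # Xs)) (prod_mod X (dsum Xs))" by (rule dsum_Cons(1)[OF X Xs])
    also have "module_iso R \<dots> (prod_mod X (dsum (Y # remove1 Y Xs)))" by (rule module_iso_prod[OF module_iso_refl Cons.IH[OF Xs Y(2)]])
    also (module_iso_trans) have "module_iso R \<dots> (prod_mod X (prod_mod Y (dsum (remove1 Y Xs))))"
      by (rule module_iso_prod[OF module_iso_refl dsum_Cons(1)[OF Y(1) rm]])
    also (module_iso_trans) have "module_iso R \<dots> (prod_mod (prod_mod X Y) (dsum (remove1 Y Xs)))" by (rule module_iso_prod_assoc')
    also (module_iso_trans) have "module_iso R \<dots> (prod_mod (prod_mod Y X) (dsum (remove1 Y Xs)))" by (rule module_iso_prod[OF module_iso_prod_comm module_iso_refl])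
    also (module_iso_trans) have "module_iso R \<dots> (prod_mod Y (prod_mod X (dsum (remove1 Y Xs))))" by (rule module_iso_prod_assoc)
    also (module_iso_trans) have "module_iso R \<dots> (prod_mod Y (dsum (X # remove1 Y Xs)))" by (rule module_iso_prod[OF module_iso_refl dsum_Cons(2)[OF X rm]])
    also (module_iso_trans) have "module_iso R \<dots> (dsum (Y # X # remove1 Y Xs))" by (rule dsum_Cons(2)[OF Y(1) rX])
    finally (module_iso_trans) show ?thesis using False by simp
  qed simp
qed simp

lemma dsum_perm:
  assumes "mset Xs = mset Ys" "\<forall>X\<in>set Xs. fg_module R X"
  shows "module_iso R (dsum Xs) (dsum Ys)"
  using assms
proof (induction Xs arbitrary: Ys)
  case (Cons X Xs)
  have X: "fg_module R X" and Xs: "\<forall>W\<in>set Xs. fg_module R W" using Cons.prems by auto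
  have XY: "X \<in> set Ys" using Cons.prems(1) by (metis list.set_intros(1) set_mset_mset)
  have setY: "set Ys = set (X # Xs)" using Cons.prems(1) by (metis set_mset_mset)
  have Ys: "\<forall>Y\<in>set Ys. fg_module R Y" using Cons.prems(2) setY by simp
  have rm: "\<forall>W\<in>set (remove1 X Ys). fg_module R W" using Ys by (meson notin_set_remove1)
  have "mset Xs = mset (remove1 X Ys)" using Cons.prems(1) by (metis add_mset_remove_trivial mset.simps(2) mset_remove1)
  then have "module_iso R (dsum Xs) (dsum (remove1 X Ys))" using Cons.IH Xs by blast
  have "module_iso R (dsum (X # Xs)) (dsum (X # remove1 X Ys))"
    by (rule module_iso_trans[OF dsum_Cons(1)[OF X Xs] module_iso_trans[OF module_iso_prod[OF module_iso_refl \<open>module_iso R (dsum Xs) (dsum (remove1 X Ys))\<close>]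
      dsum_Cons(2)[OF X rm]]])
  moreover have "module_iso R (dsum (X # remove1 X Ys)) (dsum Ys)"
    by (rule module_iso_sym[OF dsum_remove1[OF Ys XY] fg_left_module[OF dsum_fg[OF Ys]]])
  ultimately show ?case by (rule module_iso_trans)
qed simp

lemma dsum_retract_mem:
  assumes "\<forall>X\<in>set Xs. fg_module R X" "Y \<in> set Xs"
  shows "retract R Y (dsum Xs)"
proof -
  have Y: "fg_module R Y" using assms by blast
  have rm: "\<forall>X\<in>set (remove1 Y Xs). fg_module R X" using assms(1) by (meson notin_set_remove1)
  have l: "left_module R Y" "left_module R (dsum (remove1 Y Xs))" using Y dsum_fg[OF rm] by blast+
  have "module_iso R (dsum Xs) (prod_mod Y (dsum (remove1 Y Xs)))"
    by (rule module_iso_trans[OF dsum_remove1[OF assms] dsum_Cons(1)[OF Y rm]])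
  then have "retract R (prod_mod Y (dsum (remove1 Y Xs))) (dsum Xs)"
    by (rule retract_iso'[OF _ fg_left_module[OF dsum_fg[OF assms(1)]]])
  then show ?thesis using retract_trans[OF retract_inl[OF l]] by blast
qed

subsection \<open>Decomposition into indecomposable modules\<close>

lemma decompose_indecomposable:
  assumes M: "fg_module R M"
  shows "\<exists>Xs. (\<forall>X \<in> set Xs. fg_module R X \<and> indecomposable R X) \<and> module_iso R M (dsum Xs)"
proof -
  have lM: "left_module R M" using M by blast
  interpret M: left_module R M by fact
  obtain \<rho> where "rank_on R M (carrier M) \<rho>" using M unfolding fg_iff finite_length_on_def by blast
  note \<rho> = rank_onD[OF this]
  have "\<exists>Xs. (\<forall>X \<in> set Xs. fg_module R X \<and> indecomposable R X) \<and> module_iso R (M\<lparr>carrier := U\<rparr>) (dsum Xs)"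
    if "submodule U R M" for U
    using that
  proof (induction "\<rho> U" arbitrary: U rule: less_induct)
    case less
    have U: "submodule U R M" by fact
    have fgU: "fg_module R (M\<lparr>carrier := U\<rparr>)" by (rule fg_sub[OF M U])
    have lU: "left_module R (M\<lparr>carrier := U\<rparr>)" using fgU by blast
    interpret U: left_module R "M\<lparr>carrier := U\<rparr>" by fact
    consider "U = {\<zero>\<^bsub>M\<^esub>}" | "indecomposable R (M\<lparr>carrier := U\<rparr>)" | "U \<noteq> {\<zero>\<^bsub>M\<^esub>}" "\<not> indecomposable R (M\<lparr>carrier := U\<rparr>)" by blast
    then show ?case
    proof cases
      case 1
      have "module_iso R (M\<lparr>carrier := U\<rparr>) (dsum [])"
        by (rule module_iso_zero[OF lU fg_left_module[OF dsum_Nil(1)] _ dsum_Nil(2)]) (simp add: 1)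
      then show ?thesis by (intro exI[of _ "[]"]) simp
    next
      case 2
      let ?C = "fg_copy R (M\<lparr>carrier := U\<rparr>)"
      have C: "fg_module R ?C" "module_iso R (M\<lparr>carrier := U\<rparr>) ?C" using fg_copy_fg fg_copy_iso fgU by auto
      have "indecomposable R ?C" by (rule indecomposable_iso[OF lU fg_left_module[OF C(1)] C(2) 2])
      moreover have "module_iso R (M\<lparr>carrier := U\<rparr>) (dsum [?C])"
      proof -
        have "module_iso R (dsum [?C]) (prod_mod ?C (dsum []))" by (rule dsum_Cons(1)[OF C(1)]) simp
        moreover have "module_iso R (prod_mod ?C (dsum [])) ?C" by (rule module_iso_prod_zero[OF fg_left_module[OF dsum_Nil(1)] dsum_Nil(2)])
        ultimately have "module_iso R (dsum [?C]) ?C" by (rule module_iso_trans)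
        moreover have "fg_module R (dsum [?C])" by (rule dsum_fg) (use C in simp)
        ultimately show ?thesis using C(2) module_iso_sym module_iso_trans by blast
      qed
      ultimately show ?thesis using C(1) by (intro exI[of _ "[?C]"]) simp
    next
      case 3
      then obtain V W where "submodule V R (M\<lparr>carrier := U\<rparr>)" "submodule W R (M\<lparr>carrier := U\<rparr>)"
        and VW: "V \<inter> W = {\<zero>\<^bsub>M\<^esub>}" "V <+>\<^bsub>M\<lparr>carrier := U\<rparr>\<^esub> W = U" "V \<noteq> {\<zero>\<^bsub>M\<^esub>}" "W \<noteq> {\<zero>\<^bsub>M\<^esub>}"
        unfolding indecomposable_def by auto
      then have V: "submodule V R M" "V \<subseteq> U" and W: "submodule W R M" "W \<subseteq> U" and VU: "submodule V R (M\<lparr>carrier := U\<rparr>)" and WU: "submodule W R (M\<lparr>carrier := U\<rparr>)"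
        by (auto simp: M.submodule_sub_iff[OF U])
      have sum: "\<exists>v\<in>V. \<exists>w\<in>W. x = v \<oplus>\<^bsub>M\<^esub> w" if "x \<in> U" for x
        using that VW(2) unfolding U.ssum_eq_set_add[symmetric] U.ssum_def by auto
      have UM: "U \<subseteq> carrier M" by (rule M.submodule_subset[OF U])
      have "\<rho> V < \<rho> U" "\<rho> W < \<rho> U"
      proof -
        have "V \<noteq> U" "W \<noteq> U" using VW V W by auto
        then show "\<rho> V < \<rho> U" "\<rho> W < \<rho> U" using \<rho>[OF V(1) U V(2) UM] \<rho>[OF W(1) U W(2) UM] by auto
      qed
      from less.hyps[OF this(1) V(1)] less.hyps[OF this(2) W(1)] obtain Xs Ys where
        Xs: "\<forall>X \<in> set Xs. fg_module R X \<and> indecomposable R X" "module_iso R (M\<lparr>carrier := V\<rparr>) (dsum Xs)" and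
        Ys: "\<forall>X \<in> set Ys. fg_module R X \<and> indecomposable R X" "module_iso R (M\<lparr>carrier := W\<rparr>) (dsum Ys)" by blast
      have "module_iso R (prod_mod ((M\<lparr>carrier := U\<rparr>)\<lparr>carrier := V\<rparr>) ((M\<lparr>carrier := U\<rparr>)\<lparr>carrier := W\<rparr>)) (M\<lparr>carrier := U\<rparr>)"
        by (rule module_iso_internal_sum[OF lU VU WU]) (use VW(1) sum in auto)
      then have 1: "module_iso R (prod_mod (M\<lparr>carrier := V\<rparr>) (M\<lparr>carrier := W\<rparr>)) (M\<lparr>carrier := U\<rparr>)" by simp
      have "left_module R (prod_mod (M\<lparr>carrier := V\<rparr>) (M\<lparr>carrier := W\<rparr>))"
        using M.left_module_sub V(1) W(1) by blast
      note 2 = module_iso_sym[OF 1 this]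
      have 3: "module_iso R (prod_mod (M\<lparr>carrier := V\<rparr>) (M\<lparr>carrier := W\<rparr>)) (prod_mod (dsum Xs) (dsum Ys))"
        by (rule module_iso_prod[OF Xs(2) Ys(2)])
      have fgXs: "\<forall>X\<in>set Xs. fg_module R X" and fgYs: "\<forall>X\<in>set Ys. fg_module R X" using Xs Ys by auto
      have fgXY: "\<forall>X\<in>set (Xs @ Ys). fg_module R X" using Xs Ys by auto
      have 4: "module_iso R (prod_mod (dsum Xs) (dsum Ys)) (dsum (Xs @ Ys))"
        by (rule module_iso_sym[OF dsum_append[OF fgXs fgYs] fg_left_module[OF dsum_fg[OF fgXY]]])
      have "module_iso R (M\<lparr>carrier := U\<rparr>) (dsum (Xs @ Ys))" by (rule module_iso_trans[OF 2 module_iso_trans[OF 3 4]])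
      then show ?thesis using Xs(1) Ys(1) by (intro exI[of _ "Xs @ Ys"]) auto
    qed
  qed
  from this[OF M.submodule_carrier] show ?thesis by simp
qed

lemma indecomposable_retract_dsum:
  assumes "fg_module R Z" "indecomposable R Z" "\<forall>X\<in>set Xs. fg_module R X" "retract R Z (dsum Xs)"
  shows "\<exists>X \<in> set Xs. retract R Z X"
  using assms(3,4)
proof (induction Xs)
  case Nil
  obtain i p where ip: "i \<in> module_hom R Z (dsum [])" "p \<in> module_hom R (dsum []) Z" "\<And>x. x \<in> carrier Z \<Longrightarrow> p (i x) = x"
    using Nil.prems(2) unfolding retract_def by blast
  have "p \<zero>\<^bsub>dsum []\<^esub> = \<zero>\<^bsub>Z\<^esub>" by (rule hom_zero[OF fg_left_module[OF dsum_Nil(1)] fg_left_module[OF assms(1)] ip(2)])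
  then have "x = \<zero>\<^bsub>Z\<^esub>" if "x \<in> carrier Z" for x using ip(3)[OF that] hom_closed[OF ip(1) that] dsum_Nil(2) by simp
  moreover have "\<zero>\<^bsub>Z\<^esub> \<in> carrier Z" using left_module.submodule_zero[OF _ left_module.submodule_carrier] assms(1) by blast
  ultimately have "carrier Z = {\<zero>\<^bsub>Z\<^esub>}" by blast
  then show ?case using assms(2) by (simp add: indecomposable_def)
next
  case (Cons X Xs)
  have X: "fg_module R X" and Xs: "\<forall>X\<in>set Xs. fg_module R X" using Cons.prems by auto
  have l: "left_module R X" "left_module R (dsum Xs)" using X dsum_fg[OF Xs] by blast+
  have "retract R (dsum (X # Xs)) (prod_mod X (dsum Xs))"
    by (rule retract_iso[OF dsum_Cons(1)[OF X Xs] fg_left_module[OF dsum_fg[OF Cons.prems(1)]]])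
  then have "retract R Z (prod_mod X (dsum Xs))" by (rule retract_trans[OF Cons.prems(2)])
  then show ?case using indecomposable_retract_prod[OF assms(1,2) l] Cons.IH[OF Xs] by auto
qed

text \<open>The indecomposable summands of the members of \<^term>\<open>XS\<close> form \<^term>\<open>VS\<close>. An indecomposable summand of
  a direct sum of such members is isomorphic to one of them because its endomorphism ring is local.\<close>

theorem finite_summands:
  assumes "finite XS" "\<forall>X \<in> XS. fg_module R X"
  shows "\<exists>VS. finite VS \<and> (\<forall>V \<in> VS. fg_module R V) \<and>
    (\<forall>(Z :: 'a fgmod) Ys. fg_module R Z \<and> set Ys \<subseteq> XS \<and> retract R Z (dsum Ys) \<longrightarrow> (\<exists>Zs. set Zs \<subseteq> VS \<and> module_iso R Z (dsum Zs)))"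
proof -
  have "\<forall>X \<in> XS. \<exists>Ds. (\<forall>D \<in> set Ds. fg_module R D \<and> indecomposable R D) \<and> module_iso R X (dsum Ds)"
    using decompose_indecomposable assms(2) by blast
  then obtain D where D: "\<And>X V. X \<in> XS \<Longrightarrow> V \<in> set (D X) \<Longrightarrow> fg_module R V \<and> indecomposable R V"
    "\<And>X. X \<in> XS \<Longrightarrow> module_iso R X (dsum (D X))" by metis
  let ?VS = "\<Union>X\<in>XS. set (D X)"
  show ?thesis
  proof (intro exI[of _ ?VS] conjI allI impI ballI)
    show "finite ?VS" using assms(1) by auto
    show "fg_module R V" if "V \<in> ?VS" for V using that D(1) by blast
    fix Z :: "'a fgmod" and Ys assume *: "fg_module R Z \<and> set Ys \<subseteq> XS \<and> retract R Z (dsum Ys)"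
    then have Ys: "\<forall>Y\<in>set Ys. fg_module R Y" using assms(2) by blast
    obtain Ds where Ds: "\<forall>D \<in> set Ds. fg_module R D \<and> indecomposable R D" "module_iso R Z (dsum Ds)"
      using decompose_indecomposable * by blast
    have "\<exists>V \<in> ?VS. module_iso R W V" if W: "W \<in> set Ds" for W
    proof -
      have Wi: "fg_module R W" "indecomposable R W" using W Ds(1) by auto
      have "retract R W (dsum Ds)" by (rule dsum_retract_mem[OF _ W]) (use Ds(1) in blast)
      moreover have "retract R (dsum Ds) Z" using retract_iso'[OF Ds(2)] * by blast
      ultimately have "retract R W (dsum Ys)" using retract_trans * by blast
      then obtain Y where Y: "Y \<in> set Ys" "retract R W Y" using indecomposable_retract_dsum[OF Wi Ys] by blast
      have YX: "Y \<in> XS" using Y(1) * by blast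
      have "retract R Y (dsum (D Y))" using retract_iso[OF D(2)[OF YX]] Ys Y(1) by blast
      then have "retract R W (dsum (D Y))" by (rule retract_trans[OF Y(2)])
      then obtain V where V: "V \<in> set (D Y)" "retract R W V" using indecomposable_retract_dsum[OF Wi, of "D Y"] D(1)[OF YX] by blast
      have "carrier W \<noteq> {\<zero>\<^bsub>W\<^esub>}" using Wi(2) by (simp add: indecomposable_def)
      then have "module_iso R W V" using indecomposable_retract_iso[OF _ _ _ V(2)] D(1)[OF YX V(1)] Wi(1) by blast
      then show ?thesis using V(1) YX by blast
    qed
    then obtain v where v: "\<And>W. W \<in> set Ds \<Longrightarrow> v W \<in> ?VS \<and> module_iso R W (v W)" by metis
    have "module_iso R (dsum Ds) (dsum (map v Ds))"
    proof (rule dsum_cong)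
      have "\<forall>W \<in> set Ds. fg_module R W \<and> fg_module R (v W) \<and> module_iso R W (v W)" using v Ds(1) D(1) by blast
      then show "list_all2 (\<lambda>X Y. fg_module R X \<and> fg_module R Y \<and> module_iso R X Y) Ds (map v Ds)"
        by (simp add: list_all2_conv_all_nth)
    qed
    then have "module_iso R Z (dsum (map v Ds))" by (rule module_iso_trans[OF Ds(2)])
    moreover have "set (map v Ds) \<subseteq> ?VS" using v by auto
    ultimately show "\<exists>Zs. set Zs \<subseteq> ?VS \<and> module_iso R Z (dsum Zs)" by blast
  qed
qed

subsection \<open>Cancellation\<close>

text \<open>As the corner is invertible, every \<open>x\<close> in \<^term>\<open>X\<close> is the first component of a unique pair
  that \<^term>\<open>\<phi>\<close> sends to a pair \<open>(y, 0)\<close>; the isomorphism sends \<open>x\<close> to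
  \<open>y\<close>.\<close>

lemma cancel_invertible:
  assumes l: "left_module R X" "left_module R Y" "left_module R Z"
    and \<phi>: "\<phi> \<in> module_hom R (prod_mod X Z) (prod_mod Y Z)" "bij_betw \<phi> (carrier (prod_mod X Z)) (carrier (prod_mod Y Z))"
    and d: "bij_betw (\<lambda>z. snd (\<phi> (\<zero>\<^bsub>X\<^esub>, z))) (carrier Z) (carrier Z)"
  shows "module_iso R X Y"
proof -
  interpret X: left_module R X by fact
  interpret Y: left_module R Y by fact
  interpret Z: left_module R Z by fact
  let ?P = "prod_mod X Z" and ?Q = "prod_mod Y Z"
  have lP: "left_module R ?P" "left_module R ?Q" using l by auto
  let ?c = "\<lambda>x. snd (\<phi> (x, \<zero>\<^bsub>Z\<^esub>))" and ?d = "\<lambda>z. snd (\<phi> (\<zero>\<^bsub>X\<^esub>, z))"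
  have c: "?c \<in> module_hom R X Z" using hom_comp[OF hom_comp[OF hom_inl[OF l(3)] \<phi>(1)] hom_snd] .
  have dh: "?d \<in> module_hom R Z Z" using hom_comp[OF hom_comp[OF hom_inr[OF l(1)] \<phi>(1)] hom_snd] .
  let ?e = "inv_into (carrier Z) ?d"
  have e: "?e \<in> module_hom R Z Z" by (rule hom_inv[OF l(3) dh d])
  have de: "?d (?e z) = z" if "z \<in> carrier Z" for z
    by (rule bij_betw_inv_into_right[OF d that])
  have ed: "?e (?d z) = z" if "z \<in> carrier Z" for z
    by (rule bij_betw_inv_into_left[OF d that])
  have split: "\<phi> (x, z) = \<phi> (x, \<zero>\<^bsub>Z\<^esub>) \<oplus>\<^bsub>?Q\<^esub> \<phi> (\<zero>\<^bsub>X\<^esub>, z)" if "x \<in> carrier X" "z \<in> carrier Z" for x z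
  proof -
    have "\<phi> ((x, \<zero>\<^bsub>Z\<^esub>) \<oplus>\<^bsub>?P\<^esub> (\<zero>\<^bsub>X\<^esub>, z)) = \<phi> (x, \<zero>\<^bsub>Z\<^esub>) \<oplus>\<^bsub>?Q\<^esub> \<phi> (\<zero>\<^bsub>X\<^esub>, z)" by (rule hom_add[OF \<phi>(1)]) (use that in auto)
    then show ?thesis using that by simp
  qed
  let ?k = "\<lambda>x. \<ominus>\<^bsub>Z\<^esub> ?e (?c x)"
  have k: "?k \<in> module_hom R X Z" using hom_neg_fun[OF l(3) hom_comp[OF c e]] .
  let ?\<theta> = "\<lambda>x. fst (\<phi> (x, ?k x))"
  have \<theta>: "?\<theta> \<in> module_hom R X Y" using hom_comp[OF hom_comp[OF hom_pair[OF hom_id k] \<phi>(1)] hom_fst] .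
  have snd0: "snd (\<phi> (x, ?k x)) = \<zero>\<^bsub>Z\<^esub>" if x: "x \<in> carrier X" for x
  proof -
    have "snd (\<phi> (x, ?k x)) = ?c x \<oplus>\<^bsub>Z\<^esub> ?d (?k x)" using split[OF x hom_closed[OF k x]] by simp
    also have "?d (?k x) = \<ominus>\<^bsub>Z\<^esub> ?d (?e (?c x))" by (rule hom_neg[OF l(3,3) dh]) (use hom_closed[OF e] hom_closed[OF c x] in blast)
    also have "?d (?e (?c x)) = ?c x" by (rule de) (use hom_closed[OF c x] in blast)
    finally show ?thesis using hom_closed[OF c x] by (simp add: Z.M.r_neg)
  qed
  have inj: "inj_on \<phi> (carrier ?P)" using \<phi>(2) by (simp add: bij_betw_def)
  have "x = \<zero>\<^bsub>X\<^esub>" if x: "x \<in> carrier X" "?\<theta> x = \<zero>\<^bsub>Y\<^esub>" for x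
  proof -
    have "\<phi> (x, ?k x) = \<zero>\<^bsub>?Q\<^esub>" using snd0[OF x(1)] x(2) by (simp add: prod_eq_iff)
    also have "\<dots> = \<phi> \<zero>\<^bsub>?P\<^esub>" by (rule hom_zero[OF lP \<phi>(1), symmetric])
    finally have "(x, ?k x) = \<zero>\<^bsub>?P\<^esub>" by (rule inj_onD[OF inj]) (use x(1) hom_closed[OF k x(1)] in simp_all)
    then show ?thesis by (simp only: prod_mod_simps prod.inject)
  qed
  then have "kern X Y ?\<theta> = {\<zero>\<^bsub>X\<^esub>}" using hom_zero[OF l(1,2) \<theta>] unfolding kern_def by auto
  then have inj\<theta>: "inj_on ?\<theta> (carrier X)" using inj_on_kern[OF l(1,2) \<theta>] by simp
  have "y \<in> ?\<theta> ` carrier X" if y: "y \<in> carrier Y" for y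
  proof -
    have "(y, \<zero>\<^bsub>Z\<^esub>) \<in> \<phi> ` carrier ?P" using \<phi>(2) y by (simp add: bij_betw_def)
    then obtain x z where xz: "x \<in> carrier X" "z \<in> carrier Z" "\<phi> (x, z) = (y, \<zero>\<^bsub>Z\<^esub>)" by (elim imageE) (auto split: prod.splits)
    have cx: "?c x \<in> carrier Z" using hom_closed[OF c xz(1)] .
    have dz: "?d z \<in> carrier Z" using hom_closed[OF dh xz(2)] .
    have "?c x \<oplus>\<^bsub>Z\<^esub> ?d z = \<zero>\<^bsub>Z\<^esub>" using split[OF xz(1,2)] xz(3) by (metis prod_mod_simps(3) snd_conv)
    then have "?d z = \<ominus>\<^bsub>Z\<^esub> ?c x" using cx dz by (metis Z.M.a_comm Z.M.minus_equality)
    then have "z = ?e (\<ominus>\<^bsub>Z\<^esub> ?c x)" using ed[OF xz(2)] by simp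
    also have "\<dots> = ?k x" by (rule hom_neg[OF l(3,3) e cx])
    finally have "?\<theta> x = y" using xz(3) by simp
    then show ?thesis using xz(1) by blast
  qed
  then have "?\<theta> ` carrier X = carrier Y" using hom_closed[OF \<theta>] by blast
  then show ?thesis using module_isoI[OF \<theta>] inj\<theta> by (simp add: bij_betw_def)
qed

text \<open>The endomorphism ring of an indecomposable module is local, so if the corner of an isomorphism at \<^term>\<open>Z\<close> is
  not invertible, a shear of the source makes it the identity.\<close>

lemma cancel_indecomposable:
  assumes l: "left_module R X" "left_module R Y" and Z: "fg_module R Z" "indecomposable R Z"
    and iso: "module_iso R (prod_mod X Z) (prod_mod Y Z)"
  shows "module_iso R X Y"
proof -
  have lZ: "left_module R Z" using Z by blast
  interpret X: left_module R X by fact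
  interpret Y: left_module R Y by fact
  interpret Z: left_module R Z by fact
  let ?P = "prod_mod X Z" and ?Q = "prod_mod Y Z"
  have lP: "left_module R ?P" "left_module R ?Q" using l lZ by auto
  obtain \<phi> where \<phi>: "\<phi> \<in> module_hom R ?P ?Q" "bij_betw \<phi> (carrier ?P) (carrier ?Q)" using iso unfolding module_iso_def by blast
  define \<psi> where "\<psi> = inv_into (carrier ?P) \<phi>"
  have \<psi>: "\<psi> \<in> module_hom R ?Q ?P" unfolding \<psi>_def by (rule hom_inv[OF lP(1) \<phi>])
  have \<phi>\<psi>: "\<phi> (\<psi> q) = q" if "q \<in> carrier ?Q" for q
    using \<phi>(2) that unfolding \<psi>_def bij_betw_def by (metis f_inv_into_f)
  define c d b d' where "c x = snd (\<phi> (x, \<zero>\<^bsub>Z\<^esub>))" and "d z = snd (\<phi> (\<zero>\<^bsub>X\<^esub>, z))" and "b z = fst (\<psi> (\<zero>\<^bsub>Y\<^esub>, z))" and "d' z = snd (\<psi> (\<zero>\<^bsub>Y\<^esub>, z))" for x z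
  have c: "c \<in> module_hom R X Z" using hom_comp[OF hom_comp[OF hom_inl[OF lZ] \<phi>(1)] hom_snd] unfolding c_def .
  have d: "d \<in> module_hom R Z Z" using hom_comp[OF hom_comp[OF hom_inr[OF l(1)] \<phi>(1)] hom_snd] unfolding d_def .
  have b: "b \<in> module_hom R Z X" using hom_comp[OF hom_comp[OF hom_inr[OF l(2)] \<psi>] hom_fst] unfolding b_def .
  have d': "d' \<in> module_hom R Z Z" using hom_comp[OF hom_comp[OF hom_inr[OF l(2)] \<psi>] hom_snd] unfolding d'_def .
  have split: "snd (\<phi> (x, z)) = c x \<oplus>\<^bsub>Z\<^esub> d z" if "x \<in> carrier X" "z \<in> carrier Z" for x z
  proof -
    have "\<phi> ((x, \<zero>\<^bsub>Z\<^esub>) \<oplus>\<^bsub>?P\<^esub> (\<zero>\<^bsub>X\<^esub>, z)) = \<phi> (x, \<zero>\<^bsub>Z\<^esub>) \<oplus>\<^bsub>?Q\<^esub> \<phi> (\<zero>\<^bsub>X\<^esub>, z)" by (rule hom_add[OF \<phi>(1)]) (use that in auto)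
    then show ?thesis using that by (simp add: c_def d_def)
  qed
  have one: "c (b z) \<oplus>\<^bsub>Z\<^esub> d (d' z) = z" if z: "z \<in> carrier Z" for z
  proof -
    have "snd (\<phi> (b z, d' z)) = z" using \<phi>\<psi>[of "(\<zero>\<^bsub>Y\<^esub>, z)"] z by (simp add: b_def d'_def)
    then show ?thesis using split[OF hom_closed[OF b z] hom_closed[OF d' z]] by simp
  qed
  show ?thesis
  proof (cases "bij_betw d (carrier Z) (carrier Z)")
    case True
    then show ?thesis using cancel_invertible[OF l lZ \<phi>] unfolding d_def by blast
  next
    case False
    obtain n where n: "\<And>x. x \<in> carrier Z \<Longrightarrow> (d ^^ n) x = \<zero>\<^bsub>Z\<^esub>" using indecomposable_endo[OF Z d] False by blast
    have "bij_betw (\<lambda>z. c (b z)) (carrier Z) (carrier Z) \<or> bij_betw (\<lambda>z. d (d' z)) (carrier Z) (carrier Z)"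
      by (rule indecomposable_local[OF Z hom_comp[OF b c] hom_comp[OF d' d] one])
    moreover have "\<not> bij_betw (\<lambda>z. d (d' z)) (carrier Z) (carrier Z)"
    proof
      assume "bij_betw (\<lambda>z. d (d' z)) (carrier Z) (carrier Z)"
      then have "(\<lambda>z. d (d' z)) ` carrier Z = carrier Z" by (simp add: bij_betw_def)
      then have sd: "carrier Z \<subseteq> d ` carrier Z" using hom_closed[OF d'] by blast
      have "carrier Z \<subseteq> (d ^^ m) ` carrier Z" for m
      proof (induction m)
        case (Suc m)
        have "carrier Z \<subseteq> d ` ((d ^^ m) ` carrier Z)" using sd Suc by blast
        then show ?case by (simp add: image_comp)
      qed simp
      from this[of n] have "carrier Z \<subseteq> {\<zero>\<^bsub>Z\<^esub>}" using n by (auto dest!: subsetD)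
      then show False using Z(2) Z.M.zero_closed unfolding indecomposable_def by blast
    qed
    ultimately have cb: "bij_betw (\<lambda>z. c (b z)) (carrier Z) (carrier Z)" by blast
    define q where "q = inv_into (carrier Z) (\<lambda>z. c (b z))"
    have q: "q \<in> module_hom R Z Z" unfolding q_def by (rule hom_inv[OF lZ hom_comp[OF b c] cb])
    have cbq: "c (b (q z)) = z" if "z \<in> carrier Z" for z
      using cb that f_inv_into_f[of z "\<lambda>z. c (b z)" "carrier Z"] unfolding q_def bij_betw_def by simp
    \<comment> \<open>The shear is chosen so that \<open>c (t z)\<close> and \<open>d z\<close> add up to \<open>z\<close>.\<close>
    define t where "t z = b (q (z \<ominus>\<^bsub>Z\<^esub> d z))" for z
    have t: "t \<in> module_hom R Z X"
      using hom_comp[OF hom_comp[OF hom_diff_fun[OF lZ hom_id d] q] b] unfolding t_def .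
    have ct: "c (t z) = z \<ominus>\<^bsub>Z\<^esub> d z" if "z \<in> carrier Z" for z
      unfolding t_def by (rule cbq) (use that hom_closed[OF d that] in simp)
    let ?\<sigma> = "\<lambda>x. (fst x \<oplus>\<^bsub>X\<^esub> t (snd x), snd x)" and ?\<tau> = "\<lambda>x. (fst x \<ominus>\<^bsub>X\<^esub> t (snd x), snd x)"
    have \<sigma>: "?\<sigma> \<in> module_hom R ?P ?P" using hom_pair[OF hom_add_fun[OF l(1) hom_fst hom_comp[OF hom_snd t]] hom_snd] .
    have \<tau>: "?\<tau> \<in> module_hom R ?P ?P" using hom_pair[OF hom_diff_fun[OF l(1) hom_fst hom_comp[OF hom_snd t]] hom_snd] .
    have bij\<sigma>: "bij_betw ?\<sigma> (carrier ?P) (carrier ?P)"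
      by (rule bij_betw_byWitness[where f' = ?\<tau>]) (use hom_closed[OF t] in auto)
    have \<phi>\<sigma>: "(\<lambda>x. \<phi> (?\<sigma> x)) \<in> module_hom R ?P ?Q" using hom_comp[OF \<sigma> \<phi>(1)] .
    have bij\<phi>\<sigma>: "bij_betw (\<lambda>x. \<phi> (?\<sigma> x)) (carrier ?P) (carrier ?Q)" using bij_betw_trans[OF bij\<sigma> \<phi>(2)] unfolding comp_def .
    have "snd (\<phi> (?\<sigma> (\<zero>\<^bsub>X\<^esub>, z))) = z" if z: "z \<in> carrier Z" for z
      using split[OF hom_closed[OF t z] z] ct[OF z] z hom_closed[OF t z] hom_closed[OF d z] by simp
    then have "bij_betw (\<lambda>z. snd (\<phi> (?\<sigma> (\<zero>\<^bsub>X\<^esub>, z)))) (carrier Z) (carrier Z)"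
      by (simp add: bij_betw_def inj_on_def)
    then show ?thesis by (rule cancel_invertible[OF l lZ \<phi>\<sigma> bij\<phi>\<sigma>])
  qed
qed

lemma cancel_dsum:
  assumes "left_module R X" "left_module R Y" "\<forall>Z \<in> set Zs. fg_module R Z \<and> indecomposable R Z"
   "module_iso R (prod_mod X (dsum Zs)) (prod_mod Y (dsum Zs))"
  shows "module_iso R X Y"
  using assms(3,4)
proof (induction Zs)
  case Nil
  note d = fg_left_module[OF dsum_Nil(1)] dsum_Nil(2)
  show ?case
    using module_iso_trans[OF module_iso_sym[OF module_iso_prod_zero[OF d] left_module_prod[OF assms(1) d(1)]]
      module_iso_trans[OF Nil(2) module_iso_prod_zero[OF d]]] .
next
  case (Cons Z Zs)
  have Z: "fg_module R Z" "indecomposable R Z" and Zs: "\<forall>Z\<in>set Zs. fg_module R Z" using Cons.prems by auto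
  have sh1: "module_iso R (prod_mod X (dsum (Z # Zs))) (prod_mod (prod_mod X (dsum Zs)) Z)"
    by (rule module_iso_trans[OF module_iso_prod[OF module_iso_refl module_iso_trans[OF dsum_Cons(1)[OF Z(1) Zs] module_iso_prod_comm]] module_iso_prod_assoc'])
  have sh2: "module_iso R (prod_mod Y (dsum (Z # Zs))) (prod_mod (prod_mod Y (dsum Zs)) Z)"
    by (rule module_iso_trans[OF module_iso_prod[OF module_iso_refl module_iso_trans[OF dsum_Cons(1)[OF Z(1) Zs] module_iso_prod_comm]] module_iso_prod_assoc'])
  have lZs: "left_module R (dsum Zs)" "left_module R (dsum (Z # Zs))" using fg_left_module[OF dsum_fg[OF Zs]] fg_left_module[OF dsum_fg] Cons.prems(1) by blast+
  have "module_iso R (prod_mod (prod_mod X (dsum Zs)) Z) (prod_mod (prod_mod Y (dsum Zs)) Z)"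
    by (rule module_iso_trans[OF module_iso_sym[OF sh1 left_module_prod[OF assms(1) lZs(2)]] module_iso_trans[OF Cons.prems(2) sh2]])
  then have "module_iso R (prod_mod X (dsum Zs)) (prod_mod Y (dsum Zs))"
    by (rule cancel_indecomposable[OF left_module_prod[OF assms(1) lZs(1)] left_module_prod[OF assms(2) lZs(1)] Z])
  then show ?case using Cons.IH Cons.prems(1) by auto
qed

theorem cancellation:
  assumes "left_module R X" "left_module R Y" "fg_module R Z" "module_iso R (prod_mod X Z) (prod_mod Y Z)"
  shows "module_iso R X Y"
proof -
  obtain Zs where Zs: "\<forall>Z \<in> set Zs. fg_module R Z \<and> indecomposable R Z" "module_iso R Z (dsum Zs)"
    using decompose_indecomposable[OF assms(3)] by blast
  have lZ: "left_module R Z" using assms(3) by blast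
  have 1: "module_iso R (prod_mod X (dsum Zs)) (prod_mod X Z)"
    by (rule module_iso_sym[OF module_iso_prod[OF module_iso_refl Zs(2)] left_module_prod[OF assms(1) lZ]])
  show ?thesis
    by (rule cancel_dsum[OF assms(1,2) Zs(1) module_iso_trans[OF 1 module_iso_trans[OF assms(4) module_iso_prod[OF module_iso_refl Zs(2)]]]])
qed

lemma stably_iso_cancel:
  assumes "stably_iso (prod_mod X Z) (prod_mod Y Z)" "fg_module R X" "fg_module R Y" "fg_module R Z"
  shows "stably_iso X Y"
proof -
  obtain P Q :: "'a fgmod" where 1: "projective R P" "projective R Q" "module_iso R (prod_mod (prod_mod X Z) P) (prod_mod (prod_mod Y Z) Q)"
    using assms(1) unfolding stably_iso_def by blast
  have l: "left_module R X" "left_module R Y" "left_module R Z" "left_module R P" "left_module R Q" using assms 1 by blast+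
  have "module_iso R (prod_mod (prod_mod X P) Z) (prod_mod X (prod_mod P Z))" by (rule module_iso_prod_assoc)
  also have "module_iso R \<dots> (prod_mod X (prod_mod Z P))" by (rule module_iso_prod[OF module_iso_refl module_iso_prod_comm])
  also (module_iso_trans) have "module_iso R \<dots> (prod_mod (prod_mod X Z) P)" by (rule module_iso_prod_assoc')
  also (module_iso_trans) note 1(3)
  also (module_iso_trans) have "module_iso R (prod_mod (prod_mod Y Z) Q) (prod_mod Y (prod_mod Z Q))" by (rule module_iso_prod_assoc)
  also (module_iso_trans) have "module_iso R \<dots> (prod_mod Y (prod_mod Q Z))" by (rule module_iso_prod[OF module_iso_refl module_iso_prod_comm])
  also (module_iso_trans) have "module_iso R \<dots> (prod_mod (prod_mod Y Q) Z)" by (rule module_iso_prod_assoc')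
  finally (module_iso_trans) have "module_iso R (prod_mod X P) (prod_mod Y Q)"
    by (rule cancellation[OF left_module_prod[OF l(1,4)] left_module_prod[OF l(2,5)] assms(4)])
  then show ?thesis using 1 unfolding stably_iso_def by blast
qed

end

section \<open>Ascending chains of groups of integer vectors\<close>

text \<open>The least positive member of any group in the chain generates all groups from its first occurrence on.\<close>

lemma int_subgroup_chain_stable:
  fixes H :: "nat \<Rightarrow> int set"
  assumes "\<And>d. 0 \<in> H d" "\<And>d a b. a \<in> H d \<Longrightarrow> b \<in> H d \<Longrightarrow> a - b \<in> H d" "\<And>d. H d \<subseteq> H (Suc d)"
  shows "\<exists>\<phi>. \<forall>d\<ge>\<phi>. H d = H \<phi>"
proof -
  have mono: "H d \<subseteq> H e" if "d \<le> e" for d e using that by (rule lift_Suc_mono_le[of H, OF assms(3)])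
  have neg: "- a \<in> H d" if "a \<in> H d" for a d using assms(2)[OF assms(1) that] by simp
  have add: "a + b \<in> H d" if "a \<in> H d" "b \<in> H d" for a b d using assms(2)[OF that(1) neg[OF that(2)]] by simp
  have mult: "a * k \<in> H d" if "a \<in> H d" for a k d
  proof -
    have pos: "a * int n \<in> H d" for n
      by (induction n) (use assms(1) add that in \<open>auto simp: algebra_simps\<close>)
    show ?thesis using pos[of "nat k"] neg[OF pos[of "nat (- k)"]] by (cases "k \<ge> 0") auto
  qed
  show ?thesis
  proof (cases "\<exists>d. \<exists>a \<in> H d. a > 0")
    case False
    have "H d = {0}" for d
    proof -
      have "a = 0" if "a \<in> H d" for a
        using False that neg[OF that] by (metis neg_0_less_iff_less linorder_neqE)
      then show ?thesis using assms(1) by blast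
    qed
    then show ?thesis by blast
  next
    case True
    let ?P = "\<lambda>n. n > 0 \<and> (\<exists>d. int n \<in> H d)"
    have "\<exists>n. ?P n" using True by (metis pos_int_cases)
    then have P: "?P (LEAST n. ?P n)" and least: "\<And>n. ?P n \<Longrightarrow> (LEAST n. ?P n) \<le> n"
      using LeastI_ex[of ?P] Least_le[of ?P] by auto
    define g where "g = (LEAST n. ?P n)"
    obtain \<phi> where \<phi>: "int g \<in> H \<phi>" "g > 0" using P by (auto simp: g_def)
    have "H d = H \<phi>" if d: "d \<ge> \<phi>" for d
    proof
      show "H \<phi> \<subseteq> H d" using mono d by blast
      show "H d \<subseteq> H \<phi>"
      proof
        fix a assume a: "a \<in> H d"
        have gd: "int g \<in> H d" using mono[OF d] \<phi> by blast
        have "a - int g * (a div int g) \<in> H d" by (rule assms(2)[OF a mult[OF gd]])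
        then have m: "a mod int g \<in> H d" by (simp add: minus_mult_div_eq_mod)
        have "a mod int g = 0"
        proof (rule ccontr)
          assume "a mod int g \<noteq> 0"
          moreover have "a mod int g \<ge> 0" using \<phi>(2) by simp
          ultimately have "?P (nat (a mod int g))" using m by (auto intro!: exI[of _ d])
          then have "g \<le> nat (a mod int g)" unfolding g_def by (rule least)
          moreover have "a mod int g < int g" using \<phi>(2) by simp
          ultimately show False using \<phi>(2) by linarith
        qed
        then have "a = int g * (a div int g)" by (metis add_0 mult_div_mod_eq add.commute)
        then show "a \<in> H \<phi>" using mult[OF \<phi>(1)] by metis
      qed
    qed
    then show ?thesis by blast
  qed
qed

text \<open>A group of vectors in the chain is controlled by its values at one coordinate and by its members that
  vanish there; the latter have smaller support.\<close>

lemma int_vector_chain_stable: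
  fixes H :: "nat \<Rightarrow> ('i \<Rightarrow> int) set"
  assumes "finite S" "\<And>d v i. v \<in> H d \<Longrightarrow> i \<notin> S \<Longrightarrow> v i = 0" "\<And>d. (\<lambda>_. 0) \<in> H d"
    "\<And>d v w. v \<in> H d \<Longrightarrow> w \<in> H d \<Longrightarrow> (\<lambda>i. v i - w i) \<in> H d" "\<And>d. H d \<subseteq> H (Suc d)"
  shows "\<exists>\<phi>. \<forall>d\<ge>\<phi>. H d = H \<phi>"
  using assms
proof (induction S arbitrary: H rule: finite_induct)
  case empty
  have "H d = {\<lambda>_. 0}" for d using empty(1)[of _ d] empty(2)[of d] by (auto simp: fun_eq_iff)
  then show ?case by blast
next
  case (insert s S)
  have mono: "H d \<subseteq> H e" if "d \<le> e" for d e using that by (rule lift_Suc_mono_le[of H, OF insert.prems(4)])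
  let ?K = "\<lambda>d. {v \<in> H d. v s = 0}" and ?p = "\<lambda>d. (\<lambda>v. v s) ` H d"
  have "\<exists>\<phi>. \<forall>d\<ge>\<phi>. ?K d = ?K \<phi>"
  proof (rule insert.IH)
    show "v i = 0" if "v \<in> ?K d" "i \<notin> S" for d v i using that insert.prems(1)[of v d i] by (cases "i = s") auto
    show "(\<lambda>_. 0) \<in> ?K d" for d using insert.prems(2) by simp
    show "(\<lambda>i. v i - w i) \<in> ?K d" if "v \<in> ?K d" "w \<in> ?K d" for d v w using that insert.prems(3) by simp
    show "?K d \<subseteq> ?K (Suc d)" for d using insert.prems(4)[of d] by blast
  qed
  then obtain \<phi> where \<phi>: "\<And>d. d \<ge> \<phi> \<Longrightarrow> ?K d = ?K \<phi>" by blast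
  have "\<exists>\<psi>. \<forall>d\<ge>\<psi>. ?p d = ?p \<psi>"
  proof (rule int_subgroup_chain_stable)
    show "0 \<in> ?p d" for d using insert.prems(2)[of d] by (rule rev_image_eqI) simp
    show "a - b \<in> ?p d" if ab: "a \<in> ?p d" "b \<in> ?p d" for d a b
    proof -
      obtain v where "v \<in> H d" "a = v s" using ab(1) by blast
      moreover obtain w where "w \<in> H d" "b = w s" using ab(2) by blast
      ultimately show ?thesis using insert.prems(3)[of v d w] by (intro image_eqI[of _ _ "\<lambda>i. v i - w i"]) auto
    qed
    show "?p d \<subseteq> ?p (Suc d)" for d using insert.prems(4)[of d] by blast
  qed
  then obtain \<psi> where \<psi>: "\<And>d. d \<ge> \<psi> \<Longrightarrow> ?p d = ?p \<psi>" by blast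
  let ?m = "max \<phi> \<psi>"
  have "H d = H ?m" if d: "d \<ge> ?m" for d
  proof
    show "H ?m \<subseteq> H d" using mono d by blast
    show "H d \<subseteq> H ?m"
    proof
      fix v assume v: "v \<in> H d"
      have "?p d = ?p ?m" using \<psi>[of d] \<psi>[of ?m] d by simp
      then have "v s \<in> ?p ?m" using v by blast
      then obtain w where w: "w \<in> H ?m" "v s = w s" by blast
      have wd: "w \<in> H d" using w(1) mono[OF d] by blast
      have "(\<lambda>i. v i - w i) \<in> ?K d" using insert.prems(3)[OF v wd] w(2) by simp
      moreover have "?K d = ?K ?m" using \<phi>[of d] \<phi>[of ?m] d by simp
      ultimately have vw: "(\<lambda>i. v i - w i) \<in> H ?m" by blast
      have "(\<lambda>i. 0 - w i) \<in> H ?m" using insert.prems(3)[OF insert.prems(2) w(1)] by simp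
      from insert.prems(3)[OF vw this] show "v \<in> H ?m" by simp
    qed
  qed
  then show ?case by blast
qed

section \<open>A uniform bound in the manner of Igusa and Todorov\<close>

context finite_length_ring
begin

lemma syzygy_dsum: "(\<forall>X\<in>set Xs. fg_module R X) \<Longrightarrow> stably_iso (syzygy (dsum Xs)) (dsum (map syzygy Xs))"
proof (induction Xs)
  case Nil
  obtain Z :: "'a fgmod" where Z: "fg_module R Z" "carrier Z = {\<zero>\<^bsub>Z\<^esub>}" "projective R Z" by (rule zero_fgmod)
  have "projective R (dsum [])" by (rule projective_zero[OF dsum_Nil])
  then have P: "projective R (syzygy (dsum []))" "projective R (dsum [])" using syzygy_projective by auto
  have "module_iso R (prod_mod (syzygy (dsum [])) (dsum [])) (prod_mod (dsum []) (syzygy (dsum [])))" by (rule module_iso_prod_comm)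
  then show ?case using steqI[OF P(2,1)] P by auto
next
  case (Cons X Xs)
  have X: "fg_module R X" and Xs: "\<forall>X\<in>set Xs. fg_module R X" using Cons.prems by auto
  have Xs': "\<forall>Y\<in>set (map syzygy Xs). fg_module R Y" using Xs by auto
  have fg: "fg_module R (dsum (X # Xs))" "fg_module R (dsum Xs)" "fg_module R (dsum (map syzygy Xs))" "fg_module R (syzygy X)" "fg_module R (syzygy (dsum Xs))"
    using dsum_fg[OF Cons.prems] dsum_fg[OF Xs] dsum_fg[OF Xs'] syzygy_fg[OF X] syzygy_fg[OF dsum_fg[OF Xs]] by auto
  have "stably_iso (syzygy (dsum (X # Xs))) (syzygy (prod_mod X (dsum Xs)))"
    by (rule syzygy_stably_iso[OF fg(1) fg_prod[OF X fg(2)] iso_imp_stably_iso[OF dsum_Cons(1)[OF X Xs]]])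
  note this[THEN stably_iso_trans, OF syzygy_prod[OF X fg(2)] fg_left_module[OF syzygy_fg[OF fg(1)]]]
  note this[THEN stably_iso_trans, OF stably_iso_prod[OF stably_iso_refl Cons.IH[OF Xs] fg_left_module[OF fg(4)] fg_left_module[OF fg(5)]] fg_left_module[OF syzygy_fg[OF fg(1)]]]
  note this[THEN stably_iso_trans, OF iso_imp_stably_iso[OF dsum_Cons(2)[OF fg(4) Xs']] fg_left_module[OF syzygy_fg[OF fg(1)]]]
  then show ?case by simp
qed

lemma nth_syzygy_dsum: "(\<forall>X\<in>set Xs. fg_module R X) \<Longrightarrow> stably_iso (nth_syzygy d (dsum Xs)) (dsum (map (nth_syzygy d) Xs))"
proof (induction d)
  case (Suc d)
  have m: "\<forall>Y\<in>set (map (nth_syzygy d) Xs). fg_module R Y" using Suc.prems by auto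
  have "stably_iso (syzygy (nth_syzygy d (dsum Xs))) (syzygy (dsum (map (nth_syzygy d) Xs)))" by (rule syzygy_stably_iso[OF nth_syzygy_fg[OF dsum_fg[OF Suc.prems]] dsum_fg[OF m] Suc.IH[OF Suc.prems]])
  from stably_iso_trans[OF this syzygy_dsum[OF m] fg_left_module[OF syzygy_fg[OF nth_syzygy_fg[OF dsum_fg[OF Suc.prems]]]]]
  show ?case by (simp add: comp_def)
qed (simp add: map_idI)

text \<open>Equality of two direct sums after \<^term>\<open>d\<close> shifts, in the group generated by the modules up to stable
  isomorphism.\<close>

definition syz_rel :: "nat \<Rightarrow> 'a fgmod list \<Rightarrow> 'a fgmod list \<Rightarrow> bool" where
  "syz_rel d xs ys \<longleftrightarrow> stably_iso (dsum (map (nth_syzygy d) xs)) (dsum (map (nth_syzygy d) ys))"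

lemma syz_rel_Suc:
  assumes xs: "\<forall>X\<in>set xs. fg_module R X" and ys: "\<forall>X\<in>set ys. fg_module R X" and r: "syz_rel d xs ys"
  shows "syz_rel (Suc d) xs ys"
proof -
  have mx: "\<forall>X\<in>set (map (nth_syzygy d) xs). fg_module R X" and my: "\<forall>X\<in>set (map (nth_syzygy d) ys). fg_module R X" using xs ys by auto
  have mx': "fg_module R (dsum (map (nth_syzygy d) xs))" and my': "fg_module R (dsum (map (nth_syzygy d) ys))"
    using dsum_fg mx my by blast+
  have map: "map (nth_syzygy (Suc d)) zs = map syzygy (map (nth_syzygy d) zs)" for zs by (simp add: comp_def)
  have "stably_iso (dsum (map syzygy (map (nth_syzygy d) xs))) (syzygy (dsum (map (nth_syzygy d) xs)))"
    by (rule stably_iso_sym[OF syzygy_dsum[OF mx] fg_left_module[OF syzygy_fg[OF mx']]])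
  moreover have "stably_iso (syzygy (dsum (map (nth_syzygy d) xs))) (syzygy (dsum (map (nth_syzygy d) ys)))" by (rule syzygy_stably_iso[OF mx' my' r[unfolded syz_rel_def]])
  moreover have "stably_iso (syzygy (dsum (map (nth_syzygy d) ys))) (dsum (map syzygy (map (nth_syzygy d) ys)))" by (rule syzygy_dsum[OF my])
  moreover have "left_module R (dsum (map syzygy (map (nth_syzygy d) xs)))" by (rule fg_left_module[OF dsum_fg]) (use xs in auto)
  ultimately show ?thesis unfolding syz_rel_def map using stably_iso_trans by blast
qed

lemma dsum_append_nth_syzygy:
  assumes xs: "\<forall>X\<in>set xs. fg_module R X" and ys: "\<forall>X\<in>set ys. fg_module R X"
  shows "module_iso R (dsum (map (nth_syzygy d) (xs @ ys))) (prod_mod (dsum (map (nth_syzygy d) xs)) (dsum (map (nth_syzygy d) ys)))"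
    "module_iso R (prod_mod (dsum (map (nth_syzygy d) xs)) (dsum (map (nth_syzygy d) ys))) (dsum (map (nth_syzygy d) (xs @ ys)))"
    "fg_module R (dsum (map (nth_syzygy d) xs))" "fg_module R (dsum (map (nth_syzygy d) ys))" "fg_module R (dsum (map (nth_syzygy d) (xs @ ys)))"
proof -
  have mx: "\<forall>X\<in>set (map (nth_syzygy d) xs). fg_module R X" and my: "\<forall>X\<in>set (map (nth_syzygy d) ys). fg_module R X" using xs ys by auto
  show 1: "module_iso R (dsum (map (nth_syzygy d) (xs @ ys))) (prod_mod (dsum (map (nth_syzygy d) xs)) (dsum (map (nth_syzygy d) ys)))"
    using dsum_append[OF mx my] by simp
  show "fg_module R (dsum (map (nth_syzygy d) xs))" "fg_module R (dsum (map (nth_syzygy d) ys))" using dsum_fg mx my by blast+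
  show fg: "fg_module R (dsum (map (nth_syzygy d) (xs @ ys)))" by (rule dsum_fg) (use xs ys in auto)
  show "module_iso R (prod_mod (dsum (map (nth_syzygy d) xs)) (dsum (map (nth_syzygy d) ys))) (dsum (map (nth_syzygy d) (xs @ ys)))"
    by (rule module_iso_sym[OF 1 fg_left_module[OF fg]])
qed

lemma syz_rel_add:
  assumes "\<forall>X \<in> set xs \<union> set ys \<union> set xs' \<union> set ys'. fg_module R X" "syz_rel d xs ys" "syz_rel d xs' ys'"
  shows "syz_rel d (xs @ xs') (ys @ ys')"
proof -
  have xs: "\<forall>X\<in>set xs. fg_module R X" and ys: "\<forall>X\<in>set ys. fg_module R X"
   and xs': "\<forall>X\<in>set xs'. fg_module R X" and ys': "\<forall>X\<in>set ys'. fg_module R X" using assms(1) by auto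
  note X = dsum_append_nth_syzygy[OF xs xs', where d=d] and Y = dsum_append_nth_syzygy[OF ys ys', where d=d]
  have "stably_iso (prod_mod (dsum (map (nth_syzygy d) xs)) (dsum (map (nth_syzygy d) xs'))) (prod_mod (dsum (map (nth_syzygy d) ys)) (dsum (map (nth_syzygy d) ys')))"
    using stably_iso_prod assms(2,3) X(3,4) unfolding syz_rel_def by blast
  from stably_iso_trans[OF iso_imp_stably_iso[OF X(1)] stably_iso_trans[OF this iso_imp_stably_iso[OF Y(2)]]] show ?thesis
    using X(3-5) unfolding syz_rel_def by blast
qed

lemma syz_rel_cancel:
  assumes "\<forall>X \<in> set xs \<union> set ys \<union> set zs. fg_module R X" "syz_rel d (xs @ zs) (ys @ zs)"
  shows "syz_rel d xs ys"
proof -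
  have xs: "\<forall>X\<in>set xs. fg_module R X" and ys: "\<forall>X\<in>set ys. fg_module R X"
   and zs: "\<forall>X\<in>set zs. fg_module R X" using assms(1) by auto
  note X = dsum_append_nth_syzygy[OF xs zs, where d=d] and Y = dsum_append_nth_syzygy[OF ys zs, where d=d]
  have "stably_iso (prod_mod (dsum (map (nth_syzygy d) xs)) (dsum (map (nth_syzygy d) zs))) (prod_mod (dsum (map (nth_syzygy d) ys)) (dsum (map (nth_syzygy d) zs)))"
    using stably_iso_trans[OF iso_imp_stably_iso[OF X(2)] stably_iso_trans[OF assms(2)[unfolded syz_rel_def] iso_imp_stably_iso[OF Y(1)]]] X(3-5) by blast
  then show ?thesis unfolding syz_rel_def using stably_iso_cancel X(3,4) Y(3) by blast
qed

lemma syz_rel_perm: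
  assumes "\<forall>X \<in> set xs \<union> set ys. fg_module R X" "syz_rel d xs ys" "mset xs' = mset xs" "mset ys' = mset ys"
  shows "syz_rel d xs' ys'"
proof -
  have s: "set xs' = set xs" "set ys' = set ys" using assms(3,4) by (metis set_mset_mset)+
  have fg: "\<forall>X\<in>set (map (nth_syzygy d) xs'). fg_module R X" "\<forall>X\<in>set (map (nth_syzygy d) ys). fg_module R X" "\<forall>X\<in>set (map (nth_syzygy d) xs). fg_module R X"
    using assms(1) s by auto
  have "module_iso R (dsum (map (nth_syzygy d) xs')) (dsum (map (nth_syzygy d) xs))" by (rule dsum_perm[OF _ fg(1)]) (use assms(3) in simp_all)
  moreover have "module_iso R (dsum (map (nth_syzygy d) ys)) (dsum (map (nth_syzygy d) ys'))" by (rule dsum_perm[OF _ fg(2)]) (use assms(4) in simp_all)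
  moreover have "left_module R (dsum (map (nth_syzygy d) xs'))" "left_module R (dsum (map (nth_syzygy d) xs))"
    using fg_left_module[OF dsum_fg[OF fg(1)]] fg_left_module[OF dsum_fg[OF fg(3)]] by blast+
  ultimately show ?thesis using assms(2) iso_imp_stably_iso stably_iso_trans unfolding syz_rel_def by blast
qed

text \<open>The differences of the multiplicity vectors of related lists form an ascending chain of subgroups of a finitely
  generated free abelian group.  Cancellation recovers the relation from the difference of the vectors.\<close>

lemma syz_rel_stable:
  assumes "finite US" "\<And>U. U \<in> US \<Longrightarrow> fg_module R U"
  shows "\<exists>\<phi>. \<forall>d xs ys. set xs \<subseteq> US \<longrightarrow> set ys \<subseteq> US \<longrightarrow> syz_rel d xs ys \<longrightarrow> syz_rel \<phi> xs ys"
proof -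
  define v :: "'a fgmod list \<Rightarrow> 'a fgmod list \<Rightarrow> 'a fgmod \<Rightarrow> int" where "v xs ys = (\<lambda>u. int (count (mset xs) u) - int (count (mset ys) u))" for xs ys
  define H where "H d = {v xs ys | xs ys. set xs \<subseteq> US \<and> set ys \<subseteq> US \<and> syz_rel d xs ys}" for d
  have fg: "fg_module R X" if "set xs \<subseteq> US" "X \<in> set xs" for xs X using that assms(2) by blast
  have "\<exists>\<phi>. \<forall>d\<ge>\<phi>. H d = H \<phi>"
  proof (rule int_vector_chain_stable[OF assms(1)])
    show "w i = 0" if w: "w \<in> H d" "i \<notin> US" for d w i
    proof -
      obtain xs ys where "set xs \<subseteq> US" "set ys \<subseteq> US" "w = v xs ys" using w unfolding H_def by blast
      then have "i \<notin> set xs" "i \<notin> set ys" "w = v xs ys" using w(2) by auto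
      then show ?thesis by (simp add: v_def count_mset_0_iff[THEN iffD2])
    qed
    show "(\<lambda>_. 0) \<in> H d" for d unfolding H_def by (intro CollectI exI[of _ "[]"]) (simp add: v_def syz_rel_def)
    show "(\<lambda>i. w i - w' i) \<in> H d" if w: "w \<in> H d" "w' \<in> H d" for d w w'
    proof -
      obtain xs ys where 1: "set xs \<subseteq> US" "set ys \<subseteq> US" "syz_rel d xs ys" "w = v xs ys" using w(1) unfolding H_def by blast
      obtain xs' ys' where 2: "set xs' \<subseteq> US" "set ys' \<subseteq> US" "syz_rel d xs' ys'" "w' = v xs' ys'" using w(2) unfolding H_def by blast
      have "stably_iso (dsum (map (nth_syzygy d) ys')) (dsum (map (nth_syzygy d) xs'))"
        by (rule stably_iso_sym[OF 2(3)[unfolded syz_rel_def] fg_left_module[OF dsum_fg]]) (use 2(1) assms(2) in auto)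
      then have "syz_rel d ys' xs'" by (simp add: syz_rel_def)
      then have "syz_rel d (xs @ ys') (ys @ xs')" using syz_rel_add 1 2 assms(2) by blast
      moreover have "(\<lambda>i. w i - w' i) = v (xs @ ys') (ys @ xs')" unfolding 1(4) 2(4) v_def by (simp add: fun_eq_iff)
      ultimately show ?thesis unfolding H_def using 1 2 by (intro CollectI exI[of _ "xs @ ys'"] exI[of _ "ys @ xs'"]) simp
    qed
    show "H d \<subseteq> H (Suc d)" for d
    proof
      fix w assume "w \<in> H d"
      then obtain xs ys where 1: "set xs \<subseteq> US" "set ys \<subseteq> US" "syz_rel d xs ys" "w = v xs ys" unfolding H_def by blast
      then have "syz_rel (Suc d) xs ys" using syz_rel_Suc[of xs ys d] fg by blast
      then show "w \<in> H (Suc d)" using 1 unfolding H_def by blast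
    qed
  qed
  then obtain \<phi> where \<phi>: "\<And>d. d \<ge> \<phi> \<Longrightarrow> H d = H \<phi>" by blast
  have up: "syz_rel (d + e) xs ys" if "set xs \<subseteq> US" "set ys \<subseteq> US" "syz_rel d xs ys" for d e xs ys
    by (induction e) (use that syz_rel_Suc[of xs ys] fg in auto)
  show ?thesis
  proof (intro exI[of _ \<phi>] allI impI)
    fix d xs ys assume 1: "set xs \<subseteq> US" "set ys \<subseteq> US" "syz_rel d xs ys"
    have "syz_rel (d + \<phi>) xs ys" using up 1 by blast
    then have "v xs ys \<in> H (d + \<phi>)" using 1 unfolding H_def by blast
    then have "v xs ys \<in> H \<phi>" using \<phi>[of "d + \<phi>"] by simp
    then obtain xs' ys' where 2: "set xs' \<subseteq> US" "set ys' \<subseteq> US" "syz_rel \<phi> xs' ys'" "v xs ys = v xs' ys'" unfolding H_def by blast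
    have "int (count (mset (xs @ ys')) u) = int (count (mset (ys @ xs')) u)" for u
      using fun_cong[OF 2(4), of u] by (simp add: v_def)
    then have m: "mset (xs @ ys') = mset (ys @ xs')" by (intro multiset_eqI) (simp only: of_nat_eq_iff)
    have allfg: "\<forall>X \<in> set xs \<union> set ys \<union> set xs' \<union> set ys'. fg_module R X" using 1 2 assms(2) by blast
    have "syz_rel \<phi> (ys @ xs') (ys @ ys')"
      by (rule syz_rel_add[OF _ _ 2(3)]) (use allfg in \<open>auto simp: syz_rel_def\<close>)
    then have "syz_rel \<phi> (xs @ ys') (ys @ ys')" by (rule syz_rel_perm[OF _ _ m refl, rotated]) (use allfg in auto)
    then show "syz_rel \<phi> xs ys" by (rule syz_rel_cancel[rotated]) (use allfg in auto)
  qed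
qed

text \<open>The kernel of a composition of two surjections is an extension of the kernel of the second by the kernel
  of the first.\<close>

lemma exact_comp:
  assumes s: "ses R W X Y a \<alpha>" and s': "ses R B Y Z b \<beta>"
  shows "\<exists>(V :: 'a fgmod) c. ses R V X Z c (\<lambda>x. \<beta> (\<alpha> x)) \<and> exact R W V B"
proof -
  have h: "a \<in> module_hom R W X" "\<alpha> \<in> module_hom R X Y" "b \<in> module_hom R B Y" "\<beta> \<in> module_hom R Y Z"
    and fg: "fg_module R W" "fg_module R X" "fg_module R Y" "fg_module R Z" "fg_module R B"
    and sj: "\<alpha> ` carrier X = carrier Y" "\<beta> ` carrier Y = carrier Z" using s s' by (auto simp: ses_def)
  note l = fg[THEN fg_left_module]
  have \<beta>\<alpha>: "(\<lambda>x. \<beta> (\<alpha> x)) \<in> module_hom R X Z" using hom_comp[OF h(2,4)] .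
  have \<beta>\<alpha>s: "(\<lambda>x. \<beta> (\<alpha> x)) ` carrier X = carrier Z" using sj by (metis image_image)
  let ?V = "X\<lparr>carrier := kern X Z (\<lambda>x. \<beta> (\<alpha> x))\<rparr>" and ?K = "Y\<lparr>carrier := kern Y Z \<beta>\<rparr>"
  have sV: "ses R ?V X Z (\<lambda>x. x) (\<lambda>x. \<beta> (\<alpha> x))" by (rule ses_kern[OF fg(2,4) \<beta>\<alpha> \<beta>\<alpha>s])
  have sK: "ses R ?K Y Z (\<lambda>x. x) \<beta>" by (rule ses_kern[OF fg(3,4) h(4) sj(2)])
  have fgV: "fg_module R ?V" "fg_module R ?K" using sV sK by (auto simp: ses_def)
  have isoB: "module_iso R ?K B"
  proof (rule module_iso_sym[OF module_isoI l(5)])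
    show "b \<in> module_hom R B ?K" using s' by (intro hom_corestrict[OF h(3)]) (simp add: ses_def)
    show "bij_betw b (carrier B) (carrier ?K)" using s' by (simp add: ses_def bij_betw_def)
  qed
  have \<beta>0: "\<beta> \<zero>\<^bsub>Y\<^esub> = \<zero>\<^bsub>Z\<^esub>" by (rule hom_zero[OF l(3,4) h(4)])
  have "ses R W ?V ?K a \<alpha>"
  proof (rule sesI[OF fg(1) fgV])
    show "a \<in> module_hom R W ?V"
      by (rule hom_corestrict[OF h(1)]) (use ses_zero[OF s] hom_closed[OF h(1)] \<beta>0 in \<open>auto simp: kern_def\<close>)
    show "\<alpha> \<in> module_hom R ?V ?K"
      by (rule hom_corestrict[OF hom_restrict[OF h(2)]]) (use hom_closed[OF h(2)] in \<open>auto simp: kern_def\<close>)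
    show "\<exists>x\<in>carrier ?V. \<alpha> x = y" if "y \<in> carrier ?K" for y
      using that ses_surj[OF s, of y] by (auto simp: kern_def)
    show "\<exists>w\<in>carrier W. a w = x" if "x \<in> carrier ?V" "\<alpha> x = \<zero>\<^bsub>?K\<^esub>" for x
      using that ses_ker[OF s, of x] by (auto simp: kern_def)
  qed (use ses_inj[OF s] ses_zero[OF s] in simp_all)
  then have e: "exact R W (fg_copy R ?V) B"
    using exact_cong[OF exactI module_iso_refl fg_copy_iso[OF fgV(1)] isoB fg(1) fg_copy_fg[OF fgV(1)] fg(5)] by blast
  obtain c where c: "c \<in> module_hom R (fg_copy R ?V) ?V" "bij_betw c (carrier (fg_copy R ?V)) (carrier ?V)"
    using fg_copy_iso'[OF fgV(1)] unfolding module_iso_def by blast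
  have "ses R (fg_copy R ?V) X Z c (\<lambda>x. \<beta> (\<alpha> x))"
    unfolding ses_def using c fg_copy_fg[OF fgV(1)] fg \<beta>\<alpha> \<beta>\<alpha>s by (auto simp: bij_betw_def module_hom_def kern_def Pi_iff)
  then show ?thesis using e by blast
qed

text \<open>If \<^term>\<open>f\<close> is the component of the surjection at \<^term>\<open>M\<close>, composing the surjection with itself gives surjections
  onto \<^term>\<open>M\<close> with component \<^term>\<open>f ^^ j\<close> whose kernels are iterated extensions of \<^term>\<open>V\<close>.  Once \<^term>\<open>f ^^ j\<close> vanishes,
  \<^term>\<open>M\<close> is a summand of the kernel.\<close>

lemma pd_nilpotent:
  fixes M :: "'a fgmod" and Q :: "'a fgmod" and V :: "'a fgmod"
  assumes s: "ses R V (prod_mod M Q) M u g" and Q: "projective R Q" and V: "pd_le t V"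
    and nil: "\<And>x. x \<in> carrier M \<Longrightarrow> ((\<lambda>x. g (x, \<zero>\<^bsub>Q\<^esub>)) ^^ n) x = \<zero>\<^bsub>M\<^esub>"
  shows "pd_le t M"
proof -
  let ?f = "\<lambda>x. g (x, \<zero>\<^bsub>Q\<^esub>)" and ?h = "\<lambda>q. g (\<zero>\<^bsub>M\<^esub>, q)"
  have fg: "fg_module R V" "fg_module R M" "fg_module R Q" and g: "g \<in> module_hom R (prod_mod M Q) M"
    and u: "u \<in> module_hom R V (prod_mod M Q)" using s Q by (auto simp: ses_def)
  note l = fg[THEN fg_left_module]
  interpret M: left_module R M by (rule l(2))
  interpret Q: left_module R Q by (rule l(3))
  have f: "?f \<in> module_hom R M M" and h: "?h \<in> module_hom R Q M"
    using hom_comp[OF hom_inl[OF l(3)] g] hom_comp[OF hom_inr[OF l(2)] g] by auto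
  have gsplit: "g (x, q) = ?f x \<oplus>\<^bsub>M\<^esub> ?h q" if "x \<in> carrier M" "q \<in> carrier Q" for x q
  proof -
    have "g ((x, \<zero>\<^bsub>Q\<^esub>) \<oplus>\<^bsub>prod_mod M Q\<^esub> (\<zero>\<^bsub>M\<^esub>, q)) = ?f x \<oplus>\<^bsub>M\<^esub> ?h q" by (rule hom_add[OF g]) (use that in auto)
    then show ?thesis using that by simp
  qed
  have fj: "?f ^^ j \<in> module_hom R M M" for j by (rule hom_pow[OF f])
  have "\<exists>(Q' :: 'a fgmod) (V' :: 'a fgmod) H u'. projective R Q' \<and> pd_le t V' \<and> H \<in> module_hom R Q' M \<and>
    ses R V' (prod_mod M Q') M u' (\<lambda>x. (?f ^^ j) (fst x) \<oplus>\<^bsub>M\<^esub> H (snd x))" for j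
  proof (induction j)
    case 0
    obtain Z :: "'a fgmod" where Z: "fg_module R Z" "carrier Z = {\<zero>\<^bsub>Z\<^esub>}" "projective R Z" by (rule zero_fgmod)
    have lZ: "left_module R Z" using Z by blast
    interpret Z: left_module R Z by fact
    have "ses R Z (prod_mod M Z) M (\<lambda>_. (\<zero>\<^bsub>M\<^esub>, \<zero>\<^bsub>Z\<^esub>)) (\<lambda>x. (?f ^^ 0) (fst x) \<oplus>\<^bsub>M\<^esub> \<zero>\<^bsub>M\<^esub>)"
    proof (rule sesI[OF Z(1) fg_prod[OF fg(2) Z(1)] fg(2)])
      show "(\<lambda>_. (\<zero>\<^bsub>M\<^esub>, \<zero>\<^bsub>Z\<^esub>)) \<in> module_hom R Z (prod_mod M Z)" using hom_zero_fun[OF left_module_prod[OF l(2) lZ], of Z] by simp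
      show "(\<lambda>x. (?f ^^ 0) (fst x) \<oplus>\<^bsub>M\<^esub> \<zero>\<^bsub>M\<^esub>) \<in> module_hom R (prod_mod M Z) M"
        by (rule hom_cong[OF _ hom_fst]) (use l lZ in auto)
      show "\<exists>y\<in>carrier (prod_mod M Z). (?f ^^ 0) (fst y) \<oplus>\<^bsub>M\<^esub> \<zero>\<^bsub>M\<^esub> = m" if "m \<in> carrier M" for m
        using that by (intro bexI[of _ "(m, \<zero>\<^bsub>Z\<^esub>)"]) auto
    qed (use Z(2) in auto)
    then show ?case using Z(3) pd_projective[OF Z(3)] hom_zero_fun[OF l(2), of Z] by blast
  next
    case (Suc j)
    then obtain Q1 V1 :: "'a fgmod" and H u1 where IH: "projective R Q1" "pd_le t V1" "H \<in> module_hom R Q1 M"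
      "ses R V1 (prod_mod M Q1) M u1 (\<lambda>x. (?f ^^ j) (fst x) \<oplus>\<^bsub>M\<^esub> H (snd x))" by blast
    have fgQ1: "fg_module R Q1" using IH(1) by blast
    have lQ1: "left_module R Q1" using fgQ1 by blast
    interpret Q1: left_module R Q1 by fact
    let ?Q' = "fg_copy R (prod_mod Q1 Q)"
    have PP: "projective R (prod_mod Q1 Q)" using IH(1) Q by blast
    have Q': "projective R ?Q'" by (rule projective_fg_copy[OF PP])
    have lQ': "left_module R ?Q'" "left_module R (prod_mod Q1 Q)" using Q' lQ1 l(3) by blast+
    interpret Q': left_module R ?Q' by (rule lQ'(1))
    obtain c c' where c: "c \<in> module_hom R ?Q' (prod_mod Q1 Q)" "c' \<in> module_hom R (prod_mod Q1 Q) ?Q'"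
      "\<And>x. x \<in> carrier ?Q' \<Longrightarrow> c' (c x) = x" "\<And>x. x \<in> carrier (prod_mod Q1 Q) \<Longrightarrow> c (c' x) = x"
      using module_isoE[OF fg_copy_iso'[OF projective_fg[OF PP]]] lQ' by blast
    have c1: "(\<lambda>q. fst (c q)) \<in> module_hom R ?Q' Q1" and c2: "(\<lambda>q. snd (c q)) \<in> module_hom R ?Q' Q"
      using hom_comp[OF c(1) hom_fst] hom_comp[OF c(1) hom_snd] by auto
    note cl = hom_closed[OF c1] hom_closed[OF c2]
    let ?\<alpha> = "\<lambda>x. (g (fst x, snd (c (snd x))), fst (c (snd x)))"
    have \<alpha>: "?\<alpha> \<in> module_hom R (prod_mod M ?Q') (prod_mod M Q1)"
      using hom_pair[OF hom_comp[OF hom_pair[OF hom_fst hom_comp[OF hom_snd c2]] g] hom_comp[OF hom_snd c1]] .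
    let ?v = "\<lambda>w. (fst (u w), c' (\<zero>\<^bsub>Q1\<^esub>, snd (u w)))"
    have u1: "(\<lambda>w. fst (u w)) \<in> module_hom R V M" and u2: "(\<lambda>w. snd (u w)) \<in> module_hom R V Q"
      using hom_comp[OF u hom_fst] hom_comp[OF u hom_snd] by auto
    have v: "?v \<in> module_hom R V (prod_mod M ?Q')"
      using hom_pair[OF u1 hom_comp[OF hom_comp[OF u2 hom_inr[OF lQ1]] c(2)]] .
    have cv: "c (c' (\<zero>\<^bsub>Q1\<^esub>, q)) = (\<zero>\<^bsub>Q1\<^esub>, q)" if "q \<in> carrier Q" for q using c(4) that by simp
    note ucl = hom_closed[OF u1] hom_closed[OF u2]
    have gu: "g (fst (u w), snd (u w)) = \<zero>\<^bsub>M\<^esub>" if "w \<in> carrier V" for w using ses_zero[OF s that] by simp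
    have s\<alpha>: "ses R V (prod_mod M ?Q') (prod_mod M Q1) ?v ?\<alpha>"
    proof (rule sesI[OF fg(1) _ _ v \<alpha>])
      show "fg_module R (prod_mod M ?Q')" "fg_module R (prod_mod M Q1)" using fg(2) Q' fgQ1 by blast+
      show "w = \<zero>\<^bsub>V\<^esub>" if w: "w \<in> carrier V" "?v w = \<zero>\<^bsub>prod_mod M ?Q'\<^esub>" for w
      proof -
        have "fst (u w) = \<zero>\<^bsub>M\<^esub>" "c (c' (\<zero>\<^bsub>Q1\<^esub>, snd (u w))) = c \<zero>\<^bsub>?Q'\<^esub>" using w(2) by auto
        then have "(\<zero>\<^bsub>Q1\<^esub>, snd (u w)) = \<zero>\<^bsub>prod_mod Q1 Q\<^esub>" using cv[OF ucl(2)[OF w(1)]] hom_zero[OF lQ' c(1)] by metis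
        then have "u w = \<zero>\<^bsub>prod_mod M Q\<^esub>" using \<open>fst (u w) = \<zero>\<^bsub>M\<^esub>\<close> by (simp add: prod_eq_iff)
        then show ?thesis by (rule ses_inj[OF s w(1)])
      qed
      show "\<exists>x\<in>carrier (prod_mod M ?Q'). ?\<alpha> x = y" if y: "y \<in> carrier (prod_mod M Q1)" for y
      proof -
        obtain m q where mq: "y = (m, q)" "m \<in> carrier M" "q \<in> carrier Q1" using y by auto
        obtain x r where xr: "x \<in> carrier M" "r \<in> carrier Q" "g (x, r) = m" using ses_surj[OF s mq(2)] by auto
        have cqr: "c (c' (q, r)) = (q, r)" "c' (q, r) \<in> carrier ?Q'" using c(4) hom_closed[OF c(2)] mq xr by auto
        then show ?thesis using mq xr by (intro bexI[of _ "(x, c' (q, r))"]) auto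
      qed
      show "?\<alpha> (?v w) = \<zero>\<^bsub>prod_mod M Q1\<^esub>" if w: "w \<in> carrier V" for w
        using cv[OF ucl(2)[OF w]] gu[OF w] by simp
      show "\<exists>w\<in>carrier V. ?v w = x" if x: "x \<in> carrier (prod_mod M ?Q')" "?\<alpha> x = \<zero>\<^bsub>prod_mod M Q1\<^esub>" for x
      proof -
        obtain m q where mq: "x = (m, q)" "m \<in> carrier M" "q \<in> carrier ?Q'" using x(1) by auto
        have *: "g (m, snd (c q)) = \<zero>\<^bsub>M\<^esub>" "fst (c q) = \<zero>\<^bsub>Q1\<^esub>" using x(2) mq(1) by auto
        obtain w where w: "w \<in> carrier V" "u w = (m, snd (c q))" using ses_ker[OF s _ *(1)] mq cl by auto
        have "?v w = (m, c' (c q))" using w(2) *(2) by (simp add: prod_eq_iff) (metis prod.collapse)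
        then show ?thesis using w(1) mq c(3) by auto
      qed
    qed
    obtain V2 :: "'a fgmod" and u2 where V2: "ses R V2 (prod_mod M ?Q') M u2 (\<lambda>x. (?f ^^ j) (fst (?\<alpha> x)) \<oplus>\<^bsub>M\<^esub> H (snd (?\<alpha> x)))" "exact R V V2 V1"
      using exact_comp[OF s\<alpha> IH(4)] by blast
    have pdV2: "pd_le t V2" by (rule pd_ext[OF V2(2) V IH(2)])
    let ?H = "\<lambda>q. (?f ^^ j) (?h (snd (c q))) \<oplus>\<^bsub>M\<^esub> H (fst (c q))"
    have H: "?H \<in> module_hom R ?Q' M"
      using hom_add_fun[OF l(2) hom_comp[OF hom_comp[OF c2 h] fj] hom_comp[OF c1 IH(3)]] .
    have eq: "(?f ^^ j) (fst (?\<alpha> x)) \<oplus>\<^bsub>M\<^esub> H (snd (?\<alpha> x)) = (?f ^^ Suc j) (fst x) \<oplus>\<^bsub>M\<^esub> ?H (snd x)" if x: "x \<in> carrier (prod_mod M ?Q')" for x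
    proof -
      obtain m q where mq: "x = (m, q)" "m \<in> carrier M" "q \<in> carrier ?Q'" using x(1) by auto
      have c': "?f m \<in> carrier M" "?h (snd (c q)) \<in> carrier M" "H (fst (c q)) \<in> carrier M"
        using hom_closed[OF f mq(2)] hom_closed[OF h cl(2)[OF mq(3)]] hom_closed[OF IH(3) cl(1)[OF mq(3)]] by auto
      have "(?f ^^ j) (g (m, snd (c q))) = (?f ^^ j) (?f m) \<oplus>\<^bsub>M\<^esub> (?f ^^ j) (?h (snd (c q)))"
        unfolding gsplit[OF mq(2) cl(2)[OF mq(3)]] by (rule hom_add[OF fj c'(1,2)])
      moreover have "(?f ^^ j) (?f m) = (?f ^^ Suc j) m" by (simp only: funpow_Suc_right comp_apply)
      moreover have "(?f ^^ Suc j) m \<in> carrier M" "(?f ^^ j) (?h (snd (c q))) \<in> carrier M"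
        using hom_closed[OF fj mq(2)] hom_closed[OF fj c'(2)] by blast+
      ultimately show ?thesis using mq(1) M.M.a_assoc[OF _ _ c'(3)] by (simp del: funpow.simps)
    qed
    have "ses R V2 (prod_mod M ?Q') M u2 (\<lambda>x. (?f ^^ Suc j) (fst x) \<oplus>\<^bsub>M\<^esub> ?H (snd x))"
    proof -
      have 1: "(\<lambda>x. (?f ^^ Suc j) (fst x) \<oplus>\<^bsub>M\<^esub> ?H (snd x)) \<in> module_hom R (prod_mod M ?Q') M"
        using hom_add_fun[OF l(2) hom_comp[OF hom_fst fj] hom_comp[OF hom_snd H]] .
      have 2: "(\<lambda>x. (?f ^^ j) (fst (?\<alpha> x)) \<oplus>\<^bsub>M\<^esub> H (snd (?\<alpha> x))) ` carrier (prod_mod M ?Q') = (\<lambda>x. (?f ^^ Suc j) (fst x) \<oplus>\<^bsub>M\<^esub> ?H (snd x)) ` carrier (prod_mod M ?Q')"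
        by (rule image_cong[OF refl eq])
      have 3: "kern (prod_mod M ?Q') M (\<lambda>x. (?f ^^ j) (fst (?\<alpha> x)) \<oplus>\<^bsub>M\<^esub> H (snd (?\<alpha> x))) = kern (prod_mod M ?Q') M (\<lambda>x. (?f ^^ Suc j) (fst x) \<oplus>\<^bsub>M\<^esub> ?H (snd x))"
        unfolding kern_def using eq by (intro Collect_cong conj_cong) (simp_all only:)
      show ?thesis using V2(1) 1 unfolding ses_def 2 3 by blast
    qed
    then show ?case using Q' pdV2 H by blast
  qed
  then obtain Q1 V1 :: "'a fgmod" and H u1 where N: "projective R Q1" "pd_le t V1" "H \<in> module_hom R Q1 M"
      "ses R V1 (prod_mod M Q1) M u1 (\<lambda>x. (?f ^^ n) (fst x) \<oplus>\<^bsub>M\<^esub> H (snd x))" by blast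
  have lQ1: "left_module R Q1" and lV1: "left_module R V1" using N by (auto dest: pd_fg)
  interpret Q1: left_module R Q1 by fact
  let ?G = "\<lambda>x. (?f ^^ n) (fst x) \<oplus>\<^bsub>M\<^esub> H (snd x)" and ?P = "prod_mod M Q1"
  have G: "?G \<in> module_hom R ?P M" and u1: "u1 \<in> module_hom R V1 ?P" "inj_on u1 (carrier V1)" "u1 ` carrier V1 = kern ?P M ?G"
    using N(4) by (auto simp: ses_def)
  let ?K = "?P\<lparr>carrier := kern ?P M ?G\<rparr>"
  have "retract R M ?K"
  proof (rule retractI)
    have H0: "H \<zero>\<^bsub>Q1\<^esub> = \<zero>\<^bsub>M\<^esub>" by (rule hom_zero[OF lQ1 l(2) N(3)])
    show "(\<lambda>x. (x, \<zero>\<^bsub>Q1\<^esub>)) \<in> module_hom R M ?K"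
      by (rule hom_corestrict[OF hom_inl[OF lQ1]]) (use nil H0 in \<open>auto simp: kern_def\<close>)
    show "fst \<in> module_hom R ?K M" by (rule hom_restrict[OF hom_fst]) (simp add: kern_def)
  qed simp
  moreover have "retract R ?K V1"
  proof (rule retract_iso'[OF _ lV1])
    show "module_iso R V1 ?K"
      by (rule module_isoI[OF hom_corestrict[OF u1(1)]]) (use u1 in \<open>simp_all add: bij_betw_def\<close>)
  qed
  ultimately have "retract R M V1" by (rule retract_trans)
  then show ?thesis using pd_retract[OF _ fg(2) N(2)] by blast
qed

text \<open>The Fitting decomposition of the component at \<^term>\<open>M\<close> splits off the part on which it is invertible, which does
  not change the kernel.  On the remaining summand it is nilpotent.\<close>

lemma pd_kernel_summand:
  fixes M :: "'a fgmod" and Q :: "'a fgmod" and V :: "'a fgmod"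
  assumes s: "ses R V (prod_mod M Q) M u g" and Q: "projective R Q" and V: "pd_le t V"
  shows "\<exists>M2 :: 'a fgmod. fg_module R M2 \<and> retract R M2 M \<and> pd_le t M2 \<and> (\<forall>n. pd_le n M2 \<longrightarrow> pd_le n V)"
proof -
  let ?f = "\<lambda>x. g (x, \<zero>\<^bsub>Q\<^esub>)" and ?h = "\<lambda>q. g (\<zero>\<^bsub>M\<^esub>, q)"
  have fg: "fg_module R V" "fg_module R M" "fg_module R Q" and g: "g \<in> module_hom R (prod_mod M Q) M"
    and u: "u \<in> module_hom R V (prod_mod M Q)" using s Q by (auto simp: ses_def)
  note l = fg[THEN fg_left_module]
  interpret M: left_module R M by (rule l(2))
  interpret Q: left_module R Q by (rule l(3))
  have f: "?f \<in> module_hom R M M" and h: "?h \<in> module_hom R Q M"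
    using hom_comp[OF hom_inl[OF l(3)] g] hom_comp[OF hom_inr[OF l(2)] g] by auto
  have gsplit: "g (x, q) = ?f x \<oplus>\<^bsub>M\<^esub> ?h q" if "x \<in> carrier M" "q \<in> carrier Q" for x q
  proof -
    have "g ((x, \<zero>\<^bsub>Q\<^esub>) \<oplus>\<^bsub>prod_mod M Q\<^esub> (\<zero>\<^bsub>M\<^esub>, q)) = ?f x \<oplus>\<^bsub>M\<^esub> ?h q" by (rule hom_add[OF g]) (use that in auto)
    then show ?thesis using that by simp
  qed
  have fj: "?f ^^ j \<in> module_hom R M M" for j by (rule hom_pow[OF f])
  note fcl = hom_closed[OF f] and hcl = hom_closed[OF h]
  have f0: "?f \<zero>\<^bsub>M\<^esub> = \<zero>\<^bsub>M\<^esub>" by (rule hom_zero[OF l(2,2) f])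
  have h0: "?h \<zero>\<^bsub>Q\<^esub> = \<zero>\<^bsub>M\<^esub>" by (rule hom_zero[OF l(3,2) h])
  have fl: "finite_length R M" using fg(2) by (simp add: fg_iff)
  obtain n where n: "kern M M (?f ^^ n) \<inter> (?f ^^ n) ` carrier M = {\<zero>\<^bsub>M\<^esub>}"
     "\<forall>x \<in> carrier M. \<exists>u \<in> kern M M (?f ^^ n). \<exists>v \<in> (?f ^^ n) ` carrier M. x = u \<oplus>\<^bsub>M\<^esub> v"
     "?f ` ((?f ^^ n) ` carrier M) = (?f ^^ n) ` carrier M" "n > 0"
    using fitting[OF l(2) fl f] by (elim exE conjE)
  define K where "K = kern M M (?f ^^ n)"
  define I where "I = (?f ^^ n) ` carrier M"
  have K: "submodule K R M" and I: "submodule I R M"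
    using submodule_kern[OF l(2,2) fj] submodule_range[OF l(2,2) fj] by (auto simp: K_def I_def)
  note n = n[folded K_def I_def]
  obtain \<pi> where \<pi>: "\<pi> \<in> module_hom R M M" "\<And>x. x \<in> carrier M \<Longrightarrow> \<pi> x \<in> K"
    "\<And>x. x \<in> carrier M \<Longrightarrow> x \<ominus>\<^bsub>M\<^esub> \<pi> x \<in> I" "\<And>u. u \<in> K \<Longrightarrow> \<pi> u = u" "\<And>v. v \<in> I \<Longrightarrow> \<pi> v = \<zero>\<^bsub>M\<^esub>"
  proof -
    from M.complement_projection[OF K I n(1,2)] obtain \<pi> where "\<pi> \<in> module_hom R M M" "\<forall>x \<in> carrier M. \<pi> x \<in> K"
      "\<forall>x \<in> carrier M. x \<ominus>\<^bsub>M\<^esub> \<pi> x \<in> I" "\<forall>u \<in> K. \<pi> u = u" "\<forall>v \<in> I. \<pi> v = \<zero>\<^bsub>M\<^esub>" by (elim bexE conjE)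
    then show ?thesis by (intro that[of \<pi>]) simp_all
  qed
  note KC = M.submodule_mem[OF K] and IC = M.submodule_mem[OF I]
  have fK: "?f x \<in> K" if "x \<in> K" for x
  proof -
    have "(?f ^^ n) (?f x) = ?f ((?f ^^ n) x)" by (metis funpow_swap1)
    also have "\<dots> = \<zero>\<^bsub>M\<^esub>" using that f0 unfolding K_def kern_def by simp
    finally show ?thesis using that fcl unfolding K_def kern_def by simp
  qed
  have fI: "?f x \<in> I" if "x \<in> I" for x using n(3) that by blast
  have injI: "x = \<zero>\<^bsub>M\<^esub>" if x: "x \<in> I" "?f x = \<zero>\<^bsub>M\<^esub>" for x
  proof -
    obtain m where m: "n = Suc m" using n(4) by (cases n) auto
    have "(?f ^^ n) x = (?f ^^ m) (?f x)" unfolding m by (simp only: funpow_Suc_right comp_apply)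
    also have "\<dots> = \<zero>\<^bsub>M\<^esub>" using x(2) hom_zero[OF l(2,2) fj] by simp
    finally have "x \<in> K" using IC[OF x(1)] unfolding K_def kern_def by simp
    then show ?thesis using n(1) x(1) by blast
  qed
  have \<pi>f: "\<pi> (?f x) = ?f (\<pi> x)" if x: "x \<in> carrier M" for x
  proof -
    have c: "\<pi> x \<in> carrier M" "x \<ominus>\<^bsub>M\<^esub> \<pi> x \<in> carrier M" using KC[OF \<pi>(2)[OF x]] IC[OF \<pi>(3)[OF x]] by auto
    have "?f ((x \<ominus>\<^bsub>M\<^esub> \<pi> x) \<oplus>\<^bsub>M\<^esub> \<pi> x) = ?f (x \<ominus>\<^bsub>M\<^esub> \<pi> x) \<oplus>\<^bsub>M\<^esub> ?f (\<pi> x)" by (rule hom_add[OF f c(2,1)])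
    then have "?f x = ?f (x \<ominus>\<^bsub>M\<^esub> \<pi> x) \<oplus>\<^bsub>M\<^esub> ?f (\<pi> x)" using x c by simp
    then have "\<pi> (?f x) = \<pi> (?f (x \<ominus>\<^bsub>M\<^esub> \<pi> x)) \<oplus>\<^bsub>M\<^esub> \<pi> (?f (\<pi> x))" using hom_add[OF \<pi>(1) fcl[OF c(2)] fcl[OF c(1)]] by simp
    also have "\<pi> (?f (x \<ominus>\<^bsub>M\<^esub> \<pi> x)) = \<zero>\<^bsub>M\<^esub>" by (rule \<pi>(5)[OF fI[OF \<pi>(3)[OF x]]])
    also have "\<pi> (?f (\<pi> x)) = ?f (\<pi> x)" by (rule \<pi>(4)[OF fK[OF \<pi>(2)[OF x]]])
    finally show ?thesis using fcl[OF c(1)] by simp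
  qed
  have \<pi>g: "\<pi> (g (\<pi> x, q)) = \<pi> (g (x, q))" if x: "x \<in> carrier M" "q \<in> carrier Q" for x q
  proof -
    have c: "\<pi> x \<in> carrier M" using KC[OF \<pi>(2)[OF x(1)]] .
    have "\<pi> (g (\<pi> x, q)) = \<pi> (?f (\<pi> x)) \<oplus>\<^bsub>M\<^esub> \<pi> (?h q)" unfolding gsplit[OF c x(2)] by (rule hom_add[OF \<pi>(1) fcl[OF c] hcl[OF x(2)]])
    also have "\<pi> (?f (\<pi> x)) = \<pi> (?f x)" unfolding \<pi>f[OF x(1)] by (rule \<pi>(4)[OF fK[OF \<pi>(2)[OF x(1)]]])
    also have "\<pi> (?f x) \<oplus>\<^bsub>M\<^esub> \<pi> (?h q) = \<pi> (g (x, q))" unfolding gsplit[OF x] by (rule hom_add[OF \<pi>(1) fcl[OF x(1)] hcl[OF x(2)], symmetric])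
    finally show ?thesis .
  qed
  let ?M = "M\<lparr>carrier := K\<rparr>"
  have fgK: "fg_module R ?M" by (rule fg_sub[OF fg(2) K])
  have lK: "left_module R ?M" using fgK by blast
  have \<pi>K: "\<pi> \<in> module_hom R M ?M" using \<pi>(2) by (intro hom_corestrict[OF \<pi>(1)]) blast
  have inc: "(\<lambda>x. x) \<in> module_hom R ?M M" using KC by (intro hom_restrict[OF hom_id]) blast
  let ?g = "\<lambda>x. \<pi> (g x)" and ?u = "\<lambda>v. (\<pi> (fst (u v)), snd (u v))"
  have incP: "(\<lambda>x. x) \<in> module_hom R (prod_mod ?M Q) (prod_mod M Q)"
    using hom_pair[OF hom_comp[OF hom_fst inc] hom_snd] by simp
  have g2: "?g \<in> module_hom R (prod_mod ?M Q) ?M" using hom_comp[OF hom_comp[OF incP g] \<pi>K] .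
  have u1: "(\<lambda>w. fst (u w)) \<in> module_hom R V M" and u2: "(\<lambda>w. snd (u w)) \<in> module_hom R V Q"
    using hom_comp[OF u hom_fst] hom_comp[OF u hom_snd] by auto
  note ucl = hom_closed[OF u1] hom_closed[OF u2]
  have u3: "?u \<in> module_hom R V (prod_mod ?M Q)" using hom_pair[OF hom_comp[OF u1 \<pi>K] u2] .
  have gu: "g (fst (u w), snd (u w)) = \<zero>\<^bsub>M\<^esub>" if "w \<in> carrier V" for w using ses_zero[OF s that] by simp
  have s2: "ses R V (prod_mod ?M Q) ?M ?u ?g"
  proof (rule sesI[OF fg(1) fg_prod[OF fgK fg(3)] fgK u3 g2])
    fix w assume w: "w \<in> carrier V" "?u w = \<zero>\<^bsub>prod_mod ?M Q\<^esub>"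
    have 0: "\<pi> (fst (u w)) = \<zero>\<^bsub>M\<^esub>" "snd (u w) = \<zero>\<^bsub>Q\<^esub>" using w(2) by auto
    have "?f (fst (u w)) = \<zero>\<^bsub>M\<^esub>" using gu[OF w(1)] 0(2) by simp
    moreover have "fst (u w) \<in> I" using \<pi>(3)[OF ucl(1)[OF w(1)]] 0(1) ucl(1)[OF w(1)] M.minus_add_cancel[of "fst (u w)" "\<zero>\<^bsub>M\<^esub>"] by simp
    ultimately have "fst (u w) = \<zero>\<^bsub>M\<^esub>" using injI by blast
    then have "u w = \<zero>\<^bsub>prod_mod M Q\<^esub>" using 0(2) by (simp add: prod_eq_iff)
    then show "w = \<zero>\<^bsub>V\<^esub>" by (rule ses_inj[OF s w(1)])
  next
    fix m assume m: "m \<in> carrier ?M"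
    then have mK: "m \<in> K" by simp
    obtain x q where xq: "x \<in> carrier M" "q \<in> carrier Q" "g (x, q) = m" using ses_surj[OF s KC[OF mK]] by auto
    have "?g (\<pi> x, q) = m" unfolding \<pi>g[OF xq(1,2)] xq(3) by (rule \<pi>(4)[OF mK])
    then show "\<exists>y\<in>carrier (prod_mod ?M Q). ?g y = m" using \<pi>(2)[OF xq(1)] xq(2) by (intro bexI[of _ "(\<pi> x, q)"]) auto
  next
    fix w assume w: "w \<in> carrier V"
    show "?g (?u w) = \<zero>\<^bsub>?M\<^esub>"
      unfolding \<pi>g[OF ucl(1)[OF w] ucl(2)[OF w]] gu[OF w] using hom_zero[OF l(2,2) \<pi>(1)] by simp
  next
    fix y assume y: "y \<in> carrier (prod_mod ?M Q)" "?g y = \<zero>\<^bsub>?M\<^esub>"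
    obtain k q where kq: "y = (k, q)" "k \<in> K" "q \<in> carrier Q" using y(1) by auto
    have gc: "g (k, q) \<in> carrier M" using hom_closed[OF g, of "(k, q)"] kq KC by simp
    have "g (k, q) \<in> I" using \<pi>(3)[OF gc] y(2) kq(1) gc M.minus_add_cancel[of "g (k, q)" "\<zero>\<^bsub>M\<^esub>"] by simp
    then have "g (k, q) \<in> ?f ` I" unfolding n(3) .
    then obtain i where i: "i \<in> I" "g (k, q) = ?f i" by blast
    have c: "k \<in> carrier M" "i \<in> carrier M" "k \<ominus>\<^bsub>M\<^esub> i \<in> carrier M" using KC[OF kq(2)] IC[OF i(1)] by auto
    have "g ((k \<ominus>\<^bsub>M\<^esub> i, q) \<oplus>\<^bsub>prod_mod M Q\<^esub> (i, \<zero>\<^bsub>Q\<^esub>)) = g (k \<ominus>\<^bsub>M\<^esub> i, q) \<oplus>\<^bsub>M\<^esub> ?f i" by (rule hom_add[OF g]) (use c kq in auto)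
    then have "g (k \<ominus>\<^bsub>M\<^esub> i, q) \<oplus>\<^bsub>M\<^esub> ?f i = ?f i" using c kq(3) i(2) by simp
    then have "g (k \<ominus>\<^bsub>M\<^esub> i, q) = \<zero>\<^bsub>M\<^esub>"
      using hom_closed[OF g, of "(k \<ominus>\<^bsub>M\<^esub> i, q)"] c kq(3) fcl[OF c(2)] M.M.add.r_cancel_one[of "?f i" "g (k \<ominus>\<^bsub>M\<^esub> i, q)"] by simp
    then obtain w where w: "w \<in> carrier V" "u w = (k \<ominus>\<^bsub>M\<^esub> i, q)" using ses_ker[OF s, of "(k \<ominus>\<^bsub>M\<^esub> i, q)"] c kq(3) by auto
    have "\<pi> (k \<ominus>\<^bsub>M\<^esub> i) = k" using hom_diff[OF l(2,2) \<pi>(1) c(1,2)] \<pi>(4)[OF kq(2)] \<pi>(5)[OF i(1)] c(1) M.minus_add_cancel[of k "\<zero>\<^bsub>M\<^esub>"] by simp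
    then show "\<exists>w\<in>carrier V. ?u w = y" using w kq(1) by (intro bexI[of _ w]) auto
  qed
  have nil: "((\<lambda>x. ?g (x, \<zero>\<^bsub>Q\<^esub>)) ^^ n) x = \<zero>\<^bsub>?M\<^esub>" if x: "x \<in> carrier ?M" for x
  proof -
    have "((\<lambda>x. ?g (x, \<zero>\<^bsub>Q\<^esub>)) ^^ j) x = (?f ^^ j) x \<and> (?f ^^ j) x \<in> K" for j
    proof (induction j)
      case (Suc j)
      then show ?case using \<pi>(4)[OF fK] fK by simp
    qed (use x in simp)
    then show ?thesis using x unfolding K_def kern_def by simp
  qed
  have p: "pd_le t ?M" by (rule pd_nilpotent[OF s2 Q V nil])
  have "retract R ?M M" by (rule retractI[OF inc \<pi>K]) (use \<pi>(4) in simp)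
  moreover have "pd_le n V" if "pd_le n ?M" for n
    by (rule pd_kernel[OF exactI[OF s2] pd_prod[OF that pd_projective[OF Q]] that])
  ultimately show ?thesis using p fgK by blast
qed

lemma pd_of_nth_syzygy:
  fixes W :: "'a fgmod"
  assumes "pd_le t (nth_syzygy \<phi> W)" "fg_module R W" shows "pd_le (t + \<phi>) W"
  using assms pd_fgmod[OF nth_syzygy_fg[OF assms(2)]] pd_fgmod[OF assms(2)] by (simp add: nth_syzygy_add)

lemma pd_syzygy: "pd_le t W \<Longrightarrow> fg_module R W \<Longrightarrow> pd_le t (syzygy W)" for W :: "'a fgmod"
proof -
  assume W: "pd_le t W" "fg_module R W"
  have "projective R (syzygy (nth_syzygy t W))" using syzygy_projective W pd_fgmod[OF W(2)] by blast
  moreover have "syzygy (nth_syzygy t W) = nth_syzygy t (syzygy W)" using nth_syzygy_add[of t 1 W] by simp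
  ultimately show ?thesis using pd_fgmod[OF syzygy_fg[OF W(2)]] by simp
qed

lemma pd_nth_syzygy: "pd_le t W \<Longrightarrow> fg_module R W \<Longrightarrow> pd_le t (nth_syzygy n W)" for W :: "'a fgmod"
  by (induction n) (auto intro: pd_syzygy)

text \<open>A free cover of \<^term>\<open>Z\<close> also covers \<^term>\<open>M\<close>. The kernel of the latter cover is an extension of the
  projective module \<^term>\<open>P\<close> by a syzygy of \<^term>\<open>Z\<close>, and this extension splits.\<close>

lemma exact_projective_shift:
  fixes P Z M :: "'a fgmod"
  assumes e: "exact R P Z M" and P: "projective R P" shows "stably_iso (syzygy M) (syzygy Z)"
proof -
  obtain f g where s: "ses R P Z M f g" using e by (auto simp: exact_def)
  have fg: "fg_module R P" "fg_module R Z" "fg_module R M" using exact_fg[OF e] by auto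
  obtain k a b where c: "ses R (syzygy Z) (free R k) Z a b" using exact_syzygy[OF fg(2)] unfolding exact_def by metis
  obtain V :: "'a fgmod" where V: "exact R V (free R k) M" "exact R (syzygy Z) V P"
    using exact_comp[OF c s] exactI by blast
  have fgV: "fg_module R V" using exact_fg[OF V(1)] by auto
  have lZ: "left_module R (syzygy Z)" "left_module R V" using fg_left_module[OF syzygy_fg[OF fg(2)]] fg_left_module[OF fgV] .
  have "stably_iso V (syzygy M)" by (rule stably_iso_syzygy[OF V(1) projective_free stably_iso_refl fg(3)])
  then have 1: "stably_iso (syzygy M) V" by (rule stably_iso_sym[OF _ lZ(2)])
  have "stably_iso (prod_mod (syzygy Z) P) V" by (rule iso_imp_stably_iso[OF exact_split[OF V(2) P]])
  then have 2: "stably_iso V (prod_mod (syzygy Z) P)" by (rule stably_iso_sym) (use lZ fg(1) in blast)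
  show ?thesis
    by (rule stably_iso_trans[OF 1 stably_iso_trans[OF 2 stably_iso_add_projective[OF P lZ(1)] lZ(2)]]) (rule fg_left_module[OF syzygy_fg[OF fg(3)]])
qed

text \<open>Let \<open>e\<close> be the degree from \<open>syz_rel_stable\<close>. If the \<open>d\<close>-th syzygy
  of \<open>W\<close> is projective, then \<open>xs\<close> and \<open>ys\<close> are related in degree
  \<open>Suc d\<close>, hence in degree \<open>e\<close>. The \<open>e\<close>-th syzygy of \<open>W\<close> is
  thus the kernel, up to projective summands, of a surjection from \<open>N\<close> plus a projective onto
  \<open>N\<close>, where \<open>N\<close> is the direct sum of the \<open>e\<close>-th syzygies of
  \<open>xs\<close>. Its dimension is controlled by a summand of \<open>N\<close>, for whose indecomposable
  summands there are finitely many possibilities.\<close>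

theorem igusa_todorov_bound:
  assumes "finite US" "\<And>U. U \<in> US \<Longrightarrow> fg_module R U"
  shows "\<exists>t. \<forall>(W :: 'a fgmod) xs ys n. set xs \<subseteq> US \<longrightarrow> set ys \<subseteq> US \<longrightarrow> exact R W (dsum ys) (dsum xs) \<longrightarrow> pd_le n W \<longrightarrow> pd_le t W"
proof -
  obtain \<phi> where \<phi>: "\<And>d xs ys. set xs \<subseteq> US \<Longrightarrow> set ys \<subseteq> US \<Longrightarrow> syz_rel d xs ys \<Longrightarrow> syz_rel \<phi> xs ys"
    using syz_rel_stable[OF assms] by blast
  have "\<forall>X \<in> nth_syzygy \<phi> ` US. fg_module R X" using assms(2) by blast
  from finite_summands[of "nth_syzygy \<phi> ` US", OF finite_imageI[OF assms(1)] this] obtain VS where VS: "finite VS" "\<forall>V \<in> VS. fg_module R V"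
    "\<forall>(Z :: 'a fgmod) Ys. fg_module R Z \<and> set Ys \<subseteq> nth_syzygy \<phi> ` US \<and> retract R Z (dsum Ys) \<longrightarrow> (\<exists>Zs. set Zs \<subseteq> VS \<and> module_iso R Z (dsum Zs))"
    by (elim exE conjE)
  \<comment> \<open>The largest finite projective dimension among the finitely many candidates.\<close>
  have "\<exists>t. \<forall>V \<in> VS. (\<exists>n. pd_le n V) \<longrightarrow> pd_le t V"
    using VS(1)
  proof (induction VS rule: finite_induct)
    case (insert V VS)
    then obtain t where t: "\<forall>V \<in> VS. (\<exists>n. pd_le n V) \<longrightarrow> pd_le t V" by blast
    show ?case
    proof (cases "\<exists>n. pd_le n V")
      case True
      then obtain n where "pd_le n V" by blast
      have "pd_le (max n t) X" if "X \<in> insert V VS" "pd_le m X" for X m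
      proof (cases "X = V")
        case True
        then show ?thesis using pd_mono[OF \<open>pd_le n V\<close>, of "max n t"] by simp
      next
        case False
        then have "pd_le t X" using t that by blast
        then show ?thesis using pd_mono[of t X "max n t"] by simp
      qed
      then show ?thesis by blast
    qed (use t in blast)
  qed simp
  then obtain t where t: "\<And>V n. V \<in> VS \<Longrightarrow> pd_le n V \<Longrightarrow> pd_le t V" by blast
  show ?thesis
  proof (intro exI[of _ "t + \<phi>"] allI impI)
    fix W :: "'a fgmod" and xs ys d assume xs: "set xs \<subseteq> US" and ys: "set ys \<subseteq> US" and e: "exact R W (dsum ys) (dsum xs)" and W: "pd_le d W"
    have fgxs: "\<forall>X \<in> set xs. fg_module R X" and fgys: "\<forall>X \<in> set ys. fg_module R X" using xs ys assms(2) by auto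
    have fg: "fg_module R W" "fg_module R (dsum ys)" "fg_module R (dsum xs)" using exact_fg[OF e] by auto
    have fgm: "\<forall>X \<in> set (map (nth_syzygy n) xs). fg_module R X" "\<forall>X \<in> set (map (nth_syzygy n) ys). fg_module R X" for n using fgxs fgys by auto
    note fgd = dsum_fg[OF fgm(1)] dsum_fg[OF fgm(2)]
    have ox: "stably_iso (nth_syzygy n (dsum xs)) (dsum (map (nth_syzygy n) xs))" "stably_iso (nth_syzygy n (dsum ys)) (dsum (map (nth_syzygy n) ys))" for n
      using nth_syzygy_dsum[OF fgxs] nth_syzygy_dsum[OF fgys] by auto
    have ox': "stably_iso (dsum (map (nth_syzygy n) xs)) (nth_syzygy n (dsum xs))" "stably_iso (dsum (map (nth_syzygy n) ys)) (nth_syzygy n (dsum ys))" for n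
      using stably_iso_sym[OF ox(1) fg_left_module[OF nth_syzygy_fg[OF fg(3)]]] stably_iso_sym[OF ox(2) fg_left_module[OF nth_syzygy_fg[OF fg(2)]]] by auto
    note ol = fg_left_module[OF nth_syzygy_fg[OF fg(3)]] fg_left_module[OF nth_syzygy_fg[OF fg(2)]] fg_left_module[OF fgd(1)] fg_left_module[OF fgd(2)]
    \<comment> \<open>The \<^term>\<open>d\<close>-th syzygy of \<^term>\<open>W\<close> is projective.\<close>
    have "syz_rel (Suc d) xs ys"
    proof -
      obtain Z :: "'a fgmod" where Z: "exact R (nth_syzygy d W) Z (nth_syzygy d (dsum xs))" "stably_iso Z (nth_syzygy d (dsum ys))" using horseshoe_nth_syzygy[OF e] by blast
      have fgZ: "fg_module R Z" using exact_fg[OF Z(1)] by auto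
      have "projective R (nth_syzygy d W)" using W pd_fgmod[OF fg(1)] by blast
      from exact_projective_shift[OF Z(1) this] have "stably_iso (nth_syzygy (Suc d) (dsum xs)) (syzygy Z)" by simp
      from stably_iso_trans[OF this syzygy_stably_iso[OF fgZ nth_syzygy_fg[OF fg(2)] Z(2)] ol(1)]
      have "stably_iso (nth_syzygy (Suc d) (dsum xs)) (nth_syzygy (Suc d) (dsum ys))" by simp
      then show ?thesis unfolding syz_rel_def
        using stably_iso_trans[OF ox'(1) _ ol(3)] stably_iso_trans[OF _ ox(2) ol(1)] by blast
    qed
    then have r: "syz_rel \<phi> xs ys" by (rule \<phi>[OF xs ys])
    let ?N = "dsum (map (nth_syzygy \<phi>) xs)" and ?M = "nth_syzygy \<phi> (dsum xs)" and ?W = "nth_syzygy \<phi> W"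
    obtain Z :: "'a fgmod" where Z: "exact R ?W Z ?M" "stably_iso Z (nth_syzygy \<phi> (dsum ys))" using horseshoe_nth_syzygy[OF e] by blast
    have fgZ: "fg_module R Z" "fg_module R ?N" "fg_module R ?M" "fg_module R ?W" using exact_fg[OF Z(1)] fgd by auto
    have "stably_iso (dsum (map (nth_syzygy \<phi>) ys)) ?N" using stably_iso_sym[OF r[unfolded syz_rel_def] ol(3)] .
    then have "stably_iso (nth_syzygy \<phi> (dsum ys)) ?N" using stably_iso_trans[OF ox(2) _ ol(2)] by blast
    then have ZN: "stably_iso Z ?N" using stably_iso_trans[OF Z(2)] fgZ(1) by blast
    obtain P1 Q1 :: "'a fgmod" where 1: "projective R P1" "projective R Q1" "module_iso R (prod_mod ?M P1) (prod_mod ?N Q1)"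
      using ox(1)[of \<phi>] unfolding stably_iso_def by blast
    obtain \<theta> where \<theta>: "\<theta> \<in> module_hom R (prod_mod ?M P1) (prod_mod ?N Q1)" "bij_betw \<theta> (carrier (prod_mod ?M P1)) (carrier (prod_mod ?N Q1))"
      using 1(3) unfolding module_iso_def by blast
    obtain a \<alpha> where s: "ses R ?W Z ?M a \<alpha>" using Z(1) by (auto simp: exact_def)
    obtain O0 :: "'a fgmod" where O0: "fg_module R O0" "carrier O0 = {\<zero>\<^bsub>O0\<^esub>}" "projective R O0" by (rule zero_fgmod)
    have fgP: "fg_module R P1" "fg_module R Q1" using 1 by blast+
    have s1: "ses R (prod_mod ?W O0) (prod_mod Z P1) (prod_mod ?N Q1) (map_prod a (\<lambda>_. \<zero>\<^bsub>P1\<^esub>)) (\<lambda>x. \<theta> (map_prod \<alpha> (\<lambda>x. x) x))"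
      by (rule ses_iso_right[OF ses_prod[OF s ses_refl[OF fgP(1) O0(1,2)]] \<theta> fg_prod[OF fgZ(2) fgP(2)]])
    have lN: "left_module R ?N" "left_module R Q1" using fgZ(2) fgP by blast+
    have s2: "ses R Q1 (prod_mod ?N Q1) ?N (\<lambda>q. (\<zero>\<^bsub>?N\<^esub>, q)) fst"
      by (rule sesI[OF fgP(2) fg_prod[OF fgZ(2) fgP(2)] fgZ(2) hom_inr[OF lN(1)] hom_fst])
        (use left_module.submodule_zero[OF lN(2) left_module.submodule_carrier[OF lN(2)]] in \<open>auto\<close>)
    \<comment> \<open>Replacing the target by \<open>?N\<close> changes the kernel only by projective summands.\<close>
    obtain V :: "'a fgmod" where V: "exact R V (prod_mod Z P1) ?N" "exact R (prod_mod ?W O0) V Q1"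
      using exact_comp[OF s1 s2] exactI by blast
    have fgV: "fg_module R V" using exact_fg[OF V(1)] by auto
    have VW: "module_iso R (prod_mod (prod_mod ?W O0) Q1) V" by (rule exact_split[OF V(2) 1(2)])
    have lW: "left_module R ?W" "left_module R O0" "left_module R (prod_mod ?W O0)" using fgZ(4) O0(1) by blast+
    have WV: "retract R ?W V"
      by (rule retract_trans[OF retract_inl[OF lW(1,2)] retract_trans[OF retract_inl[OF lW(3) lN(2)] retract_iso[OF VW left_module_prod[OF lW(3) lN(2)]]]])
    have "pd_le d ?W" by (rule pd_nth_syzygy[OF W fg(1)])
    then have "pd_le d (prod_mod (prod_mod ?W O0) Q1)" by (rule pd_prod[OF pd_prod[OF _ pd_projective[OF O0(3)]] pd_projective[OF 1(2)]])
    then have pV: "pd_le d V" using pd_iso[OF _ VW fgV] by blast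
    \<comment> \<open>Projective summands added to the kernel and to the source turn the source into \<open>?N\<close> plus a projective module.\<close>
    obtain P2 Q2 :: "'a fgmod" where 2: "projective R P2" "projective R Q2" "module_iso R (prod_mod Z P2) (prod_mod ?N Q2)"
      using ZN unfolding stably_iso_def by blast
    have fgP2: "fg_module R P2" "fg_module R Q2" using 2 by blast+
    let ?P = "prod_mod P2 P1" and ?Q = "prod_mod Q2 P1"
    have iso: "module_iso R (prod_mod (prod_mod Z P1) P2) (prod_mod ?N (fg_copy R ?Q))"
    proof -
      have "module_iso R (prod_mod (prod_mod Z P1) P2) (prod_mod Z (prod_mod P1 P2))" by (rule module_iso_prod_assoc)
      also have "module_iso R \<dots> (prod_mod Z (prod_mod P2 P1))" by (rule module_iso_prod[OF module_iso_refl module_iso_prod_comm])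
      also (module_iso_trans) have "module_iso R \<dots> (prod_mod (prod_mod Z P2) P1)" by (rule module_iso_prod_assoc')
      also (module_iso_trans) have "module_iso R \<dots> (prod_mod (prod_mod ?N Q2) P1)" by (rule module_iso_prod[OF 2(3) module_iso_refl])
      also (module_iso_trans) have "module_iso R \<dots> (prod_mod ?N (prod_mod Q2 P1))" by (rule module_iso_prod_assoc)
      also (module_iso_trans) have "module_iso R \<dots> (prod_mod ?N (fg_copy R ?Q))" by (rule module_iso_prod[OF module_iso_refl fg_copy_iso]) (use fgP2 fgP in blast)
      finally (module_iso_trans) show ?thesis .
    qed
    have pQ: "projective R (fg_copy R ?Q)" by (rule projective_fg_copy[OF projective_prod[OF 2(2) 1(1)]])
    obtain b \<beta> where sV: "ses R V (prod_mod Z P1) ?N b \<beta>" using V(1) by (auto simp: exact_def)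
    have sVP: "exact R (prod_mod V P2) (prod_mod (prod_mod Z P1) P2) (prod_mod ?N O0)"
    proof -
      have "ses R P2 P2 O0 (\<lambda>x. x) (\<lambda>_. \<zero>\<^bsub>O0\<^esub>)"
        by (rule sesI[OF fgP2(1,1) O0(1) hom_id hom_zero_fun[OF lW(2)]]) (use O0(2) fgP2(1)
          left_module.submodule_zero[OF fg_left_module[OF fgP2(1)] left_module.submodule_carrier[OF fg_left_module[OF fgP2(1)]]] in auto)
      then show ?thesis using ses_prod[OF sV] exactI by blast
    qed
    let ?V = "fg_copy R (prod_mod V P2)"
    have fgVP: "fg_module R (prod_mod V P2)" using fgV fgP2 by blast
    have "exact R ?V (prod_mod ?N (fg_copy R ?Q)) ?N"
      by (rule exact_cong[OF sVP fg_copy_iso'[OF fgVP] iso module_iso_prod_zero[OF lW(2) O0(2)] fg_copy_fg[OF fgVP] fg_prod[OF fgZ(2) projective_fg[OF pQ]] fgZ(2)])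
    then obtain u g where sF: "ses R ?V (prod_mod ?N (fg_copy R ?Q)) ?N u g" by (auto simp: exact_def)
    have "pd_le d (prod_mod V P2)" using pd_prod[OF pV pd_projective[OF 2(1)]] .
    then have pV': "pd_le d ?V" using pd_iso[OF _ fg_copy_iso[OF fgVP] fg_copy_fg[OF fgVP]] by blast
    obtain M2 :: "'a fgmod" where M2: "fg_module R M2" "retract R M2 ?N" "pd_le d M2" "\<forall>n. pd_le n M2 \<longrightarrow> pd_le n ?V"
      using pd_kernel_summand[OF sF pQ pV'] by blast
    have "set (map (nth_syzygy \<phi>) xs) \<subseteq> nth_syzygy \<phi> ` US" using xs by auto
    then obtain Zs where Zs: "set Zs \<subseteq> VS" "module_iso R M2 (dsum Zs)" using VS(3) M2(1,2) by blast
    have fgZs: "\<forall>X \<in> set Zs. fg_module R X" using Zs(1) VS(2) by blast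
    have pdZs: "pd_le t X" if X: "X \<in> set Zs" for X
    proof -
      have "pd_le d (dsum Zs)" by (rule pd_iso[OF M2(3) Zs(2) dsum_fg[OF fgZs]])
      then have "pd_le d X" using pd_retract[OF dsum_retract_mem[OF fgZs X]] fgZs X by blast
      then show ?thesis using t X Zs(1) by blast
    qed
    have "pd_le t (dsum Zs)" using fgZs pdZs
    proof (induction Zs)
      case Nil
      show ?case by (rule pd_projective[OF projective_zero[OF dsum_Nil]])
    next
      case (Cons X Zs)
      have fgZ': "fg_module R X" "\<forall>X\<in>set Zs. fg_module R X" "\<forall>X\<in>set (X # Zs). fg_module R X" using Cons.prems(1) by auto
      have "pd_le t (prod_mod X (dsum Zs))" using Cons by (intro pd_prod) auto
      then show ?case using pd_iso[OF _ dsum_Cons(2)[OF fgZ'(1,2)] dsum_fg[OF fgZ'(3)]] by blast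
    qed
    then have "pd_le t M2" using pd_iso[OF _ module_iso_sym[OF Zs(2)] M2(1)] M2(1) by blast
    then have "pd_le t ?V" using M2(4) by blast
    then have "pd_le t (prod_mod V P2)" using pd_iso[OF _ fg_copy_iso'[OF fgVP] fgVP] by blast
    then have "pd_le t V" using pd_retract[OF retract_inl fgV] fgV fgP2 by blast
    then have "pd_le t ?W" by (rule pd_retract[OF WV fgZ(4)])
    then show "pd_le (t + \<phi>) W" by (rule pd_of_nth_syzygy[OF _ fg(1)])
  qed
qed

end

section \<open>Artin algebras have finite length\<close>

lemma artinian_minimal_ideal:
  assumes "artinian R" "\<S> \<noteq> {}" "\<forall>I \<in> \<S>. ideal I R"
  shows "\<exists>I \<in> \<S>. \<forall>J \<in> \<S>. J \<subseteq> I \<longrightarrow> J = I"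
proof (rule ccontr)
  assume "\<not> ?thesis"
  then have "\<forall>I \<in> \<S>. \<exists>J. J \<in> \<S> \<and> J \<subset> I" by blast
  then obtain f where f: "\<And>I. I \<in> \<S> \<Longrightarrow> f I \<in> \<S> \<and> f I \<subset> I" by metis
  obtain I0 where I0: "I0 \<in> \<S>" using assms(2) by blast
  define I where "I n = (f ^^ n) I0" for n
  have I: "I n \<in> \<S>" for n by (induction n) (use I0 f in \<open>auto simp: I_def\<close>)
  have Suc: "I (Suc n) \<subset> I n" for n using f[OF I[of n]] by (simp add: I_def)
  have "\<exists>n. \<forall>m\<ge>n. I m = I n" using assms(1,3) I Suc unfolding artinian_def by (meson psubset_imp_subset)
  then obtain n where "I (Suc n) = I n" by (meson le_Suc_eq order_refl)
  then show False using Suc[of n] by blast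
qed

text \<open>Zorn's lemma: a union of a chain of ideals that avoid an element avoids it.\<close>

lemma (in ring) ideal_maximal_avoiding:
  assumes J0: "ideal J0 R" "x \<notin> J0" "J0 \<subseteq> a"
  shows "\<exists>L. ideal L R \<and> J0 \<subseteq> L \<and> L \<subseteq> a \<and> x \<notin> L \<and> (\<forall>J. ideal J R \<and> L \<subseteq> J \<and> J \<subseteq> a \<and> x \<notin> J \<longrightarrow> J = L)"
proof -
  let ?A = "{L. ideal L R \<and> J0 \<subseteq> L \<and> L \<subseteq> a \<and> x \<notin> L}"
  have "\<exists>M\<in>?A. \<forall>X\<in>?A. M \<subseteq> X \<longrightarrow> X = M"
  proof (rule subset_Zorn_nonempty)
    show "?A \<noteq> {}" using J0 by blast
    fix C assume C: "C \<noteq> {}" "subset.chain ?A C"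
    have CA: "C \<subseteq> ?A" using C(2) unfolding subset_chain_def by (rule conjunct1)
    have "\<forall>X\<in>C. \<forall>Y\<in>C. X \<subseteq> Y \<or> Y \<subseteq> X" using C(2) unfolding subset_chain_def by (rule conjunct2)
    moreover have "C \<subseteq> {I. ideal I R}" by (rule subset_trans[OF CA]) auto
    ultimately have "subset.chain {I. ideal I R} C" unfolding subset_chain_def by simp
    then have I: "ideal (\<Union>C) R" using chain_Union_is_ideal[of C] C(1) by simp
    obtain I where IC: "I \<in> C" using C(1) by blast
    have "J0 \<subseteq> I" using CA IC by auto
    then have 1: "J0 \<subseteq> \<Union>C" using IC by auto
    have 2: "\<Union>C \<subseteq> a" using CA by (intro Union_least) auto
    have 3: "x \<notin> \<Union>C"
    proof
      assume "x \<in> \<Union>C"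
      then obtain X where X: "X \<in> C" "x \<in> X" by blast
      have "X \<in> ?A" by (rule subsetD[OF CA X(1)])
      then show False using X(2) by simp
    qed
    show "\<Union>C \<in> ?A" by (intro CollectI conjI I 1 2 3)
  qed
  then obtain L where L: "L \<in> ?A" "\<forall>X\<in>?A. L \<subseteq> X \<longrightarrow> X = L" by (elim bexE)
  have "J = L" if "ideal J R \<and> L \<subseteq> J \<and> J \<subseteq> a \<and> x \<notin> J" for J
  proof -
    have "J \<in> ?A" using L(1) that by auto
    then show ?thesis using L(2) that by simp
  qed
  then show ?thesis using L(1) by (intro exI[of _ L]) simp
qed

lemma (in ring) exists_maximalideal:
  assumes "ideal J R" "J \<noteq> carrier R" shows "\<exists>m. maximalideal m R \<and> J \<subseteq> m"
proof -
  have Jc: "J \<subseteq> carrier R" using assms(1) by (simp add: ideal.Icarr subsetI)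
  have one: "I = carrier R" if "ideal I R" "\<one> \<in> I" for I using ideal.one_imp_carrier[OF that] .
  then have "\<one> \<notin> J" using assms by blast
  from ideal_maximal_avoiding[OF assms(1) this Jc] obtain L where L: "ideal L R" "J \<subseteq> L" "L \<subseteq> carrier R" "\<one> \<notin> L"
    "\<forall>I. ideal I R \<and> L \<subseteq> I \<and> I \<subseteq> carrier R \<and> \<one> \<notin> I \<longrightarrow> I = L" by blast
  have "maximalideal L R"
  proof (rule maximalidealI[OF L(1)])
    show "carrier R \<noteq> L" using L(4) by blast
    fix I assume "ideal I R" "L \<subseteq> I" "I \<subseteq> carrier R"
    then show "I = L \<or> I = carrier R" using L(5) one by blast
  qed
  then show ?thesis using L(2) by blast
qed

context cring
begin

text \<open>The function witnesses that the quotient of the ring by \<^term>\<open>L\<close> has finite length.\<close>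

definition ideal_rank_above :: "'a set \<Rightarrow> ('a set \<Rightarrow> nat) \<Rightarrow> bool" where
  "ideal_rank_above L \<rho> \<longleftrightarrow> (\<forall>I J. ideal I R \<longrightarrow> ideal J R \<longrightarrow> L \<subseteq> I \<longrightarrow> I \<subset> J \<longrightarrow> \<rho> I < \<rho> J)"

lemma ideal_closed:
  assumes "ideal I R"
  shows "x \<in> I \<Longrightarrow> x \<in> carrier R" "x \<in> I \<Longrightarrow> y \<in> I \<Longrightarrow> x \<oplus> y \<in> I" "x \<in> I \<Longrightarrow> \<ominus> x \<in> I" "\<zero> \<in> I"
   "x \<in> I \<Longrightarrow> c \<in> carrier R \<Longrightarrow> c \<otimes> x \<in> I" "x \<in> I \<Longrightarrow> c \<in> carrier R \<Longrightarrow> x \<otimes> c \<in> I" "x \<in> I \<Longrightarrow> y \<in> I \<Longrightarrow> x \<ominus> y \<in> I"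
  using ideal.Icarr[OF assms] additive_subgroup.a_closed[OF ideal.axioms(1)[OF assms]] additive_subgroup.a_inv_closed[OF ideal.axioms(1)[OF assms]]
    additive_subgroup.zero_closed[OF ideal.axioms(1)[OF assms]] ideal.I_l_closed[OF assms] ideal.I_r_closed[OF assms]
  by (auto simp: a_minus_def)

lemma set_add_iff: "z \<in> I <+>\<^bsub>R\<^esub> J \<longleftrightarrow> (\<exists>x\<in>I. \<exists>y\<in>J. z = x \<oplus> y)"
  by (auto simp: set_add_def set_mult_def)

text \<open>An ideal that is maximal among those between \<^term>\<open>a \<cdot> m\<close> and \<^term>\<open>a\<close> that avoid a given element has a simple quotient
  in \<^term>\<open>a\<close>, because \<^term>\<open>a\<close> modulo \<^term>\<open>a \<cdot> m\<close> is a vector space over a field.  So passing from \<^term>\<open>a\<close> to this ideal raises the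
  length of the quotient by one.\<close>

lemma ideal_rank_step:
  assumes a: "ideal a R" and m: "maximalideal m R" and ne: "a \<cdot> m \<noteq> a" and \<rho>: "ideal_rank_above a \<rho>"
  shows "\<exists>L \<sigma>. ideal L R \<and> L \<subset> a \<and> ideal_rank_above L \<sigma>"
proof -
  have mi: "ideal m R" using m by (rule maximalideal.axioms)
  have am: "ideal (a \<cdot> m) R" "a \<cdot> m \<subseteq> a" using ideal_prod_is_ideal[OF a mi] ideal_prod_inter[OF a mi] by auto
  then obtain x where x: "x \<in> a" "x \<notin> a \<cdot> m" using ne by blast
  from ideal_maximal_avoiding[OF am(1) x(2) am(2)] obtain L where L: "ideal L R" "a \<cdot> m \<subseteq> L" "L \<subseteq> a" "x \<notin> L"
    "\<forall>J. ideal J R \<and> L \<subseteq> J \<and> J \<subseteq> a \<and> x \<notin> J \<longrightarrow> J = L" by blast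
  note ca = ideal_closed[OF a] and cm = ideal_closed[OF mi] and cL = ideal_closed[OF L(1)]
  have simple: "y \<in> J" if J: "ideal J R" "L \<subseteq> J" "x \<in> J" and y: "y \<in> a" for J y
  proof (cases "y \<in> L")
    case False
    note cJ = ideal_closed[OF J(1)]
    have yc: "y \<in> carrier R" using ca(1)[OF y] .
    let ?I = "L <+>\<^bsub>R\<^esub> PIdl y"
    have yI: "ideal (PIdl y) R" by (rule cgenideal_ideal[OF yc])
    have I: "ideal ?I R" by (rule add_ideals[OF L(1) yI])
    have "?I \<subseteq> a"
    proof
      fix z assume "z \<in> ?I"
      then obtain l c where "l \<in> L" "c \<in> carrier R" "z = l \<oplus> c \<otimes> y" unfolding set_add_iff cgenideal_def by blast
      then show "z \<in> a" using ca(2,5) L(3) y by blast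
    qed
    moreover have LI: "L \<subseteq> ?I"
    proof
      fix l assume l: "l \<in> L"
      have "l = l \<oplus> \<zero> \<otimes> y" using cL(1)[OF l] yc by simp
      then show "l \<in> ?I" using l unfolding set_add_iff cgenideal_def by blast
    qed
    moreover have "y \<in> ?I"
    proof -
      have "y = \<zero> \<oplus> \<one> \<otimes> y" using yc by simp
      then show ?thesis using cL(4) unfolding set_add_iff cgenideal_def by blast
    qed
    ultimately have "x \<in> ?I" using L(5) I False by blast
    then obtain l c where lc: "l \<in> L" "c \<in> carrier R" "x = l \<oplus> c \<otimes> y" unfolding set_add_iff cgenideal_def by blast
    have "c \<notin> m"
    proof
      assume "c \<in> m"
      then have "y \<otimes> c \<in> a \<cdot> m" using y by (intro ideal_prod.prod)
      then have "c \<otimes> y \<in> L" using L(2) m_comm[OF yc lc(2)] by auto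
      then show False using cL(2)[OF lc(1)] lc(3) L(4) by blast
    qed
    let ?M = "m <+>\<^bsub>R\<^esub> PIdl c"
    have M: "ideal ?M R" by (rule add_ideals[OF mi cgenideal_ideal[OF lc(2)]])
    have "m \<subseteq> ?M"
    proof
      fix l assume l: "l \<in> m"
      have "l = l \<oplus> \<zero> \<otimes> c" using cm(1)[OF l] lc(2) by simp
      then show "l \<in> ?M" using l unfolding set_add_iff cgenideal_def by blast
    qed
    moreover have "c \<in> ?M"
    proof -
      have "c = \<zero> \<oplus> \<one> \<otimes> c" using lc(2) by simp
      then show ?thesis using cm(4) unfolding set_add_iff cgenideal_def by blast
    qed
    ultimately have "?M = carrier R"
      using maximalideal.I_maximal[OF m M] ideal_closed(1)[OF M] \<open>c \<notin> m\<close> by blast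
    then have "\<one> \<in> ?M" by simp
    then obtain \<mu> d where md: "\<mu> \<in> m" "d \<in> carrier R" "\<one> = \<mu> \<oplus> d \<otimes> c" unfolding set_add_iff cgenideal_def by blast
    have \<mu>c: "\<mu> \<in> carrier R" using cm(1)[OF md(1)] .
    have lcr: "l \<in> carrier R" using cL(1)[OF lc(1)] .
    have "y \<otimes> \<mu> \<in> L" using L(2) ideal_prod.prod[OF y md(1), of R] by blast
    then have 1: "y \<otimes> \<mu> \<in> J" using J(2) by blast
    have "c \<otimes> y = x \<ominus> l" using lc lcr yc by (simp add: a_minus_def a_ac r_neg1 r_neg2)
    then have "c \<otimes> y \<in> J" using cJ(7)[OF J(3)] J(2) lc(1) by auto
    then have 2: "d \<otimes> (c \<otimes> y) \<in> J" using cJ(5) md(2) by blast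
    have "y = \<one> \<otimes> y" using yc by simp
    also have "\<dots> = y \<otimes> \<mu> \<oplus> d \<otimes> (c \<otimes> y)" unfolding md(3) using \<mu>c md(2) lc(2) yc by (simp add: l_distr m_assoc m_comm[of y \<mu>])
    finally show ?thesis using cJ(2)[OF 1 2] by simp
  qed (use J in blast)
  \<comment> \<open>The rank of the sum with \<^term>\<open>a\<close>, raised by one for the ideals that contain \<^term>\<open>x\<close>.\<close>
  let ?\<sigma> = "\<lambda>J. \<rho> (J <+>\<^bsub>R\<^esub> a) + (if x \<in> J then 1 else 0 :: nat)"
  have "?\<sigma> I < ?\<sigma> J" if I: "ideal I R" and J: "ideal J R" and LI: "L \<subseteq> I" and IJ: "I \<subset> J" for I J
  proof -
    note cI = ideal_closed[OF I] and cJ = ideal_closed[OF J]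
    have sI: "ideal (I <+>\<^bsub>R\<^esub> a) R" and sJ: "ideal (J <+>\<^bsub>R\<^esub> a) R" using add_ideals a I J by auto
    have aI: "a \<subseteq> I <+>\<^bsub>R\<^esub> a"
    proof
      fix y assume "y \<in> a"
      moreover then have "y = \<zero> \<oplus> y" using ca(1) by simp
      ultimately show "y \<in> I <+>\<^bsub>R\<^esub> a" using cI(4) unfolding set_add_iff by blast
    qed
    have mono: "I <+>\<^bsub>R\<^esub> a \<subseteq> J <+>\<^bsub>R\<^esub> a" using IJ unfolding subset_iff set_add_iff by blast
    show ?thesis
    proof (cases "I <+>\<^bsub>R\<^esub> a = J <+>\<^bsub>R\<^esub> a")
      case False
      then have "\<rho> (I <+>\<^bsub>R\<^esub> a) < \<rho> (J <+>\<^bsub>R\<^esub> a)" using \<rho> sI sJ aI mono unfolding ideal_rank_above_def by blast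
      then show ?thesis using IJ by auto
    next
      case True
      have Jsub: "y \<in> I" if y: "y \<in> J" and h: "\<And>b. b \<in> a \<Longrightarrow> b \<in> J \<Longrightarrow> b \<in> I" for y
      proof -
        have yc: "y \<in> carrier R" using cJ(1)[OF y] .
        have "y = y \<oplus> \<zero>" using yc by simp
        then have "y \<in> J <+>\<^bsub>R\<^esub> a" using y ca(4) unfolding set_add_iff by blast
        then obtain j b where jb: "j \<in> I" "b \<in> a" "y = j \<oplus> b" unfolding True[symmetric] set_add_iff by blast
        have c: "j \<in> carrier R" "b \<in> carrier R" using cI(1)[OF jb(1)] ca(1)[OF jb(2)] .
        have "b = y \<ominus> j" using minus_add_cancel[OF c(2,1)] a_comm[OF c] jb(3) by simp
        then have "b \<in> J" using cJ(7)[OF y] jb(1) IJ by blast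
        then show ?thesis using h jb cI(2) by blast
      qed
      have "x \<notin> I"
      proof
        assume "x \<in> I"
        then have "J \<subseteq> I" using Jsub simple[OF I LI] by blast
        then show False using IJ by blast
      qed
      moreover have "x \<in> J"
      proof (rule ccontr)
        assume xJ: "x \<notin> J"
        have "ideal (J \<inter> a) R" by (rule i_intersect[OF J a])
        then have "J \<inter> a = L" using L(3,5) xJ LI IJ by blast
        then have "J \<subseteq> I" using Jsub LI by blast
        then show False using IJ by blast
      qed
      ultimately show ?thesis using True by simp
    qed
  qed
  then have "ideal_rank_above L ?\<sigma>" unfolding ideal_rank_above_def by blast
  then show ?thesis using L(1,3,4) x(1) by blast
qed

text \<open>Let \<open>a\<close> be minimal among the ideals with quotient of finite length. By
  \<open>ideal_rank_step\<close>, \<open>a \<cdot> m = a\<close> for every maximal ideal \<open>m\<close>. If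
  \<open>a\<close> is not zero, choose an ideal \<open>b\<close> minimal among those that do not annihilate
  \<open>a\<close>, and \<open>x\<close> in \<open>b\<close> that does not annihilate \<open>a\<close>. For
  every maximal ideal \<open>m\<close>, minimality of \<open>b\<close> shows that \<open>x\<close> is a multiple
  of \<open>x \<otimes> \<mu>\<close> for some \<open>\<mu>\<close> in \<open>m\<close>, so that \<open>x\<close> is annihilated
  by an element outside \<open>m\<close>. Hence the annihilator of \<open>x\<close> lies in no maximal ideal and
  is the whole ring, a contradiction.\<close>

lemma artinian_ideal_rank:
  assumes "artinian R" shows "\<exists>\<rho>. ideal_rank_above {\<zero>} \<rho>"
proof -
  let ?G = "{L. ideal L R \<and> (\<exists>\<rho>. ideal_rank_above L \<rho>)}"
  have "carrier R \<in> ?G"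
    unfolding ideal_rank_above_def using oneideal ideal_closed(1) by blast
  then obtain a where a: "a \<in> ?G" "\<forall>J \<in> ?G. J \<subseteq> a \<longrightarrow> J = a" using artinian_minimal_ideal[OF assms, of ?G] by blast
  have ai: "ideal a R" using a(1) by blast
  note ca = ideal_closed[OF ai]
  have am: "a \<cdot> m = a" if "maximalideal m R" for m
    using ideal_rank_step[OF ai that] a by blast
  have "a = {\<zero>}"
  proof (rule ccontr)
    assume "a \<noteq> {\<zero>}"
    then obtain y0 where y0: "y0 \<in> a" "y0 \<noteq> \<zero>" using ca(4) by blast
    let ?F = "{b. ideal b R \<and> (\<exists>x\<in>b. \<exists>y\<in>a. x \<otimes> y \<noteq> \<zero>)}"
    have "\<one> \<otimes> y0 \<noteq> \<zero>" using y0 ca(1) by simp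
    then have "carrier R \<in> ?F" using oneideal y0 by blast
    then have Fne: "?F \<noteq> {}" by (metis empty_iff)
    have "\<forall>I \<in> ?F. ideal I R" by simp
    from artinian_minimal_ideal[OF assms Fne this] obtain b where b: "b \<in> ?F" "\<forall>J \<in> ?F. J \<subseteq> b \<longrightarrow> J = b" by (elim bexE)
    then obtain x y where xy: "x \<in> b" "y \<in> a" "x \<otimes> y \<noteq> \<zero>" and bi: "ideal b R" by blast
    have xc: "x \<in> carrier R" using ideal_closed(1)[OF bi xy(1)] .
    have yc: "y \<in> carrier R" using ca(1)[OF xy(2)] .
    have key: "\<exists>z\<in>m. z \<in> carrier R \<and> x \<otimes> (\<one> \<ominus> z) = \<zero>" if m: "maximalideal m R" for m
    proof -
      have mi: "ideal m R" using m by (rule maximalideal.axioms)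
      have "\<exists>z\<in>a. \<exists>\<mu>\<in>m. x \<otimes> (z \<otimes> \<mu>) \<noteq> \<zero>"
      proof (rule ccontr)
        assume "\<not> ?thesis"
        then have z: "x \<otimes> (z \<otimes> \<mu>) = \<zero>" if "z \<in> a" "\<mu> \<in> m" for z \<mu> using that by blast
        have "w \<in> carrier R \<and> x \<otimes> w = \<zero>" if "w \<in> a \<cdot> m" for w
          using that
        proof (induction rule: ideal_prod.induct)
          case (prod i j)
          then show ?case using z ca(1) ideal_closed(1)[OF mi] by simp
        next
          case (sum s1 s2)
          then show ?case using xc by (simp add: r_distr)
        qed
        then show False using xy am[OF m] by blast
      qed
      then obtain z \<mu> where z\<mu>: "z \<in> a" "\<mu> \<in> m" "x \<otimes> (z \<otimes> \<mu>) \<noteq> \<zero>" by blast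
      have c: "z \<in> carrier R" "\<mu> \<in> carrier R" using ca(1)[OF z\<mu>(1)] ideal_closed(1)[OF mi z\<mu>(2)] .
      let ?w = "x \<otimes> \<mu>"
      have w: "?w \<in> carrier R" "ideal (PIdl ?w) R" "?w \<in> PIdl ?w" using xc c cgenideal_ideal cgenideal_self by auto
      have "?w \<otimes> z \<noteq> \<zero>" using z\<mu>(3) xc c by (simp add: m_ac)
      then have "PIdl ?w \<in> ?F" using w z\<mu>(1) by blast
      moreover have "PIdl ?w \<subseteq> b" unfolding cgenideal_def using ideal_closed(5,6)[OF bi] xy(1) c by blast
      ultimately have "PIdl ?w = b" using b(2) by blast
      then obtain r where r: "r \<in> carrier R" "x = r \<otimes> ?w" using xy(1) unfolding cgenideal_def by blast
      have "x \<otimes> (\<one> \<ominus> r \<otimes> \<mu>) = x \<ominus> r \<otimes> ?w" using xc c r(1) by (simp add: a_minus_def r_distr r_minus m_ac)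
      also have "\<dots> = \<zero>" using r(2) xc minus_self by metis
      finally have "x \<otimes> (\<one> \<ominus> r \<otimes> \<mu>) = \<zero>" .
      then show ?thesis using ideal_closed(5)[OF mi z\<mu>(2) r(1)] r(1) c by blast
    qed
    let ?N = "{k \<in> carrier R. x \<otimes> k = \<zero>}"
    have N: "ideal ?N R"
    proof (rule idealI[OF ring_axioms])
      show "subgroup ?N (add_monoid R)"
        by (rule add.subgroupI) (use xc in \<open>auto simp: r_distr r_minus simp flip: a_inv_def intro!: exI[of _ \<zero>]\<close>)
    qed (use xc in \<open>auto simp flip: m_assoc simp: m_lcomm m_comm\<close>)
    have "\<one> \<notin> ?N" using xc xy yc by auto
    then have "?N \<noteq> carrier R" by blast
    then obtain m where m: "maximalideal m R" "?N \<subseteq> m" using exists_maximalideal[OF N] by blast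
    have mi: "ideal m R" using m(1) by (rule maximalideal.axioms)
    obtain z where z: "z \<in> m" "z \<in> carrier R" "x \<otimes> (\<one> \<ominus> z) = \<zero>" using key[OF m(1)] by blast
    then have "\<one> \<ominus> z \<in> m" using m(2) by blast
    then have "(\<one> \<ominus> z) \<oplus> z \<in> m" using ideal_closed(2)[OF mi] z(1) by blast
    then have "\<one> \<in> m" using z(2) by simp
    then have "m = carrier R" using ideal.one_imp_carrier[OF mi] by blast
    then show False using maximalideal.I_notcarr[OF m(1)] by blast
  qed
  then show ?thesis using a(1) by blast
qed

lemma submodule_regm_ideal: "submodule U R (regm R) \<Longrightarrow> ideal U R"
proof -
  interpret left_module R "regm R" by (rule left_module_regm)
  assume U: "submodule U R (regm R)"
  show ?thesis
  proof (rule idealI[OF ring_axioms])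
    show "subgroup U (add_monoid R)"
      using submodule.axioms(1)[OF U] by (simp add: subgroup_def regm_def m_inv_def)
    show "x \<otimes> a \<in> U" "a \<otimes> x \<in> U" if "a \<in> U" "x \<in> carrier R" for a x
      using submodule_smult[OF U that(2,1)] submodule_mem[OF U that(1)] m_comm[of a x] that(2) by simp_all
  qed
qed

lemma artinian_finite_length:
  assumes "artinian R" shows "finite_length R (regm R)"
proof -
  obtain \<rho> where \<rho>: "ideal_rank_above {\<zero>} \<rho>" using artinian_ideal_rank[OF assms] by blast
  have "rank_on R (regm R) (carrier (regm R)) \<rho>"
    unfolding rank_on_def
  proof (intro allI impI)
    fix U V assume "submodule U R (regm R)" "submodule V R (regm R)" and UV: "U \<subset> V"
    then have I: "ideal U R" "ideal V R" using submodule_regm_ideal by auto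
    have "{\<zero>} \<subseteq> U" using ideal_closed(4)[OF I(1)] by simp
    then show "\<rho> U < \<rho> V" using \<rho> I UV unfolding ideal_rank_above_def by blast
  qed
  then show ?thesis unfolding finite_length_on_def by blast
qed

end

lemma rank_on_transfer:
  assumes "finite_length_on S N H" "\<And>U. submodule U R M \<Longrightarrow> submodule U S N"
  shows "finite_length_on R M H"
proof -
  obtain \<rho> where "rank_on S N H \<rho>" using assms(1) unfolding finite_length_on_def by blast
  then have "rank_on R M H \<rho>" unfolding rank_on_def using assms(2) by simp
  then show ?thesis unfolding finite_length_on_def by blast
qed

context artin_algebra
begin

lemma left_module_base: "left_module K A"
proof (intro left_module.intro left_module_axioms.intro)
  show "ring K" by (rule R.ring_axioms)
  show "abelian_group A" by (rule M.abelian_group_axioms)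
qed (rule smult_closed smult_l_distr smult_r_distr smult_assoc1 smult_one, assumption+)+

lemma finite_length_base: "finite_length K A"
  by (rule fg_imp_finite_length) (use left_module_base fin_gen R.artinian_finite_length[OF artinian_base] in \<open>auto simp: fg_module_def\<close>)

lemma smult_one_mult: "c \<in> carrier K \<Longrightarrow> x \<in> carrier A \<Longrightarrow> c \<odot>\<^bsub>A\<^esub> x = (c \<odot>\<^bsub>A\<^esub> \<one>\<^bsub>A\<^esub>) \<otimes>\<^bsub>A\<^esub> x"
  using smult_mult_left[of c "\<one>\<^bsub>A\<^esub>" x] by simp

text \<open>Left ideals are submodules over the base ring, which acts through multiples of the identity (\<open>smult_one_mult\<close>).\<close>

lemma finite_length_ring: "finite_length_ring A"
proof (intro finite_length_ring.intro finite_length_ring_axioms.intro A.ring_axioms)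
  interpret L: left_module A "regm A" by (rule A.left_module_regm)
  interpret KA: left_module K A by (rule left_module_base)
  have "submodule U K A" if U: "submodule U A (regm A)" for U
  proof (rule KA.submoduleI)
    show "U \<subseteq> carrier A" using L.submodule_subset[OF U] by simp
    show "\<zero>\<^bsub>A\<^esub> \<in> U" using L.submodule_zero[OF U] by simp
    show "x \<oplus>\<^bsub>A\<^esub> y \<in> U" if "x \<in> U" "y \<in> U" for x y using L.submodule_add[OF U that] by simp
    show "c \<odot>\<^bsub>A\<^esub> x \<in> U" if "c \<in> carrier K" "x \<in> U" for c x
    proof -
      have x: "x \<in> carrier A" using L.submodule_mem[OF U that(2)] by simp
      have "(c \<odot>\<^bsub>A\<^esub> \<one>\<^bsub>A\<^esub>) \<otimes>\<^bsub>A\<^esub> x \<in> U"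
        using L.submodule_smult[OF U smult_closed[OF that(1) A.one_closed] that(2)] by (simp only: regm_simps)
      then show ?thesis by (simp only: smult_one_mult[OF that(1) x])
    qed
  qed
  then have "finite_length_on A (regm A) (carrier A)" by (rule rank_on_transfer[OF finite_length_base])
  then show "finite_length A (regm A)" by simp
qed

end

section \<open>Free resolutions given by matrices\<close>

lemma lincomb_vecm: "lincomb (vecm T S) s n f c = lincomb (regm T) (\<lambda>i. s i c) n f"
  by (induction n) auto

lemma lincomb_right_mult: "lincomb (right_mult_module A) x n f = lincomb (regm A) f n x"
  by (induction n) (auto simp: right_mult_module_def)

lemma op_ring_simps [simp]: "carrier (op_ring R) = carrier R" "x \<otimes>\<^bsub>op_ring R\<^esub> y = y \<otimes>\<^bsub>R\<^esub> x" "\<zero>\<^bsub>op_ring R\<^esub> = \<zero>\<^bsub>R\<^esub>" "\<one>\<^bsub>op_ring R\<^esub> = \<one>\<^bsub>R\<^esub>"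
  "x \<oplus>\<^bsub>op_ring R\<^esub> y = x \<oplus>\<^bsub>R\<^esub> y"
  by (simp_all add: op_ring_def)

lemma lincomb_op_regm: "lincomb (regm (op_ring R)) x n f = lincomb (regm R) f n x"
  by (induction n) auto

lemma vecs_op_ring [simp]: "vecs (op_ring R) k = vecs R k"
  by (simp add: vecs_def)

lemma (in ring) ring_op_ring: "ring (op_ring R)"
proof (rule ringI)
  show "abelian_group (op_ring R)"
  proof (rule abelian_groupI)
    fix x assume "x \<in> carrier (op_ring R)"
    then show "\<exists>y\<in>carrier (op_ring R). y \<oplus>\<^bsub>op_ring R\<^esub> x = \<zero>\<^bsub>op_ring R\<^esub>" by (intro bexI[of _ "\<ominus> x"]) (auto simp: l_neg)
  qed (auto simp: a_ac)
  show "monoid (op_ring R)" by (rule monoidI) (auto simp: m_assoc)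
qed (auto simp: l_distr r_distr)

lemma hom_factor:
  assumes "left_module R F" "left_module R Y" "left_module R G" and p: "p \<in> module_hom R F Y" "p ` carrier F = carrier Y"
    and e: "e \<in> module_hom R F G" and k: "\<And>x. x \<in> carrier F \<Longrightarrow> p x = \<zero>\<^bsub>Y\<^esub> \<Longrightarrow> e x = \<zero>\<^bsub>G\<^esub>"
  shows "\<exists>i \<in> module_hom R Y G. \<forall>x \<in> carrier F. i (p x) = e x"
proof -
  interpret F: left_module R F by fact
  interpret Y: left_module R Y by fact
  interpret G: left_module R G by fact
  define i where "i y = e (SOME x. x \<in> carrier F \<and> p x = y)" for y
  have wd: "e x = e x'" if "x \<in> carrier F" "x' \<in> carrier F" "p x = p x'" for x x'
  proof -
    have "p (x \<ominus>\<^bsub>F\<^esub> x') = \<zero>\<^bsub>Y\<^esub>" using hom_diff[OF assms(1,2) p(1) that(1,2)] that(3) hom_closed[OF p(1) that(2)] by simp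
    then have "e (x \<ominus>\<^bsub>F\<^esub> x') = \<zero>\<^bsub>G\<^esub>" using k that(1,2) by simp
    then show ?thesis using hom_diff[OF assms(1,3) e that(1,2)] hom_closed[OF e that(1)] hom_closed[OF e that(2)] by simp
  qed
  have ip: "i (p x) = e x" if "x \<in> carrier F" for x
  proof -
    have "\<exists>x'. x' \<in> carrier F \<and> p x' = p x" using that by blast
    from someI_ex[OF this] show ?thesis unfolding i_def using wd that by blast
  qed
  have "i \<in> module_hom R Y G"
  proof (rule homI)
    fix y assume "y \<in> carrier Y"
    then obtain x where x: "x \<in> carrier F" "y = p x" using p(2) by blast
    then show "i y \<in> carrier G" using ip hom_closed[OF e] by simp
    fix y' assume "y' \<in> carrier Y"
    then obtain x' where x': "x' \<in> carrier F" "y' = p x'" using p(2) by blast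
    have "y \<oplus>\<^bsub>Y\<^esub> y' = p (x \<oplus>\<^bsub>F\<^esub> x')" using x x' hom_add[OF p(1)] by simp
    then show "i (y \<oplus>\<^bsub>Y\<^esub> y') = i y \<oplus>\<^bsub>G\<^esub> i y'" using x x' ip hom_add[OF e] by simp
  next
    fix a y assume a: "a \<in> carrier R" and "y \<in> carrier Y"
    then obtain x where x: "x \<in> carrier F" "y = p x" using p(2) by blast
    have "a \<odot>\<^bsub>Y\<^esub> y = p (a \<odot>\<^bsub>F\<^esub> x)" using a x hom_smult[OF p(1)] by simp
    then show "i (a \<odot>\<^bsub>Y\<^esub> y) = a \<odot>\<^bsub>G\<^esub> i y" using a x ip hom_smult[OF e] by simp
  qed
  then show ?thesis using ip by blast
qed

text \<open>Row \<^term>\<open>i\<close> of the matrix of the \<^term>\<open>n\<close>-th differential is \<^term>\<open>r n i\<close>; a row vector is multiplied by the matrix from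
  the right.\<close>

definition rmul :: "('a, 'r) ring_scheme \<Rightarrow> (nat \<Rightarrow> nat) \<Rightarrow> (nat \<Rightarrow> nat \<Rightarrow> nat \<Rightarrow> 'a) \<Rightarrow> nat \<Rightarrow> (nat \<Rightarrow> 'a) \<Rightarrow> nat \<Rightarrow> 'a" where
  "rmul S k r n = lincomb (free S (k n)) (r n) (k (Suc n))"

text \<open>A free resolution, without its augmentation, given by its matrices, so that the matrices can act on other
  modules. The ranks are \<^term>\<open>k\<close>.\<close>

locale free_res = ring S for S (structure) +
  fixes k :: "nat \<Rightarrow> nat" and r :: "nat \<Rightarrow> nat \<Rightarrow> nat \<Rightarrow> 'a"
  assumes rows: "r n i \<in> vecs S (k n)"
    and complex: "rmul S k r n (r (Suc n) i) = (\<lambda>_. \<zero>)"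
    and exact: "x \<in> vecs S (k (Suc n)) \<Longrightarrow> rmul S k r n x = (\<lambda>_. \<zero>) \<Longrightarrow> \<exists>y \<in> vecs S (k (Suc (Suc n))). rmul S k r (Suc n) y = x"
begin

text \<open>Exactness at \<open>L \<otimes> S^(k (Suc n))\<close> of the resolution tensored with the right \<^term>\<open>S\<close>-module
  \<^term>\<open>L\<close>. Elements of the tensor products are tuples over \<^term>\<open>L\<close>, and the scalars act from the right,
  that is, through the opposite ring.\<close>

definition tensor_exact :: "('a, 'l, 'p) module_scheme \<Rightarrow> nat \<Rightarrow> bool" where
  "tensor_exact L n \<longleftrightarrow> (\<forall>x. (\<forall>i. x i \<in> carrier L) \<longrightarrow> (\<forall>j. lincomb L x (k (Suc n)) (\<lambda>i. r n i j) = \<zero>\<^bsub>L\<^esub>) \<longrightarrow>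
     (\<exists>y. (\<forall>i. y i \<in> carrier L) \<and> (\<forall>i<k (Suc n). x i = lincomb L y (k (Suc (Suc n))) (\<lambda>m. r (Suc n) m i))))"

lemma row_entry: "r n i j \<in> carrier S"
  using vecs_carrier[OF rows] .

lemma rmul_hom: "rmul S k r n \<in> module_hom S (free S (k (Suc n))) (free S (k n))"
  unfolding rmul_def using free_hom[OF left_module_free] rows by simp

lemma rmul_entry: "rmul S k r n x j = lincomb (regm S) (\<lambda>i. r n i j) (k (Suc n)) x"
  unfolding rmul_def lincomb_vecm ..

text \<open>Tensoring with the regular right module gives the resolution back.\<close>

lemma tensor_exact_regular: "tensor_exact (regm (op_ring S)) n"
  unfolding tensor_exact_def
proof (intro allI impI)
  fix x assume x: "\<forall>i. x i \<in> carrier (regm (op_ring S))" "\<forall>j. lincomb (regm (op_ring S)) x (k (Suc n)) (\<lambda>i. r n i j) = \<zero>\<^bsub>regm (op_ring S)\<^esub>"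
  let ?x = "\<lambda>i. if i < k (Suc n) then x i else \<zero>"
  have "?x \<in> vecs S (k (Suc n))" using x(1) by (simp add: vecs_def)
  moreover have "rmul S k r n ?x = (\<lambda>_. \<zero>)"
  proof
    fix j
    have "lincomb (regm S) (\<lambda>i. r n i j) (k (Suc n)) ?x = lincomb (regm S) (\<lambda>i. r n i j) (k (Suc n)) x" by (rule lincomb_cong) auto
    then show "rmul S k r n ?x j = \<zero>" using x(2) by (simp add: rmul_entry lincomb_op_regm)
  qed
  ultimately obtain y where y: "y \<in> vecs S (k (Suc (Suc n)))" "rmul S k r (Suc n) y = ?x" using exact by blast
  have "x i = lincomb (regm (op_ring S)) y (k (Suc (Suc n))) (\<lambda>m. r (Suc n) m i)" if "i < k (Suc n)" for i
    using fun_cong[OF y(2), of i] that by (simp add: rmul_entry lincomb_op_regm)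
  then show "\<exists>y. (\<forall>i. y i \<in> carrier (regm (op_ring S))) \<and> (\<forall>i<k (Suc n). x i = lincomb (regm (op_ring S)) y (k (Suc (Suc n))) (\<lambda>m. r (Suc n) m i))"
    using y(1) by (intro exI[of _ y]) (auto simp: vecs_carrier)
qed

lemma lincomb_op_zero:
  assumes "left_module (op_ring S) L" "\<forall>i. y i \<in> carrier L" shows "lincomb L y p (\<lambda>i. \<zero>) = \<zero>\<^bsub>L\<^esub>"
proof -
  interpret L: left_module "op_ring S" L by fact
  show ?thesis by (induction p) (use assms(2) L.smult_l_null in auto)
qed

lemma lincomb_matrix_assoc:
  assumes L: "left_module (op_ring S) L" and y: "\<forall>i. y i \<in> carrier L" and M: "\<forall>m i. M m i \<in> carrier S" and E: "\<forall>i. E i \<in> carrier S"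
  shows "lincomb L (\<lambda>i. lincomb L y p (\<lambda>m. M m i)) q E = lincomb L y p (\<lambda>m. lincomb (regm S) E q (M m))"
proof -
  interpret L: left_module "op_ring S" L by fact
  interpret G: left_module S "regm S" by (rule left_module_regm)
  show ?thesis
  proof (induction q)
    case 0
    show ?case using lincomb_op_zero[OF L y] by simp
  next
    case (Suc q)
    have c: "lincomb (regm S) E q (M m) \<in> carrier S" for m using G.lincomb_closed[of E "M m"] E M by simp
    have "lincomb L y p (\<lambda>m. lincomb (regm S) E (Suc q) (M m)) = lincomb L y p (\<lambda>m. lincomb (regm S) E q (M m) \<oplus>\<^bsub>op_ring S\<^esub> E q \<otimes>\<^bsub>op_ring S\<^esub> M m q)"
      by simp
    also have "\<dots> = lincomb L y p (\<lambda>m. lincomb (regm S) E q (M m)) \<oplus>\<^bsub>L\<^esub> lincomb L y p (\<lambda>m. E q \<otimes>\<^bsub>op_ring S\<^esub> M m q)"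
      by (rule L.lincomb_add) (use y c E M in auto)
    also have "lincomb L y p (\<lambda>m. E q \<otimes>\<^bsub>op_ring S\<^esub> M m q) = E q \<odot>\<^bsub>L\<^esub> lincomb L y p (\<lambda>m. M m q)"
      by (rule L.lincomb_smult) (use y E M in auto)
    finally show ?case using Suc by simp
  qed
qed

lemma tensor_complex:
  assumes L: "left_module (op_ring S) L" and y: "\<forall>i. y i \<in> carrier L"
  shows "lincomb L (\<lambda>i. lincomb L y (k (Suc (Suc n))) (\<lambda>m. r (Suc n) m i)) (k (Suc n)) (\<lambda>i. r n i j) = \<zero>\<^bsub>L\<^esub>"
proof -
  have "lincomb L (\<lambda>i. lincomb L y (k (Suc (Suc n))) (\<lambda>m. r (Suc n) m i)) (k (Suc n)) (\<lambda>i. r n i j) =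
    lincomb L y (k (Suc (Suc n))) (\<lambda>m. lincomb (regm S) (\<lambda>i. r n i j) (k (Suc n)) (r (Suc n) m))"
    by (rule lincomb_matrix_assoc[OF L y]) (simp_all add: row_entry)
  also have "\<dots> = lincomb L y (k (Suc (Suc n))) (\<lambda>m. \<zero>)"
    using fun_cong[OF complex, of n _ j] by (simp add: rmul_entry)
  finally show ?thesis using lincomb_op_zero[OF L y] by simp
qed

text \<open>A projective module is a retract of a free one, on which exactness holds coordinatewise.\<close>

lemma tensor_exact_projective:
  assumes Q: "projective (op_ring S) Q" shows "tensor_exact Q n"
proof -
  interpret O: ring "op_ring S" by (rule ring_op_ring)
  obtain p where "retract (op_ring S) Q (free (op_ring S) p)" using O.projective_retract_free[OF Q] .
  then obtain i q where i: "i \<in> module_hom (op_ring S) Q (free (op_ring S) p)" and q: "q \<in> module_hom (op_ring S) (free (op_ring S) p) Q"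
    and qi: "\<And>x. x \<in> carrier Q \<Longrightarrow> q (i x) = x" unfolding retract_def by blast
  let ?F = "free (op_ring S) p" and ?G = "regm (op_ring S)"
  have lQ: "left_module (op_ring S) Q" using Q by blast
  have lF: "left_module (op_ring S) ?F" by (rule O.left_module_free)
  interpret Q: left_module "op_ring S" Q by fact
  show ?thesis
    unfolding tensor_exact_def
  proof (intro allI impI)
    fix x assume x: "\<forall>i. x i \<in> carrier Q" "\<forall>j. lincomb Q x (k (Suc n)) (\<lambda>i. r n i j) = \<zero>\<^bsub>Q\<^esub>"
    have ic: "i (x l) \<in> vecs S p" for l using hom_closed[OF i, of "x l"] x(1) by simp
    have "\<exists>y. (\<forall>m. y m \<in> carrier ?G) \<and> (\<forall>l<k (Suc n). i (x l) c = lincomb ?G y (k (Suc (Suc n))) (\<lambda>m. r (Suc n) m l))" for c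
    proof -
      have "lincomb ?G (\<lambda>l. i (x l) c) (k (Suc n)) (\<lambda>l. r n l j) = \<zero>\<^bsub>?G\<^esub>" for j
      proof -
        have "i (lincomb Q x (k (Suc n)) (\<lambda>l. r n l j)) = lincomb ?F (\<lambda>l. i (x l)) (k (Suc n)) (\<lambda>l. r n l j)"
          by (rule hom_lincomb[OF lQ lF i]) (use x(1) row_entry in auto)
        then have "lincomb ?F (\<lambda>l. i (x l)) (k (Suc n)) (\<lambda>l. r n l j) = (\<lambda>_. \<zero>)" using x(2) hom_zero[OF lQ lF i] by simp
        from fun_cong[OF this, of c] show ?thesis by (simp add: lincomb_vecm)
      qed
      moreover have "\<forall>l. i (x l) c \<in> carrier ?G" using vecs_carrier[OF ic] by simp
      moreover have "(\<forall>l. i (x l) c \<in> carrier ?G) \<longrightarrow> (\<forall>j. lincomb ?G (\<lambda>l. i (x l) c) (k (Suc n)) (\<lambda>l. r n l j) = \<zero>\<^bsub>?G\<^esub>) \<longrightarrow>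
        (\<exists>y. (\<forall>m. y m \<in> carrier ?G) \<and> (\<forall>l<k (Suc n). i (x l) c = lincomb ?G y (k (Suc (Suc n))) (\<lambda>m. r (Suc n) m l)))"
        using tensor_exact_regular[of n] unfolding tensor_exact_def by (rule spec)
      ultimately show ?thesis by blast
    qed
    then obtain y where y: "\<And>c m. y c m \<in> carrier S" "\<And>c l. l < k (Suc n) \<Longrightarrow> i (x l) c = lincomb ?G (y c) (k (Suc (Suc n))) (\<lambda>m. r (Suc n) m l)"
      by (metis regm_simps(1) op_ring_simps(1))
    let ?Y = "\<lambda>m c. if c < p then y c m else \<zero>"
    have Y: "?Y m \<in> carrier ?F" for m using y(1) by (simp add: vecs_def)
    have "x l = lincomb Q (\<lambda>m. q (?Y m)) (k (Suc (Suc n))) (\<lambda>m. r (Suc n) m l)" if l: "l < k (Suc n)" for l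
    proof -
      have "i (x l) c = lincomb ?F ?Y (k (Suc (Suc n))) (\<lambda>m. r (Suc n) m l) c" for c
      proof (cases "c < p")
        case True
        then show ?thesis using y(2)[OF l] by (simp add: lincomb_vecm)
      next
        case False
        have "lincomb ?G (\<lambda>_. \<zero>) K f = \<zero>" if "\<forall>m. f m \<in> carrier S" for K and f :: "nat \<Rightarrow> 'a" by (induction K) (use that in auto)
        then show ?thesis using False ic[of l] row_entry by (simp add: lincomb_vecm vecs_def)
      qed
      then have "i (x l) = lincomb ?F ?Y (k (Suc (Suc n))) (\<lambda>m. r (Suc n) m l)" by (rule ext)
      then have "x l = q (lincomb ?F ?Y (k (Suc (Suc n))) (\<lambda>m. r (Suc n) m l))" using qi[of "x l"] x(1) by metis
      also have "\<dots> = lincomb Q (\<lambda>m. q (?Y m)) (k (Suc (Suc n))) (\<lambda>m. r (Suc n) m l)"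
        by (rule hom_lincomb[OF lF lQ q]) (use Y row_entry in auto)
      finally show ?thesis .
    qed
    then show "\<exists>y. (\<forall>i. y i \<in> carrier Q) \<and> (\<forall>i<k (Suc n). x i = lincomb Q y (k (Suc (Suc n))) (\<lambda>m. r (Suc n) m i))"
      using hom_closed[OF q Y] by (intro exI[of _ "\<lambda>m. q (?Y m)"]) simp
  qed
qed

text \<open>Dimension shift along the kernel \<open>N\<close> of \<^term>\<open>e\<close>. A cycle over \<^term>\<open>L\<close> lifts to
  \<^term>\<open>Q\<close>; the boundary of the lift is a cycle over \<open>N\<close>, hence the boundary of a tuple over
  \<open>N\<close>, and after subtraction of the latter the lift is a cycle over \<^term>\<open>Q\<close>.\<close>

lemma tensor_exact_quotient:
  assumes lQ: "left_module (op_ring S) Q" and lL: "left_module (op_ring S) L" and e: "e \<in> module_hom (op_ring S) Q L" "e ` carrier Q = carrier L"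
    and N: "tensor_exact (Q\<lparr>carrier := kern Q L e\<rparr>) n" and Q: "tensor_exact Q (Suc n)"
  shows "tensor_exact L (Suc n)"
  unfolding tensor_exact_def
proof (intro allI impI)
  interpret Q: left_module "op_ring S" Q by fact
  interpret L: left_module "op_ring S" L by fact
  let ?N = "Q\<lparr>carrier := kern Q L e\<rparr>"
  have lc: "lincomb ?N s m f = lincomb Q s m f" for s m f by (induction m) auto
  fix x assume x: "\<forall>i. x i \<in> carrier L" "\<forall>j. lincomb L x (k (Suc (Suc n))) (\<lambda>i. r (Suc n) i j) = \<zero>\<^bsub>L\<^esub>"
  have "\<forall>i. \<exists>u \<in> carrier Q. e u = x i" using x(1) e(2) by (metis imageE)
  then obtain u where u: "\<And>i. u i \<in> carrier Q" "\<And>i. e (u i) = x i" by metis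
  let ?v = "\<lambda>j. lincomb Q u (k (Suc (Suc n))) (\<lambda>i. r (Suc n) i j)"
  have vQ: "?v j \<in> carrier Q" for j using Q.lincomb_closed u(1) row_entry by simp
  have "e (?v j) = \<zero>\<^bsub>L\<^esub>" for j
    using hom_lincomb[OF lQ lL e(1), of u "\<lambda>i. r (Suc n) i j"] u row_entry x(2) by simp
  then have vN: "\<forall>j. ?v j \<in> carrier ?N" using vQ by (simp add: kern_def)
  have "\<forall>j. lincomb ?N ?v (k (Suc n)) (\<lambda>i. r n i j) = \<zero>\<^bsub>?N\<^esub>"
    unfolding lc using tensor_complex[OF lQ] u(1) by simp
  moreover have "(\<forall>j. ?v j \<in> carrier ?N) \<longrightarrow> (\<forall>j. lincomb ?N ?v (k (Suc n)) (\<lambda>i. r n i j) = \<zero>\<^bsub>?N\<^esub>) \<longrightarrow>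
      (\<exists>z. (\<forall>i. z i \<in> carrier ?N) \<and> (\<forall>i<k (Suc n). ?v i = lincomb ?N z (k (Suc (Suc n))) (\<lambda>m. r (Suc n) m i)))"
    using N unfolding tensor_exact_def by (rule spec)
  ultimately have "\<exists>z. (\<forall>i. z i \<in> carrier ?N) \<and> (\<forall>i<k (Suc n). ?v i = lincomb ?N z (k (Suc (Suc n))) (\<lambda>m. r (Suc n) m i))"
    using vN by blast
  then obtain z where z: "\<forall>i. z i \<in> carrier ?N" "\<forall>i<k (Suc n). ?v i = lincomb Q z (k (Suc (Suc n))) (\<lambda>m. r (Suc n) m i)"
    unfolding lc by (elim exE conjE)
  have zQ: "z i \<in> carrier Q" "e (z i) = \<zero>\<^bsub>L\<^esub>" for i using z(1) by (auto simp: kern_def)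
  let ?w = "\<lambda>i. u i \<oplus>\<^bsub>Q\<^esub> (\<ominus>\<^bsub>Q\<^esub> z i)"
  have lcdiff: "lincomb Q ?w m f = lincomb Q u m f \<ominus>\<^bsub>Q\<^esub> lincomb Q z m f" if f: "\<forall>i. f i \<in> carrier S" for m f
  proof (induction m)
    case 0
    then show ?case by simp
  next
    case (Suc m)
    have c: "lincomb Q u m f \<in> carrier Q" "lincomb Q z m f \<in> carrier Q" using Q.lincomb_closed u(1) zQ(1) f by auto
    have fu: "f m \<odot>\<^bsub>Q\<^esub> u m \<in> carrier Q" "f m \<odot>\<^bsub>Q\<^esub> z m \<in> carrier Q" "f m \<in> carrier (op_ring S)" using u(1) zQ(1) f by auto
    have "f m \<odot>\<^bsub>Q\<^esub> (\<ominus>\<^bsub>Q\<^esub> z m) = \<ominus>\<^bsub>Q\<^esub> (f m \<odot>\<^bsub>Q\<^esub> z m)"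
      using hom_smult[OF hom_neg_fun[OF lQ hom_id] fu(3) zQ(1)] by simp
    then have "f m \<odot>\<^bsub>Q\<^esub> (?w m) = f m \<odot>\<^bsub>Q\<^esub> u m \<oplus>\<^bsub>Q\<^esub> (\<ominus>\<^bsub>Q\<^esub> (f m \<odot>\<^bsub>Q\<^esub> z m))" using Q.smult_r_distr[OF fu(3) u(1), of "\<ominus>\<^bsub>Q\<^esub> z m"] zQ(1) by simp
    then show ?case using Suc c fu(1,2) by (simp add: a_minus_def Q.M.minus_add Q.M.a_ac)
  qed
  have "\<forall>j. lincomb Q ?w (k (Suc (Suc n))) (\<lambda>i. r (Suc n) i j) = \<zero>\<^bsub>Q\<^esub>"
  proof
    fix j
    show "lincomb Q ?w (k (Suc (Suc n))) (\<lambda>i. r (Suc n) i j) = \<zero>\<^bsub>Q\<^esub>"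
    proof (cases "j < k (Suc n)")
      case True
      then show ?thesis using z(2) lcdiff vQ[of j] row_entry by simp
    next
      case False
      then have "r (Suc n) i j = \<zero>" for i using rows[of "Suc n" i] by (simp add: vecs_def)
      moreover have "\<forall>i. ?w i \<in> carrier Q" using u(1) zQ(1) by simp
      ultimately show ?thesis using lincomb_op_zero[OF lQ] by simp
    qed
  qed
  moreover have "\<forall>i. ?w i \<in> carrier Q" using u(1) zQ(1) by simp
  moreover have "(\<forall>i. ?w i \<in> carrier Q) \<longrightarrow> (\<forall>j. lincomb Q ?w (k (Suc (Suc n))) (\<lambda>i. r (Suc n) i j) = \<zero>\<^bsub>Q\<^esub>) \<longrightarrow>
    (\<exists>y. (\<forall>i. y i \<in> carrier Q) \<and> (\<forall>i<k (Suc (Suc n)). ?w i = lincomb Q y (k (Suc (Suc (Suc n)))) (\<lambda>m. r (Suc (Suc n)) m i)))"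
    using Q unfolding tensor_exact_def by (rule spec)
  ultimately obtain y where y: "\<forall>i. y i \<in> carrier Q" "\<forall>i<k (Suc (Suc n)). ?w i = lincomb Q y (k (Suc (Suc (Suc n)))) (\<lambda>m. r (Suc (Suc n)) m i)"
    by (elim impE exE conjE)
  have "x i = lincomb L (\<lambda>m. e (y m)) (k (Suc (Suc (Suc n)))) (\<lambda>m. r (Suc (Suc n)) m i)" if i: "i < k (Suc (Suc n))" for i
  proof -
    have "e (?w i) = e (u i) \<oplus>\<^bsub>L\<^esub> (\<ominus>\<^bsub>L\<^esub> e (z i))" using hom_add[OF e(1)] hom_neg[OF lQ lL e(1)] u(1) zQ(1) by simp
    also have "\<dots> = x i" using u(2) zQ(2) x(1) L.M.minus_equality[of "\<zero>\<^bsub>L\<^esub>" "\<zero>\<^bsub>L\<^esub>"] by simp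
    finally have "x i = e (lincomb Q y (k (Suc (Suc (Suc n)))) (\<lambda>m. r (Suc (Suc n)) m i))" using y(2) i by simp
    also have "\<dots> = lincomb L (\<lambda>m. e (y m)) (k (Suc (Suc (Suc n)))) (\<lambda>m. r (Suc (Suc n)) m i)"
      by (rule hom_lincomb[OF lQ lL e(1)]) (use y(1) row_entry in auto)
    finally show ?thesis .
  qed
  then show "\<exists>y. (\<forall>i. y i \<in> carrier L) \<and> (\<forall>i<k (Suc (Suc n)). x i = lincomb L y (k (Suc (Suc (Suc n)))) (\<lambda>m. r (Suc (Suc n)) m i))"
    using y(1) hom_closed[OF e(1)] by (intro exI[of _ "\<lambda>m. e (y m)"]) simp
qed

lemma tensor_exact_resolution_fgmod:
  fixes L :: "'a fgmod"
  assumes "left_module (op_ring S) L" "projective_resolution (op_ring S) L P d e" "\<And>i. i \<ge> N \<Longrightarrow> carrier (P i) = {\<zero>\<^bsub>P i\<^esub>}" "n \<ge> N"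
  shows "tensor_exact L n"
  using assms
proof (induction N arbitrary: L P d e n)
  case 0
  interpret L: left_module "op_ring S" L by fact
  have r: "projective (op_ring S) (P 0)" "e \<in> module_hom (op_ring S) (P 0) L" "e ` carrier (P 0) = carrier L"
    using 0(2) by (auto simp: projective_resolution_def)
  have "carrier L = {\<zero>\<^bsub>L\<^esub>}" using r(3) 0(3)[of 0] hom_zero[OF fg_left_module[OF projective_fg[OF r(1)]] 0(1) r(2)] by simp
  then have L0: "x = \<zero>\<^bsub>L\<^esub>" if "x \<in> carrier L" for x using that by blast
  have "lincomb L y p f \<in> carrier L" if "\<forall>i. y i \<in> carrier L" "\<forall>i. f i \<in> carrier S" for y p f
    using L.lincomb_closed that by simp
  then show ?case unfolding tensor_exact_def using L0 row_entry by (intro allI impI exI[of _ "\<lambda>_. \<zero>\<^bsub>L\<^esub>"]) (metis L.M.zero_closed)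
next
  case (Suc N)
  obtain n' where n': "n = Suc n'" "n' \<ge> N" using Suc.prems(4) by (cases n) auto
  have r: "projective (op_ring S) (P 0)" "e \<in> module_hom (op_ring S) (P 0) L" "e ` carrier (P 0) = carrier L"
    using Suc.prems(2) by (auto simp: projective_resolution_def)
  have l: "left_module (op_ring S) (P 0)" using r(1) by blast
  have K: "left_module (op_ring S) ((P 0)\<lparr>carrier := kern (P 0) L e\<rparr>)"
    by (rule left_module.left_module_sub[OF l submodule_kern[OF l Suc.prems(1) r(2)]])
  have "tensor_exact ((P 0)\<lparr>carrier := kern (P 0) L e\<rparr>) n'"
    by (rule Suc.IH[OF K resolution_shift[OF Suc.prems(2)] _ n'(2)]) (use Suc.prems(3) in simp)
  then show ?case unfolding n'(1) by (rule tensor_exact_quotient[OF l Suc.prems(1) r(2,3) _ tensor_exact_projective[OF r(1)]])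
qed

text \<open>The first dimension shift leads from the type of \<^term>\<open>L\<close> to the type of the modules in the
  resolution.\<close>

lemma tensor_exact_resolution:
  assumes L: "left_module (op_ring S) L" "projective_resolution (op_ring S) L P d e" "\<And>i. i > N \<Longrightarrow> carrier (P i) = {\<zero>\<^bsub>P i\<^esub>}" "n > N"
  shows "tensor_exact L n"
proof -
  obtain n' where n': "n = Suc n'" "n' \<ge> N" using L(4) by (cases n) auto
  have r: "projective (op_ring S) (P 0)" "e \<in> module_hom (op_ring S) (P 0) L" "e ` carrier (P 0) = carrier L"
    using L(2) by (auto simp: projective_resolution_def)
  have l: "left_module (op_ring S) (P 0)" using r(1) by blast
  have K: "left_module (op_ring S) ((P 0)\<lparr>carrier := kern (P 0) L e\<rparr>)"
    by (rule left_module.left_module_sub[OF l submodule_kern[OF l L(1) r(2)]])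
  have "tensor_exact ((P 0)\<lparr>carrier := kern (P 0) L e\<rparr>) n'"
    by (rule tensor_exact_resolution_fgmod[OF K resolution_shift[OF L(2)] _ n'(2)]) (use L(3) in simp)
  then show ?thesis unfolding n'(1) by (rule tensor_exact_quotient[OF l L(1) r(2,3) _ tensor_exact_projective[OF r(1)]])
qed

end

lemma (in ring) left_ideal_iff: "left_ideal I R \<longleftrightarrow> submodule I R (regm R)"
  by (simp add: left_ideal_def additive_subgroup_def submodule_def submodule_axioms_def subgroup_def regm_def m_inv_def Ball_def)

context finite_length_ring begin

text \<open>Covers of successive kernels by free modules, chosen by recursion.\<close>

lemma exists_free_res:
  assumes X: "fg_module R X"
  shows "\<exists>k r g. free_res R k r \<and> g \<in> module_hom R (free R (k 0)) X \<and> g ` vecs R (k 0) = carrier X \<and>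
    kern (free R (k 0)) X g = rmul R k r 0 ` vecs R (k (Suc 0))"
proof -
  obtain k0 g where g: "g \<in> module_hom R (free R k0) X" "g ` vecs R k0 = carrier X"
    by (rule free_cover[OF X]) (rule that)
  have step: "\<exists>p' h. h \<in> module_hom R (free R p') (free R p) \<and> h ` vecs R p' = W" if W: "submodule W R (free R p)" for p W
  proof -
    have fgW: "fg_module R (vecm R W)" using fg_sub[OF finitely_generated_free W] by simp
    obtain p' h where h: "h \<in> module_hom R (free R p') (vecm R W)" "h ` vecs R p' = carrier (vecm R W)"
      by (rule free_cover[OF fgW]) (rule that)
    have "W \<subseteq> vecs R p" using left_module.submodule_subset[OF left_module_free W] by simp
    then have "h \<in> module_hom R (free R p') (free R p)" using h(1) by (auto simp: module_hom_def)
    then show ?thesis using h(2) by auto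
  qed
  define nx where "nx p W = (SOME z. snd z \<in> module_hom R (free R (fst z)) (free R p) \<and> snd z ` vecs R (fst z) = W)" for p and W :: "(nat \<Rightarrow> 'a) set"
  have nx: "snd (nx p W) \<in> module_hom R (free R (fst (nx p W))) (free R p)" "snd (nx p W) ` vecs R (fst (nx p W)) = W"
    if W: "submodule W R (free R p)" for p W
  proof -
    have "\<exists>z. snd z \<in> module_hom R (free R (fst z)) (free R p) \<and> snd z ` vecs R (fst z) = W"
      using step[OF W] by simp
    from someI_ex[OF this] show "snd (nx p W) \<in> module_hom R (free R (fst (nx p W))) (free R p)" "snd (nx p W) ` vecs R (fst (nx p W)) = W"
      unfolding nx_def by auto
  qed
  define st where "st = rec_nat (k0, kern (free R k0) X g) (\<lambda>_ (p, W). (fst (nx p W), kern (free R (fst (nx p W))) (free R p) (snd (nx p W))))"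
  define k where "k n = fst (st n)" for n
  define W where "W n = snd (st n)" for n
  define h where "h n = snd (nx (k n) (W n))" for n
  have st0: "k 0 = k0" "W 0 = kern (free R k0) X g" by (simp_all add: k_def W_def st_def)
  have stS: "k (Suc n) = fst (nx (k n) (W n))" "W (Suc n) = kern (free R (k (Suc n))) (free R (k n)) (h n)" for n
    by (simp_all add: k_def W_def st_def h_def split: prod.splits)
  have WH: "submodule (W n) R (free R (k n)) \<and> h n \<in> module_hom R (free R (k (Suc n))) (free R (k n)) \<and> h n ` vecs R (k (Suc n)) = W n" for n
  proof (induction n)
    case 0
    have "submodule (W 0) R (free R (k 0))" unfolding st0 using submodule_kern[OF left_module_free _ g(1)] X by blast
    then show ?case using nx[of "W 0" "k 0"] by (simp add: stS(1) h_def)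
  next
    case (Suc n)
    have "submodule (W (Suc n)) R (free R (k (Suc n)))" unfolding stS(2) using submodule_kern[OF left_module_free left_module_free] Suc by blast
    then show ?case using nx[of "W (Suc n)" "k (Suc n)"] by (simp add: stS(1)[of "Suc n"] h_def[of "Suc n"])
  qed
  define r where "r n i = h n (unitv R (k (Suc n)) i)" for n i
  have rows: "r n i \<in> vecs R (k n)" for n i unfolding r_def using WH[of n] hom_closed unitv_in by fastforce
  have rm: "rmul R k r n x = h n x" if "x \<in> vecs R (k (Suc n))" for n x
    unfolding rmul_def r_def using free_hom_eq[OF left_module_free, of "h n" "k (Suc n)" "k n" x] WH[of n] that by simp
  have ker: "h n x = (\<lambda>_. \<zero>) \<longleftrightarrow> x \<in> W (Suc n)" if "x \<in> vecs R (k (Suc n))" for n x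
    unfolding stS(2) kern_def using that by simp
  have "free_res R k r"
  proof (intro free_res.intro free_res_axioms.intro ring_axioms rows)
    fix n i
    have "r (Suc n) i \<in> W (Suc n)" unfolding r_def using WH[of "Suc n"] unitv_in by blast
    then show "rmul R k r n (r (Suc n) i) = (\<lambda>_. \<zero>)" using rm[OF rows] ker[OF rows] by simp
  next
    fix x n assume x: "x \<in> vecs R (k (Suc n))" "rmul R k r n x = (\<lambda>_. \<zero>)"
    then have "x \<in> W (Suc n)" using rm ker by simp
    then have "x \<in> h (Suc n) ` vecs R (k (Suc (Suc n)))" using WH[of "Suc n"] by simp
    then show "\<exists>y\<in>vecs R (k (Suc (Suc n))). rmul R k r (Suc n) y = x" using rm by auto
  qed
  moreover have "kern (free R (k 0)) X g = rmul R k r 0 ` vecs R (k (Suc 0))"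
  proof -
    have "rmul R k r 0 ` vecs R (k (Suc 0)) = h 0 ` vecs R (k (Suc 0))" by (rule image_cong[OF refl rm])
    then show ?thesis using WH[of 0] st0 by simp
  qed
  ultimately show ?thesis using g st0 by auto
qed

text \<open>Take a submodule \<^term>\<open>U\<close> of the free module minimal with the property that \<^term>\<open>g\<close> maps it onto the whole image.  A lift
  of \<^term>\<open>g\<close> through its restriction to \<^term>\<open>U\<close> induces an automorphism of \<^term>\<open>U\<close>, so \<^term>\<open>U\<close> is the image of an idempotent.
  A kernel element of \<^term>\<open>U\<close> with a coordinate outside some maximal left ideal would make \<^term>\<open>U\<close> smaller.\<close>

lemma superfluous_kernel:
  assumes Z: "fg_module R Z" and g: "g \<in> module_hom R (free R l) Z"
  shows "\<exists>E \<in> module_hom R (free R l) (free R l). (\<forall>x \<in> vecs R l. E (E x) = E x) \<and> (\<forall>x \<in> vecs R l. g (E x) = g x) \<and>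
    (\<forall>w \<in> vecs R l. g w = \<zero>\<^bsub>Z\<^esub> \<longrightarrow> (\<forall>i. E w i \<in> rad R))"
proof -
  let ?F = "free R l"
  have lF: "left_module R ?F" and fgF: "fg_module R ?F" by (rule left_module_free, rule finitely_generated_free)
  have lZ: "left_module R Z" using Z by blast
  interpret F: left_module R ?F by fact
  interpret Z: left_module R Z by fact
  have flF: "finite_length R ?F" using fgF by (simp add: fg_iff)
  let ?S = "{U. submodule U R ?F \<and> g ` U = g ` vecs R l}"
  have "carrier ?F \<in> ?S" using F.submodule_carrier by simp
  then have ne: "?S \<noteq> {}" by blast
  have sub: "submodule U R ?F" if "U \<in> ?S" for U using that by simp
  obtain U where U: "U \<in> ?S" "\<forall>V\<in>?S. V \<subseteq> U \<longrightarrow> V = U"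
    using finite_length_minimal[OF flF ne sub F.submodule_subset[OF sub]] by blast
  have Us: "submodule U R ?F" and Ug: "g ` U = g ` vecs R l" using U(1) by auto
  have UF: "U \<subseteq> vecs R l" using F.submodule_subset[OF Us] by simp
  have fgU: "fg_module R (vecm R U)" using fg_sub[OF fgF Us] by simp
  have lU: "left_module R (vecm R U)" using fgU by blast
  let ?Y = "Z\<lparr>carrier := g ` vecs R l\<rparr>"
  have Ys: "submodule (g ` vecs R l) R Z" using submodule_range[OF lF lZ g] by simp
  have fgY: "fg_module R ?Y" by (rule fg_sub[OF Z Ys])
  have gY: "g \<in> module_hom R ?F ?Y" by (rule hom_corestrict[OF g]) simp
  have gU: "g \<in> module_hom R (vecm R U) ?Y" using hom_restrict[OF gY, of U] UF by simp
  obtain h where h: "h \<in> module_hom R ?F (vecm R U)" "\<And>x. x \<in> carrier ?F \<Longrightarrow> g (h x) = g x"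
    by (rule projective_lift[OF projective_free fgU fgY gU _ gY]) (simp add: Ug, rule that)
  have hF: "h \<in> module_hom R ?F ?F" using h(1) UF by (auto simp: module_hom_def)
  have hc: "h x \<in> U" if "x \<in> vecs R l" for x using hom_closed[OF h(1)] that by simp
  have hU: "h ` U = U"
  proof -
    have "submodule (h ` U) R ?F" by (rule submodule_image[OF lF lF hF Us])
    moreover have "g ` (h ` U) = g ` vecs R l" using h(2) UF Ug by (simp add: image_image subset_iff)
    moreover have "h ` U \<subseteq> U" using hc UF by blast
    ultimately show ?thesis using U(2) by blast
  qed
  have hUU: "h \<in> module_hom R (vecm R U) (vecm R U)" using hom_restrict[OF h(1), of U] UF by simp
  have "inj_on h U"
  proof -
    have flU: "finite_length R (vecm R U)" using fgU by (simp add: fg_iff)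
    obtain n where n: "kern (vecm R U) (vecm R U) (h ^^ n) \<inter> (h ^^ n) ` carrier (vecm R U) = {\<zero>\<^bsub>vecm R U\<^esub>}" "n > 0"
      using fitting[OF lU flU hUU] by blast
    have im: "(h ^^ m) ` U = U" for m
    proof (induction m)
      case (Suc m)
      have "(h ^^ Suc m) ` U = h ` ((h ^^ m) ` U)" by (simp add: image_image)
      then show ?case using Suc hU by simp
    qed simp
    have ker: "kern (vecm R U) (vecm R U) h \<subseteq> {\<zero>\<^bsub>vecm R U\<^esub>}"
    proof
      fix x assume x: "x \<in> kern (vecm R U) (vecm R U) h"
      obtain m where m: "n = Suc m" using n(2) by (cases n) auto
      have xU: "x \<in> U" "h x = \<zero>\<^bsub>vecm R U\<^esub>" using x by (auto simp: kern_def)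
      have "(h ^^ n) x = (h ^^ m) (h x)" unfolding m by (simp only: funpow_Suc_right comp_apply)
      also have "\<dots> = \<zero>\<^bsub>vecm R U\<^esub>" unfolding xU(2) by (rule hom_zero[OF lU lU hom_pow[OF hUU]])
      finally have "x \<in> kern (vecm R U) (vecm R U) (h ^^ n) \<inter> (h ^^ n) ` carrier (vecm R U)"
        using xU(1) im[of n] by (simp add: kern_def)
      then show "x \<in> {\<zero>\<^bsub>vecm R U\<^esub>}" unfolding n(1) .
    qed
    then have "kern (vecm R U) (vecm R U) h = {\<zero>\<^bsub>vecm R U\<^esub>}"
      using left_module.submodule_zero[OF lU submodule_kern[OF lU lU hUU]] by blast
    then show ?thesis using inj_on_kern[OF lU lU hUU] by simp
  qed
  then have bij: "bij_betw h (carrier (vecm R U)) (carrier (vecm R U))" using hU by (simp add: bij_betw_def)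
  define \<sigma> where "\<sigma> = inv_into U h"
  have \<sigma>: "\<sigma> \<in> module_hom R (vecm R U) (vecm R U)" using hom_inv[OF lU hUU bij] by (simp add: \<sigma>_def)
  have h\<sigma>: "h (\<sigma> u) = u" "\<sigma> u \<in> U" if "u \<in> U" for u
    using that hU f_inv_into_f[of u h U] inv_into_into[of u h U] by (auto simp: \<sigma>_def)
  let ?E = "\<lambda>x. \<sigma> (h x)"
  have EU: "?E x \<in> U" if "x \<in> vecs R l" for x using h\<sigma>(2)[OF hc[OF that]] .
  have E: "?E \<in> module_hom R ?F ?F"
  proof -
    have "?E \<in> module_hom R ?F (vecm R U)" by (rule hom_comp[OF h(1) \<sigma>])
    then show ?thesis using UF by (auto simp: module_hom_def)
  qed
  have gE: "g (?E x) = g x" if x: "x \<in> vecs R l" for x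
  proof -
    have "g (h (?E x)) = g (?E x)" using h(2)[of "?E x"] EU[OF x] UF by auto
    moreover have "h (?E x) = h x" by (rule h\<sigma>(1)[OF hc[OF x]])
    ultimately show ?thesis using h(2)[of x] x by simp
  qed
  have EE: "?E (?E x) = ?E x" if x: "x \<in> vecs R l" for x using h\<sigma>(1)[OF hc[OF x]] by simp
  have rd: "?E w i \<in> rad R" if w: "w \<in> vecs R l" "g w = \<zero>\<^bsub>Z\<^esub>" for w i
  proof (rule ccontr)
    define v where "v = ?E w"
    assume "?E w i \<notin> rad R"
    have vU: "v \<in> U" and gv: "g v = \<zero>\<^bsub>Z\<^esub>" using EU[OF w(1)] gE[OF w(1)] w(2) by (auto simp: v_def)
    have vF: "v \<in> vecs R l" using vU UF by blast
    have vi: "v i \<in> carrier R" by (rule vecs_carrier[OF vF])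
    obtain I where I: "maximal_left_ideal I R" "v i \<notin> I" using \<open>?E w i \<notin> rad R\<close> vi unfolding rad_def v_def by blast
    then have Il: "left_ideal I R" "I \<noteq> carrier R" "\<And>J. left_ideal J R \<Longrightarrow> I \<subseteq> J \<Longrightarrow> J = I \<or> J = carrier R" by (auto simp: maximal_left_ideal_def)
    have Is: "submodule I R (regm R)" using Il(1) by (simp add: left_ideal_iff)
    interpret G: left_module R "regm R" by (rule left_module_regm)
    have Ic: "I \<subseteq> carrier R" and I0: "\<zero> \<in> I" and Iadd: "\<And>x y. x \<in> I \<Longrightarrow> y \<in> I \<Longrightarrow> x \<oplus> y \<in> I" and Im: "\<And>a x. a \<in> carrier R \<Longrightarrow> x \<in> I \<Longrightarrow> a \<otimes> x \<in> I"
      using G.submodule_subset[OF Is] G.submodule_zero[OF Is] G.submodule_add[OF Is] G.submodule_smult[OF Is] by simp_all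
    let ?V = "(\<lambda>b. b \<otimes> v i) ` carrier R"
    have V: "submodule ?V R (regm R)"
      using submodule_range[OF left_module_regm left_module_regm G.hom_right_mult[of "v i"]] vi by simp
    let ?J = "G.ssum I ?V"
    have "submodule ?J R (regm R)" by (rule G.submodule_ssum[OF Is V])
    then have "left_ideal ?J R" by (simp add: left_ideal_iff)
    moreover have "I \<subseteq> ?J" "?V \<subseteq> ?J" using G.ssum_upper1[OF Is V] G.ssum_upper2[OF Is V] by auto
    moreover have "v i \<in> ?V" using vi by (intro image_eqI[of _ _ \<one>]) auto
    ultimately have J: "?J = carrier R" using Il(3)[of ?J] I(2) by blast
    let ?U = "{u \<in> U. u i \<in> I}"
    have "submodule ?U R ?F"
      by (rule F.submoduleI) (use UF F.submodule_zero[OF Us] F.submodule_add[OF Us] F.submodule_smult[OF Us] Iadd Im I0 in auto)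
    moreover have "g ` ?U = g ` vecs R l"
    proof
      show "g ` ?U \<subseteq> g ` vecs R l" using UF by blast
      show "g ` vecs R l \<subseteq> g ` ?U"
      proof
        fix z assume "z \<in> g ` vecs R l"
        then obtain u where u: "u \<in> U" "z = g u" unfolding Ug[symmetric] by blast
        have uF: "u \<in> carrier ?F" "v \<in> carrier ?F" using u(1) UF vF by auto
        have "u i \<in> ?J" unfolding J using vecs_carrier uF(1) by simp
        then obtain y b where yb: "u i = y \<oplus> b \<otimes> v i" "y \<in> I" "b \<in> carrier R" unfolding G.ssum_def by auto
        have yc: "y \<in> carrier R" using Ic yb(2) by blast
        let ?u = "u \<oplus>\<^bsub>?F\<^esub> ((\<ominus> b) \<odot>\<^bsub>?F\<^esub> v)"
        have nb: "\<ominus> b \<in> carrier R" using yb(3) by simp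
        have "?u \<in> U" by (rule F.submodule_add[OF Us u(1) F.submodule_smult[OF Us nb vU]])
        moreover have "?u i = y" using yb(1,3) yc vi by (simp add: l_minus a_assoc r_neg)
        ultimately have "?u \<in> ?U" using yb(2) by simp
        moreover have "g ?u = z"
        proof -
          have "g ?u = g u \<oplus>\<^bsub>Z\<^esub> g ((\<ominus> b) \<odot>\<^bsub>?F\<^esub> v)" by (rule hom_add[OF g uF(1)]) (use F.smult_closed[OF nb uF(2)] in simp)
          also have "g ((\<ominus> b) \<odot>\<^bsub>?F\<^esub> v) = (\<ominus> b) \<odot>\<^bsub>Z\<^esub> g v" by (rule hom_smult[OF g nb uF(2)])
          finally show ?thesis using gv u(2) hom_closed[OF g uF(1)] Z.smult_r_null[OF nb] by simp
        qed
        ultimately show "z \<in> g ` ?U" by (intro image_eqI[of _ _ ?u]) simp_all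
      qed
    qed
    ultimately have "?U \<in> ?S" by (intro CollectI conjI)
    from U(2)[THEN bspec, OF this] have "?U = U" by (rule impE) (rule Collect_restrict)
    then show False using vU I(2) by blast
  qed
  have EE': "\<forall>x\<in>vecs R l. ?E (?E x) = ?E x" and gE': "\<forall>x\<in>vecs R l. g (?E x) = g x"
    and rd': "\<forall>w\<in>vecs R l. g w = \<zero>\<^bsub>Z\<^esub> \<longrightarrow> (\<forall>i. ?E w i \<in> rad R)"
    using EE gE rd by blast+
  show ?thesis by (rule bexI[OF _ E]) (intro conjI EE' gE' rd')
qed

end

section \<open>The radical and its powers\<close>

context ring
begin

text \<open>The left ideal is the kernel of the composition of right multiplication by \<^term>\<open>a\<close> with the projection
  to the simple quotient by \<^term>\<open>I\<close>. This makes the radical a two-sided ideal.\<close>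

lemma maximal_left_ideal_quotient:
  assumes I: "maximal_left_ideal I R" and a: "a \<in> carrier R" and x: "x \<in> carrier R" "x \<otimes> a \<notin> I"
  shows "maximal_left_ideal {y \<in> carrier R. y \<otimes> a \<in> I} R"
proof -
  interpret G: left_module R "regm R" by (rule left_module_regm)
  have Is: "submodule I R (regm R)" and Imax: "\<And>J. left_ideal J R \<Longrightarrow> I \<subseteq> J \<Longrightarrow> J = I \<or> J = carrier R"
    using I by (auto simp: maximal_left_ideal_def left_ideal_iff)
  let ?J = "{y \<in> carrier R. y \<otimes> a \<in> I}"
  have ha: "(\<lambda>y. y \<otimes> a) \<in> module_hom R (regm R) (regm R)" using G.hom_right_mult[of a] a by simp
  have J: "submodule ?J R (regm R)" using submodule_vimage[OF left_module_regm left_module_regm ha Is] by simp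
  show ?thesis
    unfolding maximal_left_ideal_def
  proof (intro conjI allI impI)
    show "left_ideal ?J R" using J by (simp add: left_ideal_iff)
    show "?J \<noteq> carrier R" using x by blast
    fix L assume L: "left_ideal L R \<and> ?J \<subseteq> L"
    then have Ls: "submodule L R (regm R)" by (simp add: left_ideal_iff)
    have LR: "L \<subseteq> carrier R" using G.submodule_subset[OF Ls] by simp
    show "L = ?J \<or> L = carrier R"
    proof (rule disjCI)
      assume "L \<noteq> carrier R"
      have "y \<in> ?J" if y: "y \<in> L" for y
      proof (rule ccontr)
        assume "y \<notin> ?J"
        have yc: "y \<in> carrier R" using LR y by blast
        then have ya: "y \<otimes> a \<notin> I" "y \<otimes> a \<in> carrier R" using \<open>y \<notin> ?J\<close> a by auto
        let ?V = "(\<lambda>b. b \<otimes> (y \<otimes> a)) ` carrier R"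
        have V: "submodule ?V R (regm R)"
          using submodule_range[OF left_module_regm left_module_regm G.hom_right_mult[of "y \<otimes> a"]] ya(2) by simp
        have "y \<otimes> a \<in> ?V" using ya(2) by (intro image_eqI[of _ _ \<one>]) auto
        then have "G.ssum I ?V \<noteq> I" "I \<subseteq> G.ssum I ?V" using G.ssum_upper1[OF Is V] G.ssum_upper2[OF Is V] ya(1) by auto
        then have full: "G.ssum I ?V = carrier R" using Imax G.submodule_ssum[OF Is V] by (auto simp: left_ideal_iff)
        have "z \<in> L" if z: "z \<in> carrier R" for z
        proof -
          have "z \<otimes> a \<in> G.ssum I ?V" unfolding full using z a by simp
          then obtain i b where ib: "i \<in> I" "b \<in> carrier R" "z \<otimes> a = i \<oplus> b \<otimes> (y \<otimes> a)" unfolding G.ssum_def by auto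
          have ic: "i \<in> carrier R" using G.submodule_mem[OF Is ib(1)] by simp
          have c: "b \<otimes> y \<in> carrier R" "b \<otimes> (y \<otimes> a) \<in> carrier R" using ib(2) yc a by simp_all
          have "(z \<ominus> b \<otimes> y) \<otimes> a = z \<otimes> a \<ominus> b \<otimes> (y \<otimes> a)" using z ib(2) yc a by (simp add: a_minus_def l_distr l_minus m_assoc)
          also have "\<dots> = i" unfolding ib(3) by (rule minus_add_cancel[OF ic c(2)])
          finally have "z \<ominus> b \<otimes> y \<in> ?J" using ib(1) z c(1) by simp
          then have "z \<ominus> b \<otimes> y \<in> L" using L by blast
          moreover have "b \<otimes> y \<in> L" using G.submodule_smult[OF Ls ib(2) y] by simp
          ultimately have "(z \<ominus> b \<otimes> y) \<oplus> b \<otimes> y \<in> L" using G.submodule_add[OF Ls] by simp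
          then show ?thesis using z c(1) by simp
        qed
        then show False using \<open>L \<noteq> carrier R\<close> LR by blast
      qed
      then show "L = ?J" using L by blast
    qed
  qed
qed

lemma ideal_rad: "ideal (rad R) R"
proof -
  interpret G: left_module R "regm R" by (rule left_module_regm)
  have left: "submodule (rad R) R (regm R)"
  proof (rule G.submoduleI)
    have s: "submodule I R (regm R)" if "maximal_left_ideal I R" for I
      using that by (simp add: maximal_left_ideal_def left_ideal_iff)
    show "rad R \<subseteq> carrier (regm R)" by (auto simp: rad_def)
    show "\<zero>\<^bsub>regm R\<^esub> \<in> rad R" using G.submodule_zero[OF s] by (simp add: rad_def)
    show "x \<oplus>\<^bsub>regm R\<^esub> y \<in> rad R" if "x \<in> rad R" "y \<in> rad R" for x y
      using that G.submodule_add[OF s] by (simp add: rad_def)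
    show "a \<odot>\<^bsub>regm R\<^esub> x \<in> rad R" if "a \<in> carrier R" "x \<in> rad R" for a x
      using that G.submodule_smult[OF s] by (simp add: rad_def)
  qed
  have right: "x \<otimes> a \<in> rad R" if x: "x \<in> rad R" and a: "a \<in> carrier R" for x a
  proof -
    have xc: "x \<in> carrier R" using x by (simp add: rad_def)
    have "x \<otimes> a \<in> I" if I: "maximal_left_ideal I R" for I
    proof (rule ccontr)
      assume n: "x \<otimes> a \<notin> I"
      have "x \<in> {y \<in> carrier R. y \<otimes> a \<in> I}"
        using x maximal_left_ideal_quotient[OF I a xc n] unfolding rad_def by blast
      then show False using n by simp
    qed
    then show ?thesis using xc a by (simp add: rad_def)
  qed
  have "additive_subgroup (rad R) R" using left by (simp flip: left_ideal_iff add: left_ideal_def)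
  then show ?thesis
    using G.submodule_smult[OF left] right by (intro ideal.intro ideal_axioms.intro ring_axioms) auto
qed

lemma ideal_rad_pow: "ideal (rad_pow R s) R"
  by (induction s) (auto intro: oneideal ideal_prod_is_ideal ideal_rad)

end

section \<open>Quotient modules and modules over a quotient ring\<close>

context finite_length_ring
begin

text \<open>The module of cosets, copied.\<close>

lemma quotient_module:
  fixes Y :: "('a, 'y, 'p) module_scheme"
  assumes Y: "fg_module R Y" and U: "submodule U R Y"
  shows "\<exists>(C :: 'a fgmod) g. fg_module R C \<and> g \<in> module_hom R Y C \<and> g ` carrier Y = carrier C \<and> kern Y C g = U"
proof -
  have lY: "left_module R Y" using Y by blast
  interpret Y: left_module R Y by fact
  note Uc = Y.submodule_mem[OF U]
  define \<phi> where "\<phi> y = {z \<in> carrier Y. z \<ominus>\<^bsub>Y\<^esub> y \<in> U}" for y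
  have \<phi>eq: "\<phi> x = \<phi> y \<longleftrightarrow> x \<ominus>\<^bsub>Y\<^esub> y \<in> U" if x: "x \<in> carrier Y" and y: "y \<in> carrier Y" for x y
  proof
    have "x \<ominus>\<^bsub>Y\<^esub> x \<in> U" using x Y.submodule_zero[OF U] by simp
    then have "x \<in> \<phi> x" using x by (simp add: \<phi>_def)
    then show "\<phi> x = \<phi> y \<Longrightarrow> x \<ominus>\<^bsub>Y\<^esub> y \<in> U" by (simp add: \<phi>_def)
  next
    assume xy: "x \<ominus>\<^bsub>Y\<^esub> y \<in> U"
    have tr: "z \<ominus>\<^bsub>Y\<^esub> v \<in> U" if "z \<ominus>\<^bsub>Y\<^esub> w \<in> U" "w \<ominus>\<^bsub>Y\<^esub> v \<in> U" "z \<in> carrier Y" "w \<in> carrier Y" "v \<in> carrier Y" for z w v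
    proof -
      have "(z \<ominus>\<^bsub>Y\<^esub> w) \<oplus>\<^bsub>Y\<^esub> (w \<ominus>\<^bsub>Y\<^esub> v) = z \<ominus>\<^bsub>Y\<^esub> v" using that(3-5) by (simp add: a_minus_def Y.M.a_assoc Y.M.r_neg1)
      then show ?thesis using Y.submodule_add[OF U that(1,2)] by simp
    qed
    have "\<ominus>\<^bsub>Y\<^esub> (x \<ominus>\<^bsub>Y\<^esub> y) = y \<ominus>\<^bsub>Y\<^esub> x" using x y by (simp add: a_minus_def Y.M.minus_add Y.M.a_comm)
    then have yx: "y \<ominus>\<^bsub>Y\<^esub> x \<in> U" using Y.submodule_neg[OF U xy] by simp
    show "\<phi> x = \<phi> y" unfolding \<phi>_def using tr[OF _ xy _ x y] tr[OF _ yx _ y x] by blast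
  qed
  define \<psi> where "\<psi> c = (SOME y. y \<in> carrier Y \<and> \<phi> y = c)" for c
  have \<psi>: "\<psi> (\<phi> y) \<in> carrier Y" "\<phi> (\<psi> (\<phi> y)) = \<phi> y" if "y \<in> carrier Y" for y
  proof -
    have "\<exists>z. z \<in> carrier Y \<and> \<phi> z = \<phi> y" using that by blast
    from someI_ex[OF this] show "\<psi> (\<phi> y) \<in> carrier Y" "\<phi> (\<psi> (\<phi> y)) = \<phi> y" by (simp_all add: \<psi>_def)
  qed
  define Q :: "('a, 'y set) module" where "Q = \<lparr>carrier = \<phi> ` carrier Y, monoid.mult = \<lambda>x y. x, one = {}, zero = \<phi> \<zero>\<^bsub>Y\<^esub>,
    add = \<lambda>x y. \<phi> (\<psi> x \<oplus>\<^bsub>Y\<^esub> \<psi> y), smult = \<lambda>a x. \<phi> (a \<odot>\<^bsub>Y\<^esub> \<psi> x)\<rparr>"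
  have Qadd: "\<phi> x \<oplus>\<^bsub>Q\<^esub> \<phi> y = \<phi> (x \<oplus>\<^bsub>Y\<^esub> y)" if x: "x \<in> carrier Y" and y: "y \<in> carrier Y" for x y
  proof -
    note p = \<psi>[OF x] \<psi>[OF y]
    have "(\<psi> (\<phi> x) \<oplus>\<^bsub>Y\<^esub> \<psi> (\<phi> y)) \<ominus>\<^bsub>Y\<^esub> (x \<oplus>\<^bsub>Y\<^esub> y) = (\<psi> (\<phi> x) \<ominus>\<^bsub>Y\<^esub> x) \<oplus>\<^bsub>Y\<^esub> (\<psi> (\<phi> y) \<ominus>\<^bsub>Y\<^esub> y)"
      using x y p by (simp add: a_minus_def Y.M.minus_add Y.M.a_ac)
    moreover have "\<psi> (\<phi> x) \<ominus>\<^bsub>Y\<^esub> x \<in> U" "\<psi> (\<phi> y) \<ominus>\<^bsub>Y\<^esub> y \<in> U" using p \<phi>eq x y by blast+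
    ultimately have "\<phi> (\<psi> (\<phi> x) \<oplus>\<^bsub>Y\<^esub> \<psi> (\<phi> y)) = \<phi> (x \<oplus>\<^bsub>Y\<^esub> y)"
      using \<phi>eq[of "\<psi> (\<phi> x) \<oplus>\<^bsub>Y\<^esub> \<psi> (\<phi> y)" "x \<oplus>\<^bsub>Y\<^esub> y"] Y.submodule_add[OF U] p x y by simp
    then show ?thesis by (simp add: Q_def)
  qed
  have Qsm: "a \<odot>\<^bsub>Q\<^esub> \<phi> x = \<phi> (a \<odot>\<^bsub>Y\<^esub> x)" if a: "a \<in> carrier R" and x: "x \<in> carrier Y" for a x
  proof -
    note p = \<psi>[OF x]
    have ax: "(\<lambda>y. a \<odot>\<^bsub>Y\<^esub> y) x = a \<odot>\<^bsub>Y\<^esub> x" by simp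
    have "a \<odot>\<^bsub>Y\<^esub> (\<psi> (\<phi> x) \<ominus>\<^bsub>Y\<^esub> x) \<oplus>\<^bsub>Y\<^esub> a \<odot>\<^bsub>Y\<^esub> x = a \<odot>\<^bsub>Y\<^esub> \<psi> (\<phi> x)" using a x p by (simp flip: Y.smult_r_distr)
    then have "a \<odot>\<^bsub>Y\<^esub> \<psi> (\<phi> x) \<ominus>\<^bsub>Y\<^esub> a \<odot>\<^bsub>Y\<^esub> x = a \<odot>\<^bsub>Y\<^esub> (\<psi> (\<phi> x) \<ominus>\<^bsub>Y\<^esub> x)"
      using Y.minus_add_cancel[of "a \<odot>\<^bsub>Y\<^esub> (\<psi> (\<phi> x) \<ominus>\<^bsub>Y\<^esub> x)" "a \<odot>\<^bsub>Y\<^esub> x"] a x p by simp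
    moreover have "\<psi> (\<phi> x) \<ominus>\<^bsub>Y\<^esub> x \<in> U" using p \<phi>eq x by blast
    ultimately have "\<phi> (a \<odot>\<^bsub>Y\<^esub> \<psi> (\<phi> x)) = \<phi> (a \<odot>\<^bsub>Y\<^esub> x)"
      using \<phi>eq[of "a \<odot>\<^bsub>Y\<^esub> \<psi> (\<phi> x)" "a \<odot>\<^bsub>Y\<^esub> x"] Y.submodule_smult[OF U a] p x a by simp
    then show ?thesis by (simp add: Q_def)
  qed
  have Qz: "\<zero>\<^bsub>Q\<^esub> = \<phi> \<zero>\<^bsub>Y\<^esub>" and Qc: "carrier Q = \<phi> ` carrier Y" by (simp_all add: Q_def)
  have ab: "abelian_group Q"
  proof (rule abelian_groupI)
    show "x \<oplus>\<^bsub>Q\<^esub> y \<in> carrier Q" if "x \<in> carrier Q" "y \<in> carrier Q" for x y using that Qadd by (auto simp: Qc)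
    show "\<zero>\<^bsub>Q\<^esub> \<in> carrier Q" by (simp add: Qc Qz)
    show "x \<oplus>\<^bsub>Q\<^esub> y \<oplus>\<^bsub>Q\<^esub> z = x \<oplus>\<^bsub>Q\<^esub> (y \<oplus>\<^bsub>Q\<^esub> z)" if "x \<in> carrier Q" "y \<in> carrier Q" "z \<in> carrier Q" for x y z
      using that by (auto simp: Qc Qadd Y.M.a_assoc)
    show "x \<oplus>\<^bsub>Q\<^esub> y = y \<oplus>\<^bsub>Q\<^esub> x" if "x \<in> carrier Q" "y \<in> carrier Q" for x y using that by (auto simp: Qc Qadd Y.M.a_comm)
    show "\<zero>\<^bsub>Q\<^esub> \<oplus>\<^bsub>Q\<^esub> x = x" if "x \<in> carrier Q" for x using that by (auto simp: Qc Qz Qadd)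
    show "\<exists>y\<in>carrier Q. y \<oplus>\<^bsub>Q\<^esub> x = \<zero>\<^bsub>Q\<^esub>" if x: "x \<in> carrier Q" for x
    proof -
      obtain y where y: "y \<in> carrier Y" "x = \<phi> y" using x by (auto simp: Qc)
      then have "\<phi> (\<ominus>\<^bsub>Y\<^esub> y) \<oplus>\<^bsub>Q\<^esub> x = \<zero>\<^bsub>Q\<^esub>" by (simp add: Qadd Qz Y.M.l_neg)
      then show ?thesis using y(1) by (auto simp: Qc)
    qed
  qed
  have lQ: "left_module R Q"
  proof (intro left_module.intro left_module_axioms.intro ab ring_axioms)
    fix a b x y assume a: "a \<in> carrier R"
    { assume "x \<in> carrier Q"
      then obtain u where u: "u \<in> carrier Y" "x = \<phi> u" by (auto simp: Qc)
      then show "a \<odot>\<^bsub>Q\<^esub> x \<in> carrier Q" using a by (simp add: Qsm Qc)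
      { assume b: "b \<in> carrier R"
        show "(a \<oplus> b) \<odot>\<^bsub>Q\<^esub> x = a \<odot>\<^bsub>Q\<^esub> x \<oplus>\<^bsub>Q\<^esub> b \<odot>\<^bsub>Q\<^esub> x" using u a b by (simp add: Qsm Qadd Y.smult_l_distr)
        show "(a \<otimes> b) \<odot>\<^bsub>Q\<^esub> x = a \<odot>\<^bsub>Q\<^esub> (b \<odot>\<^bsub>Q\<^esub> x)" using u a b by (simp add: Qsm Y.smult_assoc1) }
      { assume "y \<in> carrier Q"
        then obtain v where v: "v \<in> carrier Y" "y = \<phi> v" by (auto simp: Qc)
        then show "a \<odot>\<^bsub>Q\<^esub> (x \<oplus>\<^bsub>Q\<^esub> y) = a \<odot>\<^bsub>Q\<^esub> x \<oplus>\<^bsub>Q\<^esub> a \<odot>\<^bsub>Q\<^esub> y" using u a by (simp add: Qsm Qadd Y.smult_r_distr) } }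
  next
    fix x assume "x \<in> carrier Q"
    then show "\<one> \<odot>\<^bsub>Q\<^esub> x = x" by (auto simp: Qc Qsm)
  qed
  have \<phi>h: "\<phi> \<in> module_hom R Y Q" by (rule homI) (auto simp: Qc Qadd Qsm)
  have fgQ: "fg_module R Q" by (rule fg_surj[OF Y lQ \<phi>h]) (simp add: Qc)
  obtain c where c: "c \<in> module_hom R Q (fg_copy R Q)" "bij_betw c (carrier Q) (carrier (fg_copy R Q))"
    using fg_copy_iso[OF fgQ] unfolding module_iso_def by blast
  have lC: "left_module R (fg_copy R Q)" using fg_copy_fg[OF fgQ] by blast
  have c0: "c (\<phi> y) = \<zero>\<^bsub>fg_copy R Q\<^esub> \<longleftrightarrow> y \<in> U" if y: "y \<in> carrier Y" for y
  proof -
    have "kern Q (fg_copy R Q) c = {\<zero>\<^bsub>Q\<^esub>}" using inj_on_kern[OF lQ lC c(1)] c(2) by (simp add: bij_betw_def)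
    then have "c (\<phi> y) = \<zero>\<^bsub>fg_copy R Q\<^esub> \<longleftrightarrow> \<phi> y = \<zero>\<^bsub>Q\<^esub>" using y unfolding kern_def Qc by blast
    also have "\<dots> \<longleftrightarrow> y \<in> U" using \<phi>eq[of y "\<zero>\<^bsub>Y\<^esub>"] y Y.minus_add_cancel[of y "\<zero>\<^bsub>Y\<^esub>"] by (simp add: Qz)
    finally show ?thesis .
  qed
  show ?thesis
  proof (intro exI[of _ "fg_copy R Q"] exI[of _ "\<lambda>y. c (\<phi> y)"] conjI)
    show "fg_module R (fg_copy R Q)" by (rule fg_copy_fg[OF fgQ])
    show "(\<lambda>y. c (\<phi> y)) \<in> module_hom R Y (fg_copy R Q)" by (rule hom_comp[OF \<phi>h c(1)])
    show "(\<lambda>y. c (\<phi> y)) ` carrier Y = carrier (fg_copy R Q)" using c(2) by (simp add: bij_betw_def Qc image_image)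
    show "kern Y (fg_copy R Q) (\<lambda>y. c (\<phi> y)) = U" unfolding kern_def using c0 Uc by blast
  qed
qed

definition annihilated :: "'a set \<Rightarrow> ('a, 'm, 'p) module_scheme \<Rightarrow> bool" where
  "annihilated I X \<longleftrightarrow> (\<forall>a\<in>I. \<forall>x\<in>carrier X. a \<odot>\<^bsub>X\<^esub> x = \<zero>\<^bsub>X\<^esub>)"

text \<open>A coset acts by a chosen representative; on a module annihilated by the ideal the choice does not matter.\<close>

definition coset_module :: "('a, 'm) module \<Rightarrow> ('a set, 'm) module" where
  "coset_module X = \<lparr>carrier = carrier X, monoid.mult = monoid.mult X, one = one X, zero = zero X, add = add X,
     smult = \<lambda>c x. (SOME b. b \<in> c) \<odot>\<^bsub>X\<^esub> x\<rparr>"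

lemma coset_module_simps [simp]: "carrier (coset_module X) = carrier X" "\<zero>\<^bsub>coset_module X\<^esub> = \<zero>\<^bsub>X\<^esub>"
  "x \<oplus>\<^bsub>coset_module X\<^esub> y = x \<oplus>\<^bsub>X\<^esub> y"
  by (simp_all add: coset_module_def)

lemma quot_carrier: "ideal I R \<Longrightarrow> c \<in> carrier (R Quot I) \<longleftrightarrow> (\<exists>b \<in> carrier R. c = I +> b)"
  by (auto simp: FactRing_def A_RCOSETS_def RCOSETS_def a_r_coset_def)

lemma coset_module_smult:
  assumes I: "ideal I R" and X: "left_module R X" "annihilated I X" and b: "b \<in> carrier R" and x: "x \<in> carrier X"
  shows "(I +> b) \<odot>\<^bsub>coset_module X\<^esub> x = b \<odot>\<^bsub>X\<^esub> x"
proof -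
  interpret X: left_module R X by fact
  interpret I: ideal I R by fact
  have "b \<in> I +> b" by (rule I.a_rcos_self[OF b])
  then have "(SOME b'. b' \<in> I +> b) \<in> I +> b" by (rule someI)
  then obtain i where i: "i \<in> I" "(SOME b'. b' \<in> I +> b) = i \<oplus> b" unfolding a_r_coset_def' by blast
  have ic: "i \<in> carrier R" using I.Icarr[OF i(1)] .
  have "(i \<oplus> b) \<odot>\<^bsub>X\<^esub> x = i \<odot>\<^bsub>X\<^esub> x \<oplus>\<^bsub>X\<^esub> b \<odot>\<^bsub>X\<^esub> x" by (rule X.smult_l_distr[OF ic b x])
  then show ?thesis using X(2) i b x unfolding coset_module_def annihilated_def by simp
qed

lemma left_module_coset:
  assumes I: "ideal I R" and X: "left_module R X" "annihilated I X"
  shows "left_module (R Quot I) (coset_module X)"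
proof -
  interpret X: left_module R X by fact
  interpret I: ideal I R by fact
  have h: "(+>) I \<in> ring_hom R (R Quot I)" by (rule I.rcos_ring_hom)
  note sm = coset_module_smult[OF I X]
  have ab: "abelian_group (coset_module X)"
  proof (rule abelian_groupI)
    fix x assume "x \<in> carrier (coset_module X)"
    then show "\<exists>y\<in>carrier (coset_module X). y \<oplus>\<^bsub>coset_module X\<^esub> x = \<zero>\<^bsub>coset_module X\<^esub>"
      by (intro bexI[of _ "\<ominus>\<^bsub>X\<^esub> x"]) (auto simp: X.M.l_neg)
  qed (auto simp: X.M.a_ac)
  show ?thesis
  proof (intro left_module.intro left_module_axioms.intro I.quotient_is_ring ab)
    fix c d x y assume c: "c \<in> carrier (R Quot I)"
    obtain a where a: "a \<in> carrier R" "c = I +> a" using c quot_carrier[OF I] by blast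
    { assume x: "x \<in> carrier (coset_module X)"
      show "c \<odot>\<^bsub>coset_module X\<^esub> x \<in> carrier (coset_module X)" using a x sm by simp
      { assume "d \<in> carrier (R Quot I)"
        then obtain b where b: "b \<in> carrier R" "d = I +> b" using quot_carrier[OF I] by blast
        have "c \<oplus>\<^bsub>R Quot I\<^esub> d = I +> (a \<oplus> b)" using ring_hom_add[OF h a(1) b(1)] a b by simp
        then show "(c \<oplus>\<^bsub>R Quot I\<^esub> d) \<odot>\<^bsub>coset_module X\<^esub> x = c \<odot>\<^bsub>coset_module X\<^esub> x \<oplus>\<^bsub>coset_module X\<^esub> d \<odot>\<^bsub>coset_module X\<^esub> x"
          using a b x sm by (simp add: X.smult_l_distr)
        have "c \<otimes>\<^bsub>R Quot I\<^esub> d = I +> (a \<otimes> b)" using ring_hom_mult[OF h a(1) b(1)] a b by simp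
        then show "(c \<otimes>\<^bsub>R Quot I\<^esub> d) \<odot>\<^bsub>coset_module X\<^esub> x = c \<odot>\<^bsub>coset_module X\<^esub> (d \<odot>\<^bsub>coset_module X\<^esub> x)"
          using a b x sm by (simp add: X.smult_assoc1) }
      { assume y: "y \<in> carrier (coset_module X)"
        show "c \<odot>\<^bsub>coset_module X\<^esub> (x \<oplus>\<^bsub>coset_module X\<^esub> y) = c \<odot>\<^bsub>coset_module X\<^esub> x \<oplus>\<^bsub>coset_module X\<^esub> c \<odot>\<^bsub>coset_module X\<^esub> y"
          using a x y sm by (simp add: X.smult_r_distr) } }
  next
    fix x assume x: "x \<in> carrier (coset_module X)"
    have "\<one>\<^bsub>R Quot I\<^esub> = I +> \<one>" by (simp add: FactRing_def)
    then show "\<one>\<^bsub>R Quot I\<^esub> \<odot>\<^bsub>coset_module X\<^esub> x = x" using x sm by simp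
  qed
qed

lemma submodule_coset_iff:
  assumes I: "ideal I R" and X: "left_module R X" "annihilated I X"
  shows "submodule U (R Quot I) (coset_module X) \<longleftrightarrow> submodule U R X"
proof -
  interpret X: left_module R X by fact
  interpret C: left_module "R Quot I" "coset_module X" by (rule left_module_coset[OF assms])
  note sm = coset_module_smult[OF I X]
  show ?thesis
  proof
    assume U: "submodule U (R Quot I) (coset_module X)"
    have sub: "U \<subseteq> carrier X" using C.submodule_subset[OF U] by simp
    show "submodule U R X"
    proof (rule X.submoduleI[OF sub])
      show "\<zero>\<^bsub>X\<^esub> \<in> U" using C.submodule_zero[OF U] by simp
      show "x \<oplus>\<^bsub>X\<^esub> y \<in> U" if "x \<in> U" "y \<in> U" for x y using C.submodule_add[OF U that] by simp
      show "a \<odot>\<^bsub>X\<^esub> x \<in> U" if "a \<in> carrier R" "x \<in> U" for a x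
      proof -
        have "I +> a \<in> carrier (R Quot I)" using quot_carrier[OF I] that(1) by blast
        then show ?thesis using C.submodule_smult[OF U _ that(2)] sm[OF that(1)] sub that(2) by force
      qed
    qed
  next
    assume U: "submodule U R X"
    show "submodule U (R Quot I) (coset_module X)"
    proof (rule C.submoduleI)
      show "c \<odot>\<^bsub>coset_module X\<^esub> x \<in> U" if c: "c \<in> carrier (R Quot I)" and x: "x \<in> U" for c x
      proof -
        obtain a where a: "a \<in> carrier R" "c = I +> a" using c quot_carrier[OF I] by blast
        then show ?thesis using X.submodule_smult[OF U a(1) x] sm[OF a(1) X.submodule_mem[OF U x]] by simp
      qed
    qed (use X.submodule_subset[OF U] X.submodule_zero[OF U] X.submodule_add[OF U] in auto)
  qed
qed

lemma annihilated_retract: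
  assumes "ideal I R" "left_module R X" "left_module R Y" "annihilated I Y" "retract R X Y" shows "annihilated I X"
proof -
  obtain i p where ip: "i \<in> module_hom R X Y" "p \<in> module_hom R Y X" "\<And>x. x \<in> carrier X \<Longrightarrow> p (i x) = x"
    using assms(5) unfolding retract_def by blast
  show ?thesis unfolding annihilated_def
  proof (intro ballI)
    fix a x assume a: "a \<in> I" and x: "x \<in> carrier X"
    have ac: "a \<in> carrier R" using ideal.Icarr[OF assms(1) a] .
    have "a \<odot>\<^bsub>X\<^esub> x = p (a \<odot>\<^bsub>Y\<^esub> i x)" using hom_smult[OF ip(2) ac hom_closed[OF ip(1) x]] ip(3)[OF x] by simp
    also have "a \<odot>\<^bsub>Y\<^esub> i x = \<zero>\<^bsub>Y\<^esub>" using assms(4) a hom_closed[OF ip(1) x] by (simp add: annihilated_def)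
    finally show "a \<odot>\<^bsub>X\<^esub> x = \<zero>\<^bsub>X\<^esub>" using hom_zero[OF assms(3,2) ip(2)] by simp
  qed
qed

lemma coset_module_iso:
  assumes I: "ideal I R" and X: "left_module R X" "annihilated I X" and Y: "left_module R Y" "annihilated I Y"
    and iso: "module_iso (R Quot I) (coset_module X) (coset_module Y)"
  shows "module_iso R X Y"
proof -
  obtain f where f: "f \<in> module_hom (R Quot I) (coset_module X) (coset_module Y)" "bij_betw f (carrier X) (carrier Y)"
    using iso unfolding module_iso_def by auto
  have fc: "f x \<in> carrier Y" if "x \<in> carrier X" for x using hom_closed[OF f(1)] that by simp
  have "f \<in> module_hom R X Y"
  proof (rule homI)
    show "f (x \<oplus>\<^bsub>X\<^esub> y) = f x \<oplus>\<^bsub>Y\<^esub> f y" if "x \<in> carrier X" "y \<in> carrier X" for x y using hom_add[OF f(1)] that by simp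
    show "f (a \<odot>\<^bsub>X\<^esub> x) = a \<odot>\<^bsub>Y\<^esub> f x" if "a \<in> carrier R" "x \<in> carrier X" for a x
    proof -
      have "I +> a \<in> carrier (R Quot I)" using quot_carrier[OF I] that(1) by blast
      then have "f ((I +> a) \<odot>\<^bsub>coset_module X\<^esub> x) = (I +> a) \<odot>\<^bsub>coset_module Y\<^esub> f x" using hom_smult[OF f(1)] that(2) by simp
      then show ?thesis using coset_module_smult[OF I X that] coset_module_smult[OF I Y that(1) fc[OF that(2)]] by simp
    qed
  qed (rule fc)
  then show ?thesis using module_isoI f(2) by blast
qed

text \<open>The listed indecomposable modules over \<^term>\<open>R Quot I\<close> have another type than modules over \<^term>\<open>R\<close>.
  Each one that arises from an \<^term>\<open>R\<close>-module is represented by such a module.\<close>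

theorem annihilated_decomposition:
  assumes I: "ideal I R" and fin: "representation_finite (R Quot I)"
  shows "\<exists>US. finite US \<and> (\<forall>U\<in>US. fg_module R U) \<and>
    (\<forall>C :: 'a fgmod. fg_module R C \<and> annihilated I C \<longrightarrow> (\<exists>xs. set xs \<subseteq> US \<and> module_iso R C (dsum xs)))"
proof -
  let ?T = "R Quot I"
  obtain SS :: "'a set fgmod set" where SS: "finite SS" "\<And>M :: 'a set fgmod. fg_module ?T M \<Longrightarrow> indecomposable ?T M \<Longrightarrow> \<exists>N\<in>SS. module_iso ?T M N"
    using fin unfolding representation_finite_def by blast
  let ?P = "\<lambda>N X. fg_module R X \<and> annihilated I X \<and> module_iso ?T (fg_copy ?T (coset_module X)) N"
  define rep where "rep N = (SOME X :: 'a fgmod. ?P N X)" for N :: "'a set fgmod"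
  let ?US = "rep ` {N \<in> SS. \<exists>X :: 'a fgmod. ?P N X}"
  have rep: "?P N (rep N)" if "\<exists>X :: 'a fgmod. ?P N X" for N using someI_ex[OF that] by (simp add: rep_def)
  have fgC: "fg_module ?T (coset_module X)" if "fg_module R X" "annihilated I X" for X :: "'a fgmod"
  proof -
    have l: "left_module R X" using that by blast
    have "finitely_generated ?T (coset_module X)"
      using that(1) unfolding fg_module_def finitely_generated_def by (simp add: submodule_coset_iff[OF I l that(2)])
    then show ?thesis using left_module_coset[OF I l that(2)] by (simp add: fg_module_def)
  qed
  have key: "\<exists>U\<in>?US. module_iso R X U" if X: "fg_module R X" "annihilated I X" "indecomposable R X" for X :: "'a fgmod"
  proof -
    have l: "left_module R X" using X by blast
    let ?X = "coset_module X"
    have lX: "left_module ?T ?X" by (rule left_module_coset[OF I l X(2)])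
    have ind: "indecomposable ?T ?X" using X(3) unfolding indecomposable_def
      by (simp add: submodule_coset_iff[OF I l X(2)] set_add_def set_mult_def)
    have cX: "fg_module ?T (fg_copy ?T ?X)" "module_iso ?T ?X (fg_copy ?T ?X)" using fg_copy_fg fg_copy_iso fgC[OF X(1,2)] by blast+
    have "indecomposable ?T (fg_copy ?T ?X)"
    proof -
      have "left_module ?T (fg_copy ?T ?X)" using cX(1) by blast
      then show ?thesis using indecomposable_iso[OF lX _ cX(2) ind] by blast
    qed
    then obtain N where N: "N \<in> SS" "module_iso ?T (fg_copy ?T ?X) N" using SS(2) cX(1) by blast
    then have "\<exists>X :: 'a fgmod. ?P N X" using X by blast
    note r = rep[OF this]
    have lr: "left_module R (rep N)" using r by blast
    have fgr: "fg_module ?T (coset_module (rep N))" using fgC r by blast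
    have "module_iso ?T N (fg_copy ?T (coset_module (rep N)))"
      using module_iso_sym[of ?T "fg_copy ?T (coset_module (rep N))" N] r fg_copy_fg[OF fgr] by blast
    then have "module_iso ?T ?X (coset_module (rep N))"
      using module_iso_trans[OF cX(2) module_iso_trans[OF N(2) module_iso_trans[OF _ fg_copy_iso'[OF fgr]]]] by blast
    then have "module_iso R X (rep N)" using coset_module_iso[OF I l X(2) lr] r by blast
    then show ?thesis using N(1) \<open>\<exists>X :: 'a fgmod. ?P N X\<close> by blast
  qed
  show ?thesis
  proof (intro exI[of _ ?US] conjI allI impI ballI)
    show "finite ?US" using SS(1) by simp
    show "fg_module R U" if "U \<in> ?US" for U using that rep by blast
    fix C :: "'a fgmod" assume C: "fg_module R C \<and> annihilated I C"
    obtain Xs where Xs: "\<forall>X \<in> set Xs. fg_module R X \<and> indecomposable R X" "module_iso R C (dsum Xs)"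
      using decompose_indecomposable C by blast
    have fgXs: "\<forall>X \<in> set Xs. fg_module R X" using Xs(1) by blast
    have "\<exists>U\<in>?US. module_iso R X U" if X: "X \<in> set Xs" for X
    proof (rule key)
      show "fg_module R X" "indecomposable R X" using X Xs(1) by blast+
      have "retract R (dsum Xs) C" using retract_iso'[OF Xs(2)] C by blast
      then have "retract R X C" by (rule retract_trans[OF dsum_retract_mem[OF fgXs X]])
      then show "annihilated I X" using annihilated_retract[OF I _ _ _ \<open>retract R X C\<close>] X fgXs C by blast
    qed
    then have "\<forall>X\<in>set Xs. \<exists>U. U \<in> ?US \<and> module_iso R X U" unfolding Bex_def by (intro ballI)
    from bchoice[OF this] obtain v where v: "\<forall>X \<in> set Xs. v X \<in> ?US \<and> module_iso R X (v X)" by (elim exE)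
    have "module_iso R (dsum Xs) (dsum (map v Xs))"
    proof (rule dsum_cong)
      have "fg_module R U" if "U \<in> ?US" for U using that rep by blast
      then have "\<forall>X \<in> set Xs. fg_module R X \<and> fg_module R (v X) \<and> module_iso R X (v X)" using v fgXs by blast
      then show "list_all2 (\<lambda>X Y. fg_module R X \<and> fg_module R Y \<and> module_iso R X Y) Xs (map v Xs)"
        by (simp add: list_all2_conv_all_nth)
    qed
    then have "module_iso R C (dsum (map v Xs))" by (rule module_iso_trans[OF Xs(2)])
    moreover have "set (map v Xs) \<subseteq> ?US" using v by auto
    ultimately show "\<exists>xs. set xs \<subseteq> ?US \<and> module_iso R C (dsum xs)" by blast
  qed
qed

end

section \<open>Extensions of rings\<close>

context ring
begin

lemma free_hom_ext:
  assumes "left_module R M" "f \<in> module_hom R (free R k) M" "g \<in> module_hom R (free R k) M"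
    and eq: "\<And>i. i < k \<Longrightarrow> f (unitv R k i) = g (unitv R k i)" and x: "x \<in> vecs R k"
  shows "f x = g x"
  unfolding free_hom_eq[OF assms(1,2) x] free_hom_eq[OF assms(1,3) x] by (rule lincomb_cong) (auto simp: eq)

end

context finite_length_ring
begin

lemma exact_range:
  assumes Y: "fg_module R Y" and N: "left_module R N" and g: "g \<in> module_hom R Y N"
  shows "exact R (Y\<lparr>carrier := kern Y N g\<rparr>) Y (N\<lparr>carrier := g ` carrier Y\<rparr>)"
proof -
  have lY: "left_module R Y" using Y by blast
  have sub: "submodule (g ` carrier Y) R N" by (rule submodule_range[OF lY N g])
  let ?N = "N\<lparr>carrier := g ` carrier Y\<rparr>"
  have g': "g \<in> module_hom R Y ?N" by (rule hom_corestrict[OF g]) simp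
  have "fg_module R ?N" by (rule fg_surj[OF Y left_module.left_module_sub[OF N sub] g']) simp
  from ses_kern[OF Y this g'] have "ses R (Y\<lparr>carrier := kern Y ?N g\<rparr>) Y ?N (\<lambda>x. x) g" by simp
  moreover have "kern Y ?N g = kern Y N g" by (simp add: kern_def)
  ultimately show ?thesis using exactI by metis
qed

lemma fin_dim_bound:
  assumes "fin_dim R \<le> enat m" "pd_le n M" shows "pd_le m M"
proof -
  have M: "fg_module R M" by (rule pd_fg[OF assms(2)])
  have c: "fg_module R (fg_copy R M)" by (rule fg_copy_fg[OF M])
  have "pd_le n (fg_copy R M)" by (rule pd_iso[OF assms(2) fg_copy_iso[OF M] c])
  then have "proj_dim R (fg_copy R M) < \<infinity>" using proj_dim_finite_iff[OF c] by blast
  then have "proj_dim R (fg_copy R M) \<le> fin_dim R" unfolding fin_dim_def using c by (intro Sup_upper) blast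
  then have "pd_le m (fg_copy R M)" using assms(1) proj_dim_le_iff[OF c] order_trans by blast
  then show ?thesis by (rule pd_iso[OF _ fg_copy_iso'[OF M] M])
qed

lemma fin_dim_leI:
  assumes "\<And>(X :: 'a fgmod) n. pd_le n X \<Longrightarrow> pd_le m X" shows "fin_dim R \<le> enat m"
  unfolding fin_dim_def
proof (rule Sup_least)
  fix v assume "v \<in> {proj_dim R M | M :: 'a fgmod. fg_module R M \<and> proj_dim R M < \<infinity>}"
  then obtain M :: "'a fgmod" where M: "v = proj_dim R M" "fg_module R M" "proj_dim R M < \<infinity>" by blast
  then obtain n where "pd_le n M" using proj_dim_finite_iff by blast
  then show "v \<le> enat m" using assms[of n M] proj_dim_le_iff[OF M(2)] M(1) by simp
qed

end

text \<open>Extensions of Artin algebras with the base ring forgotten.\<close>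

locale extension = A: finite_length_ring A + S: finite_length_ring "A\<lparr>carrier := B\<rparr>" for A :: "('a, 'r) ring_scheme" (structure) and B :: "'a set" +
  assumes sub: "B \<subseteq> carrier A" and fg_ext: "fg_module (A\<lparr>carrier := B\<rparr>) (regm A)"
begin

abbreviation S where "S \<equiv> A\<lparr>carrier := B\<rparr>"

lemma vecm_S: "vecm S X = vecm A X" by (simp add: vecm_def)

lemma unitv_S: "unitv S k i = unitv A k i" by (simp add: unitv_def fun_eq_iff)

lemma vecs_S: "x \<in> vecs S k \<longleftrightarrow> x \<in> vecs A k \<and> (\<forall>i. x i \<in> B)"
proof
  assume x: "x \<in> vecs S k"
  then have "\<forall>i. x i \<in> B" using S.vecs_carrier[OF x] by simp
  then show "x \<in> vecs A k \<and> (\<forall>i. x i \<in> B)" using x sub by (auto simp: vecs_def)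
qed (simp add: vecs_def)

lemma vecs_S_subset: "x \<in> vecs S k \<Longrightarrow> x \<in> vecs A k"
  by (simp add: vecs_S)

lemma lincomb_S: "lincomb (vecm S X) s n f = lincomb (vecm A Y) s n f"
  by (induction n) simp_all

lemma rmul_S: "rmul S k r n = rmul A k r n"
  unfolding rmul_def using lincomb_S by blast

lemma left_module_S:
  assumes "left_module A M" shows "left_module S M"
proof -
  interpret M: left_module A M by fact
  show ?thesis
    by (intro left_module.intro left_module_axioms.intro S.ring_axioms M.M.abelian_group_axioms)
      (use sub in \<open>auto simp: subset_iff M.smult_l_distr M.smult_r_distr M.smult_assoc1\<close>)
qed

lemma hom_S: "f \<in> module_hom A M N \<Longrightarrow> f \<in> module_hom S M N"
  using sub by (auto simp: module_hom_def subset_iff)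

lemma retract_S: "retract A X Y \<Longrightarrow> retract S X Y"
  unfolding retract_def
  by (elim bexE, rule bexI[rotated], erule hom_S, rule bexI[rotated], erule hom_S)

lemma free_Suc_iso: "module_iso S (free A (Suc k)) (prod_mod (regm A) (free A k))"
proof (rule module_isoI2)
  show "(\<lambda>x. (x k, x(k := \<zero>\<^bsub>A\<^esub>))) \<in> module_hom S (free A (Suc k)) (prod_mod (regm A) (free A k))"
    using sub by (intro homI) (auto simp: vecs_def fun_eq_iff less_Suc_eq le_Suc_eq subset_iff)
  show "(\<lambda>(a, y). y(k := a)) \<in> module_hom S (prod_mod (regm A) (free A k)) (free A (Suc k))"
    using sub by (intro homI) (auto simp: vecs_def fun_eq_iff less_Suc_eq le_Suc_eq subset_iff)
qed (auto simp: vecs_def fun_eq_iff)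

lemma free_iso_dsum: "module_iso S (free A k) (S.dsum (replicate k (fg_copy S (regm A))))"
proof (induction k)
  case 0
  have "vecs A 0 = {\<lambda>_. \<zero>\<^bsub>A\<^esub>}" by (auto simp: vecs_def)
  then show ?case
    using module_iso_zero[OF left_module_S[OF A.left_module_free[of 0]] fg_left_module[OF S.dsum_Nil(1)]] S.dsum_Nil(2) by simp
next
  case (Suc k)
  let ?U = "fg_copy S (regm A)"
  have U: "fg_module S ?U" "module_iso S (regm A) ?U" using fg_copy_fg[OF fg_ext] fg_copy_iso[OF fg_ext] .
  have "module_iso S (prod_mod (regm A) (free A k)) (prod_mod ?U (S.dsum (replicate k ?U)))"
    by (rule module_iso_prod[OF U(2) Suc.IH])
  moreover have "module_iso S (prod_mod ?U (S.dsum (replicate k ?U))) (S.dsum (replicate (Suc k) ?U))"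
    using S.dsum_Cons(2)[of ?U "replicate k ?U"] U(1) by simp
  ultimately show ?case by (rule module_iso_trans[OF module_iso_trans[OF free_Suc_iso]])
qed

text \<open>A finitely generated free \<^term>\<open>A\<close>-module is over \<^term>\<open>S\<close> a direct sum of copies of \<^term>\<open>A\<close>.\<close>

lemma fg_S:
  assumes M: "fg_module A M" shows "fg_module S M"
proof -
  obtain k g where g: "g \<in> module_hom A (free A k) M" "g ` vecs A k = carrier M" by (rule A.free_cover[OF M])
  have lF: "left_module S (free A k)" by (rule left_module_S[OF A.left_module_free])
  have "\<forall>X\<in>set (replicate k (fg_copy S (regm A))). fg_module S X" using fg_copy_fg[OF fg_ext] by simp
  then have "fg_module S (S.dsum (replicate k (fg_copy S (regm A))))" by (rule S.dsum_fg)
  from S.fg_iso[OF this lF module_iso_sym[OF free_iso_dsum lF]]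
  have "fg_module S (free A k)" .
  then show ?thesis by (rule S.fg_surj[OF _ left_module_S hom_S[OF g(1)]]) (use M g(2) in auto)
qed

end

section \<open>Extending scalars along a free resolution\<close>

text \<open>The matrices of a free resolution over \<^term>\<open>S\<close> also act on vectors over \<^term>\<open>A\<close>; beyond degree
  \<^term>\<open>n0\<close> the resulting sequence is assumed exact.\<close>

locale lifted_res = extension A B + F: free_res "A\<lparr>carrier := B\<rparr>" k r
  for A :: "('a, 'r) ring_scheme" (structure) and B :: "'a set" and k r +
  fixes n0 :: nat
  assumes amplified: "n > n0 \<Longrightarrow> F.tensor_exact (right_mult_module A) n"
begin

abbreviation \<phi> where "\<phi> \<equiv> rmul A k r"

text \<open>The syzygies over \<^term>\<open>S\<close>, starting with the first one.\<close>

definition im_S :: "nat \<Rightarrow> (nat \<Rightarrow> 'a) set" where "im_S n = \<phi> n ` vecs S (k (Suc n))"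

text \<open>Exactness beyond degree \<^term>\<open>n0\<close> makes these modules the successive syzygies of \<open>im_A (Suc
  n0)\<close> over \<^term>\<open>A\<close>.\<close>

definition im_A :: "nat \<Rightarrow> (nat \<Rightarrow> 'a) set" where "im_A n = \<phi> n ` vecs A (k (Suc n))"

lemma rows_A: "r n i \<in> vecs A (k n)"
  by (rule vecs_S_subset[OF F.rows])

lemma hom_A: "\<phi> n \<in> module_hom A (free A (k (Suc n))) (free A (k n))"
  unfolding rmul_def by (rule A.free_hom[OF A.left_module_free]) (simp add: rows_A)

lemma hom_res: "\<phi> n \<in> module_hom S (vecm A (vecs S (k (Suc n)))) (vecm A (vecs S (k n)))"
  using F.rmul_hom[of n] by (simp add: vecm_S rmul_S)

lemma row_image: "i < k (Suc n) \<Longrightarrow> \<phi> n (unitv A (k (Suc n)) i) = r n i"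
proof -
  assume i: "i < k (Suc n)"
  interpret G: left_module A "free A (k n)" by (rule A.left_module_free)
  have "\<phi> n (unitv A (k (Suc n)) i) = lincomb (free A (k n)) (r n) (k (Suc n)) (\<lambda>j. if j = i then \<one>\<^bsub>A\<^esub> else \<zero>\<^bsub>A\<^esub>)"
    unfolding rmul_def by (rule lincomb_cong) (auto simp: unitv_def i)
  then show ?thesis using G.lincomb_unit[of "r n" "k (Suc n)" i] rows_A i by simp
qed

lemma row_in_im_S: "i < k (Suc n) \<Longrightarrow> r n i \<in> im_S n"
  unfolding im_S_def using row_image[of i n] S.unitv_in[of "k (Suc n)" i] by (metis imageI unitv_S)

lemma im_S_subset: "im_S n \<subseteq> vecs S (k n)"
  unfolding im_S_def using hom_closed[OF hom_res] by auto

lemma im_A_subset: "im_A n \<subseteq> vecs A (k n)"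
  unfolding im_A_def using hom_closed[OF hom_A] by auto

lemma im_S_im_A: "im_S n \<subseteq> im_A n"
  unfolding im_S_def im_A_def using vecs_S_subset by blast

lemma complex_A: "y \<in> vecs A (k (Suc (Suc n))) \<Longrightarrow> \<phi> n (\<phi> (Suc n) y) = (\<lambda>_. \<zero>\<^bsub>A\<^esub>)"
  using A.free_hom_ext[OF A.left_module_free hom_comp[OF hom_A[of "Suc n"] hom_A[of n]] hom_zero_fun[OF A.left_module_free]]
    row_image F.complex[of n] by (simp add: rmul_S)

lemma exact_S_iff: "im_S (Suc n) = {x \<in> vecs S (k (Suc n)). \<phi> n x = (\<lambda>_. \<zero>\<^bsub>A\<^esub>)}"
proof -
  have "im_S (Suc n) \<subseteq> {x \<in> vecs S (k (Suc n)). \<phi> n x = (\<lambda>_. \<zero>\<^bsub>A\<^esub>)}"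
    using im_S_subset[of "Suc n"] complex_A vecs_S_subset by (auto simp: im_S_def)
  moreover have "x \<in> im_S (Suc n)" if "x \<in> vecs S (k (Suc n))" "\<phi> n x = (\<lambda>_. \<zero>\<^bsub>A\<^esub>)" for x
    using F.exact[OF that(1)] that(2) unfolding im_S_def by (auto simp: rmul_S)
  ultimately show ?thesis by blast
qed

lemma exact_A_iff:
  assumes n: "n > n0" shows "im_A (Suc n) = {x \<in> vecs A (k (Suc n)). \<phi> n x = (\<lambda>_. \<zero>\<^bsub>A\<^esub>)}"
proof -
  have "x \<in> im_A (Suc n)" if x: "x \<in> vecs A (k (Suc n))" and z: "\<phi> n x = (\<lambda>_. \<zero>\<^bsub>A\<^esub>)" for x
  proof -
    have "\<forall>j. lincomb (right_mult_module A) x (k (Suc n)) (\<lambda>i. r n i j) = \<zero>\<^bsub>A\<^esub>"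
      unfolding lincomb_right_mult using fun_cong[OF z] by (simp add: rmul_def lincomb_vecm)
    moreover have "\<forall>i. x i \<in> carrier A" using A.vecs_carrier[OF x] by simp
    ultimately obtain y where y: "\<forall>i. y i \<in> carrier A"
      "\<forall>i<k (Suc n). x i = lincomb (right_mult_module A) y (k (Suc (Suc n))) (\<lambda>m. r (Suc n) m i)"
      using amplified[OF n] unfolding F.tensor_exact_def by (auto simp: right_mult_module_def)
    let ?y = "\<lambda>i. if i < k (Suc (Suc n)) then y i else \<zero>\<^bsub>A\<^esub>"
    have yv: "?y \<in> vecs A (k (Suc (Suc n)))" using y(1) by (auto simp: vecs_def)
    have "\<phi> (Suc n) ?y j = x j" for j
    proof (cases "j < k (Suc n)")
      case True
      have "\<phi> (Suc n) ?y j = lincomb (regm A) (\<lambda>m. r (Suc n) m j) (k (Suc (Suc n))) ?y" by (simp add: rmul_def lincomb_vecm)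
      also have "\<dots> = lincomb (regm A) (\<lambda>m. r (Suc n) m j) (k (Suc (Suc n))) y" by (rule lincomb_cong) simp_all
      finally show ?thesis using y(2) True by (simp add: lincomb_right_mult)
    next
      case False
      have "\<phi> (Suc n) ?y \<in> vecs A (k (Suc n))" using hom_closed[OF hom_A] yv by simp
      then show ?thesis using False x by (simp add: vecs_def)
    qed
    then have "\<phi> (Suc n) ?y = x" by (rule ext)
    then show ?thesis unfolding im_A_def using yv by blast
  qed
  then show ?thesis using im_A_subset[of "Suc n"] complex_A by (auto simp: im_A_def)
qed

lemma submodule_im_S: "submodule (im_S n) S (vecm A (vecs S (k n)))"
  using submodule_range[OF _ _ hom_res[of n]] S.left_module_free by (simp add: im_S_def vecm_S)

lemma submodule_im_A: "submodule (im_A n) A (free A (k n))"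
  using submodule_range[OF A.left_module_free A.left_module_free hom_A[of n]] by (simp add: im_A_def)

lemma free_S: "left_module S (vecm A (vecs S l))" "fg_module S (vecm A (vecs S l))" "projective S (vecm A (vecs S l))"
  using S.left_module_free[of l] S.finitely_generated_free[of l] S.projective_free[of l] by (simp_all add: vecm_S)

lemma fg_im_S: "fg_module S (vecm A (im_S n))"
  using S.fg_sub[OF free_S(2) submodule_im_S] by simp

lemma fg_im_A: "fg_module A (vecm A (im_A n))"
  using A.fg_sub[OF A.finitely_generated_free submodule_im_A] by simp

lemma exact_im_S: "exact S (vecm A (im_S (Suc n))) (vecm A (vecs S (k (Suc n)))) (vecm A (im_S n))"
  using S.exact_range[OF free_S(2) free_S(1) hom_res[of n]] by (simp add: kern_def exact_S_iff flip: im_S_def)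

lemma exact_im_A: "n > n0 \<Longrightarrow> exact A (vecm A (im_A (Suc n))) (free A (k (Suc n))) (vecm A (im_A n))"
  using A.exact_range[OF A.finitely_generated_free A.left_module_free hom_A[of n]] by (simp add: kern_def exact_A_iff flip: im_A_def)

lemma pd_im_S:
  assumes X: "exact S (vecm A (im_S 0)) (vecm A (vecs S (k 0))) X"
  shows "S.pd_le q (vecm A (im_S n)) \<longleftrightarrow> S.pd_le (Suc (q + n)) X"
proof (induction n arbitrary: q)
  case 0
  then show ?case using S.pd_Suc[OF X free_S(3)] by simp
next
  case (Suc n)
  then show ?case using S.pd_Suc[OF exact_im_S free_S(3), of q n] by simp
qed

lemma pd_im_A: "A.pd_le q (vecm A (im_A (Suc (n0 + n)))) \<longleftrightarrow> A.pd_le (q + n) (vecm A (im_A (Suc n0)))"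
proof (induction n arbitrary: q)
  case (Suc n)
  then show ?case using A.pd_Suc[OF exact_im_A A.projective_free, of "Suc (n0 + n)" q] by simp
qed simp

text \<open>A section of the cover of \<open>im_S n\<close> by vectors over \<^term>\<open>S\<close> extends linearly to vectors
  over \<^term>\<open>A\<close>. Exactness over \<^term>\<open>A\<close> in degree \<^term>\<open>n\<close> makes the extension factor through
  \<open>im_A n\<close>.\<close>

lemma projective_im_A:
  assumes n: "n > n0" and P: "projective S (vecm A (im_S n))" shows "projective A (vecm A (im_A n))"
proof -
  let ?l = "k (Suc n)"
  let ?F = "vecm A (vecs S ?l)"
  have lF: "left_module A (free A ?l)" by (rule A.left_module_free)
  have gW: "\<phi> n \<in> module_hom S ?F (vecm A (im_S n))" using hom_corestrict[OF hom_res[of n], of "im_S n"] by (simp add: im_S_def)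
  have gs: "\<phi> n ` carrier ?F = carrier (vecm A (im_S n))" by (simp add: im_S_def)
  obtain \<sigma> where \<sigma>: "\<sigma> \<in> module_hom S (vecm A (im_S n)) ?F" "\<And>w. w \<in> carrier (vecm A (im_S n)) \<Longrightarrow> \<phi> n (\<sigma> w) = w"
    by (rule projective_lift[OF P free_S(2) fg_im_S gW gs hom_id]) (rule that)
  have lW: "left_module S (vecm A (im_S n))" using fg_im_S by blast
  define e where "e i = (if i < ?l then \<sigma> (r n i) else (\<lambda>_. \<zero>\<^bsub>A\<^esub>))" for i
  have eS: "e i \<in> vecs S ?l" for i
  proof (cases "i < ?l")
    case True
    then show ?thesis using hom_closed[OF \<sigma>(1)] row_in_im_S[OF True] by (simp add: e_def)
  next
    case False
    then show ?thesis using left_module.submodule_zero[OF free_S(1) left_module.submodule_carrier[OF free_S(1)]] by (simp add: e_def)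
  qed
  define \<eta> where "\<eta> = lincomb (free A ?l) e ?l"
  have \<eta>: "\<eta> \<in> module_hom A (free A ?l) (free A ?l)"
    unfolding \<eta>_def by (rule A.free_hom[OF lF]) (use eS vecs_S_subset in simp)
  have \<eta>u: "\<eta> (unitv A ?l i) = \<sigma> (r n i)" if i: "i < ?l" for i
  proof -
    interpret G: left_module A "free A ?l" by (rule lF)
    have "\<eta> (unitv A ?l i) = lincomb (free A ?l) e ?l (\<lambda>j. if j = i then \<one>\<^bsub>A\<^esub> else \<zero>\<^bsub>A\<^esub>)"
      unfolding \<eta>_def by (rule lincomb_cong) (auto simp: unitv_def i)
    then show ?thesis using G.lincomb_unit[of e ?l i] eS vecs_S_subset i by (simp add: e_def)
  qed
  have \<sigma>\<phi>: "(\<lambda>z. \<sigma> (\<phi> n z)) \<in> module_hom S (free S ?l) (free S ?l)"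
    using hom_comp[OF gW \<sigma>(1)] by (simp add: vecm_S)
  have \<eta>S: "\<eta> \<in> module_hom S (free S ?l) (free A ?l)"
    using hom_restrict[OF hom_S[OF \<eta>], of "vecs S ?l"] vecs_S_subset by (auto simp: vecm_S)
  have \<sigma>\<phi>A: "(\<lambda>z. \<sigma> (\<phi> n z)) \<in> module_hom S (free S ?l) (free A ?l)"
    using \<sigma>\<phi> vecs_S_subset by (auto simp: module_hom_def vecm_S)
  have \<eta>\<sigma>: "\<eta> z = \<sigma> (\<phi> n z)" if "z \<in> vecs S ?l" for z
    by (rule S.free_hom_ext[OF left_module_S[OF lF] \<eta>S \<sigma>\<phi>A _ that]) (simp add: unitv_S \<eta>u row_image)
  have \<eta>0: "\<eta> x = \<zero>\<^bsub>free A ?l\<^esub>" if x: "x \<in> carrier (free A ?l)" "\<phi> n x = \<zero>\<^bsub>vecm A (im_A n)\<^esub>" for x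
  proof -
    have "x \<in> im_A (Suc n)" using x by (simp add: exact_A_iff[OF n])
    then obtain y where y: "y \<in> vecs A (k (Suc (Suc n)))" "x = \<phi> (Suc n) y" by (auto simp: im_A_def)
    have "\<eta> (\<phi> (Suc n) y) = (\<lambda>_. \<zero>\<^bsub>free A ?l\<^esub>) y"
    proof (rule A.free_hom_ext[OF lF hom_comp[OF hom_A \<eta>] hom_zero_fun[OF lF] _ y(1)])
      fix i assume i: "i < k (Suc (Suc n))"
      have "\<eta> (r (Suc n) i) = \<sigma> (\<phi> n (r (Suc n) i))" by (rule \<eta>\<sigma>[OF F.rows])
      also have "\<phi> n (r (Suc n) i) = \<zero>\<^bsub>vecm A (im_S n)\<^esub>" using F.complex[of n i] by (simp add: rmul_S)
      also have "\<sigma> \<zero>\<^bsub>vecm A (im_S n)\<^esub> = \<zero>\<^bsub>free A ?l\<^esub>" using hom_zero[OF lW free_S(1) \<sigma>(1)] by simp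
      finally show "\<eta> (\<phi> (Suc n) (unitv A (k (Suc (Suc n))) i)) = \<zero>\<^bsub>free A ?l\<^esub>" by (simp add: row_image[OF i])
    qed
    then show ?thesis using y(2) by simp
  qed
  have gA: "\<phi> n \<in> module_hom A (free A ?l) (vecm A (im_A n))" using hom_corestrict[OF hom_A[of n], of "im_A n"] by (simp add: im_A_def)
  have "\<exists>i \<in> module_hom A (vecm A (im_A n)) (free A ?l). \<forall>x \<in> carrier (free A ?l). i (\<phi> n x) = \<eta> x"
    by (rule hom_factor[OF lF _ lF gA _ \<eta> \<eta>0]) (use fg_im_A in \<open>auto simp: im_A_def\<close>)
  then obtain i where i: "i \<in> module_hom A (vecm A (im_A n)) (free A ?l)" "\<forall>x \<in> vecs A ?l. i (\<phi> n x) = \<eta> x" by auto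
  have "retract A (vecm A (im_A n)) (free A ?l)"
  proof (rule retractI[OF i(1) gA])
    fix x assume "x \<in> carrier (vecm A (im_A n))"
    then obtain y where y: "y \<in> vecs A ?l" "x = \<phi> n y" by (auto simp: im_A_def)
    have "\<phi> n (\<eta> y) = \<phi> n y"
    proof (rule A.free_hom_ext[OF A.left_module_free hom_comp[OF \<eta> hom_A] hom_A _ y(1)])
      fix j assume j: "j < ?l"
      show "\<phi> n (\<eta> (unitv A ?l j)) = \<phi> n (unitv A ?l j)" using \<sigma>(2)[of "r n j"] row_in_im_S[OF j] by (simp add: \<eta>u[OF j] row_image[OF j])
    qed
    then show "\<phi> n (i x) = x" using i(2) y by simp
  qed
  then show ?thesis by (rule retract_projective[OF A.projective_free _ fg_im_A])
qed

lemma lincomb_in_S: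
  assumes "\<And>i. f i \<otimes>\<^bsub>A\<^esub> x i \<in> B" shows "lincomb (regm A) x n f \<in> B"
proof -
  have "\<zero>\<^bsub>A\<^esub> \<in> B" "\<And>a b. a \<in> B \<Longrightarrow> b \<in> B \<Longrightarrow> a \<oplus>\<^bsub>A\<^esub> b \<in> B" using S.zero_closed S.add.m_closed by simp_all
  then show ?thesis using assms by (induction n) simp_all
qed

text \<open>The idempotent \<open>E\<close> of \<open>superfluous_kernel\<close> and its linear extension
  \<open>E'\<close> to vectors over \<^term>\<open>A\<close> cut \<open>im_S (Suc j)\<close> and \<open>im_A (Suc j)\<close>
  down to \<open>W0\<close> and \<open>AW0\<close>. Elements of \<open>AW0\<close> are combinations over
  \<^term>\<open>A\<close> of vectors with entries in \<open>rad S\<close>, so \<^term>\<open>I\<close> moves them into vectors over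
  \<^term>\<open>S\<close>. The vectors over \<^term>\<open>S\<close> in \<open>AW0\<close> are those in \<open>W0\<close>, hence
  \<^term>\<open>I\<close> annihilates the quotient. The part of \<open>im_S (Suc j)\<close> that is cut off is projective.\<close>

lemma igusa_todorov_step:
  assumes j: "j > n0" and P: "projective A (vecm A (im_A (Suc j)))" and I: "I \<subseteq> B"
    and absorb: "(I \<cdot>\<^bsub>A\<^esub> carrier A) \<cdot>\<^bsub>A\<^esub> rad S \<subseteq> B"
  shows "\<exists>W0 AW0 (C :: 'a fgmod). exact S (vecm A W0) (vecm A AW0) C \<and> projective A (vecm A AW0) \<and> S.annihilated I C \<and>
    (\<forall>q. S.pd_le q (vecm A W0) \<longleftrightarrow> S.pd_le q (vecm A (im_S (Suc j))))"
proof -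
  let ?l = "k (Suc j)"
  let ?F = "vecm A (vecs S ?l)"
  let ?G = "free A ?l"
  have lF: "left_module S ?F" and lG: "left_module A ?G" by (rule free_S(1), rule A.left_module_free)
  obtain E where E: "E \<in> module_hom S ?F ?F" and EE: "\<forall>x \<in> vecs S ?l. E (E x) = E x" and \<phi>E: "\<forall>x \<in> vecs S ?l. \<phi> j (E x) = \<phi> j x"
    and rad: "\<forall>w \<in> vecs S ?l. \<phi> j w = (\<lambda>_. \<zero>\<^bsub>A\<^esub>) \<longrightarrow> (\<forall>i. E w i \<in> rad S)"
    using S.superfluous_kernel[of "vecm A (vecs S (k j))" "\<phi> j" ?l] free_S(2) hom_res[of j] by (auto simp: vecm_S)
  have Ec: "E x \<in> vecs S ?l" if "x \<in> vecs S ?l" for x using hom_closed[OF E] that by simp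
  define E' where "E' = lincomb ?G (\<lambda>i. E (unitv A ?l i)) ?l"
  have uS: "unitv A ?l i \<in> vecs S ?l" for i using S.unitv_in[of ?l i] by (simp add: unitv_S)
  have E': "E' \<in> module_hom A ?G ?G"
    unfolding E'_def by (rule A.free_hom[OF lG]) (use Ec uS vecs_S_subset in simp)
  have E'E: "E' x = E x" if x: "x \<in> vecs S ?l" for x
  proof -
    have "E \<in> module_hom S (free S ?l) ?F" using E by (simp add: vecm_S)
    from S.free_hom_eq[OF lF this x] have "E x = lincomb ?F (\<lambda>i. E (unitv A ?l i)) ?l x" by (simp add: unitv_S)
    then show ?thesis unfolding E'_def using lincomb_S by (metis vecm_S)
  qed
  have E'E': "E' (E' x) = E' x" if x: "x \<in> vecs A ?l" for x
    by (rule A.free_hom_ext[OF lG hom_comp[OF E' E'] E' _ x]) (use E'E Ec uS EE in simp)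
  have \<phi>E': "\<phi> j (E' x) = \<phi> j x" if x: "x \<in> vecs A ?l" for x
    by (rule A.free_hom_ext[OF A.left_module_free hom_comp[OF E' hom_A] hom_A _ x]) (use E'E Ec uS \<phi>E in simp)
  define W0 where "W0 = E ` im_S (Suc j)"
  define AW0 where "AW0 = E' ` im_A (Suc j)"
  have W0W: "W0 \<subseteq> im_S (Suc j)" unfolding W0_def exact_S_iff using Ec \<phi>E by auto
  have AW0AW: "AW0 \<subseteq> im_A (Suc j)" unfolding AW0_def exact_A_iff[OF j] using hom_closed[OF E'] \<phi>E' by auto
  have W0AW0: "W0 \<subseteq> AW0"
  proof
    fix x assume "x \<in> W0"
    then obtain w where w: "w \<in> im_S (Suc j)" "x = E w" by (auto simp: W0_def)
    have "w \<in> vecs S ?l" using w(1) im_S_subset by blast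
    then have "x = E' w" using E'E w(2) by simp
    then show "x \<in> AW0" using w(1) im_S_im_A unfolding AW0_def by blast
  qed
  have AW0S: "x \<in> W0" if x: "x \<in> AW0" "x \<in> vecs S ?l" for x
  proof -
    obtain y where y: "y \<in> im_A (Suc j)" "x = E' y" using x(1) by (auto simp: AW0_def)
    have "y \<in> vecs A ?l" using y(1) im_A_subset by blast
    then have "x = E' x" using E'E' y(2) by simp
    then have "x = E x" using E'E x(2) by simp
    moreover have "x \<in> im_S (Suc j)" using AW0AW x unfolding exact_S_iff exact_A_iff[OF j] by blast
    ultimately show ?thesis unfolding W0_def by blast
  qed
  have sW0: "submodule W0 S ?F" unfolding W0_def by (rule submodule_image[OF lF lF E submodule_im_S])
  have sAW0: "submodule AW0 A ?G" unfolding AW0_def by (rule submodule_image[OF lG lG E' submodule_im_A])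
  have fgW0: "fg_module S (vecm A W0)" using S.fg_sub[OF free_S(2) sW0] by simp
  have fgAW0: "fg_module A (vecm A AW0)" using A.fg_sub[OF A.finitely_generated_free sAW0] by simp
  have "retract A (vecm A AW0) (vecm A (im_A (Suc j)))"
  proof (rule retractI[where i = "\<lambda>x. x" and p = E'])
    show "(\<lambda>x. x) \<in> module_hom A (vecm A AW0) (vecm A (im_A (Suc j)))" using AW0AW by (auto simp: module_hom_def)
    show "E' \<in> module_hom A (vecm A (im_A (Suc j))) (vecm A AW0)"
      using E' im_A_subset[of "Suc j"] by (auto simp: module_hom_def AW0_def subset_iff)
    show "E' x = x" if "x \<in> carrier (vecm A AW0)" for x using that E'E' im_A_subset by (auto simp: AW0_def)
  qed
  then have pAW0: "projective A (vecm A AW0)" by (rule retract_projective[OF P _ fgAW0])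
  have pdW0: "S.pd_le q (vecm A W0) \<longleftrightarrow> S.pd_le q (vecm A (im_S (Suc j)))" for q
  proof
    have EW: "E \<in> module_hom S (vecm A (im_S (Suc j))) (vecm A W0)"
      using E im_S_subset[of "Suc j"] by (auto simp: module_hom_def W0_def subset_iff)
    { assume "S.pd_le q (vecm A (im_S (Suc j)))"
      moreover have "retract S (vecm A W0) (vecm A (im_S (Suc j)))"
      proof (rule retractI[OF _ EW])
        show "(\<lambda>x. x) \<in> module_hom S (vecm A W0) (vecm A (im_S (Suc j)))" using W0W by (auto simp: module_hom_def)
        show "E x = x" if "x \<in> carrier (vecm A W0)" for x using that EE im_S_subset by (auto simp: W0_def)
      qed
      ultimately show "S.pd_le q (vecm A W0)" using S.pd_retract fgW0 by blast }
    assume q: "S.pd_le q (vecm A W0)"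
    let ?K = "{x \<in> vecs S ?l. E x = (\<lambda>_. \<zero>\<^bsub>A\<^esub>)}"
    interpret F': left_module S ?F by (rule lF)
    have \<phi>0: "\<phi> j (\<lambda>_. \<zero>\<^bsub>A\<^esub>) = (\<lambda>_. \<zero>\<^bsub>A\<^esub>)" using hom_zero[OF A.left_module_free A.left_module_free hom_A[of j]] by simp
    have K: "kern (vecm A (im_S (Suc j))) (vecm A W0) E = ?K"
      unfolding kern_def exact_S_iff using \<phi>E \<phi>0 by fastforce
    have "exact S (vecm A (im_S (Suc j))\<lparr>carrier := ?K\<rparr>) (vecm A (im_S (Suc j))) (vecm A W0\<lparr>carrier := E ` im_S (Suc j)\<rparr>)"
      using S.exact_range[OF fg_im_S fg_left_module[OF fgW0] EW] unfolding K by simp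
    then have ex: "exact S (vecm A ?K) (vecm A (im_S (Suc j))) (vecm A W0)" by (simp add: W0_def)
    let ?p = "\<lambda>x. x \<ominus>\<^bsub>?F\<^esub> E x"
    have p: "?p \<in> module_hom S ?F ?F" by (rule hom_diff_fun[OF lF hom_id E])
    have pK: "?p x \<in> ?K" if x: "x \<in> vecs S ?l" for x
    proof -
      have "E (?p x) = E x \<ominus>\<^bsub>?F\<^esub> E (E x)" using hom_diff[OF lF lF E, of x "E x"] x Ec by simp
      also have "\<dots> = \<zero>\<^bsub>?F\<^esub>" using EE x Ec F'.M.minus_self[of "E x"] by simp
      finally show ?thesis using hom_closed[OF p] x by simp
    qed
    have "retract S (vecm A ?K) ?F"
    proof (rule retractI[where i = "\<lambda>x. x" and p = ?p])
      show "(\<lambda>x. x) \<in> module_hom S (vecm A ?K) ?F" by (auto simp: module_hom_def)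
      show "?p \<in> module_hom S ?F (vecm A ?K)" using hom_corestrict[OF p, of ?K] pK by auto
      show "?p x = x" if "x \<in> carrier (vecm A ?K)" for x
      proof -
        have x: "x \<in> carrier ?F" "E x = \<zero>\<^bsub>?F\<^esub>" using that by simp_all
        show ?thesis
          using F'.M.minus_add_cancel[OF x(1) F'.M.zero_closed] unfolding x(2) F'.M.r_zero[OF x(1)] .
      qed
    qed
    then have "S.pd_le q (vecm A ?K)"
      using S.pd_retract[OF _ exact_fg(1)[OF ex] S.pd_projective[OF free_S(3)]] by blast
    then show "S.pd_le q (vecm A (im_S (Suc j)))" by (rule S.pd_ext[OF ex _ q])
  qed
  have mult: "(\<lambda>i. a \<otimes>\<^bsub>A\<^esub> x i) \<in> W0" if a: "a \<in> I" and x: "x \<in> AW0" for a x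
  proof (rule AW0S)
    have aA: "a \<in> carrier A" using a I sub by blast
    show ax: "(\<lambda>i. a \<otimes>\<^bsub>A\<^esub> x i) \<in> AW0" using left_module.submodule_smult[OF lG sAW0 aA x] by simp
    obtain y where y: "y \<in> im_A (Suc j)" "x = E' y" using x by (auto simp: AW0_def)
    obtain z where z: "z \<in> vecs A (k (Suc (Suc j)))" "y = \<phi> (Suc j) z" using y(1) by (auto simp: im_A_def)
    let ?n = "k (Suc (Suc j))"
    let ?r = "r (Suc j)"
    have "x = lincomb ?G (\<lambda>i. E' (\<phi> (Suc j) (unitv A ?n i))) ?n z"
      unfolding y(2) z(2) by (rule A.free_hom_eq[OF lG hom_comp[OF hom_A E'] z(1)])
    also have "\<dots> = lincomb ?G (\<lambda>i. E (?r i)) ?n z"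
      by (rule lincomb_cong) (simp_all add: row_image E'E F.rows)
    finally have x': "x c = lincomb (regm A) (\<lambda>i. E (?r i) c) ?n z" for c by (simp add: lincomb_vecm)
    have rr: "E (?r i) c \<in> rad S" for i c
      using rad F.rows[of "Suc j" i] F.complex[of j i] by (simp add: rmul_S)
    have rA: "E (?r i) c \<in> carrier A" for i c using vecs_S_subset[OF Ec[OF F.rows]] A.vecs_carrier by blast
    have "a \<otimes>\<^bsub>A\<^esub> x c \<in> B" for c
    proof -
      interpret G: left_module A "regm A" by (rule A.left_module_regm)
      have zc: "\<forall>i. z i \<in> carrier A" using A.vecs_carrier[OF z(1)] by simp
      have "a \<otimes>\<^bsub>A\<^esub> x c = lincomb (regm A) (\<lambda>i. E (?r i) c) ?n (\<lambda>i. a \<otimes>\<^bsub>A\<^esub> z i)"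
        using G.lincomb_smult[of "\<lambda>i. E (?r i) c" z a ?n] rA zc aA x' by simp
      also have "\<dots> \<in> B"
      proof (rule lincomb_in_S)
        fix i show "(a \<otimes>\<^bsub>A\<^esub> z i) \<otimes>\<^bsub>A\<^esub> E (?r i) c \<in> B"
          using absorb zc a rr by (blast intro: ideal_prod.prod)
      qed
      finally show ?thesis .
    qed
    then show "(\<lambda>i. a \<otimes>\<^bsub>A\<^esub> x i) \<in> vecs S ?l" using ax sAW0 left_module.submodule_subset[OF lG sAW0] by (auto simp: vecs_S)
  qed
  have fgSAW0: "fg_module S (vecm A AW0)" by (rule fg_S[OF fgAW0])
  have "submodule W0 S (vecm A AW0)"
  proof -
    note m = left_module.submodule_zero[OF lF sW0] left_module.submodule_add[OF lF sW0] left_module.submodule_smult[OF lF sW0]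
    show ?thesis by (rule left_module.submoduleI[OF fg_left_module[OF fgSAW0]]) (use m W0AW0 in simp_all)
  qed
  from S.quotient_module[OF fgSAW0 this]
  obtain C :: "'a fgmod" and g where C: "fg_module S C" "g \<in> module_hom S (vecm A AW0) C" "g ` AW0 = carrier C"
    "kern (vecm A AW0) C g = W0" by auto
  have "exact S (vecm A W0) (vecm A AW0) C"
    using S.ses_kern[OF fgSAW0 C(1,2)] C(3,4) exactI by (metis vecm_simps(1) vecm_simps(5))
  moreover have "S.annihilated I C"
    unfolding S.annihilated_def
  proof (intro ballI)
    fix a c assume a: "a \<in> I" and c: "c \<in> carrier C"
    obtain y where y: "y \<in> AW0" "c = g y" using c C(3) by blast
    have "a \<odot>\<^bsub>C\<^esub> c = g (\<lambda>i. a \<otimes>\<^bsub>A\<^esub> y i)" using hom_smult[OF C(2), of a y] y a I by auto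
    also have "\<dots> = \<zero>\<^bsub>C\<^esub>" using mult[OF a y(1)] unfolding C(4)[symmetric] kern_def by simp
    finally show "a \<odot>\<^bsub>C\<^esub> c = \<zero>\<^bsub>C\<^esub>" .
  qed
  ultimately show ?thesis using pAW0 pdW0 by (intro exI conjI allI)
qed

text \<open>The module \<open>im_S n\<close> is a syzygy of \<^term>\<open>X\<close> of order \<open>Suc n\<close>. For \<open>n =
  n0 + m + 1\<close> already \<open>im_A n\<close> is projective, whatever \<^term>\<open>X\<close> is;
  \<open>igusa_todorov_step\<close> is applied one degree later because it needs exactness over \<^term>\<open>A\<close> in
  the degree before, which has to exceed \<^term>\<open>n0\<close>.\<close>

lemma igusa_todorov_pd:
  assumes fin: "fin_dim A \<le> enat m" and I: "I \<subseteq> B" and absorb: "(I \<cdot>\<^bsub>A\<^esub> carrier A) \<cdot>\<^bsub>A\<^esub> rad S \<subseteq> B"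
    and US: "\<And>C :: 'a fgmod. fg_module S C \<Longrightarrow> S.annihilated I C \<Longrightarrow> \<exists>xs. set xs \<subseteq> US \<and> module_iso S C (S.dsum xs)"
    and VS: "\<And>(Z :: 'a fgmod) p. fg_module S Z \<Longrightarrow> retract S Z (S.dsum (replicate p (fg_copy S (regm A)))) \<Longrightarrow>
      \<exists>ys. set ys \<subseteq> US \<and> module_iso S Z (S.dsum ys)"
    and fgUS: "\<forall>U\<in>US. fg_module S U"
    and t: "\<And>(Z :: 'a fgmod) xs ys n. set xs \<subseteq> US \<Longrightarrow> set ys \<subseteq> US \<Longrightarrow> exact S Z (S.dsum ys) (S.dsum xs) \<Longrightarrow> S.pd_le n Z \<Longrightarrow> S.pd_le t Z"
    and X: "exact S (vecm A (im_S 0)) (vecm A (vecs S (k 0))) X" and q: "S.pd_le q X"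
  shows "S.pd_le (t + n0 + m + 3) X"
proof -
  have "S.pd_le (Suc (0 + Suc (n0 + q))) X" by (rule S.pd_mono[OF q]) simp
  then have "projective S (vecm A (im_S (Suc (n0 + q))))" unfolding pd_im_S[OF X, symmetric] S.pd_0 .
  then have "projective A (vecm A (im_A (Suc (n0 + q))))" by (rule projective_im_A[rotated]) simp
  then have "A.pd_le 0 (vecm A (im_A (Suc (n0 + q))))" by (simp add: A.pd_0)
  then have "A.pd_le q (vecm A (im_A (Suc n0)))" unfolding pd_im_A by simp
  then have "A.pd_le m (vecm A (im_A (Suc n0)))" by (rule A.fin_dim_bound[OF fin])
  then have "A.pd_le (0 + Suc m) (vecm A (im_A (Suc n0)))" by (rule A.pd_mono) simp
  then have "A.pd_le 0 (vecm A (im_A (Suc (n0 + Suc m))))" unfolding pd_im_A .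
  then have P: "projective A (vecm A (im_A (Suc (Suc (n0 + m)))))" by (simp add: A.pd_0)
  obtain W0 AW0 and C :: "'a fgmod" where ex: "exact S (vecm A W0) (vecm A AW0) C" and pAW0: "projective A (vecm A AW0)"
    and C: "S.annihilated I C" and pdW0: "\<And>q. S.pd_le q (vecm A W0) \<longleftrightarrow> S.pd_le q (vecm A (im_S (Suc (Suc (n0 + m)))))"
    using igusa_todorov_step[OF _ P I absorb] by auto
  note fg = exact_fg[OF ex]
  obtain xs where xs: "set xs \<subseteq> US" "module_iso S C (S.dsum xs)" using US[OF fg(3) C] by blast
  obtain p where "retract A (vecm A AW0) (free A p)" by (rule A.projective_retract_free[OF pAW0])
  then have "retract S (vecm A AW0) (free A p)" by (rule retract_S)
  then have "retract S (vecm A AW0) (S.dsum (replicate p (fg_copy S (regm A))))"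
    by (rule retract_trans[OF _ retract_iso[OF free_iso_dsum left_module_S[OF A.left_module_free]]])
  then have "retract S (fg_copy S (vecm A AW0)) (S.dsum (replicate p (fg_copy S (regm A))))"
    by (rule retract_trans[OF retract_iso'[OF fg_copy_iso[OF fg(2)] fg_left_module[OF fg(2)]]])
  then obtain ys where ys: "set ys \<subseteq> US" "module_iso S (fg_copy S (vecm A AW0)) (S.dsum ys)" using VS[OF fg_copy_fg[OF fg(2)]] by blast
  have fgs: "fg_module S (S.dsum xs)" "fg_module S (S.dsum ys)" using xs(1) ys(1) fgUS by (auto intro!: S.dsum_fg)
  have e: "exact S (fg_copy S (vecm A W0)) (S.dsum ys) (S.dsum xs)"
    by (rule exact_cong[OF ex fg_copy_iso'[OF fg(1)] module_iso_trans[OF fg_copy_iso[OF fg(2)] ys(2)] xs(2) fg_copy_fg[OF fg(1)] fgs(2,1)])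
  have "S.pd_le (Suc (q + Suc (Suc (n0 + m)))) X" by (rule S.pd_mono[OF q]) simp
  then have "S.pd_le q (vecm A W0)" unfolding pdW0 pd_im_S[OF X] .
  then have "S.pd_le q (fg_copy S (vecm A W0))" by (rule S.pd_iso[OF _ fg_copy_iso[OF fg(1)] fg_copy_fg[OF fg(1)]])
  then have "S.pd_le t (fg_copy S (vecm A W0))" by (rule t[OF xs(1) ys(1) e])
  then have "S.pd_le t (vecm A W0)" by (rule S.pd_iso[OF _ fg_copy_iso'[OF fg(1)] fg(1)])
  then have "S.pd_le (Suc (t + Suc (Suc (n0 + m)))) X" unfolding pdW0 pd_im_S[OF X] .
  then show ?thesis by (simp add: eval_nat_numeral add.assoc)
qed

end

context extension
begin

text \<open>The two finite lists of summands, over \<open>S Quot I\<close> and of \<^term>\<open>A\<close>, and with them the bound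
  \<open>t\<close>, are chosen before the module \<open>X\<close>, so the bound on the dimension is uniform.\<close>

theorem fin_dim_extension:
  assumes I: "ideal I S" and absorb: "(I \<cdot>\<^bsub>A\<^esub> carrier A) \<cdot>\<^bsub>A\<^esub> rad S \<subseteq> B" and rep: "representation_finite (S Quot I)"
    and res: "projective_resolution (op_ring S) (right_mult_module A) P d e" "\<And>i. i > n0 \<Longrightarrow> carrier (P i) = {\<zero>\<^bsub>P i\<^esub>}"
    and fin: "fin_dim A < \<infinity>"
  shows "fin_dim S < \<infinity>"
proof -
  obtain m where m: "fin_dim A = enat m" using fin by (cases "fin_dim A") auto
  obtain US where US: "finite US" "\<forall>U\<in>US. fg_module S U"
    "\<forall>C :: 'a fgmod. fg_module S C \<and> S.annihilated I C \<longrightarrow> (\<exists>xs. set xs \<subseteq> US \<and> module_iso S C (S.dsum xs))"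
    using S.annihilated_decomposition[OF I rep] by blast
  have "\<forall>X\<in>{fg_copy S (regm A)}. fg_module S X" using fg_copy_fg[OF fg_ext] by simp
  from S.finite_summands[OF _ this] obtain VS where VS: "finite VS" "\<forall>V \<in> VS. fg_module S V"
    "\<forall>(Z :: 'a fgmod) Ys. fg_module S Z \<and> set Ys \<subseteq> {fg_copy S (regm A)} \<and> retract S Z (S.dsum Ys) \<longrightarrow> (\<exists>Zs. set Zs \<subseteq> VS \<and> module_iso S Z (S.dsum Zs))"
    by auto
  let ?US = "US \<union> VS"
  have finU: "finite ?US" and fgU: "\<forall>U\<in>?US. fg_module S U" using US(1,2) VS(1,2) by auto
  have "\<exists>t. \<forall>(Z :: 'a fgmod) xs ys n. set xs \<subseteq> ?US \<longrightarrow> set ys \<subseteq> ?US \<longrightarrow> exact S Z (S.dsum ys) (S.dsum xs) \<longrightarrow> S.pd_le n Z \<longrightarrow> S.pd_le t Z"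
    by (rule S.igusa_todorov_bound[OF finU]) (rule bspec[OF fgU])
  then obtain t where t: "\<forall>(Z :: 'a fgmod) xs ys n. set xs \<subseteq> ?US \<longrightarrow> set ys \<subseteq> ?US \<longrightarrow> exact S Z (S.dsum ys) (S.dsum xs) \<longrightarrow> S.pd_le n Z \<longrightarrow> S.pd_le t Z"
    by (elim exE)
  have "fin_dim S \<le> enat (t + n0 + m + 3)"
  proof (rule S.fin_dim_leI)
    fix X :: "'a fgmod" and q assume q: "S.pd_le q X"
    have X: "fg_module S X" by (rule S.pd_fg[OF q])
    obtain k r g where kr: "free_res S k r" and g: "g \<in> module_hom S (free S (k 0)) X" "g ` vecs S (k 0) = carrier X"
      "kern (free S (k 0)) X g = rmul S k r 0 ` vecs S (k (Suc 0))"
      using S.exists_free_res[OF X] by (elim exE conjE)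
    interpret F: free_res S k r by (rule kr)
    interpret lifted_res A B k r n0
    proof unfold_locales
      have L: "left_module (op_ring S) (right_mult_module A)"
      proof (intro left_module.intro left_module_axioms.intro S.ring_op_ring)
        show "abelian_group (right_mult_module A)"
        proof (rule abelian_groupI)
          fix x assume "x \<in> carrier (right_mult_module A)"
          then show "\<exists>y\<in>carrier (right_mult_module A). y \<oplus>\<^bsub>right_mult_module A\<^esub> x = \<zero>\<^bsub>right_mult_module A\<^esub>"
            by (intro bexI[of _ "\<ominus>\<^bsub>A\<^esub> x"]) (auto simp: right_mult_module_def A.l_neg)
        qed (auto simp: right_mult_module_def A.a_ac)
      qed (use sub in \<open>auto simp: right_mult_module_def subset_iff A.l_distr A.r_distr A.m_assoc\<close>)
      show "F.tensor_exact (right_mult_module A) n" if "n > n0" for n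
        by (rule F.tensor_exact_resolution[OF L res that])
    qed
    have "exact S (vecm A (im_S 0)) (vecm A (vecs S (k 0))) X"
      using S.ses_kern[OF S.finitely_generated_free X g(1)] g(2,3) exactI by (auto simp: im_S_def vecm_S rmul_S)
    show "S.pd_le (t + n0 + m + 3) X"
    proof (rule igusa_todorov_pd[where m = m and US = ?US and q = q, OF _ _ absorb])
      show "fin_dim A \<le> enat m" using m by simp
      show "I \<subseteq> B" using ideal.Icarr[OF I] by auto
      show "\<exists>xs. set xs \<subseteq> ?US \<and> module_iso S C (S.dsum xs)" if C: "fg_module S C" "S.annihilated I C" for C :: "'a fgmod"
      proof -
        have "\<exists>xs. set xs \<subseteq> US \<and> module_iso S C (S.dsum xs)" by (rule US(3)[rule_format, OF conjI[OF C]])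
        then show ?thesis by (elim exE conjE) (intro exI conjI, erule le_supI1)
      qed
      show "\<exists>ys. set ys \<subseteq> ?US \<and> module_iso S Z (S.dsum ys)"
        if Z: "fg_module S Z" "retract S Z (S.dsum (replicate p (fg_copy S (regm A))))" for Z :: "'a fgmod" and p
      proof -
        have "set (replicate p (fg_copy S (regm A))) \<subseteq> {fg_copy S (regm A)}" by auto
        then have "\<exists>Zs. set Zs \<subseteq> VS \<and> module_iso S Z (S.dsum Zs)" using VS(3) Z by blast
        then show ?thesis by blast
      qed
      show "S.pd_le t Z" if "set xs \<subseteq> ?US" "set ys \<subseteq> ?US" "exact S Z (S.dsum ys) (S.dsum xs)" "S.pd_le n Z" for Z :: "'a fgmod" and xs ys n
        using t that by blast
    qed fact+
  qed
  then show ?thesis by (rule le_less_trans) simp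
qed

end

section \<open>Artin algebras\<close>

text \<open>Submodules over the subring are stable under the base ring, which acts through elements of \<^term>\<open>B\<close>. So
  \<^term>\<open>A\<close> has finite length over the subring because it has finite length over the base ring.\<close>

lemma artin_extension_extension:
  assumes "artin_extension K B A" shows "extension A B"
proof -
  have B: "artin_algebra K A" "artin_algebra K (A\<lparr>carrier := B\<rparr>)" "submodule B K A" "subring B A"
    using assms by (auto simp: artin_extension_def)
  interpret A: artin_algebra K A by (rule B(1))
  interpret S: artin_algebra K "A\<lparr>carrier := B\<rparr>" by (rule B(2))
  interpret AA: finite_length_ring A by (rule A.finite_length_ring)
  interpret SS: finite_length_ring "A\<lparr>carrier := B\<rparr>" by (rule S.finite_length_ring)
  interpret KA: left_module K A by (rule A.left_module_base)
  have sub: "B \<subseteq> carrier A" by (rule KA.submodule_subset[OF B(3)])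
  have lS: "left_module (A\<lparr>carrier := B\<rparr>) (regm A)"
  proof -
    interpret G: left_module A "regm A" by (rule A.left_module_regm)
    show ?thesis
      by (intro left_module.intro left_module_axioms.intro S.ring_axioms G.M.abelian_group_axioms)
        (use sub in \<open>auto simp: subset_iff A.l_distr A.r_distr A.m_assoc\<close>)
  qed
  have "finite_length (A\<lparr>carrier := B\<rparr>) (regm A)"
  proof -
    have "submodule U K A" if U: "submodule U (A\<lparr>carrier := B\<rparr>) (regm A)" for U
    proof (rule KA.submoduleI)
      note U' = left_module.submodule_subset[OF lS U] left_module.submodule_zero[OF lS U]
        left_module.submodule_add[OF lS U] left_module.submodule_smult[OF lS U]
      show "U \<subseteq> carrier A" "\<zero>\<^bsub>A\<^esub> \<in> U" "\<And>x y. x \<in> U \<Longrightarrow> y \<in> U \<Longrightarrow> x \<oplus>\<^bsub>A\<^esub> y \<in> U" using U'(1-3) by auto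
      fix c x assume c: "c \<in> carrier K" and x: "x \<in> U"
      have "c \<odot>\<^bsub>A\<^esub> \<one>\<^bsub>A\<^esub> \<in> B" using KA.submodule_smult[OF B(3) c] subringE(3)[OF B(4)] by simp
      then have "(c \<odot>\<^bsub>A\<^esub> \<one>\<^bsub>A\<^esub>) \<otimes>\<^bsub>A\<^esub> x \<in> U" using U'(4) x by simp
      moreover have "x \<in> carrier A" using U'(1) x by auto
      ultimately show "c \<odot>\<^bsub>A\<^esub> x \<in> U" by (subst A.smult_one_mult[OF c])
    qed
    then have "finite_length_on (A\<lparr>carrier := B\<rparr>) (regm A) (carrier A)" by (rule rank_on_transfer[OF A.finite_length_base])
    then show ?thesis by simp
  qed
  then have "fg_module (A\<lparr>carrier := B\<rparr>) (regm A)" using SS.fg_iff lS by blast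
  then show ?thesis
    by (intro extension.intro extension_axioms.intro AA.finite_length_ring_axioms SS.finite_length_ring_axioms sub)
qed

theorem corollary1p2:
  fixes K :: "('k, 'r) ring_scheme"
    and A :: "('k, 'a, 'm) module_scheme"
    and B :: "'a set"
    and s :: nat
  assumes "artin_extension K B A"
    and "right_finite B A"
    and "(rad_pow (A\<lparr>carrier := B\<rparr>) s \<cdot>\<^bsub>A\<^esub> carrier A) \<cdot>\<^bsub>A\<^esub> rad (A\<lparr>carrier := B\<rparr>) \<subseteq> B"
    and "representation_finite ((A\<lparr>carrier := B\<rparr>) Quot rad_pow (A\<lparr>carrier := B\<rparr>) s)"
    and "fin_dim A < \<infinity>"
  shows "fin_dim (A\<lparr>carrier := B\<rparr>) < \<infinity>"
proof -
  interpret extension A B by (rule artin_extension_extension[OF assms(1)])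
  let ?N = "{enat n | n. \<exists>P d e. projective_resolution (op_ring S) (right_mult_module A) P d e \<and> (\<forall>i>n. carrier (P i) = {\<zero>\<^bsub>P i\<^esub>})}"
  have "Inf ?N < \<infinity>" using assms(2) by (simp add: right_finite_def proj_dim_def)
  then have "\<exists>v\<in>?N. v < \<infinity>" unfolding Inf_less_iff .
  then obtain v where "v \<in> ?N" by (elim bexE)
  then obtain n P d e where P: "projective_resolution (op_ring S) (right_mult_module A) P d e" "\<forall>i>n. carrier (P i) = {\<zero>\<^bsub>P i\<^esub>}"
    by blast
  show ?thesis
    by (rule fin_dim_extension[OF S.ideal_rad_pow assms(3,4) P(1) _ assms(5)]) (use P(2) in blast)
qed

end
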